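(* The only compact Toeplitz operator on the Hardy space $H^2(S_\Omega)$ is the zero operator: if $\phi\in L^\infty(S_\Omega)$ and $T_\phi$ is compact, then $\phi=0$ almost everywhere on $S_\Omega$.
   Context: $\Omega\subset\mathbb C^d$ is a classical (irreducible) Cartan domain of rank $r$ in Harish-Chandra realization; $S_\Omega$ its Shilov boundary with the unique probability measure $dz$ invariant under the stabilizer $\mathbb K$ of $0$ in the identity component of $\mathrm{Aut}(\Omega)$. $H^2(S_\Omega)$ is the Hardy space (holomorphic $f$ on $\Omega$ with $\sup_{0<t<1}\int_{S_\Omega}|f(tz)|^2dz<\infty$, identified with the closure of polynomials in $L^2(S_\Omega,dz)$), $P_{H^2(S_\Omega)}$ the Szegő projection, and $T_\phi h=P_{H^2(S_\Omega)}(\phi h)$ for $\phi\in L^\infty(S_\Omega)$. *)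

theory Defs
  imports "HOL-Analysis.Analysis" "HOL-Probability.Probability"
begin

text \<open>Points of \<open>\<complex>^d\<close> are vectors \<open>complex^'d\<close>; the coordinates are identified with the
  free entries of the matrix models via a bijection \<open>e\<close>.\<close>

text \<open>\<open>mat_contr m n M\<close>: the \<open>m \<times> n\<close> matrix \<open>M\<close> satisfies \<open>I_n - M^* M > 0\<close>.\<close>
definition mat_contr :: "nat \<Rightarrow> nat \<Rightarrow> (nat \<Rightarrow> nat \<Rightarrow> complex) \<Rightarrow> bool" where
  "mat_contr m n M \<longleftrightarrow>
     (\<forall>v::nat \<Rightarrow> complex. (\<exists>j<n. v j \<noteq> 0) \<longrightarrow>
        (\<Sum>i<m. (cmod (\<Sum>j<n. M i j * v j))\<^sup>2) < (\<Sum>j<n. (cmod (v j))\<^sup>2))"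

definition cartan_I :: "(complex^'d::finite) set \<Rightarrow> bool" where
  "cartan_I \<Omega> \<longleftrightarrow> (\<exists>m n (e :: nat \<times> nat \<Rightarrow> 'd). 1 \<le> m \<and> 1 \<le> n \<and>
      bij_betw e ({..<m} \<times> {..<n}) UNIV \<and>
      \<Omega> = {z. mat_contr m n (\<lambda>i j. z $ e (i, j))})"

definition cartan_II :: "(complex^'d::finite) set \<Rightarrow> bool" where
  "cartan_II \<Omega> \<longleftrightarrow> (\<exists>n (e :: nat \<times> nat \<Rightarrow> 'd). 2 \<le> n \<and>
      bij_betw e {(i, j). i < j \<and> j < n} UNIV \<and>
      \<Omega> = {z. mat_contr n n (\<lambda>i j. if i < j then z $ e (i, j)
                                    else if j < i then - (z $ e (j, i)) else 0)})"

definition cartan_III :: "(complex^'d::finite) set \<Rightarrow> bool" where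
  "cartan_III \<Omega> \<longleftrightarrow> (\<exists>n (e :: nat \<times> nat \<Rightarrow> 'd). 1 \<le> n \<and>
      bij_betw e {(i, j). i \<le> j \<and> j < n} UNIV \<and>
      \<Omega> = {z. mat_contr n n (\<lambda>i j. if i \<le> j then z $ e (i, j) else z $ e (j, i))})"

text \<open>Type IV (Lie ball): \<open>|z|^2 < 1\<close> and \<open>1 - 2|z|^2 + |z^T z|^2 > 0\<close>; \<open>n \<ge> 3\<close>
  (\<open>IV_1\<close> is the disc, \<open>IV_2\<close> is reducible).\<close>
definition cartan_IV :: "(complex^'d::finite) set \<Rightarrow> bool" where
  "cartan_IV \<Omega> \<longleftrightarrow> (\<exists>n (e :: nat \<Rightarrow> 'd). 3 \<le> n \<and> bij_betw e {..<n} UNIV \<and>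
      \<Omega> = {z. (\<Sum>i<n. (cmod (z $ e i))\<^sup>2) < 1 \<and>
               1 - 2 * (\<Sum>i<n. (cmod (z $ e i))\<^sup>2) + (cmod (\<Sum>i<n. (z $ e i)\<^sup>2))\<^sup>2 > 0})"

definition classical_cartan :: "(complex^'d::finite) set \<Rightarrow> bool" where
  "classical_cartan \<Omega> \<longleftrightarrow> cartan_I \<Omega> \<or> cartan_II \<Omega> \<or> cartan_III \<Omega> \<or> cartan_IV \<Omega>"

definition sholo_on :: "(complex^'d::finite) set \<Rightarrow> (complex^'d \<Rightarrow> complex) \<Rightarrow> bool" where
  "sholo_on S f \<longleftrightarrow> (\<forall>z\<in>S. \<exists>D. (f has_derivative D) (at z) \<and> (\<forall>c v. D (c *s v) = c * D v))"

definition vholo_on :: "(complex^'d::finite) set \<Rightarrow> (complex^'d \<Rightarrow> complex^'d) \<Rightarrow> bool" where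
  "vholo_on S g \<longleftrightarrow> (\<forall>z\<in>S. \<exists>D. (g has_derivative D) (at z) \<and> (\<forall>c v. D (c *s v) = c *s D v))"

definition aut :: "(complex^'d::finite) set \<Rightarrow> (complex^'d \<Rightarrow> complex^'d) set" where
  "aut \<Omega> = {g. bij_betw g \<Omega> \<Omega> \<and> vholo_on \<Omega> g \<and> vholo_on \<Omega> (inv_into \<Omega> g)}"

text \<open>Identity component (compact-open topology): automorphisms joined to the identity by a
  path of automorphisms depending jointly continuously on \<open>(t,z)\<close>.\<close>
definition aut0 :: "(complex^'d::finite) set \<Rightarrow> (complex^'d \<Rightarrow> complex^'d) set" where
  "aut0 \<Omega> = {g \<in> aut \<Omega>. \<exists>H :: real \<Rightarrow> complex^'d \<Rightarrow> complex^'d.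
      continuous_on ({0..1} \<times> \<Omega>) (\<lambda>(t, z). H t z) \<and> (\<forall>t\<in>{0..1}. H t \<in> aut \<Omega>) \<and>
      (\<forall>z\<in>\<Omega>. H 0 z = z \<and> H 1 z = g z)}"

definition stabK :: "(complex^'d::finite) set \<Rightarrow> (complex^'d \<Rightarrow> complex^'d) set" where
  "stabK \<Omega> = {g \<in> aut0 \<Omega>. g 0 = 0}"

definition disc_alg :: "(complex^'d::finite) set \<Rightarrow> (complex^'d \<Rightarrow> complex) set" where
  "disc_alg \<Omega> = {f. continuous_on (closure \<Omega>) f \<and> sholo_on \<Omega> f}"

definition closed_boundary :: "(complex^'d::finite) set \<Rightarrow> (complex^'d) set \<Rightarrow> bool" where
  "closed_boundary \<Omega> B \<longleftrightarrow> closed B \<and> B \<subseteq> closure \<Omega> \<and>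
     (\<forall>f\<in>disc_alg \<Omega>. \<exists>z\<in>B. \<forall>w\<in>closure \<Omega>. cmod (f w) \<le> cmod (f z))"

definition shilov :: "(complex^'d::finite) set \<Rightarrow> (complex^'d) set" where
  "shilov \<Omega> = \<Inter>{B. closed_boundary \<Omega> B}"

text \<open>Elements of \<open>K\<close> act on \<open>S_\<Omega>\<close> through their continuous extension to the closure.\<close>
definition K_inv_prob :: "(complex^'d::finite) set \<Rightarrow> (complex^'d) measure \<Rightarrow> bool" where
  "K_inv_prob \<Omega> \<mu> \<longleftrightarrow> space \<mu> = shilov \<Omega> \<and> sets \<mu> = sets (restrict_space borel (shilov \<Omega>)) \<and>
     prob_space \<mu> \<and>
     (\<forall>g\<in>stabK \<Omega>. \<forall>h. continuous_on (closure \<Omega>) h \<and> (\<forall>z\<in>\<Omega>. h z = g z) \<longrightarrow> distr \<mu> \<mu> h = \<mu>)"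

definition shilov_measure :: "(complex^'d::finite) set \<Rightarrow> (complex^'d) measure" where
  "shilov_measure \<Omega> = (THE \<mu>. K_inv_prob \<Omega> \<mu>)"

definition cpoly :: "(complex^'d::finite \<Rightarrow> complex) set" where
  "cpoly = {p. \<exists>(A :: ('d \<Rightarrow> nat) set) c. finite A \<and>
              (\<forall>z. p z = (\<Sum>\<alpha>\<in>A. c \<alpha> * (\<Prod>i\<in>UNIV. (z $ i) ^ \<alpha> i)))}"

definition sq_int :: "'a measure \<Rightarrow> ('a \<Rightarrow> complex) \<Rightarrow> bool" where
  "sq_int \<mu> f \<longleftrightarrow> f \<in> borel_measurable \<mu> \<and> integrable \<mu> (\<lambda>z. (cmod (f z))\<^sup>2)"

definition linf :: "'a measure \<Rightarrow> ('a \<Rightarrow> complex) \<Rightarrow> bool" where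
  "linf \<mu> f \<longleftrightarrow> f \<in> borel_measurable \<mu> \<and> (\<exists>C. AE z in \<mu>. cmod (f z) \<le> C)"

definition hardy :: "(complex^'d::finite) measure \<Rightarrow> (complex^'d \<Rightarrow> complex) set" where
  "hardy \<mu> = {f. sq_int \<mu> f \<and>
     (\<forall>\<epsilon>>0. \<exists>p\<in>cpoly. (\<integral>z. (cmod (f z - p z))\<^sup>2 \<partial>\<mu>) < \<epsilon>)}"

definition szego_proj :: "(complex^'d::finite) measure \<Rightarrow> (complex^'d \<Rightarrow> complex) \<Rightarrow> (complex^'d \<Rightarrow> complex) \<Rightarrow> bool" where
  "szego_proj \<mu> h g \<longleftrightarrow> g \<in> hardy \<mu> \<and>
     (\<forall>q\<in>hardy \<mu>. (\<integral>z. (h z - g z) * cnj (q z) \<partial>\<mu>) = 0)"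

text \<open>\<open>T_\<phi> h = P(\<phi> h)\<close> is compact on \<open>H^2\<close>: the image of every bounded sequence has an
  \<open>L^2\<close>-Cauchy (hence convergent) subsequence.\<close>
definition toeplitz_compact :: "(complex^'d::finite) measure \<Rightarrow> (complex^'d \<Rightarrow> complex) \<Rightarrow> bool" where
  "toeplitz_compact \<mu> \<phi> \<longleftrightarrow>
     (\<forall>(h :: nat \<Rightarrow> complex^'d \<Rightarrow> complex) g.
        (\<forall>n. h n \<in> hardy \<mu> \<and> (\<integral>z. (cmod (h n z))\<^sup>2 \<partial>\<mu>) \<le> 1 \<and>
             szego_proj \<mu> (\<lambda>z. \<phi> z * h n z) (g n)) \<longrightarrow>
        (\<exists>\<sigma>. strict_mono \<sigma> \<and>
           (\<forall>\<epsilon>>0. \<exists>N::nat. \<forall>m\<ge>N. \<forall>k\<ge>N. (\<integral>z. (cmod (g (\<sigma> m) z - g (\<sigma> k) z))\<^sup>2 \<partial>\<mu>) < \<epsilon>)))"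

end

theory Submission
  imports Defs "HOL-Complex_Analysis.Conformal_Mappings"
begin

text \<open>
  On a bounded circular domain that is homogeneous in the following sense, the argument is the same for all four types.
  Let \<open>S\<close> be the set of complex extreme points of the closure and let a group \<open>G\<close> of unitary maps of the domain, lying in
  \<open>\<bbbK>\<close>, act transitively on \<open>S\<close>. Averaging \<open>|z + \<lambda>w|\<^sup>2\<close> over \<open>|\<lambda>| = 1\<close> shows that \<open>S\<close> consists of
  the points of maximal norm, and the peak functions \<open>1 + \<langle>z, \<zeta>\<rangle>/N\<close> show that \<open>S\<close> is the Shilov boundary. By Cartan's
  uniqueness theorem \<open>\<bbbK>\<close> acts linearly; a \<open>\<bbbK>\<close>-invariant probability measure arises from Lebesgue
  measure on a ball by sending \<open>z\<close> to the point \<open>\<zeta> \<in> S\<close> maximising \<open>Re \<langle>z, \<zeta>\<rangle>\<close>, and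
  transitivity makes it unique.

  The normalised powers of the peak function at \<open>\<zeta>\<close> tend weakly to \<open>0\<close> in \<open>H\<^sup>2\<close>. If \<open>T\<^sub>\<phi>\<close> is compact, the integrals of
  \<open>\<phi>\<close> against their squared moduli, an approximate identity at \<open>\<zeta>\<close>, therefore tend to \<open>0\<close> for every \<open>\<zeta>\<close>. Integrating
  against a continuous \<open>\<psi>\<close> and using Fubini's theorem gives \<open>\<integral> \<phi> \<psi> = 0\<close>, hence \<open>\<phi> = 0\<close>.

  Transitivity on extreme points is linear algebra. For matrices \<open>Z\<close> the perturbation \<open>Z + \<epsilon> (I - ZZ\<^sup>*) A (I - Z\<^sup>*Z)\<close> shows
  that an extreme \<open>Z\<close> satisfies \<open>(I - ZZ\<^sup>*) A (I - Z\<^sup>*Z) = 0\<close> for all admissible \<open>A\<close>; unitary reflections then bring it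
  to normal form.
\<close>

section \<open>Linearity of automorphisms fixing the origin\<close>

text \<open>The obstacle is that the measure is only described, as the unique one invariant under
  all of K, and K only through paths of automorphisms. Just the circles \<open>\<Psi> c\<close> are
  exhibited inside K; its other elements are not known to be unitary for the chosen inner product.
  Two devices bridge this gap. Cartan's theorem makes every element of K the restriction of a linear
  map preserving \<Omega>, and such a map preserves the Shilov boundary by the very definition of
  the latter. Uniqueness of the measure is proved by comparing masses of small neighbourhoods that
  are translates of multiples of \<Omega> itself. Every linear automorphism respects these, so the
  image of the G-invariant measure under one again gives them constant mass and therefore equals it:
  uniqueness yields invariance under all of K. A second constraint is that compactness is stated
  through given projections, so the Szego projection must be shown to exist before the hypothesis
  says anything.\<close>

definition clinear :: "(complex^'d::finite \<Rightarrow> complex^'d) \<Rightarrow> bool" where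
  "clinear L \<longleftrightarrow> (\<forall>x y. L (x + y) = L x + L y) \<and> (\<forall>c x. L (c *s x) = c *s L x)"

lemma scaleR_eq_smult: "r *\<^sub>R z = complex_of_real r *s z" for z :: "complex^'d::finite"
  by (simp add: vec_eq_iff) (metis scaleR_conv_of_real)

lemma norm_smult: "norm (c *s z) = cmod c * norm z" for z :: "complex^'d::finite"
  by (simp add: norm_vec_def norm_mult L2_set_right_distrib)

lemma bounded_bilinear_smult: "bounded_bilinear (\<lambda>c (z::complex^'d::finite). c *s z)"
  by (rule bounded_bilinear.intro)
     (auto simp: vec_eq_iff algebra_simps norm_smult intro!: exI[of _ 1])

lemmas tendsto_smult [tendsto_intros] = bounded_bilinear.tendsto [OF bounded_bilinear_smult]
lemmas continuous_on_smult [continuous_intros] = bounded_bilinear.continuous_on [OF bounded_bilinear_smult]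
lemmas has_derivative_smult = bounded_bilinear.FDERIV [OF bounded_bilinear_smult]

lemma clinear_imp_linear:
  assumes "clinear L" shows "linear L"
  using assms by (auto simp: clinear_def linear_iff scaleR_eq_smult)

lemma continuous_on_clinear:
  assumes "clinear L" shows "continuous_on S L"
  using clinear_imp_linear[OF assms] linear_continuous_on linear_conv_bounded_linear by blast

section \<open>Holomorphic maps along complex lines\<close>

lemma holomorphic_on_slice:
  assumes f: "sholo_on S f" and S: "\<And>c. c \<in> T \<Longrightarrow> a + c *s b \<in> S"
  shows "(\<lambda>c. f (a + c *s b)) holomorphic_on T"
proof -
  have "(\<lambda>c. f (a + c *s b)) field_differentiable (at c within T)" if "c \<in> T" for c
  proof -
    have "a + c *s b \<in> S" by (rule S[OF that])
    then obtain D where D: "(f has_derivative D) (at (a + c *s b))" "\<And>c v. D (c *s v) = c * D v"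
      using f unfolding sholo_on_def by blast
    have "((\<lambda>c. a + c *s b) has_derivative (\<lambda>h. h *s b)) (at c within T)"
      by (auto intro!: derivative_eq_intros has_derivative_smult)
    from has_derivative_compose[OF this D(1)]
    have "((\<lambda>c. f (a + c *s b)) has_derivative (\<lambda>h. D (h *s b))) (at c within T)" .
    moreover have "(\<lambda>h. D (h *s b)) = (*) (D b)"
      by (simp add: D(2) fun_eq_iff mult.commute)
    ultimately show ?thesis
      unfolding field_differentiable_def has_field_derivative_def by metis
  qed
  then show ?thesis
    by (simp add: holomorphic_on_def)
qed

lemma vholo_on_component:
  assumes "vholo_on S g" shows "sholo_on S (\<lambda>z. g z $ i)"
  unfolding sholo_on_def
proof
  fix z assume "z \<in> S"
  then obtain D where D: "(g has_derivative D) (at z)" "\<And>c v. D (c *s v) = c *s D v"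
    using assms unfolding vholo_on_def by blast
  have "((\<lambda>z. g z $ i) has_derivative (\<lambda>v. D v $ i)) (at z)"
    using bounded_linear.has_derivative[OF bounded_linear_vec_nth D(1)] .
  then show "\<exists>D. ((\<lambda>z. g z $ i) has_derivative D) (at z) \<and> (\<forall>c v. D (c *s v) = c * D v)"
    by (intro exI[of _ "\<lambda>v. D v $ i"]) (simp add: D(2))
qed

lemma vholo_on_imp_continuous_on: "vholo_on S g \<Longrightarrow> continuous_on S g"
  unfolding vholo_on_def
  by (meson continuous_at_imp_continuous_on has_derivative_continuous)

lemma vholo_on_compose:
  assumes "vholo_on S f" "vholo_on T g" "f ` S \<subseteq> T"
  shows "vholo_on S (\<lambda>z. g (f z))"
  unfolding vholo_on_def
proof
  fix z assume z: "z \<in> S"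
  obtain D where D: "(f has_derivative D) (at z)" "\<And>c v. D (c *s v) = c *s D v"
    using assms(1) z unfolding vholo_on_def by blast
  obtain E where E: "(g has_derivative E) (at (f z))" "\<And>c v. E (c *s v) = c *s E v"
    using assms(2,3) z unfolding vholo_on_def by blast
  show "\<exists>D. ((\<lambda>z. g (f z)) has_derivative D) (at z) \<and> (\<forall>c v. D (c *s v) = c *s D v)"
    using has_derivative_compose[OF D(1) E(1)]
    by (intro exI[of _ "\<lambda>v. E (D v)"]) (simp add: D(2) E(2))
qed

lemma clinear_has_derivative:
  assumes "clinear L" shows "(L has_derivative L) F"
  using clinear_imp_linear[OF assms]
  by (simp add: linear_conv_bounded_linear bounded_linear_imp_has_derivative)

lemma clinear_vholo_on:
  assumes "clinear L" shows "vholo_on S L"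
  using clinear_has_derivative[OF assms] assms
  unfolding vholo_on_def by (metis clinear_def)

lemma vholo_on_funpow:
  assumes "vholo_on S f" "f ` S \<subseteq> S"
  shows "vholo_on S (f ^^ k) \<and> (f ^^ k) ` S \<subseteq> S"
proof (induction k)
  case 0
  have "clinear (\<lambda>z::complex^'a. z)" by (simp add: clinear_def)
  from clinear_vholo_on[OF this, of S] show ?case by (simp add: id_def)
next
  case (Suc k)
  then show ?case
    using vholo_on_compose[of S "f ^^ k" S f] assms by (auto simp: comp_def)
qed

text \<open>Schwarz's lemma with bound B: dividing out a zero at 0 does not increase the bound. It
  is applied to \<open>h / (B + e)\<close>, because it asks for values strictly inside the disc and
  B may be 0; then e tends to 0.\<close>

lemma divide_by_identity:
  assumes h: "h holomorphic_on ball 0 1" and h0: "h 0 = 0"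
    and B: "\<And>c. cmod c < 1 \<Longrightarrow> cmod (h c) \<le> B"
  obtains g where "g holomorphic_on ball 0 1" "\<And>c. cmod c < 1 \<Longrightarrow> h c = c * g c"
    "\<And>c. cmod c < 1 \<Longrightarrow> cmod (g c) \<le> B"
proof -
  obtain g where g: "g holomorphic_on ball 0 1" "\<And>c. cmod c < 1 \<Longrightarrow> h c = c * g c" "deriv h 0 = g 0"
    using Schwarz3[OF h h0] by metis
  have B0: "B \<ge> 0" using B[of 0] h0 by simp
  have "cmod (g c) \<le> B" if c: "cmod c < 1" for c
  proof (rule field_le_epsilon)
    fix e :: real assume e: "e > 0"
    define B' where "B' = B + e"
    have B': "B' > 0" using B0 e by (simp add: B'_def)
    have lt: "cmod (h z / B') < 1" if "cmod z < 1" for z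
      using B[OF that] B' e by (simp add: norm_divide divide_simps B'_def del: of_real_add)
    have hol: "(\<lambda>z. h z / B') holomorphic_on ball 0 1"
      using B' by (intro holomorphic_intros h) auto
    show "cmod (g c) \<le> B + e"
    proof (cases "c = 0")
      case True
      have "deriv (\<lambda>z. h z / B') 0 = g 0 / B'"
        using g(3) h B' by (subst deriv_cdivide_right)
          (auto simp: holomorphic_on_imp_differentiable_at)
      then have "cmod (g 0 / B') \<le> 1"
        using Schwarz_Lemma(2)[OF hol _ lt, of 0] h0 by simp
      then show ?thesis using B' True by (simp add: norm_divide divide_simps B'_def del: of_real_add)
    next
      case False
      have "cmod (h c / B') \<le> cmod c"
        using Schwarz_Lemma(1)[OF hol _ lt c] h0 by simp
      then show ?thesis using B' False g(2)[OF c] by (simp add: norm_divide norm_mult divide_simps B'_def del: of_real_add)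
    qed
  qed
  with g that show thesis by blast
qed

text \<open>Cauchy's estimate for a leading coefficient without power series: for m > 0, convergence
  of \<open>h c / c ^ m\<close> forces h to vanish at 0, and dividing by c keeps the bound while
  lowering m.\<close>

lemma bound_of_order_limit:
  assumes "h holomorphic_on ball 0 1" "\<And>c. cmod c < 1 \<Longrightarrow> cmod (h c) \<le> B"
    and "((\<lambda>c. h c / c ^ m) \<longlongrightarrow> l) (at 0)"
  shows "cmod l \<le> B"
  using assms
proof (induction m arbitrary: h)
  case 0
  have "h \<midarrow>0\<rightarrow> h 0"
    using 0 by (metis centre_in_ball continuous_on_eq_continuous_at holomorphic_on_imp_continuous_on isCont_def open_ball zero_less_one)
  with 0 have "l = h 0" using LIM_unique[of h l 0 "h 0"] by simp
  then show ?case using 0(2)[of 0] by simp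
next
  case (Suc m)
  have "h \<midarrow>0\<rightarrow> h 0"
    using Suc(2) by (metis centre_in_ball continuous_on_eq_continuous_at holomorphic_on_imp_continuous_on isCont_def open_ball zero_less_one)
  moreover have "((\<lambda>c. (h c / c ^ Suc m) * c ^ Suc m) \<longlongrightarrow> l * 0 ^ Suc m) (at 0)"
    by (intro tendsto_intros Suc.prems)
  then have "h \<midarrow>0\<rightarrow> 0"
    by (intro Lim_transform_eventually[of _ _ _ h]) (auto simp: eventually_at_filter)
  ultimately have "h 0 = 0" using LIM_unique by blast
  then obtain g where g: "g holomorphic_on ball 0 1" "\<And>c. cmod c < 1 \<Longrightarrow> h c = c * g c"
    "\<And>c. cmod c < 1 \<Longrightarrow> cmod (g c) \<le> B"
    using divide_by_identity Suc.prems by blast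
  have "((\<lambda>c. g c / c ^ m) \<longlongrightarrow> l) (at 0)"
  proof (rule Lim_transform_eventually[OF Suc.prems(3)])
    show "\<forall>\<^sub>F x in at 0. h x / x ^ Suc m = g x / x ^ m"
      unfolding eventually_at by (rule exI[of _ 1]) (auto simp: g(2))
  qed
  then show ?case using Suc.IH g by blast
qed


text \<open>Cartan's iteration. If F deviates from the identity first at order m \<ge> 2, with
  coefficient G, then the k-th iterate deviates with coefficient k G. All iterates stay in the
  bounded domain, so k G is bounded in k and G = 0. Everything happens on discs c \<mapsto> c z,
  where one-variable theory applies.\<close>

theorem cartan_uniqueness:
  fixes \<Omega> :: "(complex^'d::finite) set"
  assumes "open \<Omega>" "bounded \<Omega>"
    and bal: "\<And>z c. z \<in> \<Omega> \<Longrightarrow> cmod c \<le> 1 \<Longrightarrow> c *s z \<in> \<Omega>"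
    and F: "vholo_on \<Omega> F" "F ` \<Omega> \<subseteq> \<Omega>" "F 0 = 0" "(F has_derivative (\<lambda>v. v)) (at 0)"
    and z: "z \<in> \<Omega>"
  shows "F z = z"
proof -
  obtain b where b: "\<And>w. w \<in> \<Omega> \<Longrightarrow> norm w \<le> b"
    using \<open>bounded \<Omega>\<close> unfolding bounded_iff by blast
  define B where "B = 2 * b"
  have B: "cmod (w $ i - w' $ i) \<le> B" if "w \<in> \<Omega>" "w' \<in> \<Omega>" for w w' i
    using Finite_Cartesian_Product.norm_nth_le[of w i] Finite_Cartesian_Product.norm_nth_le[of w' i]
      b[OF that(1)] b[OF that(2)] norm_triangle_ineq4[of "w $ i" "w' $ i"]
    unfolding B_def by linarith
  define h where "h k z i c = (F ^^ k) (c *s z) $ i - c * z $ i" for k z i c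
  have Fk: "vholo_on \<Omega> (F ^^ k)" "(F ^^ k) ` \<Omega> \<subseteq> \<Omega>" for k
    using vholo_on_funpow[OF F(1,2)] by blast+
  have h_hol: "h k z i holomorphic_on ball 0 1" if "z \<in> \<Omega>" for k z i
  proof -
    have "(\<lambda>c. (F ^^ k) (0 + c *s z) $ i) holomorphic_on ball 0 1"
      by (rule holomorphic_on_slice[OF vholo_on_component[OF Fk(1)]]) (auto intro!: bal that)
    then show ?thesis unfolding h_def by (auto intro!: holomorphic_intros)
  qed
  have h_bd: "cmod (h k z i c) \<le> B" if "z \<in> \<Omega>" "cmod c < 1" for k z i c
    using B[of "(F ^^ k) (c *s z)" "c *s z" i] Fk(2)[of k] bal[of z c] that
    by (auto simp: h_def)
  have B0: "B \<ge> 0" using B[OF z z] norm_ge_zero order_trans by blast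
  \<comment> \<open>Vanishing to order m along every disc, with a quotient still bounded by B.
    Keeping the same B at each order lets the induction on m run and finally gives the bound
    \<open>cmod c ^ m * B\<close> for all m.\<close>
  define P where "P m \<longleftrightarrow> (\<forall>z\<in>\<Omega>. \<forall>i. \<exists>g. g holomorphic_on ball 0 1 \<and>
      (\<forall>c. cmod c < 1 \<longrightarrow> h 1 z i c = c ^ m * g c) \<and> (\<forall>c. cmod c < 1 \<longrightarrow> cmod (g c) \<le> B))" for m
  have P2: "P 2"
    unfolding P_def
  proof (intro ballI allI)
    fix z i assume z: "z \<in> \<Omega>"
    have h0: "h 1 z i 0 = 0" by (simp add: h_def F(3))
    from divide_by_identity[OF h_hol[OF z] h0 h_bd[OF z]] obtain g where
      g: "g holomorphic_on ball 0 1" "\<And>c. cmod c < 1 \<Longrightarrow> h 1 z i c = c * g c"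
        "\<And>c. cmod c < 1 \<Longrightarrow> cmod (g c) \<le> B" by blast
    have "((\<lambda>c. F (c *s z)) has_derivative (\<lambda>v. v *s z)) (at 0)"
    proof -
      have "((\<lambda>c. c *s z) has_derivative (\<lambda>v. v *s z)) (at 0)"
        by (rule has_derivative_eq_rhs[OF has_derivative_smult[OF has_derivative_ident has_derivative_const]]) simp
      from has_derivative_compose[OF this] F(4) show ?thesis by auto
    qed
    from bounded_linear.has_derivative[OF bounded_linear_vec_nth this, of i]
    have "((\<lambda>c. F (c *s z) $ i) has_derivative (\<lambda>v. v * z $ i)) (at 0)" by simp
    then have "((\<lambda>c. F (c *s z) $ i) has_field_derivative (z $ i)) (at 0)"
      by (simp add: has_field_derivative_def mult_commute_abs)
    then have "(h 1 z i has_field_derivative (z $ i - z $ i)) (at 0)"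
      unfolding h_def by (auto intro!: derivative_eq_intros)
    then have "((\<lambda>c. h 1 z i c / c) \<longlongrightarrow> 0) (at 0)"
      using h0 by (simp add: DERIV_def)
    then have "g \<midarrow>0\<rightarrow> 0"
      by (rule Lim_transform_eventually)
         (auto simp: eventually_at g(2)[simplified] intro!: exI[of _ 1])
    moreover have "g \<midarrow>0\<rightarrow> g 0"
      using g(1) by (metis centre_in_ball continuous_on_eq_continuous_at holomorphic_on_imp_continuous_on isCont_def open_ball zero_less_one)
    ultimately have "g 0 = 0" using LIM_unique by blast
    from divide_by_identity[OF g(1) this g(3)] obtain g' where
      "g' holomorphic_on ball 0 1" "\<And>c. cmod c < 1 \<Longrightarrow> g c = c * g' c"
        "\<And>c. cmod c < 1 \<Longrightarrow> cmod (g' c) \<le> B" by blast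
    then show "\<exists>g. g holomorphic_on ball 0 1 \<and> (\<forall>c. cmod c < 1 \<longrightarrow> h 1 z i c = c\<^sup>2 * g c) \<and>
        (\<forall>c. cmod c < 1 \<longrightarrow> cmod (g c) \<le> B)"
      using g(2) by (intro exI[of _ g']) (auto simp: power2_eq_square)
  qed
  have Pstep: "P (Suc m)" if "P m" "2 \<le> m" for m
  proof -
    from \<open>P m\<close> obtain G where G_hol: "\<And>z i. z \<in> \<Omega> \<Longrightarrow> G z i holomorphic_on ball 0 1"
      and G: "\<And>z i c. z \<in> \<Omega> \<Longrightarrow> cmod c < 1 \<Longrightarrow> h 1 z i c = c ^ m * G z i c"
      and G_bd: "\<And>z i c. z \<in> \<Omega> \<Longrightarrow> cmod c < 1 \<Longrightarrow> cmod (G z i c) \<le> B"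
      unfolding P_def by metis
    \<comment> \<open>The bound is uniform in z because the base point moves with c in the iteration
      below.\<close>
    have G_lip: "cmod (G z i c - G z i 0) \<le> 2 * B * cmod c" if "z \<in> \<Omega>" "cmod c < 1" for z i c
    proof -
      have hol: "(\<lambda>c. G z i c - G z i 0) holomorphic_on ball 0 1"
        by (intro holomorphic_intros G_hol that)
      have bd: "cmod (G z i c - G z i 0) \<le> 2 * B" if "cmod c < 1" for c
        using G_bd[of z c i] G_bd[of z 0 i] \<open>z \<in> \<Omega>\<close> that norm_triangle_ineq4[of "G z i c" "G z i 0"] by simp
      have "G z i 0 - G z i 0 = 0" by simp
      from divide_by_identity[OF hol this bd] obtain g where
        "g holomorphic_on ball 0 1" and g: "\<And>c. cmod c < 1 \<Longrightarrow> G z i c - G z i 0 = c * g c"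
        "\<And>c. cmod c < 1 \<Longrightarrow> cmod (g c) \<le> 2 * B" by blast
      show ?thesis
        using g(2)[OF that(2)] by (simp add: g(1)[OF that(2)] norm_mult mult.commute mult_left_mono)
    qed
    \<comment> \<open>By \<open>G_lip\<close> the quotients converge uniformly on \<Omega>, so the
      leading coefficient depends continuously on z.\<close>
    have a_cont: "continuous_on \<Omega> (\<lambda>z. G z i 0)" for i
    proof (rule uniform_limit_theorem[where F="at 0" and f="\<lambda>c z. h 1 z i c / c ^ m"])
      show "\<forall>\<^sub>F c in at 0. continuous_on \<Omega> (\<lambda>z. h 1 z i c / c ^ m)"
        unfolding eventually_at
      proof (intro exI[of _ 1] conjI ballI impI)
        fix c :: complex assume c: "c \<noteq> 0 \<and> dist c 0 < 1"
        have "continuous_on \<Omega> (\<lambda>z. F (c *s z))"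
          by (rule continuous_on_compose2[OF vholo_on_imp_continuous_on[OF F(1)]])
             (use c in \<open>auto intro!: continuous_intros bal\<close>)
        then show "continuous_on \<Omega> (\<lambda>z. h 1 z i c / c ^ m)"
          unfolding h_def using c by (auto intro!: continuous_intros)
      qed auto
      show "uniform_limit \<Omega> (\<lambda>c z. h 1 z i c / c ^ m) (\<lambda>z. G z i 0) (at 0)"
        unfolding uniform_limit_iff
      proof (intro allI impI)
        fix e :: real assume e: "e > 0"
        show "\<forall>\<^sub>F c in at 0. \<forall>z\<in>\<Omega>. dist (h 1 z i c / c ^ m) (G z i 0) < e"
          unfolding eventually_at
        proof (intro exI[of _ "min 1 (e / (2 * B + 1))"] conjI ballI impI)
          show "0 < min 1 (e / (2 * B + 1))" using e B0 by simp
          fix c :: complex and z assume c: "c \<noteq> 0 \<and> dist c 0 < min 1 (e / (2 * B + 1))" and z: "z \<in> \<Omega>"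
          then have c1: "cmod c < 1" "c \<noteq> 0" "cmod c * (2 * B + 1) < e"
            using B0 by (auto simp: pos_less_divide_eq)
          have "dist (h 1 z i c / c ^ m) (G z i 0) \<le> 2 * B * cmod c"
            using G_lip[OF z c1(1)] G[OF z c1(1)] c1(2) by (simp add: dist_norm)
          also have "\<dots> < e"
          proof -
            have "cmod c * (2 * B + 1) = 2 * B * cmod c + cmod c" by (simp add: algebra_simps)
            then show ?thesis using c1(3) norm_ge_zero[of c] by linarith
          qed
          finally show "dist (h 1 z i c / c ^ m) (G z i 0) < e" .
        qed
      qed
    qed auto
    have lim: "((\<lambda>c. h k z i c / c ^ m) \<longlongrightarrow> of_nat k * G z i 0) (at 0)" if z: "z \<in> \<Omega>" for k z i
    proof (induction k arbitrary: i)
      case 0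
      then show ?case by (simp add: h_def)
    next
      case (Suc k)
      \<comment> \<open>Written as \<open>c *s z' c\<close>, the k-th iterate is again a point of a
        disc, now the one through \<open>z' c\<close>, and the order-m expansion of F applies there.
        As m \<ge> 2, the deviation disappears after division by c, so \<open>z' c\<close> tends to
        z.\<close>
      define z' where "z' c = (1 / c) *s (F ^^ k) (c *s z)" for c
      have z'_lim: "(z' \<longlongrightarrow> z) (at 0)"
      proof (rule vec_tendstoI)
        fix i
        have "((\<lambda>c. z $ i + c ^ (m - 1) * (h k z i c / c ^ m)) \<longlongrightarrow> z $ i + 0 ^ (m - 1) * (of_nat k * G z i 0)) (at 0)"
          by (intro tendsto_intros Suc)
        then have "((\<lambda>c. z $ i + c ^ (m - 1) * (h k z i c / c ^ m)) \<longlongrightarrow> z $ i) (at 0)"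
          using \<open>2 \<le> m\<close> by (simp add: power_0_left)
        then show "((\<lambda>c. z' c $ i) \<longlongrightarrow> z $ i) (at 0)"
        proof (rule Lim_transform_eventually)
          have "c ^ m = c * c ^ (m - 1)" for c :: complex
            using \<open>2 \<le> m\<close> by (metis Suc_1 Suc_le_D diff_Suc_1 power_Suc Suc_diff_1 less_le_trans zero_less_Suc)
          then show "\<forall>\<^sub>F c in at 0. z $ i + c ^ (m - 1) * (h k z i c / c ^ m) = z' c $ i"
            by (auto simp: eventually_at_filter z'_def h_def field_simps)
        qed
      qed
      have ev: "\<forall>\<^sub>F c in at 0. z' c \<in> \<Omega>"
        using topological_tendstoD[OF z'_lim \<open>open \<Omega>\<close> z] .
      have ev1: "\<forall>\<^sub>F c in at (0::complex). cmod c < 1 \<and> c \<noteq> 0"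
        unfolding eventually_at by (intro exI[of _ 1]) auto
      have "isCont (\<lambda>z. G z i 0) z"
        using a_cont[of i] \<open>open \<Omega>\<close> z continuous_on_eq_continuous_at by blast
      then have l1: "((\<lambda>c. G (z' c) i 0) \<longlongrightarrow> G z i 0) (at 0)"
        using isCont_tendsto_compose z'_lim by blast
      have l2: "((\<lambda>c. G (z' c) i c - G (z' c) i 0) \<longlongrightarrow> 0) (at 0)"
      proof (rule Lim_null_comparison)
        show "\<forall>\<^sub>F c in at 0. norm (G (z' c) i c - G (z' c) i 0) \<le> 2 * B * cmod c"
          using ev ev1 by eventually_elim (use G_lip in blast)
        have "((\<lambda>c::complex. 2 * B * cmod c) \<longlongrightarrow> 2 * B * cmod 0) (at 0)"
          by (intro tendsto_intros)
        then show "((\<lambda>c::complex. 2 * B * cmod c) \<longlongrightarrow> 0) (at 0)" by simp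
      qed
      have "((\<lambda>c. (G (z' c) i c - G (z' c) i 0) + G (z' c) i 0 + h k z i c / c ^ m)
          \<longlongrightarrow> 0 + G z i 0 + of_nat k * G z i 0) (at 0)"
        by (intro tendsto_add l1 l2 Suc)
      then have "((\<lambda>c. (G (z' c) i c - G (z' c) i 0) + G (z' c) i 0 + h k z i c / c ^ m)
          \<longlongrightarrow> of_nat (Suc k) * G z i 0) (at 0)"
        by (simp add: algebra_simps)
      then show ?case
      proof (rule Lim_transform_eventually)
        show "\<forall>\<^sub>F c in at 0. G (z' c) i c - G (z' c) i 0 + G (z' c) i 0 + h k z i c / c ^ m
            = h (Suc k) z i c / c ^ m"
          using ev ev1
        proof eventually_elim
          case (elim c)
          then have Fk: "(F ^^ k) (c *s z) = c *s z' c"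
            by (simp add: z'_def)
          have "h (Suc k) z i c = h 1 (z' c) i c + h k z i c"
            unfolding h_def by (simp add: Fk)
          also have "\<dots> = c ^ m * G (z' c) i c + h k z i c"
            using G elim by simp
          finally show ?case using elim by (simp add: field_simps)
        qed
      qed
    qed
    have "G z i 0 = 0" if z: "z \<in> \<Omega>" for z i
    proof (rule ccontr)
      assume "G z i 0 \<noteq> 0"
      then obtain k :: nat where "B < of_nat k * cmod (G z i 0)"
        by (metis reals_Archimedean3 zero_less_norm_iff)
      moreover have "cmod (of_nat k * G z i 0) \<le> B"
        by (rule bound_of_order_limit[OF h_hol h_bd lim]) (use z in auto)
      ultimately show False by (simp add: norm_mult)
    qed
    then have "\<exists>g. g holomorphic_on ball 0 1 \<and> (\<forall>c. cmod c < 1 \<longrightarrow> G z i c = c * g c) \<and>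
        (\<forall>c. cmod c < 1 \<longrightarrow> cmod (g c) \<le> B)" if "z \<in> \<Omega>" for z i
      using divide_by_identity[OF G_hol _ G_bd, of z i] that by (metis (no_types, lifting))
    then show "P (Suc m)"
      unfolding P_def using G by (metis (no_types, lifting) mult.assoc power_Suc2)
  qed
  have Pm: "P (m + 2)" for m
    by (induction m) (use P2 Pstep in \<open>auto simp: numeral_2_eq_2\<close>)
  have eq: "F (c *s z) = c *s z" if c: "cmod c < 1" for c
  proof -
    have "h 1 z i c = 0" for i
    proof -
      have "cmod (h 1 z i c) \<le> cmod c ^ m * B" for m
      proof -
        obtain g where "h 1 z i c = c ^ (m + 2) * g c" "cmod (g c) \<le> B"
          using Pm[of m] z c unfolding P_def by metis
        then have "cmod (h 1 z i c) \<le> cmod c ^ (m + 2) * B"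
          by (simp add: norm_mult norm_power mult_left_mono)
        also have "\<dots> \<le> cmod c ^ m * B"
          using c B0 by (intro mult_right_mono power_decreasing) auto
        finally show ?thesis .
      qed
      moreover have "(\<lambda>m. cmod c ^ m * B) \<longlonglongrightarrow> 0 * B"
        using c by (intro tendsto_intros LIMSEQ_realpow_zero) auto
      ultimately have "cmod (h 1 z i c) \<le> 0 * B"
        by (intro LIMSEQ_le_const) auto
      then show ?thesis by simp
    qed
    then show ?thesis by (simp add: h_def vec_eq_iff)
  qed
  \<comment> \<open>The identity is known for \<open>cmod c < 1\<close> only, so z itself is reached
    as a limit along the segment.\<close>
  have ct: "continuous_on {0..1} (\<lambda>t. F (complex_of_real t *s z))"
    by (rule continuous_on_compose2[OF vholo_on_imp_continuous_on[OF F(1)]])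
       (auto intro!: continuous_intros bal z)
  have "((\<lambda>t. F (complex_of_real t *s z)) \<longlongrightarrow> F (complex_of_real 1 *s z)) (at 1 within {0..1})"
    using ct[unfolded continuous_on_def, rule_format, of 1] by simp
  then have l1: "((\<lambda>t. F (complex_of_real t *s z)) \<longlongrightarrow> F z) (at_left 1)"
    by (simp add: at_within_Icc_at_left)
  have "((\<lambda>t. complex_of_real t *s z) \<longlongrightarrow> complex_of_real 1 *s z) (at_left 1)"
    by (intro tendsto_intros)
  moreover have "\<forall>\<^sub>F t in at_left 1. complex_of_real t *s z = F (complex_of_real t *s z)"
    unfolding eventually_at_left_field by (intro exI[of _ 0]) (auto simp: eq)
  ultimately have "((\<lambda>t. F (complex_of_real t *s z)) \<longlongrightarrow> z) (at_left 1)"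
    by (auto intro: Lim_transform_eventually)
  from tendsto_unique[OF _ l1 this] show "F z = z" by simp
qed

text \<open>The map z \<mapsto> g^-1 (c^-1 g (c z)) fixes 0 and has the identity as derivative
  there, so by uniqueness g commutes with every rotation c. Maximum modulus extends this to the
  disc, and a map that is homogeneous for small real factors agrees with its derivative at
  0.\<close>

theorem cartan_linear:
  fixes \<Omega> :: "(complex^'d::finite) set"
  assumes "open \<Omega>" "bounded \<Omega>" "0 \<in> \<Omega>"
    and bal: "\<And>z c. z \<in> \<Omega> \<Longrightarrow> cmod c \<le> 1 \<Longrightarrow> c *s z \<in> \<Omega>"
    and g: "g \<in> aut \<Omega>" "g 0 = 0"
  obtains L where "clinear L" "\<And>z. z \<in> \<Omega> \<Longrightarrow> g z = L z"
proof -
  define k where "k = inv_into \<Omega> g"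
  have bij: "bij_betw g \<Omega> \<Omega>" and gh: "vholo_on \<Omega> g" and kh: "vholo_on \<Omega> k"
    using g unfolding aut_def k_def by auto
  have kg: "\<And>z. z \<in> \<Omega> \<Longrightarrow> k (g z) = z" and gk: "\<And>z. z \<in> \<Omega> \<Longrightarrow> g (k z) = z"
    and gO: "\<And>z. z \<in> \<Omega> \<Longrightarrow> g z \<in> \<Omega>" and kO: "\<And>z. z \<in> \<Omega> \<Longrightarrow> k z \<in> \<Omega>"
    using bij unfolding k_def
    by (auto simp: bij_betw_inv_into_left bij_betw_inv_into_right bij_betwE bij_betw_inv_into)
       (meson bij bij_betwE bij_betw_inv_into)
  obtain D where D: "(g has_derivative D) (at 0)" "\<And>c v. D (c *s v) = c *s D v"
    using gh \<open>0 \<in> \<Omega>\<close> unfolding vholo_on_def by blast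
  have k0: "k 0 = 0" using kg[OF \<open>0 \<in> \<Omega>\<close>] g(2) by simp
  obtain E where E: "(k has_derivative E) (at 0)" "\<And>c v. E (c *s v) = c *s E v"
    using kh \<open>0 \<in> \<Omega>\<close> unfolding vholo_on_def by blast
  have "((\<lambda>z. k (g z)) has_derivative (\<lambda>v. E (D v))) (at 0)"
    using has_derivative_compose[OF D(1)] E(1) g(2) by simp
  then have "((\<lambda>z. z) has_derivative (\<lambda>v. E (D v))) (at 0)"
    by (rule has_derivative_transform_within_open[OF _ \<open>open \<Omega>\<close> \<open>0 \<in> \<Omega>\<close>]) (simp add: kg)
  then have "(\<lambda>v. E (D v)) = (\<lambda>v. v)"
    using has_derivative_unique has_derivative_ident by blast
  then have ED: "E (D v) = v" for v by metis
  have rot: "g (c *s z) = c *s g z" if c: "cmod c = 1" and z: "z \<in> \<Omega>" for c z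
  proof -
    define F where "F z = k (inverse c *s g (c *s z))" for z
    have [simp]: "c \<noteq> 0" "cmod (inverse c) = 1" using c by (auto simp: norm_inverse)
    have lin: "clinear (\<lambda>z. c *s z)" "clinear (\<lambda>z. inverse c *s z)"
      unfolding clinear_def by (auto simp: vec_eq_iff algebra_simps)
    have bc: "c *s z \<in> \<Omega>" "inverse c *s z \<in> \<Omega>" if "z \<in> \<Omega>" for z
      using bal that c by auto
    have "F z = z"
    proof (rule cartan_uniqueness[OF assms(1,2) bal])
      have "vholo_on \<Omega> (\<lambda>z. g (c *s z))"
        by (rule vholo_on_compose[OF clinear_vholo_on[OF lin(1)] gh]) (auto intro: bc)
      then have "vholo_on \<Omega> (\<lambda>z. inverse c *s g (c *s z))"
        by (rule vholo_on_compose[OF _ clinear_vholo_on[OF lin(2)], of _ _ UNIV]) auto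
      then show "vholo_on \<Omega> F" unfolding F_def
        by (rule vholo_on_compose[OF _ kh]) (auto intro!: bc gO)
      show "F ` \<Omega> \<subseteq> \<Omega>" unfolding F_def by (auto intro!: kO bc gO)
      show "F 0 = 0" by (simp add: F_def g(2) k0)
      have "((\<lambda>z. g (c *s z)) has_derivative (\<lambda>v. D (c *s v))) (at 0)"
        using has_derivative_compose[OF clinear_has_derivative[OF lin(1), of "at 0"], of g D] D(1) by simp
      from has_derivative_compose[OF this clinear_has_derivative[OF lin(2)]]
      have "((\<lambda>z. inverse c *s g (c *s z)) has_derivative (\<lambda>v. inverse c *s D (c *s v))) (at 0)" .
      from has_derivative_compose[OF this, of k E]
      have "(F has_derivative (\<lambda>v. E (inverse c *s D (c *s v)))) (at 0)"
        using E(1) by (simp add: F_def[abs_def] g(2))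
      then show "(F has_derivative (\<lambda>v. v)) (at 0)"
        by (simp add: D(2) vector_smult_assoc ED)
    qed (use z in auto)
    then have "g (F z) = g z" by simp
    then have "inverse c *s g (c *s z) = g z"
      unfolding F_def using gk bc gO z by simp
    then have "c *s (inverse c *s g (c *s z)) = c *s g z" by simp
    then show ?thesis by (simp add: vector_smult_assoc)
  qed
  \<comment> \<open>The difference of both sides is holomorphic in c and vanishes on the unit circle
    by \<open>rot\<close>, hence on the whole disc.\<close>
  have hom: "g (c *s z) = c *s g z" if c: "cmod c \<le> 1" and z: "z \<in> \<Omega>" for c z
  proof -
    have "g (c *s z) $ i - c * g z $ i = 0" for i
    proof -
      define f where "f c = g (c *s z) $ i - c * g z $ i" for c
      have sl: "(\<lambda>c. g (0 + c *s z) $ i) holomorphic_on ball 0 1"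
        by (rule holomorphic_on_slice[OF vholo_on_component[OF gh]]) (auto intro!: bal z)
      have ct: "continuous_on (cball 0 1) (\<lambda>c. g (c *s z) $ i)"
        by (intro continuous_intros continuous_on_compose2[OF vholo_on_imp_continuous_on[OF gh]])
           (auto intro!: bal z)
      have "cmod (f c) \<le> 0"
      proof (rule maximum_modulus_frontier[where f=f and S="cball 0 1" and \<xi>=c])
        show "f holomorphic_on interior (cball 0 1)"
          using sl unfolding f_def by (auto intro!: holomorphic_intros)
        show "continuous_on (closure (cball 0 1)) f"
          unfolding f_def using ct by (auto intro!: continuous_intros)
        show "\<And>c. c \<in> frontier (cball 0 1) \<Longrightarrow> cmod (f c) \<le> 0"
          by (auto simp: f_def rot z)
        show "bounded (cball (0::complex) 1)" by simp
        show "c \<in> cball 0 1" using c by simp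
      qed
      then show ?thesis by (simp add: f_def)
    qed
    then show ?thesis by (simp add: vec_eq_iff)
  qed
  have "clinear D"
    using D(2) has_derivative_linear[OF D(1)] by (auto simp: clinear_def linear_add)
  moreover have "g z = D z" if z: "z \<in> \<Omega>" for z
  proof -
    have "((\<lambda>t::real. t *\<^sub>R z) has_derivative (\<lambda>t. t *\<^sub>R z)) (at 0)"
      by (auto intro!: derivative_eq_intros)
    from has_derivative_compose[OF this, of g D] D(1)
    have "((\<lambda>t::real. g (t *\<^sub>R z)) has_derivative (\<lambda>t. D (t *\<^sub>R z))) (at 0)" by simp
    moreover have "D (t *\<^sub>R z) = t *\<^sub>R D z" for t by (simp add: scaleR_eq_smult D(2))
    ultimately have "((\<lambda>t::real. g (t *\<^sub>R z)) has_vector_derivative D z) (at 0)"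
      by (simp add: has_vector_derivative_def)
    then have "((\<lambda>t::real. t *\<^sub>R g z) has_vector_derivative D z) (at 0)"
    proof (rule has_vector_derivative_transform_within_open[where S="ball 0 1"])
      show "\<And>t::real. t \<in> ball 0 1 \<Longrightarrow> g (t *\<^sub>R z) = t *\<^sub>R g z"
        using hom[OF _ z] by (simp add: scaleR_eq_smult)
    qed auto
    moreover have "((\<lambda>t::real. t *\<^sub>R g z) has_vector_derivative g z) (at 0)"
      by (auto intro!: derivative_eq_intros)
    ultimately show ?thesis by (metis vector_derivative_at)
  qed
  ultimately show thesis using that by blast
qed

section \<open>Square-integrable functions and the Szego projection\<close>

lemma sq_int_mult_integrable:
  assumes "sq_int M f" "sq_int M g"
  shows "integrable M (\<lambda>z. f z * cnj (g z))"
proof (rule Bochner_Integration.integrable_bound)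
  show "integrable M (\<lambda>z. (cmod (f z))\<^sup>2 + (cmod (g z))\<^sup>2)"
    using assms by (auto simp: sq_int_def)
  show "(\<lambda>z. f z * cnj (g z)) \<in> borel_measurable M"
    using assms unfolding sq_int_def
    by (intro borel_measurable_times measurable_compose[of g M borel cnj borel]
        borel_measurable_continuous_onI continuous_intros) auto
  have "cmod (f z) * cmod (g z) \<le> (cmod (f z))\<^sup>2 + (cmod (g z))\<^sup>2" for z
    using sum_squares_bound[of "cmod (f z)" "cmod (g z)"]
      mult_nonneg_nonneg[OF norm_ge_zero[of "f z"] norm_ge_zero[of "g z"]] by linarith
  then show "AE z in M. norm (f z * cnj (g z)) \<le> norm ((cmod (f z))\<^sup>2 + (cmod (g z))\<^sup>2)"
    by (simp add: norm_mult)
qed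

lemma sq_int_cmult: "sq_int M f \<Longrightarrow> sq_int M (\<lambda>z. c * f z)"
  by (auto simp: sq_int_def norm_mult power_mult_distrib)

lemma sq_int_add:
  assumes "sq_int M f" "sq_int M g"
  shows "sq_int M (\<lambda>z. f z + g z)"
proof -
  have [measurable]: "f \<in> borel_measurable M" "g \<in> borel_measurable M"
    using assms by (auto simp: sq_int_def)
  have le: "(cmod (f z + g z))\<^sup>2 \<le> 2 * (cmod (f z))\<^sup>2 + 2 * (cmod (g z))\<^sup>2" for z
  proof -
    have "(cmod (f z + g z))\<^sup>2 \<le> (cmod (f z) + cmod (g z))\<^sup>2"
      by (intro power_mono norm_triangle_ineq) auto
    also have "\<dots> \<le> 2 * (cmod (f z))\<^sup>2 + 2 * (cmod (g z))\<^sup>2"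
      using sum_squares_bound[of "cmod (f z)" "cmod (g z)"] by (simp add: power2_sum)
    finally show ?thesis .
  qed
  have "integrable M (\<lambda>z. (cmod (f z + g z))\<^sup>2)"
    by (rule Bochner_Integration.integrable_bound[of _ "\<lambda>z. 2 * (cmod (f z))\<^sup>2 + 2 * (cmod (g z))\<^sup>2"])
       (use assms le in \<open>auto simp: sq_int_def\<close>)
  then show ?thesis by (auto simp: sq_int_def)
qed

lemma sq_int_diff:
  assumes "sq_int M f" "sq_int M g"
  shows "sq_int M (\<lambda>z. f z - g z)"
  using sq_int_add[OF assms(1) sq_int_cmult[OF assms(2), of "-1"]] by simp

lemma integral_norm_sq_diff:
  assumes f: "sq_int M f" and g: "sq_int M g"
  shows "(\<integral>z. (cmod (f z - t * g z))\<^sup>2 \<partial>M) =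
    (\<integral>z. (cmod (f z))\<^sup>2 \<partial>M) - 2 * Re (cnj t * (\<integral>z. f z * cnj (g z) \<partial>M)) + (cmod t)\<^sup>2 * (\<integral>z. (cmod (g z))\<^sup>2 \<partial>M)"
proof -
  have eq: "(cmod (a - t * b))\<^sup>2 = (cmod a)\<^sup>2 - 2 * Re (cnj t * (a * cnj b)) + (cmod t)\<^sup>2 * (cmod b)\<^sup>2" for a b
    by (simp only: cmod_power2) (simp add: power2_eq_square algebra_simps)
  have [simp]: "integrable M (\<lambda>z. f z * cnj (g z))" by (rule sq_int_mult_integrable[OF f g])
  have [simp]: "integrable M (\<lambda>z. (cmod (f z))\<^sup>2)" "integrable M (\<lambda>z. (cmod (g z))\<^sup>2)"
    using f g by (auto simp: sq_int_def)
  have i3: "integrable M (\<lambda>z. Re (cnj t * (f z * cnj (g z))))"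
    by (intro integrable_Re integrable_mult_right) simp
  have "(\<integral>z. Re (cnj t * (f z * cnj (g z))) \<partial>M) = Re (\<integral>z. cnj t * (f z * cnj (g z)) \<partial>M)"
    by (rule integral_Re) simp
  then have i4: "(\<integral>z. Re (cnj t * (f z * cnj (g z))) \<partial>M) = Re (cnj t * (\<integral>z. f z * cnj (g z) \<partial>M))"
    by simp
  show ?thesis
    unfolding eq using i3 by (simp add: i4 del: complex_cnj_cnj times_complex.sel)
qed

lemma L2_Cauchy_Schwarz:
  assumes f: "sq_int M f" and g: "sq_int M g"
  shows "(cmod (\<integral>z. f z * cnj (g z) \<partial>M))\<^sup>2 \<le> (\<integral>z. (cmod (f z))\<^sup>2 \<partial>M) * (\<integral>z. (cmod (g z))\<^sup>2 \<partial>M)"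
proof -
  define I a b where "I = (\<integral>z. f z * cnj (g z) \<partial>M)" and "a = (\<integral>z. (cmod (f z))\<^sup>2 \<partial>M)"
    and "b = (\<integral>z. (cmod (g z))\<^sup>2 \<partial>M)"
  have pos: "0 \<le> a - 2 * s * (cmod I)\<^sup>2 + s\<^sup>2 * (cmod I)\<^sup>2 * b" for s :: real
  proof -
    have "0 \<le> (\<integral>z. (cmod (f z - (of_real s * I) * g z))\<^sup>2 \<partial>M)" by simp
    also have "\<dots> = a - 2 * Re (cnj (of_real s * I) * I) + (cmod (of_real s * I))\<^sup>2 * b"
      unfolding I_def a_def b_def by (rule integral_norm_sq_diff[OF f g])
    also have "Re (cnj (of_real s * I) * I) = s * (cmod I)\<^sup>2"
      by (simp only: cmod_power2) (simp add: power2_eq_square algebra_simps)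
    finally show ?thesis by (simp add: norm_mult power_mult_distrib algebra_simps)
  qed
  have a0: "a \<ge> 0" and b0: "b \<ge> 0" by (simp_all add: a_def b_def)
  have "(cmod I)\<^sup>2 \<le> a * b"
  proof (cases "b = 0")
    case True
    have "(cmod I)\<^sup>2 = 0"
    proof (rule ccontr)
      assume ne: "(cmod I)\<^sup>2 \<noteq> 0"
      have "0 \<le> a - 2 * ((a + 1) / (cmod I)\<^sup>2) * (cmod I)\<^sup>2"
        using pos[of "(a + 1) / (cmod I)\<^sup>2"] True by simp
      then show False using ne a0 by simp
    qed
    then show ?thesis using True by simp
  next
    case False
    then have "b > 0" using b0 by simp
    have "0 \<le> a - 2 * (1 / b) * (cmod I)\<^sup>2 + (1 / b)\<^sup>2 * (cmod I)\<^sup>2 * b" by (rule pos)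
    also have "\<dots> = a - (cmod I)\<^sup>2 / b"
      using \<open>b > 0\<close> by (simp add: field_simps power2_eq_square)
    finally show ?thesis using \<open>b > 0\<close> by (simp add: field_simps)
  qed
  then show ?thesis by (simp add: I_def a_def b_def)
qed

lemma L2_triangle:
  assumes f: "sq_int M f" and g: "sq_int M g"
  shows "sqrt (\<integral>z. (cmod (f z + g z))\<^sup>2 \<partial>M) \<le> sqrt (\<integral>z. (cmod (f z))\<^sup>2 \<partial>M) + sqrt (\<integral>z. (cmod (g z))\<^sup>2 \<partial>M)"
proof -
  define I a b where "I = (\<integral>z. f z * cnj (g z) \<partial>M)" and "a = (\<integral>z. (cmod (f z))\<^sup>2 \<partial>M)"
    and "b = (\<integral>z. (cmod (g z))\<^sup>2 \<partial>M)"
  have ab: "a \<ge> 0" "b \<ge> 0" by (simp_all add: a_def b_def)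
  have "(\<integral>z. (cmod (f z + g z))\<^sup>2 \<partial>M) = a + 2 * Re I + b"
    using integral_norm_sq_diff[OF f g, of "-1"] by (simp add: I_def a_def b_def)
  also have "\<dots> \<le> a + 2 * (sqrt a * sqrt b) + b"
  proof -
    have "Re I \<le> cmod I" by (rule complex_Re_le_cmod)
    also have "\<dots> \<le> sqrt (a * b)"
      using L2_Cauchy_Schwarz[OF f g] by (simp add: I_def a_def b_def real_le_rsqrt)
    finally show ?thesis by (simp add: real_sqrt_mult)
  qed
  also have "\<dots> = (sqrt a + sqrt b)\<^sup>2"
    using ab by (simp add: power2_sum)
  finally show ?thesis
    unfolding a_def[symmetric] b_def[symmetric] using ab by (intro real_le_lsqrt) auto
qed

text \<open>Riesz-Fischer. A subsequence whose squared increments are below 4^-k has absolutely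
  summable increments almost everywhere; finiteness of the measure turns L2 bounds into L1 bounds.
  The pointwise limit is then the limit in the mean.\<close>

theorem (in finite_measure) L2_complete:
  assumes f: "\<And>n::nat. sq_int M (f n)"
    and cauchy: "\<And>\<epsilon>. \<epsilon> > 0 \<Longrightarrow> \<exists>N. \<forall>m\<ge>N. \<forall>k\<ge>N. (\<integral>z. (cmod (f m z - f k z))\<^sup>2 \<partial>M) < \<epsilon>"
  obtains g where "sq_int M g" "(\<lambda>n. \<integral>z. (cmod (f n z - g z))\<^sup>2 \<partial>M) \<longlonglongrightarrow> 0"
proof -
  have [measurable]: "f n \<in> borel_measurable M" for n using f by (auto simp: sq_int_def)
  have "\<forall>k. \<exists>N. \<forall>m\<ge>N. \<forall>n\<ge>N. (\<integral>z. (cmod (f m z - f n z))\<^sup>2 \<partial>M) < (1/4) ^ k"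
    using cauchy by simp
  then obtain N where N: "\<And>k m n. m \<ge> N k \<Longrightarrow> n \<ge> N k \<Longrightarrow> (\<integral>z. (cmod (f m z - f n z))\<^sup>2 \<partial>M) < (1/4) ^ k"
    by (auto dest!: choice)
  \<comment> \<open>Summing the thresholds up to k and adding k makes r strictly increasing and
    keeps it above \<open>N k\<close>.\<close>
  define r where "r k = (\<Sum>j\<le>k. N j) + k" for k
  have r_mono: "strict_mono r" by (simp add: strict_mono_Suc_iff r_def)
  have r_N: "r k \<ge> N k" for k
    unfolding r_def by (meson atMost_iff finite_atMost le_add1 member_le_sum order_refl order_trans zero_le)
  define \<Delta> where "\<Delta> k z = f (r (Suc k)) z - f (r k) z" for k z
  have \<Delta>_sq: "sq_int M (\<Delta> k)" for k unfolding \<Delta>_def by (intro sq_int_diff f)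
  then have [measurable]: "\<Delta> k \<in> borel_measurable M" for k by (auto simp: sq_int_def)
  have \<Delta>_bd: "(\<integral>z. (cmod (\<Delta> k z))\<^sup>2 \<partial>M) < (1/4) ^ k" for k
    unfolding \<Delta>_def using r_N[of k] strict_monoD[OF r_mono, of k "Suc k"] by (intro N) auto
  have \<Delta>_L1: "(\<integral>\<^sup>+z. ennreal (cmod (\<Delta> k z)) \<partial>M) \<le> ennreal ((1/2) ^ k * (1 + measure M (space M)))" for k
  proof -
    \<comment> \<open>The weights 2^k and 2^-k balance: the integral of the square is below 4^-k, so
      both terms contribute a multiple of 2^-k.\<close>
    have pt: "cmod (\<Delta> k z) \<le> 2 ^ k * (cmod (\<Delta> k z))\<^sup>2 + (1/2) ^ k" for z
    proof -
      define x where "x = cmod (\<Delta> k z)"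
      have "0 \<le> (2 ^ k * x - 1)\<^sup>2" by simp
      then have "2 * (2 ^ k * x) \<le> (2 ^ k * x)\<^sup>2 + 1" by (simp add: power2_diff)
      moreover have "x \<ge> 0" by (simp add: x_def)
      ultimately have "2 ^ k * x \<le> (2 ^ k * x)\<^sup>2 + 1"
        by (smt (verit) mult_nonneg_nonneg zero_le_power)
      then have "(1/2) ^ k * (2 ^ k * x) \<le> (1/2) ^ k * ((2 ^ k * x)\<^sup>2 + 1)"
        by (intro mult_left_mono) auto
      then show ?thesis
        by (simp add: x_def[symmetric] power_one_over field_simps power2_eq_square)
    qed
    have "(\<integral>\<^sup>+z. ennreal (cmod (\<Delta> k z)) \<partial>M) \<le> (\<integral>\<^sup>+z. ennreal (2 ^ k * (cmod (\<Delta> k z))\<^sup>2 + (1/2) ^ k) \<partial>M)"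
      by (intro nn_integral_mono ennreal_leI pt)
    also have "\<dots> = ennreal (\<integral>z. 2 ^ k * (cmod (\<Delta> k z))\<^sup>2 + (1/2) ^ k \<partial>M)"
      using \<Delta>_sq[of k] by (intro nn_integral_eq_integral) (auto simp: sq_int_def)
    also have "(\<integral>z. 2 ^ k * (cmod (\<Delta> k z))\<^sup>2 + (1/2) ^ k \<partial>M)
        = 2 ^ k * (\<integral>z. (cmod (\<Delta> k z))\<^sup>2 \<partial>M) + (1/2) ^ k * measure M (space M)"
      using \<Delta>_sq[of k] by (auto simp: sq_int_def)
    also have "\<dots> \<le> 2 ^ k * (1/4) ^ k + (1/2) ^ k * measure M (space M)"
      using \<Delta>_bd[of k] by (intro add_right_mono mult_left_mono) auto
    also have "2 ^ k * (1/4::real) ^ k = (1/2) ^ k"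
      by (simp add: power_mult_distrib[symmetric])
    finally show ?thesis by (simp add: algebra_simps ennreal_leI)
  qed
  have "(\<integral>\<^sup>+z. (\<Sum>k. ennreal (cmod (\<Delta> k z))) \<partial>M) = (\<Sum>k. \<integral>\<^sup>+z. ennreal (cmod (\<Delta> k z)) \<partial>M)"
    by (rule nn_integral_suminf) measurable
  also have "\<dots> \<le> (\<Sum>k. ennreal ((1/2) ^ k * (1 + measure M (space M))))"
    by (intro suminf_le \<Delta>_L1) auto
  also have "\<dots> = ennreal (\<Sum>k. (1/2) ^ k * (1 + measure M (space M)))"
    by (intro suminf_ennreal2 summable_mult2) (auto intro: summable_geometric)
  also have "\<dots> < \<infinity>" by simp
  finally have "AE z in M. (\<Sum>k. ennreal (cmod (\<Delta> k z))) \<noteq> \<infinity>"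
    by (intro nn_integral_PInf_AE) (auto simp: less_top)
  then have conv: "AE z in M. convergent (\<lambda>k. f (r k) z)"
  proof eventually_elim
    case (elim z)
    then have "summable (\<lambda>k. cmod (\<Delta> k z))"
      by (intro summable_suminf_not_top) auto
    then have "summable (\<lambda>k. \<Delta> k z)" by (rule summable_norm_cancel)
    then have "convergent (\<lambda>n. \<Sum>k<n. \<Delta> k z)" by (simp add: summable_iff_convergent)
    moreover have "(\<Sum>k<n. \<Delta> k z) = f (r n) z - f (r 0) z" for n
      unfolding \<Delta>_def by (rule sum_lessThan_telescope)
    ultimately have "convergent (\<lambda>n. (f (r n) z - f (r 0) z) + f (r 0) z)"
      by (intro convergent_add convergent_const) simp
    then show ?case by simp
  qed
  define g where "g z = lim (\<lambda>k. f (r k) z)" for z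
  have [measurable]: "g \<in> borel_measurable M" unfolding g_def by measurable
  \<comment> \<open>Fatou's lemma along the subsequence passes the Cauchy bound on to the
    limit.\<close>
  have key: "(\<integral>\<^sup>+z. ennreal ((cmod (f n z - g z))\<^sup>2) \<partial>M) \<le> ennreal \<epsilon>"
    if "\<And>m k. m \<ge> K \<Longrightarrow> k \<ge> K \<Longrightarrow> (\<integral>z. (cmod (f m z - f k z))\<^sup>2 \<partial>M) < \<epsilon>" "n \<ge> K" for n \<epsilon> K
  proof -
    have "(\<integral>\<^sup>+z. ennreal ((cmod (f n z - g z))\<^sup>2) \<partial>M) =
        (\<integral>\<^sup>+z. liminf (\<lambda>k. ennreal ((cmod (f n z - f (r k) z))\<^sup>2)) \<partial>M)"
    proof (rule nn_integral_cong_AE)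
      show "AE z in M. ennreal ((cmod (f n z - g z))\<^sup>2) = liminf (\<lambda>k. ennreal ((cmod (f n z - f (r k) z))\<^sup>2))"
        using conv
      proof eventually_elim
        case (elim z)
        then have "(\<lambda>k. f (r k) z) \<longlonglongrightarrow> g z" by (simp add: g_def convergent_LIMSEQ_iff)
        then have "(\<lambda>k. ennreal ((cmod (f n z - f (r k) z))\<^sup>2)) \<longlonglongrightarrow> ennreal ((cmod (f n z - g z))\<^sup>2)"
          by (intro tendsto_intros tendsto_ennrealI)
        then show ?case by (metis lim_imp_Liminf trivial_limit_sequentially)
      qed
    qed
    also have "\<dots> \<le> liminf (\<lambda>k. \<integral>\<^sup>+z. ennreal ((cmod (f n z - f (r k) z))\<^sup>2) \<partial>M)"
      by (intro nn_integral_liminf) measurable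
    also have "\<dots> \<le> liminf (\<lambda>k. ennreal \<epsilon>)"
    proof (rule Liminf_mono)
      show "\<forall>\<^sub>F k in sequentially. (\<integral>\<^sup>+z. ennreal ((cmod (f n z - f (r k) z))\<^sup>2) \<partial>M) \<le> ennreal \<epsilon>"
        using eventually_ge_at_top[of K]
      proof eventually_elim
        case (elim k)
        have "(\<integral>\<^sup>+z. ennreal ((cmod (f n z - f (r k) z))\<^sup>2) \<partial>M) = ennreal (\<integral>z. (cmod (f n z - f (r k) z))\<^sup>2 \<partial>M)"
          using sq_int_diff[OF f[of n] f[of "r k"]] by (intro nn_integral_eq_integral) (auto simp: sq_int_def)
        moreover have "r k \<ge> K" using elim seq_suble[OF r_mono, of k] by linarith
        ultimately show ?case using that by (simp add: ennreal_leI less_imp_le)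
      qed
    qed
    also have "\<dots> = ennreal \<epsilon>" by (simp add: Liminf_const)
    finally show ?thesis .
  qed
  have fg: "sq_int M (\<lambda>z. f n z - g z) \<and> (\<integral>z. (cmod (f n z - g z))\<^sup>2 \<partial>M) \<le> \<epsilon>"
    if "\<And>m k. m \<ge> K \<Longrightarrow> k \<ge> K \<Longrightarrow> (\<integral>z. (cmod (f m z - f k z))\<^sup>2 \<partial>M) < \<epsilon>" "n \<ge> K" "\<epsilon> > 0" for n \<epsilon> K
  proof -
    have fin: "(\<integral>\<^sup>+z. ennreal ((cmod (f n z - g z))\<^sup>2) \<partial>M) < \<infinity>"
      using le_less_trans[OF key[OF that(1,2)] ennreal_less_top] by simp
    have int: "integrable M (\<lambda>z. (cmod (f n z - g z))\<^sup>2)"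
      by (rule integrableI_nonneg) (use fin in auto)
    moreover have "ennreal (\<integral>z. (cmod (f n z - g z))\<^sup>2 \<partial>M) \<le> ennreal \<epsilon>"
      using key[OF that(1,2)] nn_integral_eq_integral[OF int] by simp
    ultimately show ?thesis using \<open>\<epsilon> > 0\<close> by (auto simp: sq_int_def)
  qed
  obtain K where "\<And>m k. m \<ge> K \<Longrightarrow> k \<ge> K \<Longrightarrow> (\<integral>z. (cmod (f m z - f k z))\<^sup>2 \<partial>M) < 1"
    using cauchy[of 1] by auto
  from fg[OF this, of K] have "sq_int M (\<lambda>z. f K z - g z)" by simp
  from sq_int_diff[OF f[of K] this] have "sq_int M g" by simp
  moreover have "(\<lambda>n. \<integral>z. (cmod (f n z - g z))\<^sup>2 \<partial>M) \<longlonglongrightarrow> 0"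
  proof (rule LIMSEQ_I)
    fix e :: real assume e: "e > 0"
    obtain K where "\<And>m k. m \<ge> K \<Longrightarrow> k \<ge> K \<Longrightarrow> (\<integral>z. (cmod (f m z - f k z))\<^sup>2 \<partial>M) < e / 2"
      using cauchy[of "e / 2"] e by auto
    from fg[OF this] e have "(\<integral>z. (cmod (f n z - g z))\<^sup>2 \<partial>M) \<le> e / 2" if "n \<ge> K" for n
      using that by simp
    then have "\<forall>n\<ge>K. norm ((\<integral>z. (cmod (f n z - g z))\<^sup>2 \<partial>M) - 0) < e"
      using e by fastforce
    then show "\<exists>no. \<forall>n\<ge>no. norm ((\<integral>z. (cmod (f n z - g z))\<^sup>2 \<partial>M) - 0) < e" by blast
  qed
  ultimately show thesis using that by blast
qed

section \<open>Polynomials\<close>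

lemma cpoly_sum:
  assumes "finite A" "\<And>a. a \<in> A \<Longrightarrow> p a \<in> cpoly"
  shows "(\<lambda>z. \<Sum>a\<in>A. p a z) \<in> cpoly"
  using assms
proof (induction A rule: finite_induct)
  case empty
  show ?case unfolding cpoly_def by (auto intro!: exI[of _ "{}"])
next
  case (insert a A)
  then have "p a \<in> cpoly" "(\<lambda>z. \<Sum>a\<in>A. p a z) \<in> cpoly" by auto
  then obtain B1 c1 B2 c2 where B: "finite B1" "finite B2"
    "\<And>z. p a z = (\<Sum>\<alpha>\<in>B1. c1 \<alpha> * (\<Prod>i\<in>UNIV. (z $ i) ^ \<alpha> i))"
    "\<And>z. (\<Sum>a\<in>A. p a z) = (\<Sum>\<alpha>\<in>B2. c2 \<alpha> * (\<Prod>i\<in>UNIV. (z $ i) ^ \<alpha> i))"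
    unfolding cpoly_def by auto
  define c where "c \<alpha> = (if \<alpha> \<in> B1 then c1 \<alpha> else 0) + (if \<alpha> \<in> B2 then c2 \<alpha> else 0)" for \<alpha>
  have "(\<Sum>a\<in>insert a A. p a z) = (\<Sum>\<alpha>\<in>B1 \<union> B2. c \<alpha> * (\<Prod>i\<in>UNIV. (z $ i) ^ \<alpha> i))" for z
  proof -
    have 1: "(\<Sum>\<alpha>\<in>B1. c1 \<alpha> * (\<Prod>i\<in>UNIV. (z $ i) ^ \<alpha> i)) =
        (\<Sum>\<alpha>\<in>B1 \<union> B2. (if \<alpha> \<in> B1 then c1 \<alpha> else 0) * (\<Prod>i\<in>UNIV. (z $ i) ^ \<alpha> i))"
      using B by (intro sum.mono_neutral_cong_left) auto
    have 2: "(\<Sum>\<alpha>\<in>B2. c2 \<alpha> * (\<Prod>i\<in>UNIV. (z $ i) ^ \<alpha> i)) =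
        (\<Sum>\<alpha>\<in>B1 \<union> B2. (if \<alpha> \<in> B2 then c2 \<alpha> else 0) * (\<Prod>i\<in>UNIV. (z $ i) ^ \<alpha> i))"
      using B by (intro sum.mono_neutral_cong_left) auto
    show ?thesis
      using insert B(3,4)[of z] by (simp add: 1 2 c_def sum.distrib ring_distribs)
  qed
  then show ?case unfolding cpoly_def using B by (auto intro!: exI[of _ "B1 \<union> B2"] exI[of _ c])
qed

lemma cpoly_add: "p \<in> cpoly \<Longrightarrow> q \<in> cpoly \<Longrightarrow> (\<lambda>z. p z + q z) \<in> cpoly"
  using cpoly_sum[of "UNIV :: bool set" "\<lambda>b. if b then p else q"] by (simp add: UNIV_bool add.commute)

lemma cpoly_monomial: "(\<lambda>z. c * (\<Prod>i\<in>UNIV. (z $ i) ^ \<alpha> i)) \<in> cpoly"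
  unfolding cpoly_def by (auto intro!: exI[of _ "{\<alpha>}"] exI[of _ "\<lambda>_. c"])

lemma cpoly_mult:
  assumes "p \<in> cpoly" "q \<in> cpoly" shows "(\<lambda>z. p z * q z) \<in> cpoly"
proof -
  obtain B1 c1 B2 c2 where B: "finite B1" "finite B2"
    "\<And>z. p z = (\<Sum>\<alpha>\<in>B1. c1 \<alpha> * (\<Prod>i\<in>UNIV. (z $ i) ^ \<alpha> i))"
    "\<And>z. q z = (\<Sum>\<alpha>\<in>B2. c2 \<alpha> * (\<Prod>i\<in>UNIV. (z $ i) ^ \<alpha> i))"
    using assms unfolding cpoly_def by auto
  have "(\<lambda>z. p z * q z) = (\<lambda>z. \<Sum>\<alpha>\<in>B1. \<Sum>\<beta>\<in>B2. (c1 \<alpha> * c2 \<beta>) * (\<Prod>i\<in>UNIV. (z $ i) ^ (\<alpha> i + \<beta> i)))"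
    by (simp add: B sum_product power_add prod.distrib mult_ac)
  also have "\<dots> \<in> cpoly"
    by (intro cpoly_sum B cpoly_monomial)
  finally show ?thesis .
qed

lemma cpoly_const: "(\<lambda>z. c) \<in> cpoly"
  using cpoly_monomial[of c "\<lambda>_. 0"] by simp

lemma cpoly_coord: "(\<lambda>z. z $ i) \<in> cpoly"
proof -
  have "(\<Prod>j\<in>UNIV. (z $ j) ^ (if j = i then 1 else 0)) = z $ i" for z :: "complex^'a"
    by (subst prod.remove[of _ i]) auto
  then show ?thesis using cpoly_monomial[of 1 "\<lambda>j. if j = i then 1 else 0"] by simp
qed

lemma cpoly_power: "p \<in> cpoly \<Longrightarrow> (\<lambda>z. p z ^ k) \<in> cpoly"
  by (induction k) (auto intro: cpoly_const cpoly_mult)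

lemma cpoly_continuous: "p \<in> cpoly \<Longrightarrow> continuous_on UNIV p"
proof -
  assume "p \<in> cpoly"
  then obtain B c where B: "p = (\<lambda>z. \<Sum>\<alpha>\<in>B. c \<alpha> * (\<Prod>i\<in>UNIV. (z $ i) ^ \<alpha> i))"
    unfolding cpoly_def by auto
  show ?thesis unfolding B by (intro continuous_intros)
qed

section \<open>The Hardy space over a compact set\<close>

locale compact_prob =
  fixes M :: "(complex^'d::finite) measure" and S
  assumes compact: "compact S" and space_M: "space M = S"
    and sets_M: "sets M = sets (restrict_space borel S)" and prob: "prob_space M"
begin

sublocale prob_space M by (rule prob)

lemma measurable_M: "f \<in> borel_measurable borel \<Longrightarrow> f \<in> borel_measurable M"
  using measurable_restrict_space1[of f borel borel S] measurable_cong_sets[OF sets_M refl] by blast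

lemma measurable_M_continuous:
  fixes f :: "_ \<Rightarrow> 'b::topological_space"
  assumes "continuous_on S f" shows "f \<in> borel_measurable M"
  using borel_measurable_continuous_on_restrict[OF assms] measurable_cong_sets[OF sets_M refl] by blast

lemma integrable_M_continuous:
  fixes f :: "_ \<Rightarrow> 'b::{banach, second_countable_topology}"
  assumes "continuous_on S f" shows "integrable M f"
proof -
  have "bounded (f ` S)" using compact_continuous_image[OF assms compact] compact_imp_bounded by blast
  then obtain B where "\<forall>x\<in>S. norm (f x) \<le> B" unfolding bounded_iff by auto
  then show ?thesis
    by (intro integrable_const_bound[of _ B]) (auto simp: space_M measurable_M_continuous[OF assms])
qed

lemma sq_int_continuous:
  assumes "continuous_on S f" shows "sq_int M f"
  unfolding sq_int_def using assms
  by (auto intro!: measurable_M_continuous integrable_M_continuous continuous_intros)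

lemma sq_int_cpoly: "p \<in> cpoly \<Longrightarrow> sq_int M p"
  by (rule sq_int_continuous) (metis cpoly_continuous continuous_on_subset subset_UNIV)

text \<open>The definition approximates in squared norm; the square root is a norm and admits the
  triangle inequality.\<close>

lemma hardy_iff:
  "f \<in> hardy M \<longleftrightarrow> sq_int M f \<and> (\<forall>\<epsilon>>0. \<exists>p\<in>cpoly. sqrt (\<integral>z. (cmod (f z - p z))\<^sup>2 \<partial>M) < \<epsilon>)"
proof
  assume f: "f \<in> hardy M"
  then have "sq_int M f" by (simp add: hardy_def)
  moreover have "\<exists>p\<in>cpoly. sqrt (\<integral>z. (cmod (f z - p z))\<^sup>2 \<partial>M) < \<epsilon>" if "\<epsilon> > 0" for \<epsilon>
  proof -
    obtain p where "p \<in> cpoly" "(\<integral>z. (cmod (f z - p z))\<^sup>2 \<partial>M) < \<epsilon>\<^sup>2"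
      using f zero_less_power[OF \<open>\<epsilon> > 0\<close>, of 2] unfolding hardy_def by blast
    then show ?thesis using \<open>\<epsilon> > 0\<close> by (intro bexI[of _ p]) (auto intro: real_less_lsqrt)
  qed
  ultimately show "sq_int M f \<and> (\<forall>\<epsilon>>0. \<exists>p\<in>cpoly. sqrt (\<integral>z. (cmod (f z - p z))\<^sup>2 \<partial>M) < \<epsilon>)" by blast
next
  assume f: "sq_int M f \<and> (\<forall>\<epsilon>>0. \<exists>p\<in>cpoly. sqrt (\<integral>z. (cmod (f z - p z))\<^sup>2 \<partial>M) < \<epsilon>)"
  have "\<exists>p\<in>cpoly. (\<integral>z. (cmod (f z - p z))\<^sup>2 \<partial>M) < \<epsilon>" if "\<epsilon> > 0" for \<epsilon>
  proof -
    obtain p where "p \<in> cpoly" "sqrt (\<integral>z. (cmod (f z - p z))\<^sup>2 \<partial>M) < sqrt \<epsilon>"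
      using f \<open>\<epsilon> > 0\<close> by (metis real_sqrt_gt_zero)
    then show ?thesis by auto
  qed
  then show "f \<in> hardy M" using f by (simp add: hardy_def)
qed

lemma cpoly_hardy: "p \<in> cpoly \<Longrightarrow> p \<in> hardy M"
  unfolding hardy_iff using sq_int_cpoly by (auto intro!: bexI[of _ p])

lemma hardy_sq_int: "f \<in> hardy M \<Longrightarrow> sq_int M f"
  by (simp add: hardy_def)

lemma hardy_closed:
  assumes g: "sq_int M g" and "\<And>\<epsilon>. \<epsilon> > 0 \<Longrightarrow> \<exists>f\<in>hardy M. sqrt (\<integral>z. (cmod (g z - f z))\<^sup>2 \<partial>M) < \<epsilon>"
  shows "g \<in> hardy M"
  unfolding hardy_iff
proof (intro conjI allI impI g)
  fix \<epsilon> :: real assume e: "\<epsilon> > 0"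
  obtain f where f: "f \<in> hardy M" "sqrt (\<integral>z. (cmod (g z - f z))\<^sup>2 \<partial>M) < \<epsilon> / 2"
    using assms(2)[of "\<epsilon> / 2"] e by auto
  obtain p where p: "p \<in> cpoly" "sqrt (\<integral>z. (cmod (f z - p z))\<^sup>2 \<partial>M) < \<epsilon> / 2"
    using f(1) e unfolding hardy_iff by (meson half_gt_zero)
  have "sqrt (\<integral>z. (cmod (g z - p z))\<^sup>2 \<partial>M) < \<epsilon>"
    using L2_triangle[OF sq_int_diff[OF g hardy_sq_int[OF f(1)]] sq_int_diff[OF hardy_sq_int[OF f(1)] sq_int_cpoly[OF p(1)]]]
      f p by simp
  then show "\<exists>p\<in>cpoly. sqrt (\<integral>z. (cmod (g z - p z))\<^sup>2 \<partial>M) < \<epsilon>" using p by blast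
qed

lemma hardy_lincomb:
  assumes f: "f \<in> hardy M" and g: "g \<in> hardy M"
  shows "(\<lambda>z. f z + c * g z) \<in> hardy M"
  unfolding hardy_iff
proof (intro conjI allI impI)
  show "sq_int M (\<lambda>z. f z + c * g z)" by (rule sq_int_add[OF hardy_sq_int[OF f] sq_int_cmult[OF hardy_sq_int[OF g]]])
  fix \<epsilon> :: real assume e: "\<epsilon> > 0"
  define d where "d = \<epsilon> / (1 + cmod c)"
  have c1: "1 + cmod c > 0" by (simp add: add_pos_nonneg)
  have d: "d > 0" using e c1 by (simp add: d_def)
  obtain p where p: "p \<in> cpoly" "sqrt (\<integral>z. (cmod (f z - p z))\<^sup>2 \<partial>M) < d"
    using f d unfolding hardy_iff by meson
  obtain q where q: "q \<in> cpoly" "sqrt (\<integral>z. (cmod (g z - q z))\<^sup>2 \<partial>M) < d"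
    using g d unfolding hardy_iff by meson
  have sq: "sq_int M (\<lambda>z. f z - p z)" "sq_int M (\<lambda>z. g z - q z)"
    by (rule sq_int_diff[OF hardy_sq_int[OF f] sq_int_cpoly[OF p(1)]], rule sq_int_diff[OF hardy_sq_int[OF g] sq_int_cpoly[OF q(1)]])
  have "sqrt (\<integral>z. (cmod ((f z - p z) + c * (g z - q z)))\<^sup>2 \<partial>M) \<le>
     sqrt (\<integral>z. (cmod (f z - p z))\<^sup>2 \<partial>M) + cmod c * sqrt (\<integral>z. (cmod (g z - q z))\<^sup>2 \<partial>M)"
    using L2_triangle[OF sq(1) sq_int_cmult[OF sq(2), of c]]
    by (simp add: norm_mult power_mult_distrib real_sqrt_mult)
  also have "\<dots> < d + cmod c * d"
    using p q by (intro add_less_le_mono mult_left_mono) auto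
  also have "\<dots> = d * (1 + cmod c)" by (simp add: algebra_simps)
  also have "\<dots> = \<epsilon>" using c1 by (simp add: d_def)
  finally have "sqrt (\<integral>z. (cmod ((f z + c * g z) - (p z + c * q z)))\<^sup>2 \<partial>M) < \<epsilon>"
    by (simp add: algebra_simps)
  then show "\<exists>p\<in>cpoly. sqrt (\<integral>z. (cmod (f z + c * g z - p z))\<^sup>2 \<partial>M) < \<epsilon>"
    using p q by (intro bexI[of _ "\<lambda>z. p z + c * q z"] cpoly_add cpoly_mult cpoly_const)
qed

text \<open>A minimising sequence for the distance to the Hardy space is Cauchy by the parallelogram
  law. Its limit stays in the closed space, and moving it along q would lower the distance unless
  the residual is orthogonal to q.\<close>

theorem szego_proj_exists:
  assumes u: "sq_int M u"
  obtains g where "szego_proj M u g"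
proof -
  define D where "D p = (\<integral>z. (cmod (u z - p z))\<^sup>2 \<partial>M)" for p
  define d where "d = (INF p\<in>hardy M. D p)"
  have z0: "(\<lambda>_. 0) \<in> hardy M" by (rule cpoly_hardy[OF cpoly_const])
  have D0: "D p \<ge> 0" for p by (simp add: D_def)
  then have bdd: "bdd_below (D ` hardy M)" by (intro bdd_belowI[of _ 0]) auto
  have d_le: "d \<le> D p" if "p \<in> hardy M" for p
    unfolding d_def by (rule cINF_lower[OF bdd that])
  have "\<exists>p\<in>hardy M. D p < d + e" if "e > 0" for e
    using cInf_lessD[of "D ` hardy M" "d + e"] z0 that unfolding d_def by auto
  then have "\<forall>n. \<exists>p. p \<in> hardy M \<and> D p < d + 1 / real (Suc n)"
    by (metis of_nat_0_less_iff zero_less_Suc zero_less_divide_1_iff)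
  then obtain p where p: "\<And>n. p n \<in> hardy M" "\<And>n. D (p n) < d + 1 / real (Suc n)" by metis
  note sqp = hardy_sq_int[OF p(1)]
  have par: "(\<integral>z. (cmod (p m z - p k z))\<^sup>2 \<partial>M) \<le> 2 * (1 / real (Suc m)) + 2 * (1 / real (Suc k))" for m k
  proof -
    have mid: "(\<lambda>z. (p m z + p k z) / 2) \<in> hardy M"
      using hardy_lincomb[OF hardy_lincomb[OF z0 p(1)[of m], of "1/2"] p(1)[of k], of "1/2"]
      by (simp add: add_divide_distrib)
    \<comment> \<open>Parallelogram law for a - b and a - c. The midpoint of two nearly optimal
      points cannot be closer than the infimum, which forces the two points together.\<close>
    have alg: "(cmod (b - c))\<^sup>2 + 4 * (cmod (a - (b + c) / 2))\<^sup>2 = 2 * (cmod (a - b))\<^sup>2 + 2 * (cmod (a - c))\<^sup>2" for a b c :: complex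
      by (simp only: cmod_power2) (simp add: power2_eq_square algebra_simps add_divide_distrib diff_divide_distrib)
    have "(\<integral>z. (cmod (p m z - p k z))\<^sup>2 + 4 * (cmod (u z - (p m z + p k z) / 2))\<^sup>2 \<partial>M) =
        (\<integral>z. 2 * (cmod (u z - p m z))\<^sup>2 + 2 * (cmod (u z - p k z))\<^sup>2 \<partial>M)"
      by (simp only: alg)
    then have "(\<integral>z. (cmod (p m z - p k z))\<^sup>2 \<partial>M) + 4 * D (\<lambda>z. (p m z + p k z) / 2) = 2 * D (p m) + 2 * D (p k)"
      using sq_int_diff[OF sqp[of m] sqp[of k]] sq_int_diff[OF u hardy_sq_int[OF mid]]
        sq_int_diff[OF u sqp[of m]] sq_int_diff[OF u sqp[of k]]
      unfolding D_def by (simp add: sq_int_def)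
    moreover have "d \<le> D (\<lambda>z. (p m z + p k z) / 2)" by (rule d_le[OF mid])
    ultimately show ?thesis using p(2)[of m] p(2)[of k] by linarith
  qed
  have "\<exists>N. \<forall>m\<ge>N. \<forall>k\<ge>N. (\<integral>z. (cmod (p m z - p k z))\<^sup>2 \<partial>M) < \<epsilon>" if e: "\<epsilon> > 0" for \<epsilon>
  proof -
    obtain N where N: "inverse (real (Suc N)) < \<epsilon> / 4" using reals_Archimedean[of "\<epsilon> / 4"] e by auto
    have small: "1 / real (Suc m) < \<epsilon> / 4" if "m \<ge> N" for m
    proof -
      have "1 / real (Suc m) \<le> 1 / real (Suc N)" using that by (intro divide_left_mono) auto
      then show ?thesis using N by (simp add: inverse_eq_divide)
    qed
    have "(\<integral>z. (cmod (p m z - p k z))\<^sup>2 \<partial>M) < \<epsilon>" if "m \<ge> N" "k \<ge> N" for m k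
      using par[of m k] small[OF that(1)] small[OF that(2)] by linarith
    then show ?thesis by blast
  qed
  from L2_complete[OF sqp this] obtain g where g: "sq_int M g"
    and lim: "(\<lambda>n. \<integral>z. (cmod (p n z - g z))\<^sup>2 \<partial>M) \<longlonglongrightarrow> 0" by blast
  have lim': "(\<lambda>n. sqrt (\<integral>z. (cmod (p n z - g z))\<^sup>2 \<partial>M)) \<longlonglongrightarrow> 0"
    using tendsto_real_sqrt[OF lim] by simp
  have gH: "g \<in> hardy M"
  proof (rule hardy_closed[OF g])
    fix \<epsilon> :: real assume "\<epsilon> > 0"
    then obtain n where "sqrt (\<integral>z. (cmod (p n z - g z))\<^sup>2 \<partial>M) < \<epsilon>"
      using order_tendstoD(2)[OF lim'] by (meson eventually_happens trivial_limit_sequentially)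
    then show "\<exists>f\<in>hardy M. sqrt (\<integral>z. (cmod (g z - f z))\<^sup>2 \<partial>M) < \<epsilon>"
      by (intro bexI[of _ "p n"] p) (simp add: norm_minus_commute)
  qed
  have "sqrt (D g) \<le> sqrt d"
  proof (rule LIMSEQ_le_const)
    have "(\<lambda>n. sqrt (d + 1 / real (Suc n)) + sqrt (\<integral>z. (cmod (p n z - g z))\<^sup>2 \<partial>M)) \<longlonglongrightarrow> sqrt (d + 0) + 0"
      by (intro tendsto_intros lim' LIMSEQ_Suc[OF lim_1_over_n, unfolded o_def])
    then show "(\<lambda>n. sqrt (d + 1 / real (Suc n)) + sqrt (\<integral>z. (cmod (p n z - g z))\<^sup>2 \<partial>M)) \<longlonglongrightarrow> sqrt d" by simp
    have "sqrt (D g) \<le> sqrt (d + 1 / real (Suc n)) + sqrt (\<integral>z. (cmod (p n z - g z))\<^sup>2 \<partial>M)" for n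
    proof -
      have "sqrt (D g) \<le> sqrt (D (p n)) + sqrt (\<integral>z. (cmod (p n z - g z))\<^sup>2 \<partial>M)"
        using L2_triangle[OF sq_int_diff[OF u sqp[of n]] sq_int_diff[OF sqp[of n] g]] by (simp add: D_def)
      moreover have "sqrt (D (p n)) \<le> sqrt (d + 1 / real (Suc n))" using p(2)[of n] by simp
      ultimately show ?thesis by linarith
    qed
    then show "\<exists>N. \<forall>n\<ge>N. sqrt (D g) \<le> sqrt (d + 1 / real (Suc n)) + sqrt (\<integral>z. (cmod (p n z - g z))\<^sup>2 \<partial>M)" by blast
  qed
  then have Dg: "D g \<le> d" by simp
  have "(\<integral>z. (u z - g z) * cnj (q z) \<partial>M) = 0" if q: "q \<in> hardy M" for q
  proof (rule ccontr)
    define I where "I = (\<integral>z. (u z - g z) * cnj (q z) \<partial>M)"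
    define b where "b = (\<integral>z. (cmod (q z))\<^sup>2 \<partial>M)"
    assume "(\<integral>z. (u z - g z) * cnj (q z) \<partial>M) \<noteq> 0"
    then have I: "(cmod I)\<^sup>2 > 0" by (simp add: I_def)
    have b0: "b \<ge> 0" by (simp add: b_def)
    \<comment> \<open>Since \<open>s * b < 1\<close>, the first-order gain 2 s |I|^2 beats the
      quadratic loss s^2 |I|^2 b.\<close>
    define s where "s = 1 / (1 + b)"
    have s: "s > 0" using b0 by (simp add: s_def add_pos_nonneg)
    have "D g \<le> D (\<lambda>z. g z + (of_real s * I) * q z)"
      using Dg d_le[OF hardy_lincomb[OF gH q]] order_trans by blast
    also have "\<dots> = (\<integral>z. (cmod ((u z - g z) - (of_real s * I) * q z))\<^sup>2 \<partial>M)"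
      by (simp add: D_def algebra_simps)
    also have "\<dots> = D g - 2 * Re (cnj (of_real s * I) * I) + (cmod (of_real s * I))\<^sup>2 * b"
      unfolding D_def I_def b_def by (rule integral_norm_sq_diff[OF sq_int_diff[OF u g] hardy_sq_int[OF q]])
    also have "Re (cnj (of_real s * I) * I) = s * (cmod I)\<^sup>2"
      by (simp only: cmod_power2) (simp add: power2_eq_square algebra_simps)
    finally have "2 * s * (cmod I)\<^sup>2 \<le> s\<^sup>2 * (cmod I)\<^sup>2 * b"
      by (simp add: norm_mult power_mult_distrib)
    then have "2 * (s * (cmod I)\<^sup>2) \<le> (s * b) * (s * (cmod I)\<^sup>2)"
      by (simp add: power2_eq_square mult_ac)
    then have "2 \<le> s * b" using I s by (simp add: mult.commute)
    then show False using b0 by (simp add: s_def divide_simps split: if_splits)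
  qed
  then show thesis using that gH unfolding szego_proj_def by blast
qed

end

section \<open>Invariant measures\<close>

lemma closed_Int_sets_restrict_borel: "closed C \<Longrightarrow> C \<inter> S \<in> sets (restrict_space borel S)"
  unfolding sets_restrict_space by (rule image_eqI[of _ _ C]) auto

lemma measure_eq_on_closed:
  fixes M N :: "'a::topological_space measure"
  assumes M: "finite_measure M" "sets M = sets (restrict_space borel S)"
    and N: "finite_measure N" "sets N = sets (restrict_space borel S)"
    and eq: "\<And>C. closed C \<Longrightarrow> emeasure M (C \<inter> S) = emeasure N (C \<inter> S)"
  shows "M = N"
proof (rule measure_eqI)
  show "sets M = sets N" using M N by simp
  have sp: "space M = S" "space N = S"
    using sets_eq_imp_space_eq[OF M(2)] sets_eq_imp_space_eq[OF N(2)] by (auto simp: space_restrict_space)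
  have id: "(\<lambda>x. x) \<in> borel_measurable M" "(\<lambda>x. x) \<in> borel_measurable N"
    using measurable_restrict_space1[OF measurable_ident_sets[OF refl], of borel S]
      measurable_cong_sets[OF M(2) refl] measurable_cong_sets[OF N(2) refl] by blast+
  have "distr M borel (\<lambda>x. x) = distr N borel (\<lambda>x. x)"
  proof (rule measure_eqI_generator_eq[where E="Collect closed" and \<Omega>=UNIV and A="\<lambda>_. UNIV"])
    show "Int_stable (Collect closed :: 'a set set)" by (auto simp: Int_stable_def)
    show "sets (distr M borel (\<lambda>x. x)) = sigma_sets UNIV (Collect closed)"
      "sets (distr N borel (\<lambda>x. x)) = sigma_sets UNIV (Collect closed)"
      by (simp_all add: borel_eq_closed)
    fix X :: "'a set" assume "X \<in> Collect closed"
    then show "emeasure (distr M borel (\<lambda>x. x)) X = emeasure (distr N borel (\<lambda>x. x)) X"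
      using eq[of X] by (simp add: emeasure_distr id sp)
  next
    show "emeasure (distr M borel (\<lambda>x. x)) UNIV \<noteq> \<infinity>"
      using finite_measure.emeasure_finite[OF M(1)] by (simp add: emeasure_distr id)
  qed auto
  moreover fix A assume "A \<in> sets M"
  then obtain B where B: "B \<in> sets borel" "A = B \<inter> S"
    unfolding M(2) sets_restrict_space by auto
  have "emeasure (distr M borel (\<lambda>x. x)) B = emeasure M A" "emeasure (distr N borel (\<lambda>x. x)) B = emeasure N A"
    using B by (simp_all add: emeasure_distr id sp)
  ultimately show "emeasure M A = emeasure N A" by simp
qed

text \<open>Fubini for the set of pairs (x, y) with x in C and \<open>k x y\<close>: integrating
  over y first gives n times the mass of C, integrating over x first meets only points y within r of
  C.\<close>

lemma emeasure_le_kernel: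
  fixes M N :: "'a::{metric_space,second_countable_topology} measure"
  assumes M: "finite_measure M" "sets M = sets (restrict_space borel S)"
    and N: "finite_measure N" "sets N = sets (restrict_space borel S)"
    and k: "{(x, y). k x y} \<in> sets borel" "\<And>x y. k x y \<Longrightarrow> dist x y \<le> r"
    and m: "\<And>y. y \<in> S \<Longrightarrow> emeasure M {x\<in>S. k x y} = m"
    and n: "\<And>x. x \<in> S \<Longrightarrow> emeasure N {y\<in>S. k x y} = n"
    and C: "closed C"
  shows "n * emeasure M (C \<inter> S) \<le> m * emeasure N ({y. infdist y C \<le> r} \<inter> S)"
proof -
  interpret M: finite_measure M by fact
  interpret N: finite_measure N by fact
  interpret pair_sigma_finite M N by unfold_locales
  have sp: "space M = S" "space N = S"
    using sets_eq_imp_space_eq[OF M(2)] sets_eq_imp_space_eq[OF N(2)] by (auto simp: space_restrict_space)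
  have idM [measurable]: "(\<lambda>x. x) \<in> borel_measurable M" and idN [measurable]: "(\<lambda>x. x) \<in> borel_measurable N"
    using measurable_restrict_space1[OF measurable_ident_sets[OF refl], of borel S]
      measurable_cong_sets[OF M(2) refl] measurable_cong_sets[OF N(2) refl] by blast+
  have "(\<lambda>p. p) \<in> M \<Otimes>\<^sub>M N \<rightarrow>\<^sub>M borel \<Otimes>\<^sub>M borel"
    using measurable_Pair[OF measurable_compose[OF measurable_fst idM] measurable_compose[OF measurable_snd idN]] by simp
  then have idP: "(\<lambda>p. p) \<in> M \<Otimes>\<^sub>M N \<rightarrow>\<^sub>M borel" by (simp add: borel_prod)
  have K: "{(x, y). k x y} \<inter> space (M \<Otimes>\<^sub>M N) \<in> sets (M \<Otimes>\<^sub>M N)"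
    using measurable_sets[OF idP k(1)] by simp
  have CM: "C \<inter> S \<in> sets M"
    unfolding M(2) by (rule closed_Int_sets_restrict_borel[OF C])
  have [measurable]: "(\<lambda>(x, y). indicator (C \<inter> S) x * indicator {(x, y). k x y} (x, y) :: ennreal) \<in> borel_measurable (M \<Otimes>\<^sub>M N)"
  proof -
    have "(\<lambda>p. indicator {(x, y). k x y} p :: ennreal) \<in> borel_measurable (M \<Otimes>\<^sub>M N)"
      using borel_measurable_indicator_iff[of "{(x, y). k x y}" "M \<Otimes>\<^sub>M N"] K by blast
    moreover have "(\<lambda>p. indicator (C \<inter> S) (fst p) :: ennreal) \<in> borel_measurable (M \<Otimes>\<^sub>M N)"
      by (rule measurable_compose[OF measurable_fst borel_measurable_indicator[OF CM]])
    ultimately show ?thesis by (simp add: case_prod_beta' borel_measurable_times)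
  qed
  define Cr where "Cr = {y. infdist y C \<le> r}"
  have near: "infdist y C \<le> r" if "x \<in> C" "k x y" for x y
    using infdist_le2[of x C y r] k(2)[OF that(2)] that(1) by (simp add: dist_commute)
  have kM: "{x\<in>S. k x y} \<in> sets M" if "y \<in> S" for y
    using sets_Pair2[OF K, of y] that by (simp add: vimage_def space_pair_measure sp) (metis (no_types, lifting) Collect_cong)
  have kN: "{y\<in>S. k x y} \<in> sets N" if "x \<in> S" for x
    using sets_Pair1[OF K, of x] that by (simp add: vimage_def space_pair_measure sp) (metis (no_types, lifting) Collect_cong)
  have "n * emeasure M (C \<inter> S) = (\<integral>\<^sup>+x. n * indicator (C \<inter> S) x \<partial>M)"
    using CM by (simp add: nn_integral_cmult)
  also have "\<dots> = (\<integral>\<^sup>+x. \<integral>\<^sup>+y. indicator (C \<inter> S) x * indicator {(x, y). k x y} (x, y) \<partial>N \<partial>M)"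
  proof (rule nn_integral_cong)
    fix x assume "x \<in> space M"
    then have x: "x \<in> S" by (simp add: sp)
    have "(\<integral>\<^sup>+y. indicator (C \<inter> S) x * indicator {(x, y). k x y} (x, y) \<partial>N) = (\<integral>\<^sup>+y. indicator (C \<inter> S) x * indicator {y\<in>S. k x y} y \<partial>N)"
      by (intro nn_integral_cong) (auto simp: sp indicator_def)
    also have "\<dots> = indicator (C \<inter> S) x * n"
      using kN[OF x] n[OF x] by (simp add: nn_integral_cmult)
    finally show "n * indicator (C \<inter> S) x = (\<integral>\<^sup>+y. indicator (C \<inter> S) x * indicator {(x, y). k x y} (x, y) \<partial>N)"
      by (simp add: mult.commute)
  qed
  also have "\<dots> = (\<integral>\<^sup>+y. \<integral>\<^sup>+x. indicator (C \<inter> S) x * indicator {(x, y). k x y} (x, y) \<partial>M \<partial>N)"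
    by (rule Fubini'[symmetric]) measurable
  also have "\<dots> \<le> (\<integral>\<^sup>+y. m * indicator (Cr \<inter> S) y \<partial>N)"
  proof (rule nn_integral_mono)
    fix y assume "y \<in> space N"
    then have y: "y \<in> S" by (simp add: sp)
    have "(\<integral>\<^sup>+x. indicator (C \<inter> S) x * indicator {(x, y). k x y} (x, y) \<partial>M) \<le> (\<integral>\<^sup>+x. indicator Cr y * indicator {x\<in>S. k x y} x \<partial>M)"
      using near by (intro nn_integral_mono) (auto simp: sp indicator_def Cr_def)
    also have "\<dots> = indicator Cr y * m"
      using kM[OF y] m[OF y] by (simp add: nn_integral_cmult)
    finally show "(\<integral>\<^sup>+x. indicator (C \<inter> S) x * indicator {(x, y). k x y} (x, y) \<partial>M) \<le> m * indicator (Cr \<inter> S) y"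
      using y by (simp add: mult.commute indicator_def)
  qed
  also have "\<dots> = m * emeasure N (Cr \<inter> S)"
  proof -
    have "closed Cr" unfolding Cr_def by (intro closed_Collect_le continuous_intros)
    then have "Cr \<inter> S \<in> sets N" unfolding N(2) by (rule closed_Int_sets_restrict_borel)
    then show ?thesis by (simp add: nn_integral_cmult)
  qed
  finally show ?thesis by (simp add: Cr_def)
qed

text \<open>Haar uniqueness by hand, without determinants: the product of the masses of A and of the
  L-invariant set B is a double integral, evaluated in two orders after moving the translation from
  one set to the other.\<close>

lemma distr_lborel_linear:
  fixes L :: "'a::euclidean_space \<Rightarrow> 'a"
  assumes L: "linear L" "inj L" and B: "open B" "bounded B" "B \<noteq> {}" "\<And>x. x \<in> B \<Longrightarrow> - x \<in> B"
    and LB: "\<And>x. L x \<in> B \<longleftrightarrow> x \<in> B"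
  shows "distr lborel borel L = lborel"
proof -
  have "surj L" using L linear_injective_imp_surjective by blast
  define L' where "L' = inv L"
  have LL': "L (L' x) = x" for x using \<open>surj L\<close> by (simp add: L'_def surj_f_inv_f)
  have cont: "continuous_on UNIV L"
    using L(1) linear_continuous_on linear_conv_bounded_linear by blast
  have cont': "continuous_on UNIV L'"
    unfolding L'_def using inj_linear_imp_inv_linear[OF L] linear_continuous_on linear_conv_bounded_linear by blast
  note [measurable] = borel_measurable_continuous_onI[OF cont] borel_measurable_continuous_onI[OF cont'] borel_open[OF B(1)]
  have tr: "(\<integral>\<^sup>+x. f (x + a) \<partial>lborel) = (\<integral>\<^sup>+x. f x \<partial>lborel)" if [measurable]: "f \<in> borel_measurable borel" for f :: "'a \<Rightarrow> ennreal" and a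
  proof -
    have "(\<integral>\<^sup>+x. f x \<partial>lborel) = (\<integral>\<^sup>+x. f x \<partial>distr lborel borel ((+) a))"
      by (simp add: lborel_distr_plus)
    also have "\<dots> = (\<integral>\<^sup>+x. f (a + x) \<partial>lborel)" by (rule nn_integral_distr) auto
    finally show ?thesis by (simp add: add.commute)
  qed
  define b where "b = emeasure lborel B"
  have b: "b \<noteq> 0" "b \<noteq> \<infinity>"
    unfolding b_def using B emeasure_bounded_finite[of B] open_not_negligible[of B]
    by (auto simp: negligible_iff_null_sets null_sets_def emeasure_completion) 
  have "emeasure (distr lborel borel L) A = emeasure lborel A" if [measurable]: "A \<in> sets borel" for A
  proof -
    have "emeasure lborel A * b = (\<integral>\<^sup>+y. indicator B y * emeasure lborel A \<partial>lborel)"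
      by (simp add: nn_integral_multc b_def mult.commute)
    also have "\<dots> = (\<integral>\<^sup>+y. indicator B (L y) * emeasure lborel A \<partial>lborel)"
      using LB by (simp add: indicator_def)
    also have "\<dots> = (\<integral>\<^sup>+y. \<integral>\<^sup>+x. indicator B (L y) * indicator A (x + L y) \<partial>lborel \<partial>lborel)"
    proof (rule nn_integral_cong)
      fix y :: 'a
      have "(\<integral>\<^sup>+x. indicator A (x + L y) \<partial>lborel) = emeasure lborel A"
        using tr[of "indicator A" "L y"] by simp
      then show "indicator B (L y) * emeasure lborel A = (\<integral>\<^sup>+x. indicator B (L y) * indicator A (x + L y) \<partial>lborel)"
        by (simp add: nn_integral_cmult)
    qed
    also have "\<dots> = (\<integral>\<^sup>+x. \<integral>\<^sup>+y. indicator B (L y) * indicator A (x + L y) \<partial>lborel \<partial>lborel)"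
      by (rule lborel_pair.Fubini') measurable
    \<comment> \<open>Shifting y by \<open>L' x\<close> trades the translation by x in A for one in
      B. Afterwards the x-integral sees B only, and the symmetry of B about 0 turns
      \<open>L y - x\<close> into \<open>x - L y\<close>.\<close>
    also have "\<dots> = (\<integral>\<^sup>+x. \<integral>\<^sup>+y. indicator B (L y - x) * indicator A (L y) \<partial>lborel \<partial>lborel)"
    proof (rule nn_integral_cong)
      fix x :: 'a
      show "(\<integral>\<^sup>+y. indicator B (L y) * indicator A (x + L y) \<partial>lborel) = (\<integral>\<^sup>+y. indicator B (L y - x) * indicator A (L y) \<partial>lborel)"
        using tr[of "\<lambda>y. indicator B (L y - x) * indicator A (L y)" "L' x"]
        by (simp add: linear_add[OF L(1)] LL' add.commute)
    qed
    also have "\<dots> = (\<integral>\<^sup>+y. \<integral>\<^sup>+x. indicator B (L y - x) * indicator A (L y) \<partial>lborel \<partial>lborel)"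
      by (rule lborel_pair.Fubini'[symmetric]) measurable
    also have "\<dots> = (\<integral>\<^sup>+y. b * indicator A (L y) \<partial>lborel)"
    proof (rule nn_integral_cong)
      fix y :: 'a
      have "L y - x \<in> B \<longleftrightarrow> x + - L y \<in> B" for x
        using B(4)[of "L y - x"] B(4)[of "x - L y"] by auto
      then have "indicator B (L y - x) = (indicator B (x + - L y) :: ennreal)" for x
        by (simp add: indicator_def)
      then have "(\<integral>\<^sup>+x. indicator B (L y - x) \<partial>lborel) = b"
        using tr[of "indicator B" "- L y"] by (simp add: b_def)
      then show "(\<integral>\<^sup>+x. indicator B (L y - x) * indicator A (L y) \<partial>lborel) = b * indicator A (L y)"
        by (simp add: nn_integral_multc)
    qed
    also have "\<dots> = b * emeasure (distr lborel borel L) A"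
    proof -
      have "(\<integral>\<^sup>+y. indicator A (L y) \<partial>lborel) = (\<integral>\<^sup>+y. indicator A y \<partial>distr lborel borel L)"
        by (rule nn_integral_distr[symmetric]) auto
      then show ?thesis by (simp add: nn_integral_cmult)
    qed
    finally show ?thesis using b by (simp add: mult.commute ennreal_mult_cancel_left)
  qed
  then show ?thesis by (intro measure_eqI) auto
qed


text \<open>Stands in for uniqueness of an invariant measure on a homogeneous space. What enters is
  that neighbourhoods of each size have constant mass: comparing both ways on the whole space gives
  \<open>m r = n r\<close>, and for closed C the neighbourhoods shrink to C as r tends to 0.\<close>

theorem prob_measure_unique_kernel:
  fixes M N :: "'a::{metric_space,second_countable_topology} measure"
  assumes M: "prob_space M" "sets M = sets (restrict_space borel S)"
    and N: "prob_space N" "sets N = sets (restrict_space borel S)"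
    and k: "\<And>r. r > 0 \<Longrightarrow> {(x, y). k r x y} \<in> sets borel" "\<And>r x y. r > 0 \<Longrightarrow> k r x y \<Longrightarrow> dist x y \<le> r"
      "\<And>r x y. k r x y \<Longrightarrow> k r y x"
    and m: "\<And>r y. r > 0 \<Longrightarrow> y \<in> S \<Longrightarrow> emeasure M {x\<in>S. k r x y} = m r" "\<And>r. r > 0 \<Longrightarrow> m r \<noteq> 0"
    and n: "\<And>r y. r > 0 \<Longrightarrow> y \<in> S \<Longrightarrow> emeasure N {x\<in>S. k r x y} = n r"
  shows "M = N"
proof -
  interpret M: prob_space M by fact
  interpret N: prob_space N by fact
  have sp: "space M = S" "space N = S"
    using sets_eq_imp_space_eq[OF M(2)] sets_eq_imp_space_eq[OF N(2)] by (auto simp: space_restrict_space)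
  have one: "emeasure M S = 1" "emeasure N S = 1"
    using M.emeasure_space_1 N.emeasure_space_1 by (simp_all add: sp)
  have sym: "{x\<in>S. k r y x} = {x\<in>S. k r x y}" for r y using k(3) by blast
  obtain y0 where y0: "y0 \<in> S" using M.not_empty sp by auto
  have fin: "m r \<noteq> \<top>" if "r > 0" for r using m(1)[OF that y0] M.emeasure_finite by metis
  have le1: "n r * emeasure M (C \<inter> S) \<le> m r * emeasure N ({y. infdist y C \<le> r} \<inter> S)" if "r > 0" "closed C" for r C
    by (rule emeasure_le_kernel[OF M.finite_measure_axioms M(2) N.finite_measure_axioms N(2) k(1,2)])
       (use that m n sym in auto)
  have le2: "m r * emeasure N (C \<inter> S) \<le> n r * emeasure M ({y. infdist y C \<le> r} \<inter> S)" if "r > 0" "closed C" for r C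
    by (rule emeasure_le_kernel[OF N.finite_measure_axioms N(2) M.finite_measure_axioms M(2) k(1,2)])
       (use that m n sym in auto)
  have full: "{y. infdist y UNIV \<le> r} \<inter> S = S" if "r > 0" for r
    using that by (auto intro!: order_trans[OF infdist_le[of _ UNIV]])
  have mn: "m r = n r" if "r > 0" for r
    using le1[OF that, of UNIV] le2[OF that, of UNIV] that by (simp add: one)
  have le1': "emeasure M (C \<inter> S) \<le> emeasure N ({y. infdist y C \<le> r} \<inter> S)" if "r > 0" "closed C" for r C
    using le1[OF that] m(2)[OF that(1)] fin[OF that(1)] by (simp add: mn[OF that(1), symmetric] ennreal_mult_le_mult_iff)
  have le2': "emeasure N (C \<inter> S) \<le> emeasure M ({y. infdist y C \<le> r} \<inter> S)" if "r > 0" "closed C" for r C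
    using le2[OF that] m(2)[OF that(1)] fin[OF that(1)] by (simp add: mn[OF that(1), symmetric] ennreal_mult_le_mult_iff)
  have lim: "(\<lambda>i. emeasure Q ({y. infdist y C \<le> 1 / real (Suc i)} \<inter> S)) \<longlonglongrightarrow> emeasure Q (C \<inter> S)"
    if Q: "finite_measure Q" "sets Q = sets (restrict_space borel S)" and C: "closed C" "C \<noteq> {}" for Q C
  proof -
    let ?A = "\<lambda>i. {y. infdist y C \<le> 1 / real (Suc i)} \<inter> S"
    have cl: "closed {y. infdist y C \<le> 1 / real (Suc i)}" for i
      by (intro closed_Collect_le continuous_intros)
    have "(\<Inter>i. ?A i) = C \<inter> S"
    proof (intro equalityI subsetI)
      fix y assume y: "y \<in> (\<Inter>i. ?A i)"
      have "infdist y C \<le> 0"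
      proof (rule LIMSEQ_le_const[OF LIMSEQ_Suc[OF lim_1_over_n, unfolded o_def]])
        show "\<exists>N. \<forall>n\<ge>N. infdist y C \<le> 1 / real (Suc n)" using y by auto
      qed
      then have "infdist y C = 0" using infdist_nonneg[of y C] by linarith
      then show "y \<in> C \<inter> S" using y C in_closed_iff_infdist_zero[of C y] by auto
    qed (use C in auto)
    moreover have "(\<lambda>i. emeasure Q (?A i)) \<longlonglongrightarrow> emeasure Q (\<Inter>i. ?A i)"
    proof (rule Lim_emeasure_decseq)
      show "range ?A \<subseteq> sets Q"
        using closed_Int_sets_restrict_borel[OF cl] unfolding Q(2) by blast
      show "decseq ?A"
      proof (rule decseq_SucI, intro subsetI)
        fix i y assume y: "y \<in> ?A (Suc i)"
        have "1 / real (Suc (Suc i)) \<le> 1 / real (Suc i)" by (intro divide_left_mono) auto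
        then show "y \<in> ?A i" using y by auto
      qed
      show "emeasure Q (?A i) \<noteq> \<infinity>" for i
        using finite_measure.emeasure_finite[OF Q(1)] by auto
    qed
    ultimately show ?thesis by simp
  qed
  show ?thesis
  proof (rule measure_eq_on_closed[OF M.finite_measure_axioms M(2) N.finite_measure_axioms N(2)])
    fix C :: "'a set" assume C: "closed C"
    show "emeasure M (C \<inter> S) = emeasure N (C \<inter> S)"
    proof (cases "C = {}")
      case False
      show ?thesis
      proof (rule antisym)
        show "emeasure M (C \<inter> S) \<le> emeasure N (C \<inter> S)"
          by (rule LIMSEQ_le_const[OF lim[OF N.finite_measure_axioms N(2) C False]]) (use le1'[OF _ C] in auto)
        show "emeasure N (C \<inter> S) \<le> emeasure M (C \<inter> S)"
          by (rule LIMSEQ_le_const[OF lim[OF M.finite_measure_axioms M(2) C False]]) (use le2'[OF _ C] in auto)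
      qed
    qed simp
  qed
qed

text \<open>The integer part of f t / d separates the points of T and takes finitely many
  values.\<close>

lemma finite_of_spaced_values:
  fixes f :: "real \<Rightarrow> real"
  assumes d: "d > 0" and inc: "\<And>s t. s \<in> T \<Longrightarrow> t \<in> T \<Longrightarrow> s < t \<Longrightarrow> f s + d \<le> f t"
    and bd: "\<And>t. t \<in> T \<Longrightarrow> \<bar>f t\<bar> \<le> K"
  shows "finite T"
proof (rule inj_on_finite)
  define F where "F t = \<lfloor>f t / d\<rfloor>" for t
  have lt: "F s < F t" if "s \<in> T" "t \<in> T" "s < t" for s t
  proof -
    have "f s / d + 1 \<le> f t / d"
      using divide_right_mono[OF inc[OF that], of d] d by (simp add: add_divide_distrib)
    then have "\<lfloor>f s / d + 1\<rfloor> \<le> \<lfloor>f t / d\<rfloor>" by (rule floor_mono)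
    then show ?thesis by (simp add: F_def)
  qed
  show "inj_on F T"
    by (rule inj_onI) (metis lt linorder_neqE less_irrefl)
  show "F ` T \<subseteq> {\<lfloor>- K / d\<rfloor>..\<lfloor>K / d\<rfloor>}"
  proof -
    have "- K / d \<le> f t / d" "f t / d \<le> K / d" if "t \<in> T" for t
      using divide_right_mono[of "- K" "f t" d] divide_right_mono[of "f t" K d] bd[OF that] d by auto
    then show ?thesis unfolding F_def by (auto intro!: floor_mono)
  qed
qed simp

section \<open>Support points of a compact set and the measure they carry\<close>

locale support_points =
  fixes b :: "'a::euclidean_space \<Rightarrow> 'a \<Rightarrow> real" and S :: "'a set"
  assumes b: "bounded_bilinear b" and pos: "\<And>z. z \<noteq> 0 \<Longrightarrow> b z z > 0"
    and S: "compact S" "S \<noteq> {}"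
begin

definition maxi :: "'a \<Rightarrow> 'a set" where
  "maxi z = {\<zeta>\<in>S. \<forall>\<eta>\<in>S. b z \<eta> \<le> b z \<zeta>}"

lemma continuous_b [continuous_intros]:
  "continuous_on T f \<Longrightarrow> continuous_on T g \<Longrightarrow> continuous_on T (\<lambda>x. b (f x) (g x))"
  by (rule bounded_bilinear.continuous_on[OF b])

lemma maxi_nonempty: "maxi z \<noteq> {}"
  using continuous_attains_sup[OF S, of "b z"] continuous_b[OF continuous_on_const continuous_on_id]
  by (auto simp: maxi_def)

text \<open>A closed relation projected along a compact set stays closed. Pairs of maximisers
  measure non-uniqueness; the diagonal of \<open>S \<inter> C\<close> will give the preimages of
  closed sets.\<close>

lemma closed_maxi_pair:
  assumes K: "compact K"
  shows "closed {z. \<exists>p\<in>K. fst p \<in> maxi z \<and> snd p \<in> maxi z}"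
proof -
  define T where "T = (S \<times> S) \<times> UNIV \<inter> (\<Inter>\<eta>\<in>S. {q. b (snd q) \<eta> \<le> b (snd q) (fst (fst q))} \<inter> {q. b (snd q) \<eta> \<le> b (snd q) (snd (fst q))})"
  have "closed T"
    unfolding T_def using S(1)
    by (intro closed_Int closed_INT ballI closed_Collect_le closed_Times continuous_intros closed_UNIV compact_imp_closed) auto
  from closed_compact_projection[OF K this]
  have "closed {y. \<exists>x. x \<in> K \<and> (x, y) \<in> T}" .
  moreover have "{y. \<exists>x. x \<in> K \<and> (x, y) \<in> T} = {z. \<exists>p\<in>K. fst p \<in> maxi z \<and> snd p \<in> maxi z}"
    by (simp add: T_def maxi_def Bex_def mem_Times_iff) blast
  ultimately show ?thesis by simp
qed

text \<open>Non-uniqueness made quantitative: two maximisers separated by at least 1/(n+1) in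
  direction v. The fixed gap makes the set closed and its trace on every line parallel to v
  finite.\<close>

definition bad :: "'a \<Rightarrow> nat \<Rightarrow> 'a set" where
  "bad v n = {z. \<exists>p\<in>{p\<in>S \<times> S. b v (snd p) + 1 / real (Suc n) \<le> b v (fst p)}. fst p \<in> maxi z \<and> snd p \<in> maxi z}"

lemma closed_bad: "closed (bad v n)"
  unfolding bad_def
proof (rule closed_maxi_pair)
  have cl: "closed {p. b v (snd p) + 1 / real (Suc n) \<le> b v (fst p)}"
    by (intro closed_Collect_le continuous_intros)
  have eq: "{p\<in>S \<times> S. b v (snd p) + 1 / real (Suc n) \<le> b v (fst p)} =
      (S \<times> S) \<inter> {p. b v (snd p) + 1 / real (Suc n) \<le> b v (fst p)}" by auto
  show "compact {p\<in>S \<times> S. b v (snd p) + 1 / real (Suc n) \<le> b v (fst p)}"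
    unfolding eq by (intro compact_Int_closed compact_Times S(1) cl)
qed

text \<open>Along a line, the subgradient intervals of the convex function \<open>max\<^bsub>\<zeta>\<in>S\<^esub> b z \<zeta>\<close> are ordered and
  have disjoint interiors, so only finitely many of them can have length at least \<open>1 / (n + 1)\<close>.\<close>
lemma finite_bad_line: "finite {t. z + t *\<^sub>R v \<in> bad v n}"
proof -
  let ?T = "{t. z + t *\<^sub>R v \<in> bad v n}"
  have "\<forall>t\<in>?T. \<exists>\<zeta> \<zeta>'. \<zeta> \<in> maxi (z + t *\<^sub>R v) \<and> \<zeta>' \<in> maxi (z + t *\<^sub>R v) \<and> b v \<zeta>' + 1 / real (Suc n) \<le> b v \<zeta>"
    unfolding bad_def by auto
  then obtain p q where pq: "\<And>t. t \<in> ?T \<Longrightarrow> p t \<in> maxi (z + t *\<^sub>R v)" "\<And>t. t \<in> ?T \<Longrightarrow> q t \<in> maxi (z + t *\<^sub>R v)"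
    "\<And>t. t \<in> ?T \<Longrightarrow> b v (q t) + 1 / real (Suc n) \<le> b v (p t)"
    by metis
  have bl: "b (z + t *\<^sub>R v) \<eta> = b z \<eta> + t * b v \<eta>" for t \<eta>
    by (simp add: bounded_bilinear.add_left[OF b] bounded_bilinear.scaleR_left[OF b])
  obtain K where K: "\<forall>\<eta>\<in>S. \<bar>b v \<eta>\<bar> \<le> K"
  proof -
    have "bounded (b v ` S)"
      by (intro compact_imp_bounded compact_continuous_image continuous_b continuous_intros S)
    then show ?thesis using that unfolding bounded_iff by auto
  qed
  show ?thesis
  proof (rule finite_of_spaced_values[where f="\<lambda>t. b v (q t)" and d="1 / real (Suc n)" and K=K])
    fix s t assume s: "s \<in> ?T" and t: "t \<in> ?T" and "s < t"
    have "b (z + s *\<^sub>R v) (q t) \<le> b (z + s *\<^sub>R v) (p s)"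
      using pq(1)[OF s] pq(2)[OF t] by (auto simp: maxi_def)
    moreover have "b (z + t *\<^sub>R v) (p s) \<le> b (z + t *\<^sub>R v) (q t)"
      using pq(1)[OF s] pq(2)[OF t] by (auto simp: maxi_def)
    ultimately have "(t - s) * b v (p s) \<le> (t - s) * b v (q t)"
      by (simp add: bl algebra_simps)
    then have "b v (p s) \<le> b v (q t)" using \<open>s < t\<close> by simp
    then show "b v (q s) + 1 / real (Suc n) \<le> b v (q t)" using pq(3)[OF s] by linarith
  next
    fix t assume "t \<in> ?T"
    then show "\<bar>b v (q t)\<bar> \<le> K" using pq(2)[of t] K by (auto simp: maxi_def)
  qed simp
qed

text \<open>By translation invariance the mass is the average over t in [0, 1] of the masses of the
  translates by t v; exchanging the integrals leaves, for each z, the measure of a finite set of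
  t.\<close>

lemma bad_null: "emeasure lborel (bad v n) = 0"
proof -
  have [measurable]: "bad v n \<in> sets borel" using closed_bad by (simp add: borel_closed)
  have tr: "(\<integral>\<^sup>+z. indicator (bad v n) (z + t *\<^sub>R v) \<partial>lborel) = emeasure lborel (bad v n)" for t
  proof -
    have "(\<integral>\<^sup>+z. indicator (bad v n) z \<partial>lborel) = (\<integral>\<^sup>+z. indicator (bad v n) z \<partial>distr lborel borel ((+) (t *\<^sub>R v)))"
      by (simp add: lborel_distr_plus)
    also have "\<dots> = (\<integral>\<^sup>+z. indicator (bad v n) (t *\<^sub>R v + z) \<partial>lborel)" by (rule nn_integral_distr) auto
    finally show ?thesis by (simp add: add.commute)
  qed
  have "emeasure lborel (bad v n) = (\<integral>\<^sup>+t. indicator {0..1::real} t * emeasure lborel (bad v n) \<partial>lborel)"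
    by (simp add: nn_integral_multc)
  also have "\<dots> = (\<integral>\<^sup>+t. \<integral>\<^sup>+z. indicator {0..1::real} t * indicator (bad v n) (z + t *\<^sub>R v) \<partial>lborel \<partial>lborel)"
    by (simp add: nn_integral_cmult tr)
  also have "\<dots> = (\<integral>\<^sup>+z. \<integral>\<^sup>+t. indicator {0..1::real} t * indicator (bad v n) (z + t *\<^sub>R v) \<partial>lborel \<partial>lborel)"
    by (rule lborel_pair.Fubini') measurable
  also have "\<dots> = (\<integral>\<^sup>+z. 0 \<partial>(lborel :: 'a measure))"
  proof (rule nn_integral_cong)
    fix z :: 'a
    have "AE t in lborel. t \<notin> {t. z + t *\<^sub>R v \<in> bad v n}"
      by (rule AE_not_in[OF finite_imp_null_set_lborel[OF finite_bad_line]])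
    then have "AE t in lborel. indicator {0..1::real} t * indicator (bad v n) (z + t *\<^sub>R v) = (0::ennreal)"
      by eventually_elim (simp add: indicator_def)
    then show "(\<integral>\<^sup>+t. indicator {0..1::real} t * indicator (bad v n) (z + t *\<^sub>R v) \<partial>lborel) = 0"
      by (subst nn_integral_cong_AE[of _ "\<lambda>_. 0"]) auto
  qed
  finally show ?thesis by simp
qed

definition nice :: "'a set" where "nice = - (\<Union>v\<in>Basis. \<Union>n. bad v n)"

lemma nice_borel [measurable]: "nice \<in> sets borel"
  unfolding nice_def using closed_bad by (intro borel_comp sets.finite_UN sets.countable_UN) (auto simp: borel_closed)

lemma AE_nice: "AE z in lborel. z \<in> nice"
proof -
  have "AE z in lborel. \<forall>v\<in>Basis. \<forall>n. z \<notin> bad v n"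
    using closed_bad bad_null
    by (intro AE_finite_allI AE_all_countable[THEN iffD2] allI AE_not_in) (auto simp: null_sets_def borel_closed)
  then show ?thesis by eventually_elim (auto simp: nice_def)
qed

text \<open>If no basis vector v distinguishes the maximisers through b v, then no vector w does,
  and positivity of b at w = \<zeta> - \<zeta>' makes them equal.\<close>

lemma nice_unique:
  assumes z: "z \<in> nice" and \<zeta>: "\<zeta> \<in> maxi z" "\<zeta>' \<in> maxi z"
  shows "\<zeta> = \<zeta>'"
proof -
  have le: "b v \<eta> \<le> b v \<eta>'" if "v \<in> Basis" "\<eta> \<in> maxi z" "\<eta>' \<in> maxi z" for v \<eta> \<eta>'
  proof (rule ccontr)
    assume "\<not> b v \<eta> \<le> b v \<eta>'"
    then obtain n where "inverse (real (Suc n)) < b v \<eta> - b v \<eta>'"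
      using reals_Archimedean[of "b v \<eta> - b v \<eta>'"] by auto
    then have "z \<in> bad v n" unfolding bad_def using that
      by (intro CollectI bexI[of _ "(\<eta>, \<eta>')"]) (auto simp: maxi_def inverse_eq_divide)
    then show False using z that(1) by (auto simp: nice_def)
  qed
  have "b w \<zeta> = b w \<zeta>'" for w
  proof -
    have "b w \<eta> = (\<Sum>v\<in>Basis. (w \<bullet> v) * b v \<eta>)" for \<eta>
    proof -
      have "b w \<eta> = b (\<Sum>v\<in>Basis. (w \<bullet> v) *\<^sub>R v) \<eta>" by (simp add: euclidean_representation)
      also have "\<dots> = (\<Sum>v\<in>Basis. (w \<bullet> v) * b v \<eta>)"
        by (simp add: bounded_bilinear.sum_left[OF b] bounded_bilinear.scaleR_left[OF b])
      finally show ?thesis .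
    qed
    moreover have "b v \<zeta> = b v \<zeta>'" if "v \<in> Basis" for v
      using le[OF that \<zeta>] le[OF that \<zeta>(2,1)] by simp
    ultimately show ?thesis by (simp cong: sum.cong)
  qed
  then have "b (\<zeta> - \<zeta>') (\<zeta> - \<zeta>') = 0"
    by (simp add: bounded_bilinear.diff_right[OF b])
  then show ?thesis using pos[of "\<zeta> - \<zeta>'"] by force
qed

definition e0 :: 'a where "e0 = (SOME x. x \<in> S)"

text \<open>On the null set outside \<open>nice\<close> the value is one fixed point of S, so that
  the map takes values in S everywhere and remains Borel.\<close>

definition top_pt :: "'a \<Rightarrow> 'a" where
  "top_pt z = (if z \<in> nice then (SOME \<zeta>. \<zeta> \<in> maxi z) else e0)"

lemma top_pt_maxi: "z \<in> nice \<Longrightarrow> top_pt z \<in> maxi z"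
  unfolding top_pt_def using maxi_nonempty[of z] by (auto intro: someI)

lemma top_pt_eq: "z \<in> nice \<Longrightarrow> \<zeta> \<in> maxi z \<Longrightarrow> top_pt z = \<zeta>"
  using nice_unique top_pt_maxi by blast

lemma top_pt_S: "top_pt z \<in> S"
  using top_pt_maxi[of z] someI_ex[of "\<lambda>x. x \<in> S"] S(2)
  by (cases "z \<in> nice") (auto simp: maxi_def top_pt_def e0_def)

lemma top_pt_measurable: "top_pt \<in> borel \<rightarrow>\<^sub>M restrict_space borel S"
proof (rule measurable_restrict_space2)
  show "top_pt \<in> space borel \<rightarrow> S" using top_pt_S by auto
  have "top_pt \<in> borel \<rightarrow>\<^sub>M sigma UNIV (Collect closed)"
  proof (rule measurable_measure_of)
    fix C :: "'a set" assume "C \<in> Collect closed"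
    \<comment> \<open>On \<open>nice\<close> the preimage of C is the set of z with some maximiser
      in C; restricted to diagonal pairs, \<open>closed_maxi_pair\<close> shows that this set is
      closed.\<close>
    then have "compact ((\<lambda>x. (x, x)) ` (S \<inter> C))"
      using S(1) by (intro compact_continuous_image continuous_intros) (auto simp: compact_Int_closed)
    from closed_maxi_pair[OF this]
    have [measurable]: "{z. \<exists>\<zeta>\<in>S \<inter> C. \<zeta> \<in> maxi z} \<in> sets borel" by (auto intro: borel_closed)
    have "top_pt z \<in> C \<longleftrightarrow> (\<exists>\<zeta>\<in>S \<inter> C. \<zeta> \<in> maxi z)" if "z \<in> nice" for z
    proof
      assume "top_pt z \<in> C"
      then show "\<exists>\<zeta>\<in>S \<inter> C. \<zeta> \<in> maxi z" using top_pt_S[of z] top_pt_maxi[OF that] by blast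
    next
      assume "\<exists>\<zeta>\<in>S \<inter> C. \<zeta> \<in> maxi z"
      then show "top_pt z \<in> C" using top_pt_eq[OF that] by blast
    qed
    moreover have "top_pt z = e0" if "z \<notin> nice" for z using that by (simp add: top_pt_def)
    ultimately have "top_pt -` C \<inter> space borel = (nice \<inter> {z. \<exists>\<zeta>\<in>S \<inter> C. \<zeta> \<in> maxi z}) \<union> (if e0 \<in> C then - nice else {})"
      by (intro set_eqI) (case_tac "x \<in> nice"; simp)
    also have "\<dots> \<in> sets borel" by (auto)
    finally show "top_pt -` C \<inter> space borel \<in> sets borel" .
  qed auto
  then show "top_pt \<in> borel_measurable borel" by (simp add: borel_eq_closed)
qed

definition unit :: "'a set" where "unit = {z. b z z < 1}"

lemma open_unit: "open unit"
  unfolding unit_def by (intro open_Collect_less continuous_intros)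

lemma bounded_unit: "bounded unit"
proof -
  have "sphere (0::'a) 1 \<noteq> {}" by simp
  from continuous_attains_inf[OF compact_sphere this continuous_b[OF continuous_on_id continuous_on_id]]
  obtain u :: 'a where u: "u \<in> sphere 0 1" "\<And>x. x \<in> sphere 0 1 \<Longrightarrow> b u u \<le> b x x" by blast
  have c: "b u u > 0" using u(1) by (intro pos) auto
  have "norm z \<le> sqrt (1 / b u u)" if "z \<in> unit" for z
  proof (cases "z = 0")
    case False
    have "b u u \<le> b (z /\<^sub>R norm z) (z /\<^sub>R norm z)" using False by (intro u) simp
    also have "\<dots> = b z z / (norm z)\<^sup>2"
      by (simp add: bounded_bilinear.scaleR_left[OF b] bounded_bilinear.scaleR_right[OF b] power2_eq_square field_simps)
    finally have "(norm z)\<^sup>2 * b u u < 1"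
      using that False by (simp add: unit_def field_simps)
    then show ?thesis using c by (intro real_le_rsqrt) (simp add: field_simps)
  qed (use c in auto)
  then show ?thesis by (auto simp: bounded_iff)
qed

lemma unit_measure: "emeasure lborel unit \<noteq> 0" "emeasure lborel unit \<noteq> \<infinity>"
proof -
  have "0 \<in> unit" by (simp add: unit_def bounded_bilinear.zero_left[OF b])
  then show "emeasure lborel unit \<noteq> 0"
    using open_not_negligible[OF open_unit] open_unit
    by (auto simp: negligible_iff_null_sets null_sets_def emeasure_completion)
  show "emeasure lborel unit \<noteq> \<infinity>" using emeasure_bounded_finite[OF bounded_unit] by simp
qed

definition inv_meas :: "'a measure" where
  "inv_meas = distr (uniform_measure lborel unit) (restrict_space borel S) top_pt"

lemma space_inv_meas: "space inv_meas = S" and sets_inv_meas: "sets inv_meas = sets (restrict_space borel S)"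
  by (simp_all add: inv_meas_def space_restrict_space)

lemma prob_inv_meas: "prob_space inv_meas"
  unfolding inv_meas_def
proof (rule prob_space.prob_space_distr)
  show "prob_space (uniform_measure lborel unit)" by (rule prob_space_uniform_measure[OF unit_measure])
  show "top_pt \<in> uniform_measure lborel unit \<rightarrow>\<^sub>M restrict_space borel S"
    using top_pt_measurable by (simp cong: measurable_cong_sets)
qed

text \<open>g preserves the ball \<open>unit\<close>, hence Lebesgue measure, and carries the
  maximisers for z onto those for g z. Where these are unique, \<open>top_pt\<close> commutes with
  g, and that is almost everywhere.\<close>

theorem distr_inv_meas:
  assumes g: "linear g" and gb: "\<And>z \<zeta>. b (g z) (g \<zeta>) = b z \<zeta>" and gS: "g ` S = S"
  shows "distr inv_meas inv_meas g = inv_meas"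
proof -
  have inj: "inj g"
    using linear_injective_0[OF g] pos gb by (metis bounded_bilinear.zero_left[OF b] less_irrefl)
  have cont: "continuous_on UNIV g"
    using g linear_continuous_on linear_conv_bounded_linear by blast
  note [measurable] = borel_measurable_continuous_onI[OF cont] borel_open[OF open_unit]
  have gm: "g \<in> restrict_space borel S \<rightarrow>\<^sub>M restrict_space borel S"
    using gS by (intro measurable_restrict_space2 measurable_restrict_space1) (auto simp: space_restrict_space)
  have lb: "distr lborel borel g = lborel"
    by (rule distr_lborel_linear[OF g inj open_unit bounded_unit])
       (auto simp: unit_def gb bounded_bilinear.minus_left[OF b] bounded_bilinear.minus_right[OF b]
          bounded_bilinear.zero_left[OF b] intro!: exI[of _ 0])
  have maxi_g: "maxi (g z) = g ` maxi z" for z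
  proof (intro equalityI subsetI)
    fix \<xi> assume \<xi>: "\<xi> \<in> maxi (g z)"
    then obtain \<zeta> where \<zeta>: "\<zeta> \<in> S" "\<xi> = g \<zeta>" using gS by (auto simp: maxi_def)
    have "b z \<eta> \<le> b z \<zeta>" if "\<eta> \<in> S" for \<eta>
      using \<xi> imageI[OF that, of g] gb \<zeta>(2) by (auto simp: maxi_def gS)
    then show "\<xi> \<in> g ` maxi z" using \<zeta> by (auto simp: maxi_def)
  next
    fix \<xi> assume "\<xi> \<in> g ` maxi z"
    then obtain \<zeta> where \<zeta>: "\<zeta> \<in> maxi z" "\<xi> = g \<zeta>" by blast
    have "b (g z) \<eta> \<le> b (g z) \<xi>" if \<eta>: "\<eta> \<in> S" for \<eta>
    proof -
      obtain \<eta>' where "\<eta>' \<in> S" "\<eta> = g \<eta>'" using \<eta> gS by blast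
      then show ?thesis using \<zeta> by (simp add: gb maxi_def)
    qed
    moreover have "\<xi> \<in> S" using \<zeta> gS by (auto simp: maxi_def)
    ultimately show "\<xi> \<in> maxi (g z)" by (simp add: maxi_def)
  qed
  \<comment> \<open>Null sets pull back to null sets because g preserves Lebesgue measure.\<close>
  have AE_g: "AE z in lborel. g z \<in> nice"
  proof -
    have "AE z in distr lborel borel g. z \<in> nice" unfolding lb by (rule AE_nice)
    then show ?thesis by (subst (asm) AE_distr_iff) auto
  qed
  have top: "AE z in lborel. top_pt (g z) = g (top_pt z)"
    using AE_g AE_nice
  proof eventually_elim
    case (elim z)
    then show ?case using top_pt_eq[of "g z"] top_pt_maxi[of z] maxi_g by auto
  qed
  have unif: "distr (uniform_measure lborel unit) borel g = uniform_measure lborel unit"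
  proof (rule measure_eqI)
    fix A assume "A \<in> sets (distr (uniform_measure lborel unit) borel g)"
    then have [measurable]: "A \<in> sets borel" by simp
    have [measurable]: "g -` A \<in> sets borel" using measurable_sets_borel[of g borel A] by simp
    have gu: "unit \<inter> g -` A = g -` (unit \<inter> A)" by (auto simp: unit_def gb)
    have "emeasure lborel (g -` (unit \<inter> A)) = emeasure (distr lborel borel g) (unit \<inter> A)"
      by (subst emeasure_distr) auto
    then show "emeasure (distr (uniform_measure lborel unit) borel g) A = emeasure (uniform_measure lborel unit) A"
      by (simp add: emeasure_distr gu lb)
  qed simp
  have tm: "top_pt \<in> uniform_measure lborel unit \<rightarrow>\<^sub>M restrict_space borel S"
    using top_pt_measurable by (simp cong: measurable_cong_sets)
  have "distr inv_meas inv_meas g = distr inv_meas (restrict_space borel S) g"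
    by (rule distr_cong) (auto simp: sets_inv_meas)
  also have "\<dots> = distr (uniform_measure lborel unit) (restrict_space borel S) (g \<circ> top_pt)"
    unfolding inv_meas_def by (rule distr_distr[OF gm tm])
  also have "\<dots> = distr (uniform_measure lborel unit) (restrict_space borel S) (top_pt \<circ> g)"
  proof (rule distr_cong_AE)
    show "AE z in uniform_measure lborel unit. (g \<circ> top_pt) z = (top_pt \<circ> g) z"
      using top by (intro AE_uniform_measureI) (auto elim: eventually_mono)
  qed (use measurable_comp[OF tm gm] measurable_comp[of g borel borel top_pt, OF _ top_pt_measurable] in \<open>auto cong: measurable_cong_sets\<close>)
  also have "\<dots> = distr (distr (uniform_measure lborel unit) borel g) (restrict_space borel S) top_pt"
    by (rule distr_distr[symmetric, OF top_pt_measurable]) (auto cong: measurable_cong_sets)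
  also have "\<dots> = inv_meas" by (simp add: unif inv_meas_def)
  finally show ?thesis .
qed

end

section \<open>Circular domains and their Shilov boundary\<close>

lemma clinear_zero: "clinear L \<Longrightarrow> L 0 = 0"
  using linear_0[OF clinear_imp_linear] .

lemma clinear_diff: "clinear L \<Longrightarrow> L (x - y) = L x - L y"
  using linear_diff[OF clinear_imp_linear] .

text \<open>Each \<open>\<Psi>\<close> in \<open>Fam\<close> is a circle of unitary maps passing
  through the identity at c = 1, which supplies paths in the automorphism group. The axiom
  \<open>scale\<close> shrinks Cl into the open \<Omega>; it makes Cl the closure of \<Omega> and
  yields balancedness. The form \<open>ip\<close> is an inner product adapted to the maps of
  \<open>Fam\<close>.\<close>

locale circular_domain =
  fixes \<Omega> Cl :: "(complex^'d::finite) set" and ip :: "complex^'d \<Rightarrow> complex^'d \<Rightarrow> complex"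
    and Fam :: "(complex \<Rightarrow> complex^'d \<Rightarrow> complex^'d) set" and e0 :: "complex^'d"
  assumes open_\<Omega>: "open \<Omega>" and bounded_Cl: "bounded Cl" and closed_Cl: "closed Cl"
    and \<Omega>_sub_Cl: "\<Omega> \<subseteq> Cl" and scale: "\<And>z c. z \<in> Cl \<Longrightarrow> cmod c < 1 \<Longrightarrow> c *s z \<in> \<Omega>"
    and e0_Cl: "e0 \<in> Cl"
    and ip_add: "\<And>x y z. ip (x + y) z = ip x z + ip y z"
    and ip_smult: "\<And>c x z. ip (c *s x) z = c * ip x z"
    and ip_cnj: "\<And>x y. ip y x = cnj (ip x y)"
    and ip_pos: "\<And>z. z \<noteq> 0 \<Longrightarrow> Re (ip z z) > 0"
    and Fam_clinear: "\<And>\<Psi> c. \<Psi> \<in> Fam \<Longrightarrow> cmod c = 1 \<Longrightarrow> clinear (\<Psi> c)"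
    and Fam_\<Omega>: "\<And>\<Psi> c z. \<Psi> \<in> Fam \<Longrightarrow> cmod c = 1 \<Longrightarrow> z \<in> \<Omega> \<Longrightarrow> \<Psi> c z \<in> \<Omega>"
    and Fam_inverse: "\<And>\<Psi> c z. \<Psi> \<in> Fam \<Longrightarrow> cmod c = 1 \<Longrightarrow> \<Psi> c (\<Psi> (cnj c) z) = z"
    and Fam_ip: "\<And>\<Psi> c x y. \<Psi> \<in> Fam \<Longrightarrow> cmod c = 1 \<Longrightarrow> ip (\<Psi> c x) (\<Psi> c y) = ip x y"
    and Fam_one: "\<And>\<Psi> z. \<Psi> \<in> Fam \<Longrightarrow> \<Psi> 1 z = z"
    and Fam_cont: "\<And>\<Psi>. \<Psi> \<in> Fam \<Longrightarrow> continuous_on (sphere 0 1 \<times> UNIV) (\<lambda>(c, z). \<Psi> c z)"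
begin

definition gens :: "(complex \<Rightarrow> complex^'d \<Rightarrow> complex^'d) set" where
  "gens = insert (\<lambda>c z. c *s z) Fam"

text \<open>Composing with generators already produces a group: the inverse of
  \<open>\<Psi> c\<close> is \<open>\<Psi> (cnj c)\<close>, which is of the same kind.\<close>

inductive_set G :: "(complex^'d \<Rightarrow> complex^'d) set" where
  G_id: "(\<lambda>z. z) \<in> G"
| G_step: "g \<in> G \<Longrightarrow> \<Psi> \<in> gens \<Longrightarrow> cmod c = 1 \<Longrightarrow> (\<lambda>z. \<Psi> c (g z)) \<in> G"

text \<open>Complex extreme points: every affine disc in Cl centred at z is constant.\<close>

definition cext :: "complex^'d \<Rightarrow> bool" where
  "cext z \<longleftrightarrow> z \<in> Cl \<and> (\<forall>w. (\<forall>c. cmod c \<le> 1 \<longrightarrow> z + c *s w \<in> Cl) \<longrightarrow> w = 0)"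

lemma zero_\<Omega>: "0 \<in> \<Omega>"
  using scale[OF e0_Cl, of 0] by simp

lemma compact_Cl: "compact Cl"
  using bounded_Cl closed_Cl by (simp add: compact_eq_bounded_closed)

lemma bounded_\<Omega>: "bounded \<Omega>"
  using bounded_Cl \<Omega>_sub_Cl bounded_subset by blast

lemma Cl_balanced:
  assumes z: "z \<in> Cl" and c: "cmod c \<le> 1"
  shows "c *s z \<in> Cl"
proof (rule closed_sequentially[OF closed_Cl])
  show "(c * of_real (1 - 1 / real (Suc n))) *s z \<in> Cl" for n
  proof -
    have "cmod c * (1 - 1 / real (Suc n)) \<le> 1 * (1 - 1 / real (Suc n))"
      using c by (intro mult_right_mono) auto
    also have "\<dots> < 1" by simp
    finally have "cmod (c * of_real (1 - 1 / real (Suc n))) < 1"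
      by (simp add: norm_mult del: of_real_diff of_real_divide)
    then show "(c * of_real (1 - 1 / real (Suc n))) *s z \<in> Cl"
      using scale[OF z] \<Omega>_sub_Cl by blast
  qed
  have "(\<lambda>n. (c * of_real (1 - 1 / real (Suc n))) *s z) \<longlonglongrightarrow> (c * of_real (1 - 0)) *s z"
    by (intro tendsto_intros LIMSEQ_Suc[OF lim_1_over_n, unfolded o_def])
  then show "(\<lambda>n. (c * of_real (1 - 1 / real (Suc n))) *s z) \<longlonglongrightarrow> c *s z" by simp
qed

lemma closure_\<Omega>: "closure \<Omega> = Cl"
proof
  show "closure \<Omega> \<subseteq> Cl" using \<Omega>_sub_Cl closed_Cl closure_minimal by blast
  show "Cl \<subseteq> closure \<Omega>"
  proof
    fix z assume z: "z \<in> Cl"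
    have "(\<lambda>n. of_real (1 - 1 / real (Suc n)) *s z) \<longlonglongrightarrow> of_real (1 - 0) *s z"
      by (intro tendsto_intros LIMSEQ_Suc[OF lim_1_over_n, unfolded o_def])
    moreover have "of_real (1 - 1 / real (Suc n)) *s z \<in> \<Omega>" for n
      by (rule scale[OF z]) (simp del: of_real_diff of_real_divide)
    ultimately show "z \<in> closure \<Omega>"
      unfolding closure_sequential
      by (intro exI[of _ "\<lambda>n. of_real (1 - 1 / real (Suc n)) *s z"]) simp
  qed
qed

lemma \<Omega>_balanced:
  assumes z: "z \<in> \<Omega>" and c: "cmod c \<le> 1"
  shows "c *s z \<in> \<Omega>"
proof -
  \<comment> \<open>Openness leaves room for a factor t > 1, so c z = (c / t) (t z) is a strict
    shrinking of a point of \<Omega>.\<close>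
  have "((\<lambda>t. complex_of_real t *s z) \<longlongrightarrow> complex_of_real 1 *s z) (at_right 1)"
    by (intro tendsto_intros)
  then have "\<forall>\<^sub>F t in at_right 1. complex_of_real t *s z \<in> \<Omega>"
    using topological_tendstoD[OF _ open_\<Omega>] z by fastforce
  moreover have "\<forall>\<^sub>F t in at_right (1::real). t > 1" by (simp add: eventually_at_right_less)
  ultimately have "\<forall>\<^sub>F t in at_right (1::real). t > 1 \<and> complex_of_real t *s z \<in> \<Omega>"
    by eventually_elim simp
  then have "\<exists>t>1. complex_of_real t *s z \<in> \<Omega>" by (rule eventually_happens'[rotated]) simp
  then obtain t where t: "t > 1" "complex_of_real t *s z \<in> \<Omega>" by blast
  have "cmod (c / complex_of_real t) < 1"
    using t(1) c by (simp add: norm_divide divide_simps)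
  from scale[OF subsetD[OF \<Omega>_sub_Cl t(2)] this] show ?thesis
    using t(1) by (simp add: vector_smult_assoc)
qed

lemma clinear_Cl:
  assumes L: "clinear L" and "\<And>z. z \<in> \<Omega> \<Longrightarrow> L z \<in> \<Omega>" and "z \<in> Cl"
  shows "L z \<in> Cl"
proof -
  have "L ` closure \<Omega> \<subseteq> closure \<Omega>"
    by (rule image_closure_subset[OF continuous_on_clinear[OF L]]) (use assms(2) closure_subset in auto)
  then show ?thesis using assms(3) by (auto simp: closure_\<Omega>)
qed

lemma gens_props:
  assumes "\<Psi> \<in> gens" "cmod c = 1"
  shows "clinear (\<Psi> c)" "z \<in> \<Omega> \<Longrightarrow> \<Psi> c z \<in> \<Omega>" "\<Psi> c (\<Psi> (cnj c) z) = z" "\<Psi> (cnj c) (\<Psi> c z) = z"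
    "ip (\<Psi> c x) (\<Psi> c y) = ip x y" "\<Psi> 1 z = z" "continuous_on (sphere 0 1 \<times> UNIV) (\<lambda>(c, z). \<Psi> c z)"
proof -
  have *: "clinear (\<Psi> c) \<and> (z \<in> \<Omega> \<longrightarrow> \<Psi> c z \<in> \<Omega>) \<and> \<Psi> c (\<Psi> (cnj c) z) = z \<and> \<Psi> (cnj c) (\<Psi> c z) = z \<and>
    ip (\<Psi> c x) (\<Psi> c y) = ip x y \<and> \<Psi> 1 z = z \<and> continuous_on (sphere 0 1 \<times> UNIV) (\<lambda>(c, z). \<Psi> c z)"
  proof (cases "\<Psi> \<in> Fam")
    case True
    then show ?thesis
      using Fam_clinear[of \<Psi> c] Fam_\<Omega>[of \<Psi> c z] Fam_inverse[of \<Psi> c z] Fam_inverse[of \<Psi> "cnj c" z]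
        Fam_ip[of \<Psi> c x y] Fam_one[of \<Psi> z] Fam_cont[of \<Psi>] assms(2) by simp
  next
    case False
    then have \<Psi>: "\<Psi> = (\<lambda>c z. c *s z)" using assms by (simp add: gens_def)
    have cc: "c * cnj c = 1" using assms(2) complex_norm_square[of c] by simp
    then have cc': "cnj c * c = 1" by (simp add: mult.commute)
    have "ip (c *s x) (c *s y) = c * cnj c * ip x y"
      by (simp add: ip_smult ip_cnj[of x "c *s y"] ip_cnj[of x y])
    moreover have "continuous_on (sphere (0::complex) 1 \<times> UNIV) (\<lambda>(c, z::complex^'d). c *s z)"
      by (simp add: case_prod_beta') (intro continuous_intros)
    ultimately show ?thesis
      using \<Omega>_balanced[of z c] assms(2)
      by (auto simp: \<Psi> clinear_def vec_eq_iff algebra_simps cc cc' mult.assoc[symmetric])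
  qed
  then show "clinear (\<Psi> c)" "z \<in> \<Omega> \<Longrightarrow> \<Psi> c z \<in> \<Omega>" "\<Psi> c (\<Psi> (cnj c) z) = z" "\<Psi> (cnj c) (\<Psi> c z) = z"
    "ip (\<Psi> c x) (\<Psi> c y) = ip x y" "\<Psi> 1 z = z" "continuous_on (sphere 0 1 \<times> UNIV) (\<lambda>(c, z). \<Psi> c z)"
    by blast+
qed

lemma G_gen: "\<Psi> \<in> gens \<Longrightarrow> cmod c = 1 \<Longrightarrow> \<Psi> c \<in> G"
  using G_step[OF G_id] by simp

lemma G_compose: "g \<in> G \<Longrightarrow> h \<in> G \<Longrightarrow> (\<lambda>z. g (h z)) \<in> G"
  by (induction g rule: G.induct) (auto intro: G_step)

lemma G_inverse: "g \<in> G \<Longrightarrow> \<exists>g'\<in>G. \<forall>z. g' (g z) = z \<and> g (g' z) = z"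
proof (induction g rule: G.induct)
  case G_id
  show ?case by (rule bexI[OF _ G.G_id]) simp
next
  case (G_step g \<Psi> c)
  then obtain g' where g': "g' \<in> G" "\<And>z. g' (g z) = z" "\<And>z. g (g' z) = z" by blast
  have "(\<lambda>z. g' (\<Psi> (cnj c) z)) \<in> G"
    by (rule G_compose[OF g'(1) G_gen]) (use G_step in auto)
  then show ?case
    by (rule bexI[rotated]) (use g' gens_props(3,4)[OF G_step(2,3)] in auto)
qed

lemma G_props:
  assumes "g \<in> G"
  shows "clinear g" "ip (g x) (g y) = ip x y"
proof -
  have "clinear g \<and> (\<forall>x y. ip (g x) (g y) = ip x y)"
    using assms
    by (induction g rule: G.induct) (auto simp: gens_props clinear_def, (metis clinear_def gens_props(1))+)
  then show "clinear g" "ip (g x) (g y) = ip x y" by blast+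
qed

lemma G_\<Omega>: "g \<in> G \<Longrightarrow> z \<in> \<Omega> \<Longrightarrow> g z \<in> \<Omega>"
  by (induction g rule: G.induct) (auto intro: gens_props)

lemma G_\<Omega>_iff: "g \<in> G \<Longrightarrow> g z \<in> \<Omega> \<longleftrightarrow> z \<in> \<Omega>"
  using G_\<Omega> G_inverse by metis

lemma G_Cl: "g \<in> G \<Longrightarrow> z \<in> Cl \<Longrightarrow> g z \<in> Cl"
  using clinear_Cl G_props(1) G_\<Omega> by blast

lemma cext_G:
  assumes "cext z" "g \<in> G" shows "cext (g z)"
  unfolding cext_def
proof (intro conjI allI impI)
  obtain g' where g': "g' \<in> G" "\<And>z. g' (g z) = z" "\<And>z. g (g' z) = z" using G_inverse[OF assms(2)] by blast
  show "g z \<in> Cl" using assms G_Cl by (auto simp: cext_def)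
  fix w assume w: "\<forall>c. cmod c \<le> 1 \<longrightarrow> g z + c *s w \<in> Cl"
  have "g' (g z + c *s w) = z + c *s g' w" for c
    using G_props(1)[OF g'(1)] by (simp add: clinear_def g')
  then have "z + c *s g' w \<in> Cl" if "cmod c \<le> 1" for c
    using G_Cl[OF g'(1)] w that by metis
  then have "g' w = 0" using assms(1) by (auto simp: cext_def)
  then show "w = 0" using g'(3)[of w] clinear_zero[OF G_props(1)[OF assms(2)]] by simp
qed

definition nrm :: "complex^'d \<Rightarrow> real" where "nrm z = Re (ip z z)"

lemma ip_add_right: "ip x (y + z) = ip x y + ip x z"
  by (simp add: ip_cnj[of x "y + z"] ip_cnj[of x y] ip_cnj[of x z] ip_add)

lemma ip_smult_right: "ip x (c *s y) = cnj c * ip x y"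
  by (simp add: ip_cnj[of x "c *s y"] ip_cnj[of x y] ip_smult)

lemma ip_zero [simp]: "ip 0 x = 0" "ip x 0 = 0"
  using ip_smult[of 0 0 x] ip_smult_right[of x 0 0] by simp_all

lemma bounded_bilinear_ip: "bounded_bilinear ip"
proof -
  have "bilinear ip"
    unfolding bilinear_def linear_iff
    by (simp add: ip_add ip_add_right scaleR_eq_smult ip_smult ip_smult_right scaleR_conv_of_real)
  then show ?thesis by (simp add: bilinear_conv_bounded_bilinear)
qed

lemmas continuous_on_ip [continuous_intros] = bounded_bilinear.continuous_on[OF bounded_bilinear_ip]
lemmas ip_diff = bounded_bilinear.diff_left[OF bounded_bilinear_ip]
lemmas ip_diff_right = bounded_bilinear.diff_right[OF bounded_bilinear_ip]

lemma ip_self: "ip z z = complex_of_real (nrm z)"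
  using ip_cnj[of z z] by (simp add: nrm_def complex_eq_iff)

lemma nrm_nonneg: "nrm z \<ge> 0"
  using ip_pos[of z] by (cases "z = 0") (auto simp: nrm_def)

lemma nrm_eq_0: "nrm z = 0 \<longleftrightarrow> z = 0"
  using ip_pos[of z] by (cases "z = 0") (auto simp: nrm_def)

lemma nrm_parallelogram: "nrm (z + w) + nrm (z - w) = 2 * nrm z + 2 * nrm w"
  by (simp add: nrm_def ip_add ip_add_right ip_diff ip_diff_right)

lemma nrm_diff: "nrm (z - w) = nrm z + nrm w - 2 * Re (ip z w)"
  using ip_cnj[of z w] by (simp add: nrm_def ip_diff ip_diff_right)

lemma continuous_on_nrm [continuous_intros]: "continuous_on T f \<Longrightarrow> continuous_on T (\<lambda>x. nrm (f x))"
  unfolding nrm_def by (intro continuous_intros)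

lemma G_nrm: "g \<in> G \<Longrightarrow> nrm (g z) = nrm z"
  by (simp add: nrm_def G_props)

definition S :: "(complex^'d) set" where "S = {z\<in>Cl. \<forall>w\<in>Cl. nrm w \<le> nrm z}"

lemma S_nonempty: "S \<noteq> {}"
  using continuous_attains_sup[OF compact_Cl _ continuous_on_nrm[OF continuous_on_id]] e0_Cl
  by (auto simp: S_def)

text \<open>Averaging over the two points c = 1 and c = -1, that is the parallelogram law, already
  forces \<open>nrm w \<le> 0\<close>.\<close>

lemma cext_of_max:
  assumes z: "z \<in> Cl" and "\<And>w. (\<forall>c. cmod c \<le> 1 \<longrightarrow> z + c *s w \<in> Cl) \<Longrightarrow> nrm (z + w) \<le> nrm z \<and> nrm (z - w) \<le> nrm z"
  shows "cext z"
  unfolding cext_def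
proof (intro conjI allI impI z)
  fix w assume "\<forall>c. cmod c \<le> 1 \<longrightarrow> z + c *s w \<in> Cl"
  from assms(2)[OF this] have "nrm w \<le> 0" using nrm_parallelogram[of z w] by linarith
  then show "w = 0" using nrm_nonneg[of w] nrm_eq_0[of w] by linarith
qed

lemma S_cext:
  assumes "z \<in> S" shows "cext z"
proof (rule cext_of_max)
  show "z \<in> Cl" using assms by (simp add: S_def)
  fix w assume *: "\<forall>c. cmod c \<le> 1 \<longrightarrow> z + c *s w \<in> Cl"
  have "z + w \<in> Cl" "z - w \<in> Cl" using *[rule_format, of 1] *[rule_format, of "-1"] by simp_all
  then show "nrm (z + w) \<le> nrm z \<and> nrm (z - w) \<le> nrm z" using assms by (simp add: S_def)
qed

text \<open>Among the points where |f| is maximal take one of maximal norm. On an affine disc around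
  it f is constant by the maximum principle, so the disc consists of maximum points, and maximality
  of the norm collapses it. Hence the point is complex extreme.\<close>

lemma closed_boundary_cext:
  assumes "closed B" "B \<subseteq> Cl" and B: "\<And>z. cext z \<Longrightarrow> z \<in> B"
  shows "closed_boundary \<Omega> B"
  unfolding closed_boundary_def closure_\<Omega>
proof (intro conjI ballI assms(1,2))
  fix f assume f: "f \<in> disc_alg \<Omega>"
  then have fc: "continuous_on Cl f" and fh: "sholo_on \<Omega> f" by (auto simp: disc_alg_def closure_\<Omega>)
  have "Cl \<noteq> {}" using e0_Cl by blast
  from continuous_attains_sup[OF compact_Cl this continuous_on_norm[OF fc]]
  obtain z0 where z0: "z0 \<in> Cl" "\<And>w. w \<in> Cl \<Longrightarrow> cmod (f w) \<le> cmod (f z0)" by blast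
  define A where "A = {z\<in>Cl. cmod (f z) = cmod (f z0)}"
  have "closed A" unfolding A_def
    using continuous_closed_preimage_constant[OF continuous_on_norm[OF fc] closed_Cl] by simp
  then have "compact A" using compact_Cl by (metis A_def Collect_subset closed_Int_compact inf.absorb_iff1 Collect_mem_eq Collect_conj_eq)
  moreover have "z0 \<in> A" using z0 by (simp add: A_def)
  ultimately obtain z where z: "z \<in> A" "\<And>w. w \<in> A \<Longrightarrow> nrm w \<le> nrm z"
    using continuous_attains_sup[OF _ _ continuous_on_nrm[OF continuous_on_id], of A] by blast
  have "cext z"
  proof (rule cext_of_max)
    show "z \<in> Cl" using z by (simp add: A_def)
    fix w assume w: "\<forall>c. cmod c \<le> 1 \<longrightarrow> z + c *s w \<in> Cl"
    define \<phi> where "\<phi> c = f (z + c *s w)" for c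
    \<comment> \<open>The disc may lie in the boundary, where f is only continuous. Shrinking by
      \<open>t n\<close> moves it into \<Omega>, and the holomorphic functions so obtained converge
      uniformly.\<close>
    define t where "t n = complex_of_real (1 - 1 / real (Suc n))" for n
    have t1: "cmod (t n) < 1" for n by (simp add: t_def del: of_real_diff of_real_divide)
    define R where "R = (SOME R. \<forall>x\<in>Cl. norm x \<le> R)"
    have R: "norm x \<le> R" if "x \<in> Cl" for x
      using someI_ex[of "\<lambda>R. \<forall>x\<in>Cl. norm x \<le> R"] bounded_Cl that unfolding bounded_iff R_def by blast
    have tlim: "(\<lambda>n. cmod (t n - 1) * R) \<longlonglongrightarrow> 0"
    proof -
      have "(\<lambda>n. cmod (complex_of_real (1 - 1 / real (Suc n)) - 1) * R) \<longlonglongrightarrow> cmod (complex_of_real (1 - 0) - 1) * R"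
        by (intro tendsto_intros LIMSEQ_Suc[OF lim_1_over_n, unfolded o_def])
      then show ?thesis by (simp add: t_def)
    qed
    define \<phi>n where "\<phi>n n c = f (t n *s z + c *s (t n *s w))" for n c
    have tx: "t n *s z + c *s (t n *s w) = t n *s (z + c *s w)" for n c
      by (simp add: vec_eq_iff algebra_simps)
    have tO: "t n *s z + c *s (t n *s w) \<in> \<Omega>" if "cmod c \<le> 1" for n c
      unfolding tx using w that by (intro scale t1) auto
    have "\<forall>\<^sub>F n in sequentially. continuous_on (cball 0 1) (\<phi>n n) \<and> \<phi>n n holomorphic_on ball 0 1"
    proof (intro always_eventually allI conjI)
      fix n
      show "continuous_on (cball 0 1) (\<phi>n n)"
        unfolding \<phi>n_def by (intro continuous_on_compose2[OF fc] continuous_intros) (use tO \<Omega>_sub_Cl in auto)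
      show "\<phi>n n holomorphic_on ball 0 1"
        unfolding \<phi>n_def by (rule holomorphic_on_slice[OF fh]) (use tO in auto)
    qed
    moreover have "uniform_limit (cball 0 1) \<phi>n \<phi> sequentially"
      unfolding uniform_limit_iff
    proof (intro allI impI)
      fix e :: real assume "e > 0"
      with compact_uniformly_continuous[OF fc compact_Cl]
      obtain d where d: "d > 0" "\<And>x y. x \<in> Cl \<Longrightarrow> y \<in> Cl \<Longrightarrow> dist x y < d \<Longrightarrow> dist (f x) (f y) < e"
        unfolding uniformly_continuous_on_def by blast
      have "\<forall>\<^sub>F n in sequentially. cmod (t n - 1) * R < d"
        using order_tendstoD(2)[OF tlim d(1)] .
      then show "\<forall>\<^sub>F n in sequentially. \<forall>c\<in>cball 0 1. dist (\<phi>n n c) (\<phi> c) < e"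
      proof eventually_elim
        case (elim n)
        show ?case
        proof
          fix c :: complex assume c: "c \<in> cball 0 1"
          define x where "x = z + c *s w"
          have x: "x \<in> Cl" using w c by (simp add: x_def)
          have "t n *s x - x = (t n - 1) *s x" by (simp add: vec_eq_iff algebra_simps)
          then have "dist (t n *s x) x = cmod (t n - 1) * norm x" unfolding dist_norm by (simp only: norm_smult)
          also have "\<dots> \<le> cmod (t n - 1) * R" by (intro mult_left_mono R x) auto
          also have "\<dots> < d" by (rule elim)
          finally have "dist (f (t n *s x)) (f x) < e"
            using x Cl_balanced[OF x less_imp_le[OF t1]] by (intro d(2)) auto
          then show "dist (\<phi>n n c) (\<phi> c) < e" unfolding \<phi>n_def \<phi>_def tx x_def .
        qed
      qed
    qed
    ultimately have hol: "\<phi> holomorphic_on ball 0 1"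
      by (rule holomorphic_uniform_limit) auto
    have ct: "continuous_on (cball 0 1) \<phi>"
      unfolding \<phi>_def by (intro continuous_on_compose2[OF fc] continuous_intros) (use w in auto)
    have inner: "\<phi> c = \<phi> 0" if "cmod c < 1" for c
    proof -
      have "\<phi> constant_on ball 0 1"
      proof (rule maximum_modulus_principle[OF hol, of "ball 0 1" 0])
        fix c :: complex assume "c \<in> ball 0 1"
        then have "cmod (f (z + c *s w)) \<le> cmod (f z0)" using w z0(2) by auto
        then show "cmod (\<phi> c) \<le> cmod (\<phi> 0)" using z(1) by (simp add: \<phi>_def A_def)
      qed auto
      then show ?thesis using that unfolding constant_on_def by (metis centre_in_ball dist_0_norm mem_ball zero_less_one)
    qed
    have "\<phi> c = \<phi> 0" if "cmod c \<le> 1" for c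
    proof (rule continuous_constant_on_closure[of "ball 0 1" \<phi> "\<phi> 0" c])
      show "continuous_on (closure (ball 0 1)) \<phi>" using ct by simp
      show "\<phi> x = \<phi> 0" if "x \<in> ball 0 1" for x using that by (intro inner) simp
      show "c \<in> closure (ball 0 1)" using that by simp
    qed
    then have "z + c *s w \<in> A" if "cmod c \<le> 1" for c
      using w that z(1) by (simp add: A_def \<phi>_def)
    from this[of 1] this[of "-1"] z(2) show "nrm (z + w) \<le> nrm z \<and> nrm (z - w) \<le> nrm z" by simp
  qed
  then have "z \<in> B" by (rule B)
  moreover have "\<forall>w\<in>Cl. cmod (f w) \<le> cmod (f z)" using z0 z by (simp add: A_def)
  ultimately show "\<exists>z\<in>B. \<forall>w\<in>Cl. cmod (f w) \<le> cmod (f z)" by blast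
qed

end

section \<open>Linear automorphisms and neighbourhoods adapted to them\<close>

context circular_domain
begin

text \<open>The maps that Cartan's theorem produces from K: they preserve \<Omega> but are not known
  to preserve \<open>ip\<close>, so they may lie outside G.\<close>

definition lin_aut :: "(complex^'d \<Rightarrow> complex^'d) \<Rightarrow> bool" where
  "lin_aut L \<longleftrightarrow> clinear L \<and> inj L \<and> (\<forall>z. L z \<in> \<Omega> \<longleftrightarrow> z \<in> \<Omega>)"

lemma lin_aut_inv:
  assumes "lin_aut L"
  shows "lin_aut (inv L)" "L (inv L z) = z" "inv L (L z) = z"
proof -
  have L: "clinear L" "inj L" "\<And>z. L z \<in> \<Omega> \<longleftrightarrow> z \<in> \<Omega>" using assms by (auto simp: lin_aut_def)
  have "surj L" using linear_injective_imp_surjective[OF clinear_imp_linear[OF L(1)] L(2)] by simp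
  then have r: "L (inv L z) = z" for z by (simp add: surj_f_inv_f)
  have l: "inv L (L z) = z" for z using L(2) by simp
  have "clinear (inv L)"
    unfolding clinear_def
  proof (intro conjI allI)
    fix x y c
    have "L (inv L x + inv L y) = x + y" "L (c *s inv L x) = c *s x"
      using L(1) r by (auto simp: clinear_def)
    then show "inv L (x + y) = inv L x + inv L y" "inv L (c *s x) = c *s inv L x"
      using l by metis+
  qed
  then show "lin_aut (inv L)"
    unfolding lin_aut_def using r L(3) by (metis injI)
  show "L (inv L z) = z" "inv L (L z) = z" by (fact r l)+
qed

lemma lin_aut_Cl: "lin_aut L \<Longrightarrow> z \<in> Cl \<Longrightarrow> L z \<in> Cl"
  using clinear_Cl unfolding lin_aut_def by blast

lemma lin_aut_clinear: "lin_aut L \<Longrightarrow> clinear L"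
  by (simp add: lin_aut_def)

lemma G_lin_aut: "g \<in> G \<Longrightarrow> lin_aut g"
  unfolding lin_aut_def using G_props(1) G_\<Omega>_iff G_inverse by (metis injI)

lemma sholo_on_clinear_compose:
  assumes f: "sholo_on \<Omega> f" and L: "lin_aut L"
  shows "sholo_on \<Omega> (\<lambda>z. f (L z))"
  unfolding sholo_on_def
proof
  fix z assume "z \<in> \<Omega>"
  then have "L z \<in> \<Omega>" using L by (simp add: lin_aut_def)
  then obtain D where D: "(f has_derivative D) (at (L z))" "\<And>c v. D (c *s v) = c * D v"
    using f unfolding sholo_on_def by blast
  have "((\<lambda>z. f (L z)) has_derivative (\<lambda>v. D (L v))) (at z)"
    by (rule has_derivative_compose[OF clinear_has_derivative[OF lin_aut_clinear[OF L]] D(1)])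
  moreover have "D (L (c *s v)) = c * D (L v)" for c v
    using lin_aut_clinear[OF L] by (simp add: clinear_def D(2))
  ultimately show "\<exists>D. ((\<lambda>z. f (L z)) has_derivative D) (at z) \<and> (\<forall>c v. D (c *s v) = c * D v)"
    by blast
qed

text \<open>Composition with L maps the disc algebra into itself, so maxima of f are located by
  those of f composed with L.\<close>

lemma closed_boundary_image:
  assumes L: "lin_aut L" and B: "closed_boundary \<Omega> B"
  shows "closed_boundary \<Omega> (L ` B)"
  unfolding closed_boundary_def closure_\<Omega>
proof (intro conjI ballI)
  have Bc: "closed B" "B \<subseteq> Cl" using B by (auto simp: closed_boundary_def closure_\<Omega>)
  show "closed (L ` B)"
    using closed_injective_linear_image[OF Bc(1) clinear_imp_linear[OF lin_aut_clinear[OF L]]] L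
    by (simp add: lin_aut_def)
  show "L ` B \<subseteq> Cl" using Bc(2) lin_aut_Cl[OF L] by blast
  fix f assume "f \<in> disc_alg \<Omega>"
  then have f: "continuous_on Cl f" "sholo_on \<Omega> f" by (auto simp: disc_alg_def closure_\<Omega>)
  have "(\<lambda>z. f (L z)) \<in> disc_alg \<Omega>"
    unfolding disc_alg_def closure_\<Omega>
    using sholo_on_clinear_compose[OF f(2) L] lin_aut_Cl[OF L]
    by (auto intro!: continuous_on_compose2[OF f(1)] continuous_on_clinear lin_aut_clinear[OF L])
  then have "\<exists>z\<in>B. \<forall>w\<in>Cl. cmod (f (L w)) \<le> cmod (f (L z))"
    using B[unfolded closed_boundary_def closure_\<Omega>] by (elim conjE bspec)
  then obtain z where z: "z \<in> B" "\<And>w. w \<in> Cl \<Longrightarrow> cmod (f (L w)) \<le> cmod (f (L z))" by blast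
  have "cmod (f w) \<le> cmod (f (L z))" if "w \<in> Cl" for w
    using z(2)[OF lin_aut_Cl[OF lin_aut_inv(1)[OF L] that]] by (simp add: lin_aut_inv[OF L])
  then show "\<exists>z\<in>L ` B. \<forall>w\<in>Cl. cmod (f w) \<le> cmod (f z)" using z(1) by blast
qed

lemma lin_aut_shilov:
  assumes L: "lin_aut L" and z: "z \<in> shilov \<Omega>"
  shows "L z \<in> shilov \<Omega>"
  unfolding shilov_def
proof (rule InterI, simp)
  fix B assume "closed_boundary \<Omega> B"
  from closed_boundary_image[OF lin_aut_inv(1)[OF L] this] z
  have "z \<in> inv L ` B" by (auto simp: shilov_def)
  then show "L z \<in> B" using lin_aut_inv(2)[OF L] by auto
qed

text \<open>The path t \<mapsto> \<open>\<Psi> (cis (t * Arg c))\<close> runs through automorphisms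
  from the identity to \<open>\<Psi> c\<close>.\<close>

lemma gens_stabK:
  assumes \<Psi>: "\<Psi> \<in> gens" and c: "cmod c = 1"
  shows "\<Psi> c \<in> stabK \<Omega>"
proof -
  have aut: "\<Psi> a \<in> aut \<Omega>" if a: "cmod a = 1" for a
  proof -
    have a': "cmod (cnj a) = 1" using a by simp
    note p = gens_props[OF \<Psi> a] and q = gens_props[OF \<Psi> a']
    have bij: "bij_betw (\<Psi> a) \<Omega> \<Omega>"
      by (rule bij_betw_byWitness[where f'="\<Psi> (cnj a)"]) (use p(2-4) q(2) in auto)
    have inv: "inv_into \<Omega> (\<Psi> a) z = \<Psi> (cnj a) z" if "z \<in> \<Omega>" for z
      using bij_betw_inv_into_left[OF bij q(2)[OF that]] p(3)[of z] by simp
    have "vholo_on \<Omega> (inv_into \<Omega> (\<Psi> a))"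
      unfolding vholo_on_def
    proof
      fix z assume z: "z \<in> \<Omega>"
      have "(inv_into \<Omega> (\<Psi> a) has_derivative \<Psi> (cnj a)) (at z)"
        by (rule has_derivative_transform_within_open[OF clinear_has_derivative[OF q(1)] open_\<Omega> z])
           (simp add: inv)
      then show "\<exists>D. (inv_into \<Omega> (\<Psi> a) has_derivative D) (at z) \<and> (\<forall>c v. D (c *s v) = c *s D v)"
        using q(1) by (auto simp: clinear_def)
    qed
    then show ?thesis
      unfolding aut_def using bij clinear_vholo_on[OF p(1)] by simp
  qed
  define H where "H t z = \<Psi> (cis (t * Arg c)) z" for t z
  have "continuous_on ({0..1} \<times> \<Omega>) (\<lambda>p. (\<lambda>(c, z). \<Psi> c z) ((\<lambda>(t, z). (cis (t * Arg c), z)) p))"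
    by (rule continuous_on_compose2[OF gens_props(7)[OF \<Psi> c]])
       (auto simp: case_prod_beta' intro!: continuous_intros)
  then have "continuous_on ({0..1} \<times> \<Omega>) (\<lambda>(t, z). H t z)"
    by (simp add: H_def case_prod_beta')
  moreover have "\<forall>t\<in>{0..1}. H t \<in> aut \<Omega>"
    unfolding H_def using aut by simp
  moreover have "H 0 z = z" "H 1 z = \<Psi> c z" for z
    using gens_props(6)[OF \<Psi> c] cis_Arg[of c] c norm_zero by (force simp: H_def sgn_div_norm)+
  ultimately have "\<Psi> c \<in> aut0 \<Omega>"
    unfolding aut0_def using aut[OF c] by (auto intro!: exI[of _ H])
  then show ?thesis
    using clinear_zero[OF gens_props(1)[OF \<Psi> c]] by (simp add: stabK_def)
qed

text \<open>The linear map given by Cartan's theorem agrees with h on \<Omega>, hence by continuity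
  on Cl. It is injective: a kernel vector scaled into a small ball would be a second zero of the
  injective g.\<close>

lemma stabK_lin_aut:
  assumes g: "g \<in> stabK \<Omega>" and h: "continuous_on Cl h" "\<And>z. z \<in> \<Omega> \<Longrightarrow> h z = g z"
  obtains L where "lin_aut L" "\<And>z. z \<in> Cl \<Longrightarrow> h z = L z"
proof -
  have ga: "g \<in> aut \<Omega>" "g 0 = 0" using g by (auto simp: stabK_def aut0_def)
  obtain L where L: "clinear L" "\<And>z. z \<in> \<Omega> \<Longrightarrow> g z = L z"
    using cartan_linear[OF open_\<Omega> bounded_\<Omega> zero_\<Omega> \<Omega>_balanced ga] by blast
  have bij: "bij_betw g \<Omega> \<Omega>" using ga by (simp add: aut_def)
  obtain d where d: "d > 0" "ball 0 d \<subseteq> \<Omega>"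
    using open_\<Omega> zero_\<Omega> by (meson open_contains_ball)
  have inj: "inj L"
  proof -
    have "x = 0" if "L x = 0" for x
    proof (rule ccontr)
      assume x: "x \<noteq> 0"
      define y where "y = complex_of_real (d / (2 * norm x)) *s x"
      have "norm y < d" using x d(1) by (simp add: y_def norm_smult norm_divide norm_mult)
      then have y: "y \<in> \<Omega>" using d(2) by auto
      have "g y = 0" using L(2)[OF y] L(1) that by (simp add: y_def clinear_def)
      then have "y = 0" using bij y zero_\<Omega> ga(2) by (metis bij_betw_imp_inj_on inj_onD)
      then show False using x d(1) by (simp add: y_def vec_eq_iff)
    qed
    then show ?thesis using linear_injective_0[OF clinear_imp_linear[OF L(1)]] by blast
  qed
  have "L z \<in> \<Omega> \<longleftrightarrow> z \<in> \<Omega>" for z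
  proof
    assume "L z \<in> \<Omega>"
    then obtain y where "y \<in> \<Omega>" "g y = L z" using bij by (metis bij_betw_imp_surj_on imageE)
    then show "z \<in> \<Omega>" using L(2) inj by (metis injD)
  next
    assume "z \<in> \<Omega>"
    then show "L z \<in> \<Omega>" using L(2) bij by (metis bij_betwE)
  qed
  then have "lin_aut L" using L(1) inj by (simp add: lin_aut_def)
  moreover have "h z = L z" if "z \<in> Cl" for z
  proof -
    have "h z - L z = 0"
    proof (rule continuous_constant_on_closure[of \<Omega> "\<lambda>z. h z - L z" 0 z])
      show "continuous_on (closure \<Omega>) (\<lambda>z. h z - L z)"
        unfolding closure_\<Omega> by (intro continuous_intros h continuous_on_clinear L)
    qed (use that h(2) L(2) in \<open>auto simp: closure_\<Omega>\<close>)
    then show ?thesis by simp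
  qed
  ultimately show thesis using that by blast
qed

text \<open>x lies in a translate to y of a multiple of \<Omega>. Measuring nearness by \<Omega>
  instead of a metric makes the relation invariant under all linear automorphisms; the bound R of Cl
  calibrates it so that it implies distance at most r.\<close>

definition ker :: "real \<Rightarrow> complex^'d \<Rightarrow> complex^'d \<Rightarrow> bool" where
  "ker r x y \<longleftrightarrow> complex_of_real ((SOME R. R > 0 \<and> (\<forall>x\<in>Cl. norm x \<le> R)) / r) *s (x - y) \<in> \<Omega>"

lemma ker_props:
  assumes r: "r > 0"
  shows "open {(x, y). ker r x y}" "ker r x y \<Longrightarrow> dist x y \<le> r" "ker r x x"
proof -
  define R where "R = (SOME R. R > 0 \<and> (\<forall>x\<in>Cl. norm x \<le> R))"
  have "\<exists>R. R > 0 \<and> (\<forall>x\<in>Cl. norm x \<le> R)" using bounded_Cl unfolding bounded_pos by blast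
  from someI_ex[OF this] have R: "R > 0" "\<And>x. x \<in> Cl \<Longrightarrow> norm x \<le> R" by (auto simp: R_def)
  note k = ker_def[folded R_def]
  have "{(x, y). ker r x y} = (\<lambda>p. complex_of_real (R / r) *s (fst p - snd p)) -` \<Omega>"
    by (auto simp: k)
  moreover have "open \<dots>"
    by (intro open_vimage[OF open_\<Omega>] continuous_intros)
  ultimately show "open {(x, y). ker r x y}" by simp
  show "ker r x x" using zero_\<Omega> by (simp add: k)
  assume "ker r x y"
  then have "norm (complex_of_real (R / r) *s (x - y)) \<le> R" using \<Omega>_sub_Cl R(2) unfolding k by blast
  then have "cmod (complex_of_real (R / r)) * norm (x - y) \<le> R" by (simp only: norm_smult)
  then have "R / r * norm (x - y) \<le> R" using R(1) r by (simp add: norm_divide)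
  then show "dist x y \<le> r" using R(1) r by (simp add: dist_norm field_simps)
qed

lemma ker_sym: "ker r x y \<Longrightarrow> ker r y x"
proof -
  assume "ker r x y"
  then have "(- 1) *s (complex_of_real ((SOME R. R > 0 \<and> (\<forall>x\<in>Cl. norm x \<le> R)) / r) *s (x - y)) \<in> \<Omega>"
    unfolding ker_def by (rule \<Omega>_balanced) simp
  moreover have "(- 1) *s (a *s (x - y)) = a *s (y - x)" for a by (simp add: vec_eq_iff algebra_simps)
  ultimately show ?thesis unfolding ker_def by simp
qed

lemma ker_lin_aut: "lin_aut L \<Longrightarrow> ker r (L x) (L y) \<longleftrightarrow> ker r x y"
proof -
  assume L: "lin_aut L"
  have eq: "a *s (L x - L y) = L (a *s (x - y))" for a
    using lin_aut_clinear[OF L] clinear_diff[OF lin_aut_clinear[OF L], of x y] unfolding clinear_def by metis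
  show ?thesis unfolding ker_def eq using L by (simp add: lin_aut_def)
qed

end

section \<open>Homogeneity, peak functions and the Shilov boundary\<close>

locale homogeneous_domain = circular_domain \<Omega> Cl ip Fam e0
  for \<Omega> Cl :: "(complex^'d::finite) set" and ip Fam e0 +
  assumes trans_cext: "\<And>z. cext z \<Longrightarrow> \<exists>g\<in>G. g z = e0"
begin

lemma cext_nrm: "cext z \<Longrightarrow> nrm z = nrm e0"
  using trans_cext G_nrm by metis

text \<open>Transitivity gives all complex extreme points the same norm, and the points of maximal
  norm are among them.\<close>

lemma S_eq_cext: "S = {z. cext z}"
proof
  show "S \<subseteq> {z. cext z}" using S_cext by blast
  show "{z. cext z} \<subseteq> S"
  proof
    fix z assume "z \<in> {z. cext z}"
    then have z: "cext z" by simp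
    obtain s where s: "s \<in> S" using S_nonempty by blast
    have "nrm z = nrm s" using cext_nrm[OF z] cext_nrm[OF S_cext[OF s]] by simp
    then show "z \<in> S" using s z by (auto simp: S_def cext_def)
  qed
qed

lemma e0_S: "e0 \<in> S"
proof -
  obtain s where s: "s \<in> S" using S_nonempty by blast
  obtain g where "g \<in> G" "g s = e0" using trans_cext[OF S_cext[OF s]] by blast
  then show ?thesis using cext_G[OF S_cext[OF s]] by (auto simp: S_eq_cext)
qed

lemma S_nrm: "z \<in> S \<Longrightarrow> nrm z = nrm e0"
  using cext_nrm S_cext by blast

lemma S_sub_Cl: "S \<subseteq> Cl" by (auto simp: S_def)

lemma S_alt: "S = Cl \<inter> {z. nrm z = nrm e0}"
proof
  show "S \<subseteq> Cl \<inter> {z. nrm z = nrm e0}" using S_nrm S_sub_Cl by blast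
  show "Cl \<inter> {z. nrm z = nrm e0} \<subseteq> S"
  proof
    fix z assume z: "z \<in> Cl \<inter> {z. nrm z = nrm e0}"
    then have "nrm z = nrm e0" by simp
    then show "z \<in> S" using z e0_S unfolding S_def by simp
  qed
qed

lemma compact_S: "compact S"
proof -
  have "closed {z. nrm z = nrm e0}"
    by (intro closed_Collect_eq continuous_intros)
  then show ?thesis unfolding S_alt by (rule compact_Int_closed[OF compact_Cl])
qed

lemma G_S: "g \<in> G \<Longrightarrow> z \<in> S \<Longrightarrow> g z \<in> S"
  using cext_G by (simp add: S_eq_cext)

lemma trans_S:
  assumes "x \<in> S" "y \<in> S" obtains g where "g \<in> G" "g x = y"
proof -
  obtain g h where g: "g \<in> G" "g x = e0" and h: "h \<in> G" "h y = e0"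
    using trans_cext S_cext assms by metis
  obtain h' where h': "h' \<in> G" "\<And>z. h' (h z) = z" using G_inverse[OF h(1)] by blast
  have "(\<lambda>z. h' (g z)) \<in> G" by (rule G_compose[OF h'(1) g(1)])
  moreover have "h' (g x) = y" using g h h'(2)[of y] by simp
  ultimately show thesis using that by blast
qed

lemma nrm_e0_pos: "nrm e0 > 0"
proof -
  obtain d where d: "d > 0" "ball 0 d \<subseteq> \<Omega>"
    using open_\<Omega> zero_\<Omega> by (meson open_contains_ball)
  define z :: "complex^'d" where "z = (d / 2) *\<^sub>R (SOME i. i \<in> Basis)"
  have nz: "norm z = d / 2" using d(1) by (simp add: z_def SOME_Basis)
  then have "z \<in> ball 0 d" "z \<noteq> 0" using d(1) by auto
  then have "z \<in> Cl" "z \<noteq> 0" using d \<Omega>_sub_Cl by blast+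
  then have "nrm z \<le> nrm e0" "nrm z > 0" using e0_S nrm_nonneg[of z] nrm_eq_0[of z] by (auto simp: S_def)
  then show ?thesis by linarith
qed

lemma nrm_le: "z \<in> Cl \<Longrightarrow> nrm z \<le> nrm e0"
  using e0_S by (simp add: S_def)

text \<open>For \<zeta> in S, the values on Cl lie in the disc of radius 1/2 about 1/2, which
  touches the unit circle at 1 only.\<close>

definition pk :: "complex^'d \<Rightarrow> complex^'d \<Rightarrow> complex" where
  "pk \<zeta> z = (1 + ip z \<zeta> / of_real (nrm e0)) / 2"

text \<open>The equality case of the Cauchy-Schwarz inequality makes \<open>\<zeta>\<close> the only peak point of \<open>pk \<zeta>\<close>.\<close>
lemma pk_le:
  assumes z: "z \<in> Cl" and \<zeta>: "\<zeta> \<in> S"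
  shows "cmod (pk \<zeta> z) \<le> 1" "cmod (pk \<zeta> z) = 1 \<Longrightarrow> z = \<zeta>"
proof -
  define N where "N = nrm e0"
  have N: "N > 0" using nrm_e0_pos by (simp add: N_def)
  have z\<zeta>: "nrm z \<le> N" "nrm \<zeta> = N" using nrm_le[OF z] S_nrm[OF \<zeta>] by (simp_all add: N_def)
  define w where "w = ip z \<zeta> / of_real N"
  have w1: "cmod w \<le> 1"
  proof -
    define u where "u = (if ip z \<zeta> = 0 then 1 else sgn (ip z \<zeta>))"
    have u: "cmod u = 1" by (simp add: u_def norm_sgn)
    have "Re (ip z (u *s \<zeta>)) = cmod (ip z \<zeta>)"
    proof -
      have "cnj u * ip z \<zeta> = of_real (cmod (ip z \<zeta>))"
        by (simp add: u_def sgn_eq mult.commute[of "cnj _"] complex_norm_square[symmetric] power2_eq_square)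
      then show ?thesis by (simp add: ip_smult_right)
    qed
    moreover have "nrm (u *s \<zeta>) = N"
    proof -
      have "cnj u * u = 1" using u complex_norm_square[of u] by (simp add: mult.commute)
      then have "ip (u *s \<zeta>) (u *s \<zeta>) = ip \<zeta> \<zeta>"
        by (simp add: ip_smult ip_smult_right mult.assoc[symmetric])
      then show ?thesis using z\<zeta>(2) by (simp add: nrm_def)
    qed
    moreover have "0 \<le> nrm (z - u *s \<zeta>)" by (rule nrm_nonneg)
    ultimately have "cmod (ip z \<zeta>) \<le> N" using nrm_diff[of z "u *s \<zeta>"] z\<zeta>(1) by linarith
    then show ?thesis using N by (simp add: w_def norm_divide)
  qed
  have pk: "pk \<zeta> z = (1 + w) / 2" by (simp add: pk_def w_def N_def)
  show "cmod (pk \<zeta> z) \<le> 1" using norm_triangle_ineq[of 1 w] w1 by (simp add: pk norm_divide)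
  assume "cmod (pk \<zeta> z) = 1"
  then have "(cmod (1 + w))\<^sup>2 = 4" by (simp add: pk norm_divide)
  moreover have "(cmod (1 + w))\<^sup>2 = 1 + 2 * Re w + (cmod w)\<^sup>2"
    by (simp only: cmod_power2) (simp add: power2_eq_square algebra_simps)
  moreover have "(cmod w)\<^sup>2 \<le> 1" using w1 by (simp add: power_le_one)
  ultimately have "Re w \<ge> 1" by linarith
  then have "Re (ip z \<zeta>) \<ge> N" using N by (simp add: w_def)
  then have "nrm (z - \<zeta>) \<le> 0" using nrm_diff[of z \<zeta>] z\<zeta> by linarith
  then show "z = \<zeta>" using nrm_nonneg[of "z - \<zeta>"] nrm_eq_0[of "z - \<zeta>"] by simp
qed

lemma pk_self: "\<zeta> \<in> S \<Longrightarrow> pk \<zeta> \<zeta> = 1"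
  using nrm_e0_pos S_nrm[of \<zeta>] by (simp add: pk_def ip_self)

lemma continuous_on_pk [continuous_intros]:
  "continuous_on T f \<Longrightarrow> continuous_on T g \<Longrightarrow> continuous_on T (\<lambda>x. pk (f x) (g x))"
  unfolding pk_def using nrm_e0_pos by (intro continuous_intros) auto

theorem shilov_eq_S: "shilov \<Omega> = S"
proof
  have "closed_boundary \<Omega> S"
    using compact_imp_closed[OF compact_S] S_sub_Cl by (intro closed_boundary_cext) (auto simp: S_eq_cext)
  then show "shilov \<Omega> \<subseteq> S" by (auto simp: shilov_def)
  show "S \<subseteq> shilov \<Omega>"
  proof
    fix \<zeta> assume \<zeta>: "\<zeta> \<in> S"
    have "sholo_on \<Omega> (pk \<zeta>)"
      unfolding sholo_on_def
    proof
      fix z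
      have bl: "bounded_linear (\<lambda>z. ip z \<zeta>)"
        by (rule bounded_bilinear.bounded_linear_left[OF bounded_bilinear_ip])
      have "(pk \<zeta> has_derivative (\<lambda>v. ip v \<zeta> / of_real (nrm e0) / 2)) (at z)"
        unfolding pk_def using nrm_e0_pos
        by (auto intro!: derivative_eq_intros bounded_linear_imp_has_derivative[OF bl])
      then show "\<exists>D. (pk \<zeta> has_derivative D) (at z) \<and> (\<forall>c v. D (c *s v) = c * D v)"
        by (intro exI[of _ "\<lambda>v. ip v \<zeta> / of_real (nrm e0) / 2"]) (simp add: ip_smult)
    qed
    then have d: "pk \<zeta> \<in> disc_alg \<Omega>"
      by (simp add: disc_alg_def continuous_on_pk)
    show "\<zeta> \<in> shilov \<Omega>"
      unfolding shilov_def
    proof (rule InterI, simp)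
      fix B assume "closed_boundary \<Omega> B"
      then obtain z where z: "z \<in> B" "z \<in> Cl" "\<And>w. w \<in> Cl \<Longrightarrow> cmod (pk \<zeta> w) \<le> cmod (pk \<zeta> z)"
        using d unfolding closed_boundary_def closure_\<Omega> by blast
      have "1 \<le> cmod (pk \<zeta> z)" using z(3)[of \<zeta>] pk_self[OF \<zeta>] \<zeta> S_sub_Cl by auto
      then have "z = \<zeta>" using pk_le[OF z(2) \<zeta>] by linarith
      then show "\<zeta> \<in> B" using z(1) by simp
    qed
  qed
qed

lemma lin_aut_S: "lin_aut L \<Longrightarrow> L ` S = S"
proof -
  assume L: "lin_aut L"
  have "L z \<in> S" "inv L z \<in> S" if "z \<in> S" for z
    using lin_aut_shilov[OF L] lin_aut_shilov[OF lin_aut_inv(1)[OF L]] that by (auto simp: shilov_eq_S)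
  then show ?thesis using lin_aut_inv(2)[OF L] by (metis (no_types, lifting) image_iff image_subset_iff subsetI subset_antisym)
qed

end

section \<open>The invariant probability measure on the Shilov boundary\<close>

context homogeneous_domain
begin

lemma bounded_bilinear_of_Re_ip: "bounded_bilinear (\<lambda>x y. Re (ip x y))"
proof -
  have "bilinear (\<lambda>x y. Re (ip x y))"
    unfolding bilinear_def linear_iff
    by (simp add: ip_add ip_add_right scaleR_eq_smult ip_smult ip_smult_right)
  then show ?thesis by (simp add: bilinear_conv_bounded_bilinear)
qed

sublocale sp: support_points "\<lambda>x y. Re (ip x y)" S
  by (rule support_points.intro) (use bounded_bilinear_of_Re_ip ip_pos compact_S S_nonempty in auto)

definition G_inv :: "(complex^'d) measure \<Rightarrow> bool" where
  "G_inv M \<longleftrightarrow> compact_prob M S \<and> (\<forall>g\<in>G. distr M M g = M)"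

lemma lin_aut_measurable:
  assumes M: "compact_prob M S" and L: "lin_aut L"
  shows "L \<in> M \<rightarrow>\<^sub>M M"
proof -
  interpret compact_prob M S by fact
  have "L \<in> M \<rightarrow>\<^sub>M restrict_space borel S"
    by (rule measurable_restrict_space2)
       (use lin_aut_S[OF L] in \<open>auto simp: space_M intro!: measurable_M_continuous continuous_on_clinear lin_aut_clinear[OF L]\<close>)
  then show ?thesis using measurable_cong_sets[OF refl sets_M] by blast
qed

lemma open_ker: "r > 0 \<Longrightarrow> open {x. ker r x y}"
proof -
  assume "r > 0"
  have "open ((\<lambda>x. (x, y)) -` {(x, y). ker r x y})"
    by (intro open_vimage ker_props(1)[OF \<open>r > 0\<close>] continuous_intros)
  then show ?thesis by (simp add: vimage_def)
qed

lemma ker_sets: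
  assumes M: "compact_prob M S" and r: "r > 0"
  shows "{x\<in>S. ker r x y} \<in> sets M"
proof -
  have "{x\<in>S. ker r x y} = S \<inter> {x. ker r x y}" by auto
  then show ?thesis
    unfolding compact_prob.sets_M[OF M] sets_restrict_space using borel_open[OF open_ker[OF r]] by blast
qed

lemma emeasure_ker_image:
  assumes M: "compact_prob M S" and r: "r > 0" and L: "lin_aut L"
  shows "emeasure (distr M M L) {x\<in>S. ker r x (L y)} = emeasure M {x\<in>S. ker r x y}"
proof -
  interpret compact_prob M S by fact
  have "L -` {x\<in>S. ker r x (L y)} \<inter> space M = {x\<in>S. ker r x y}"
    using lin_aut_S[OF L] by (auto simp: space_M ker_lin_aut[OF L])
  then show ?thesis by (simp add: emeasure_distr[OF lin_aut_measurable[OF M L] ker_sets[OF M r]])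
qed

text \<open>The mass is the same at all points by transitivity, and non-zero because finitely many
  kernel neighbourhoods cover the compact set S.\<close>

lemma ker_measure:
  assumes M: "G_inv M" and r: "r > 0"
  obtains m where "m \<noteq> 0" "\<And>y. y \<in> S \<Longrightarrow> emeasure M {x\<in>S. ker r x y} = m"
proof -
  have cp: "compact_prob M S" and inv: "\<And>g. g \<in> G \<Longrightarrow> distr M M g = M" using M by (auto simp: G_inv_def)
  interpret compact_prob M S by fact
  define m where "m = emeasure M {x\<in>S. ker r x e0}"
  have m: "emeasure M {x\<in>S. ker r x y} = m" if y: "y \<in> S" for y
  proof -
    obtain g where g: "g \<in> G" "g e0 = y" using trans_S[OF e0_S y] by blast
    show ?thesis
      using emeasure_ker_image[OF cp r G_lin_aut[OF g(1)], of e0] inv[OF g(1)] g(2) by (simp add: m_def)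
  qed
  have "m \<noteq> 0"
  proof
    assume "m = 0"
    have "S \<subseteq> (\<Union>y\<in>S. {x. ker r x y})" using ker_props(3)[OF r] by blast
    then obtain F where F: "F \<subseteq> S" "finite F" "S \<subseteq> (\<Union>y\<in>F. {x. ker r x y})"
      using compactE_image[OF compact_S, of S "\<lambda>y. {x. ker r x y}"] open_ker[OF r] by metis
    have "emeasure M S \<le> emeasure M (\<Union>y\<in>F. {x\<in>S. ker r x y})"
      using F ker_sets[OF cp r] by (intro emeasure_mono) auto
    also have "\<dots> \<le> (\<Sum>y\<in>F. emeasure M {x\<in>S. ker r x y})"
      using F ker_sets[OF cp r] by (intro emeasure_subadditive_finite) auto
    also have "\<dots> = 0" using F(1) m \<open>m = 0\<close> by (intro sum.neutral) auto
    finally show False using emeasure_space_1 by (simp add: space_M)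
  qed
  with m that show thesis by blast
qed

text \<open>Stated for N with constant kernel masses rather than for invariant N, since constancy is
  what can be checked for the image of M under a linear automorphism.\<close>

lemma kernel_unique:
  assumes M: "G_inv M" and N: "compact_prob N S"
    and "\<And>r y. r > 0 \<Longrightarrow> y \<in> S \<Longrightarrow> emeasure N {x\<in>S. ker r x y} = emeasure N {x\<in>S. ker r x e0}"
  shows "M = N"
proof -
  have cp: "compact_prob M S" using M by (simp add: G_inv_def)
  have "\<exists>m. m \<noteq> 0 \<and> (\<forall>y\<in>S. emeasure M {x\<in>S. ker r x y} = m)" if r: "r > 0" for r
  proof -
    obtain m where "m \<noteq> 0" "\<And>y. y \<in> S \<Longrightarrow> emeasure M {x\<in>S. ker r x y} = m"
      using ker_measure[OF M r] by blast
    then show ?thesis by blast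
  qed
  then obtain m where m: "\<And>r. r > 0 \<Longrightarrow> m r \<noteq> 0"
    "\<And>r y. r > 0 \<Longrightarrow> y \<in> S \<Longrightarrow> emeasure M {x\<in>S. ker r x y} = m r" by metis
  show ?thesis
  proof (rule prob_measure_unique_kernel[where k=ker and S=S and m=m and n="\<lambda>r. emeasure N {x\<in>S. ker r x e0}"])
    show "{(x, y). ker r x y} \<in> sets borel" if "r > 0" for r
      by (rule borel_open[OF ker_props(1)[OF that]])
    show "dist x y \<le> r" if "r > 0" "ker r x y" for r x y by (rule ker_props(2)[OF that])
    show "ker r y x" if "ker r x y" for r x y by (rule ker_sym[OF that])
  qed (fact compact_prob.prob[OF cp] compact_prob.prob[OF N] compact_prob.sets_M[OF cp] compact_prob.sets_M[OF N] assms(3) m)+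
qed

lemma G_inv_unique:
  assumes M: "G_inv M" and N: "G_inv N"
  shows "M = N"
proof (rule kernel_unique[OF M])
  show "compact_prob N S" using N by (simp add: G_inv_def)
  fix r :: real and y assume r: "r > 0" and y: "y \<in> S"
  obtain m where "\<And>y. y \<in> S \<Longrightarrow> emeasure N {x\<in>S. ker r x y} = m"
    using ker_measure[OF N r] by blast
  then show "emeasure N {x\<in>S. ker r x y} = emeasure N {x\<in>S. ker r x e0}"
    using y e0_S by simp
qed

text \<open>The kernel is invariant under L, so the image measure gives the neighbourhood of y the
  mass that M gives to that of \<open>inv L y\<close>, which is constant on S; uniqueness identifies
  it with M.\<close>

lemma G_inv_lin_aut:
  assumes M: "G_inv M" and L: "lin_aut L"
  shows "distr M M L = M"
proof -
  have cp: "compact_prob M S" using M by (simp add: G_inv_def)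
  interpret compact_prob M S by fact
  have cp': "compact_prob (distr M M L) S"
    by (rule compact_prob.intro) (simp_all add: space_M sets_M compact prob_space_distr[OF lin_aut_measurable[OF cp L]])
  have *: "emeasure (distr M M L) {x\<in>S. ker r x y} = emeasure M {x\<in>S. ker r x (inv L y)}" if "r > 0" for r y
    using emeasure_ker_image[OF cp that L, of "inv L y"] by (simp add: lin_aut_inv[OF L])
  have "M = distr M M L"
  proof (rule kernel_unique[OF M cp'])
    fix r :: real and y assume r: "r > 0" and y: "y \<in> S"
    have S: "inv L y \<in> S" "inv L e0 \<in> S" using lin_aut_S[OF lin_aut_inv(1)[OF L]] y e0_S by auto
    obtain m where "\<And>y. y \<in> S \<Longrightarrow> emeasure M {x\<in>S. ker r x y} = m"
      using ker_measure[OF M r] by blast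
    then show "emeasure (distr M M L) {x\<in>S. ker r x y} = emeasure (distr M M L) {x\<in>S. ker r x e0}"
      unfolding *[OF r] using S by simp
  qed
  then show ?thesis by simp
qed

lemma G_inv_inv_meas: "G_inv sp.inv_meas"
  unfolding G_inv_def
proof (intro conjI ballI)
  show "compact_prob sp.inv_meas S"
    by (rule compact_prob.intro) (simp_all add: compact_S sp.space_inv_meas sp.sets_inv_meas sp.prob_inv_meas)
  fix g assume g: "g \<in> G"
  show "distr sp.inv_meas sp.inv_meas g = sp.inv_meas"
    by (rule sp.distr_inv_meas) (simp_all add: clinear_imp_linear G_props[OF g] lin_aut_S[OF G_lin_aut[OF g]])
qed

text \<open>One direction holds since the generators lie in K. For the other, an element of K
  coincides on Cl with a linear automorphism, and M is invariant under all of these.\<close>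

lemma K_inv_prob_iff: "K_inv_prob \<Omega> M \<longleftrightarrow> G_inv M"
proof
  assume K: "K_inv_prob \<Omega> M"
  then have K': "space M = S" "sets M = sets (restrict_space borel S)" "prob_space M"
    "\<forall>g\<in>stabK \<Omega>. \<forall>h. continuous_on Cl h \<and> (\<forall>z\<in>\<Omega>. h z = g z) \<longrightarrow> distr M M h = M"
    unfolding K_inv_prob_def closure_\<Omega> shilov_eq_S by simp_all
  have cp: "compact_prob M S"
    by (rule compact_prob.intro) (fact compact_S K')+
  have gen: "distr M M (\<Psi> c) = M" if "\<Psi> \<in> gens" "cmod c = 1" for \<Psi> c
    using K'(4)[rule_format, OF gens_stabK[OF that], of "\<Psi> c"] continuous_on_clinear[OF gens_props(1)[OF that]]
    by simp
  have "distr M M g = M" if "g \<in> G" for g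
    using that
  proof (induction g rule: G.induct)
    case G_id
    show ?case using distr_id[of M] by (simp add: id_def)
  next
    case (G_step g \<Psi> c)
    have "distr M M (\<Psi> c \<circ> g) = distr (distr M M g) M (\<Psi> c)"
      by (rule distr_distr[symmetric])
         (use G_step lin_aut_measurable[OF cp] G_lin_aut G_gen in auto)
    then show ?case using G_step gen by (simp add: comp_def)
  qed
  then show "G_inv M" using cp by (simp add: G_inv_def)
next
  assume M: "G_inv M"
  then interpret compact_prob M S by (simp add: G_inv_def)
  have "distr M M h = M" if g: "g \<in> stabK \<Omega>" and h: "continuous_on Cl h" "\<And>z. z \<in> \<Omega> \<Longrightarrow> h z = g z" for g h
  proof -
    obtain L where L: "lin_aut L" "\<And>z. z \<in> Cl \<Longrightarrow> h z = L z" using stabK_lin_aut[OF g h] by blast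
    have "distr M M h = distr M M L"
      by (rule distr_cong) (use L(2) S_sub_Cl in \<open>auto simp: space_M\<close>)
    then show ?thesis using G_inv_lin_aut[OF M L(1)] by simp
  qed
  then show "K_inv_prob \<Omega> M"
    unfolding K_inv_prob_def closure_\<Omega> shilov_eq_S by (intro conjI space_M sets_M prob) blast
qed

theorem shilov_measure_G_inv: "G_inv (shilov_measure \<Omega>)"
proof -
  have "shilov_measure \<Omega> = sp.inv_meas"
    unfolding shilov_measure_def K_inv_prob_iff
    using G_inv_inv_meas G_inv_unique by blast
  then show ?thesis using G_inv_inv_meas by simp
qed

end

section \<open>Toeplitz operators on homogeneous domains\<close>

text \<open>Adding C turns u into a non-negative density, so the claim becomes the equality of two
  finite measures, tested on closed sets. Indicators of these are limits of the continuous functions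
  \<open>max 0 (1 - n * infdist z K)\<close>.\<close>

lemma (in compact_prob) AE_zero_of_continuous:
  fixes u :: "complex^'d \<Rightarrow> real"
  assumes u: "u \<in> borel_measurable M" and bd: "\<And>z. \<bar>u z\<bar> \<le> C"
    and orth: "\<And>\<psi>. continuous_on UNIV \<psi> \<Longrightarrow> (\<integral>z. u z * \<psi> z \<partial>M) = 0"
  shows "AE z in M. u z = 0"
proof -
  have int_u: "integrable M u" by (rule integrable_const_bound[of _ C]) (use bd u in auto)
  have closed0: "(\<integral>z. u z * indicator K z \<partial>M) = 0" if K: "closed K" for K
  proof (cases "K = {}")
    case False
    define \<psi> where "\<psi> n z = max 0 (1 - real n * infdist z K)" for n z
    have "(\<lambda>n. \<integral>z. u z * \<psi> n z \<partial>M) \<longlonglongrightarrow> (\<integral>z. u z * indicator K z \<partial>M)"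
    proof (rule integral_dominated_convergence[where w="\<lambda>z. C"])
      show "(\<lambda>z. u z * indicator K z) \<in> borel_measurable M"
        by (intro borel_measurable_times u measurable_M borel_measurable_indicator borel_closed K)
      show "(\<lambda>z. u z * \<psi> n z) \<in> borel_measurable M" for n
        unfolding \<psi>_def
        by (intro borel_measurable_times u measurable_M borel_measurable_continuous_onI continuous_intros)
      show "AE z in M. (\<lambda>n. u z * \<psi> n z) \<longlonglongrightarrow> u z * indicator K z"
      proof (rule AE_I2, intro tendsto_intros)
        fix z
        show "(\<lambda>n. \<psi> n z) \<longlonglongrightarrow> indicator K z"
        proof (cases "z \<in> K")
          case True
          then show ?thesis by (simp add: \<psi>_def)
        next
          case out: False
          then have d: "infdist z K > 0"
            using in_closed_iff_infdist_zero[OF K False, of z] infdist_nonneg[of z K] by linarith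
          obtain N where N: "1 < real N * infdist z K" using reals_Archimedean3[OF d] by blast
          have "\<psi> n z = 0" if "n \<ge> N" for n
          proof -
            have "real N * infdist z K \<le> real n * infdist z K" using that d by (intro mult_right_mono) auto
            then show ?thesis using N by (simp add: \<psi>_def)
          qed
          then have "\<forall>\<^sub>F n in sequentially. \<psi> n z = indicator K z"
            using out by (intro eventually_sequentiallyI[of N]) simp
          then show ?thesis by (rule tendsto_eventually)
        qed
      qed
      show "AE z in M. norm (u z * \<psi> n z) \<le> C" for n
      proof (rule AE_I2)
        fix z
        have "\<bar>\<psi> n z\<bar> \<le> 1" using infdist_nonneg[of z K] by (simp add: \<psi>_def)
        then have "\<bar>u z\<bar> * \<bar>\<psi> n z\<bar> \<le> C * 1" using bd[of z] by (intro mult_mono) auto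
        then show "norm (u z * \<psi> n z) \<le> C" by (simp add: abs_mult)
      qed
    qed auto
    moreover have "(\<integral>z. u z * \<psi> n z \<partial>M) = 0" for n
      unfolding \<psi>_def by (intro orth continuous_intros)
    ultimately show ?thesis by (simp add: LIMSEQ_const_iff)
  qed simp
  have dens: "density M (\<lambda>z. ennreal (u z + C)) = density M (\<lambda>z. ennreal C)"
  proof (rule measure_eq_on_closed)
    have C0: "C \<ge> 0" using bd[of undefined] by linarith
    have uC: "0 \<le> u z + C" for z using bd[of z] by linarith
    have em: "emeasure (density M (\<lambda>z. ennreal (v z))) (K \<inter> S) = ennreal (\<integral>z. v z * indicator K z \<partial>M)"
      if v: "v \<in> borel_measurable M" "integrable M v" "\<And>z. 0 \<le> v z" and K: "closed K" for v K
    proof -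
      have KS: "K \<inter> S \<in> sets M" unfolding sets_M by (rule closed_Int_sets_restrict_borel[OF K])
      have "emeasure (density M (\<lambda>z. ennreal (v z))) (K \<inter> S) = (\<integral>\<^sup>+z. ennreal (v z) * indicator (K \<inter> S) z \<partial>M)"
        using v KS by (intro emeasure_density) auto
      also have "\<dots> = (\<integral>\<^sup>+z. ennreal (v z * indicator K z) \<partial>M)"
        by (intro nn_integral_cong) (auto simp: space_M indicator_def)
      also have "\<dots> = ennreal (\<integral>z. v z * indicator K z \<partial>M)"
      proof (rule nn_integral_eq_integral)
        have "integrable M (\<lambda>z. indicator K z * v z)"
          using integrable_mult_indicator[OF KS v(2)]
          by (rule Bochner_Integration.integrable_cong[THEN iffD1, rotated -1]) (auto simp: space_M indicator_def)
        then show "integrable M (\<lambda>z. v z * indicator K z)" by (simp add: mult.commute)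
      qed (use v(3) in auto)
      finally show ?thesis .
    qed
    fix K :: "(complex^'d) set" assume K: "closed K"
    have Km: "(\<lambda>z. indicator K z :: real) \<in> borel_measurable M"
      by (intro measurable_M borel_measurable_indicator borel_closed K)
    have iK: "integrable M (\<lambda>z. v z * indicator K z)" if "v \<in> borel_measurable M" "\<And>z. \<bar>v z\<bar> \<le> C" for v :: "_ \<Rightarrow> real"
    proof (rule integrable_const_bound[of _ C])
      show "AE z in M. norm (v z * indicator K z) \<le> C"
        by (rule AE_I2) (use that(2) C0 in \<open>simp add: indicator_def\<close>)
    qed (rule borel_measurable_times[OF that(1) Km])
    have "(\<integral>z. (u z + C) * indicator K z \<partial>M) = (\<integral>z. C * indicator K z \<partial>M)"
      using closed0[OF K] iK[OF u bd] iK[of "\<lambda>_. C"] C0 by (simp add: distrib_right)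
    then show "emeasure (density M (\<lambda>z. ennreal (u z + C))) (K \<inter> S) = emeasure (density M (\<lambda>z. ennreal C)) (K \<inter> S)"
      using em[of "\<lambda>z. u z + C" K] em[of "\<lambda>z. C" K] u int_u K uC C0 by simp
  next
    have fin: "finite_measure (density M (\<lambda>z. ennreal (v z)))"
      if "v \<in> borel_measurable M" "\<And>z. v z \<le> 2 * C" for v
    proof (rule finite_measureI)
      have "emeasure (density M (\<lambda>z. ennreal (v z))) (space M) = (\<integral>\<^sup>+z. ennreal (v z) * indicator (space M) z \<partial>M)"
        using that(1) by (intro emeasure_density) auto
      also have "\<dots> \<le> (\<integral>\<^sup>+z. ennreal (2 * C) \<partial>M)"
        by (intro nn_integral_mono) (auto simp: indicator_def intro!: ennreal_leI that(2))
      also have "\<dots> < \<infinity>" by (simp add: emeasure_space_1)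
      finally show "emeasure (density M (\<lambda>z. ennreal (v z))) (space (density M (\<lambda>z. ennreal (v z)))) \<noteq> \<infinity>" by simp
    qed
    have C0: "C \<ge> 0" using bd[of undefined] by linarith
    have "u z + C \<le> 2 * C" for z using bd[of z] by linarith
    then show "finite_measure (density M (\<lambda>z. ennreal (u z + C)))"
      using u by (intro fin) auto
    show "finite_measure (density M (\<lambda>z. ennreal C))"
      using C0 by (intro fin) auto
  qed (simp_all add: sets_M)
  have "AE z in M. ennreal (u z + C) = ennreal C"
    by (rule density_unique[OF _ _ dens]) (use u in auto)
  then show ?thesis
    by eventually_elim (use bd in \<open>smt (verit) ennreal_inj\<close>)
qed

section \<open>The squared peak function as a kernel\<close>

context homogeneous_domain
begin

definition q :: "complex^'d \<Rightarrow> complex^'d \<Rightarrow> real" where "q \<zeta> z = (cmod (pk \<zeta> z))\<^sup>2"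

lemma q_nonneg: "q \<zeta> z \<ge> 0" by (simp add: q_def)

lemma q_le_1: "\<zeta> \<in> S \<Longrightarrow> z \<in> S \<Longrightarrow> q \<zeta> z \<le> 1"
  using pk_le(1)[of z \<zeta>] S_sub_Cl by (auto simp: q_def power_le_one)

lemma q_eq_1: "\<zeta> \<in> S \<Longrightarrow> z \<in> S \<Longrightarrow> q \<zeta> z = 1 \<Longrightarrow> z = \<zeta>"
  using pk_le(2)[of z \<zeta>] S_sub_Cl by (auto simp: q_def power2_eq_1_iff) (smt (verit) norm_ge_zero)

lemma q_self: "\<zeta> \<in> S \<Longrightarrow> q \<zeta> \<zeta> = 1"
  by (simp add: q_def pk_self)

lemma q_sym: "q \<zeta> z = q z \<zeta>"
proof -
  have "pk \<zeta> z = cnj (pk z \<zeta>)" using ip_cnj[of z \<zeta>] by (simp add: pk_def)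
  then show ?thesis by (simp add: q_def)
qed

lemma q_G: "g \<in> G \<Longrightarrow> q (g \<zeta>) (g z) = q \<zeta> z"
  by (simp add: q_def pk_def G_props)

lemma continuous_on_q [continuous_intros]:
  "continuous_on T f \<Longrightarrow> continuous_on T g \<Longrightarrow> continuous_on T (\<lambda>x. q (f x) (g x))"
  unfolding q_def by (intro continuous_intros)

text \<open>On the compact set of pairs where \<psi> differs by at least e, q attains its maximum,
  which is below 1 because q = 1 only on the diagonal; this maximum serves as a. If the set is
  empty, a = 0 will do.\<close>

lemma q_close:
  fixes \<psi> :: "complex^'d \<Rightarrow> real"
  assumes \<psi>: "continuous_on UNIV \<psi>" and e: "e > 0"
  obtains a where "0 \<le> a" "a < 1" "\<And>\<zeta> z. \<zeta> \<in> S \<Longrightarrow> z \<in> S \<Longrightarrow> q \<zeta> z > a \<Longrightarrow> \<bar>\<psi> z - \<psi> \<zeta>\<bar> < e"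
proof -
  define T where "T = (S \<times> S) \<inter> {p. e \<le> \<bar>\<psi> (snd p) - \<psi> (fst p)\<bar>}"
  have cs: "continuous_on UNIV (\<lambda>p. \<psi> (snd p))" "continuous_on UNIV (\<lambda>p. \<psi> (fst p))"
    by (rule continuous_on_compose2[OF \<psi>]; auto intro!: continuous_intros)+
  have "compact T"
    unfolding T_def
    by (intro compact_Int_closed compact_Times compact_S closed_Collect_le continuous_intros cs)
  show thesis
  proof (cases "T = {}")
    case True
    have "\<bar>\<psi> z - \<psi> \<zeta>\<bar> < e" if "\<zeta> \<in> S" "z \<in> S" for \<zeta> z
    proof (rule ccontr)
      assume "\<not> \<bar>\<psi> z - \<psi> \<zeta>\<bar> < e"
      then have "(\<zeta>, z) \<in> T" using that by (simp add: T_def)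
      then show False using True by simp
    qed
    then show ?thesis by (intro that[of 0]) auto
  next
    case False
    have "continuous_on T (\<lambda>p. q (fst p) (snd p))" by (intro continuous_intros)
    from continuous_attains_sup[OF \<open>compact T\<close> False this]
    obtain p where p: "p \<in> T" "\<And>p'. p' \<in> T \<Longrightarrow> q (fst p') (snd p') \<le> q (fst p) (snd p)" by blast
    show ?thesis
    proof (rule that[of "q (fst p) (snd p)"])
      show "0 \<le> q (fst p) (snd p)" by (rule q_nonneg)
      have pS: "fst p \<in> S" "snd p \<in> S" "e \<le> \<bar>\<psi> (snd p) - \<psi> (fst p)\<bar>" using p(1) by (auto simp: T_def)
      then have "snd p \<noteq> fst p" using e by auto
      then show "q (fst p) (snd p) < 1" using q_le_1[OF pS(1,2)] q_eq_1[OF pS(1,2)] by force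
      fix \<zeta> z assume z: "\<zeta> \<in> S" "z \<in> S" "q (fst p) (snd p) < q \<zeta> z"
      show "\<bar>\<psi> z - \<psi> \<zeta>\<bar> < e"
      proof (rule ccontr)
        assume "\<not> \<bar>\<psi> z - \<psi> \<zeta>\<bar> < e"
        then have "(\<zeta>, z) \<in> T" using z by (simp add: T_def)
        from p(2)[OF this] z(3) show False by simp
      qed
    qed
  qed
qed

end

locale homogeneous_measure = homogeneous_domain \<Omega> Cl ip Fam e0
  for \<Omega> Cl :: "(complex^'d::finite) set" and ip Fam e0 +
  fixes M :: "(complex^'d) measure"
  assumes G_inv_M: "G_inv M"
begin

sublocale compact_prob M S
  using G_inv_M by (simp add: G_inv_def)

lemma cp: "compact_prob M S"
  using G_inv_M by (simp add: G_inv_def)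

lemma G_meas: "g \<in> G \<Longrightarrow> g \<in> M \<rightarrow>\<^sub>M M"
  by (rule lin_aut_measurable[OF cp G_lin_aut])

lemma G_integral:
  fixes f :: "_ \<Rightarrow> real"
  assumes g: "g \<in> G" and f: "f \<in> borel_measurable M"
  shows "(\<integral>z. f (g z) \<partial>M) = (\<integral>z. f z \<partial>M)"
proof -
  have "(\<integral>z. f z \<partial>M) = (\<integral>z. f z \<partial>distr M M g)" using G_inv_M g by (simp add: G_inv_def)
  also have "\<dots> = (\<integral>z. f (g z) \<partial>M)" by (rule integral_distr[OF G_meas[OF g] f])
  finally show ?thesis by simp
qed

text \<open>The squared L2 norm of the k-th power of the peak function; by transitivity it is the
  same for every peak point in S.\<close>

definition cc :: "nat \<Rightarrow> real" where "cc k = (\<integral>z. q e0 z ^ k \<partial>M)"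

lemma q_meas: "q \<zeta> \<in> borel_measurable M"
  by (intro measurable_M_continuous continuous_intros)

lemma integral_q_power:
  assumes "\<zeta> \<in> S" shows "(\<integral>z. q \<zeta> z ^ k \<partial>M) = cc k"
proof -
  obtain g where g: "g \<in> G" "g e0 = \<zeta>" using trans_S[OF e0_S assms] by blast
  have "(\<integral>z. q \<zeta> z ^ k \<partial>M) = (\<integral>z. q \<zeta> (g z) ^ k \<partial>M)"
    by (rule G_integral[OF g(1), symmetric]) (intro borel_measurable_power q_meas)
  also have "\<dots> = cc k" using q_G[OF g(1)] g(2) by (auto simp: cc_def)
  finally show ?thesis .
qed

text \<open>A ball about e0 inside the set q > b contains a kernel neighbourhood, and those have
  positive mass.\<close>

lemma measure_near_pos:
  assumes "b < 1" shows "measure M {z\<in>S. q e0 z > b} > 0"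
proof -
  have "open {z. q e0 z > b}" by (intro open_Collect_less continuous_intros)
  moreover have "e0 \<in> {z. q e0 z > b}" using q_self[OF e0_S] assms by simp
  ultimately obtain r where r: "r > 0" "cball e0 r \<subseteq> {z. q e0 z > b}"
    by (meson open_contains_cball)
  obtain m where m': "m \<noteq> 0" "\<And>y. y \<in> S \<Longrightarrow> emeasure M {x\<in>S. ker r x y} = m"
    using ker_measure[OF G_inv_M r(1)] by blast
  note m = m'(1) m'(2)[OF e0_S]
  have "{x\<in>S. ker r x e0} \<subseteq> {z\<in>S. q e0 z > b}"
  proof
    fix x assume x: "x \<in> {x\<in>S. ker r x e0}"
    then have "x \<in> cball e0 r" using ker_props(2)[OF r(1), of x e0] by (simp add: dist_commute)
    then show "x \<in> {z\<in>S. q e0 z > b}" using x r(2) by blast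
  qed
  moreover have "{z\<in>S. q e0 z > b} \<in> sets M"
    using q_meas[of e0] by (simp add: space_M[symmetric])
  ultimately have "emeasure M {x\<in>S. ker r x e0} \<le> emeasure M {z\<in>S. q e0 z > b}" by (rule emeasure_mono)
  then have "m \<le> emeasure M {z\<in>S. q e0 z > b}" by (simp add: m(2))
  then show ?thesis using m(1) by (auto simp: emeasure_eq_measure zero_less_measure_iff)
qed

lemma cc_lower:
  assumes "0 \<le> b" "b < 1"
  shows "b ^ k * measure M {z\<in>S. q e0 z > b} \<le> cc k"
proof -
  have sets: "{z\<in>S. q e0 z > b} \<in> sets M"
    using q_meas[of e0] by (simp add: space_M[symmetric])
  have "b ^ k * measure M {z\<in>S. q e0 z > b} = (\<integral>z. b ^ k * indicator {z\<in>S. q e0 z > b} z \<partial>M)"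
    using sets by simp
  also have "\<dots> \<le> cc k"
    unfolding cc_def
  proof (rule integral_mono)
    show "integrable M (\<lambda>z. b ^ k * indicator {z\<in>S. q e0 z > b} z)"
      using sets by (simp add: emeasure_eq_measure)
    show "integrable M (\<lambda>z. q e0 z ^ k)" by (intro integrable_M_continuous continuous_intros)
    show "b ^ k * indicator {z\<in>S. q e0 z > b} z \<le> q e0 z ^ k" for z
      using assms q_nonneg[of e0 z] by (auto simp: indicator_def intro!: power_mono)
  qed
  finally show ?thesis .
qed

lemma cc_pos: "cc k > 0"
proof -
  have "0 < (1/2) ^ k * measure M {z\<in>S. q e0 z > 1/2}" using measure_near_pos[of "1/2"] by simp
  then show ?thesis using cc_lower[of "1/2" k] by linarith
qed

text \<open>Restricting the integral to q > b bounds \<open>cc k\<close> below by a positive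
  multiple of b^k, for any b in [0, 1); here b is taken halfway between a and 1.\<close>

lemma power_div_cc_tendsto_0:
  assumes "0 \<le> a" "a < 1"
  shows "(\<lambda>k. a ^ k / cc k) \<longlonglongrightarrow> 0"
proof -
  define b where "b = (1 + a) / 2"
  define m where "m = measure M {z\<in>S. q e0 z > b}"
  have b: "0 < b" "b < 1" "a < b" using assms by (auto simp: b_def)
  have m: "m > 0" using measure_near_pos[OF b(2)] by (simp add: m_def)
  have "(\<lambda>k. (a / b) ^ k * (1 / m)) \<longlonglongrightarrow> 0 * (1 / m)"
    using b assms by (intro tendsto_intros LIMSEQ_realpow_zero) auto
  then have lim: "(\<lambda>k. (a / b) ^ k * (1 / m)) \<longlonglongrightarrow> 0" by simp
  have upper: "a ^ k / cc k \<le> (a / b) ^ k * (1 / m)" for k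
  proof -
    have "a ^ k / cc k \<le> a ^ k / (b ^ k * m)"
      using cc_lower[of b k] b m assms by (intro divide_left_mono) (auto simp: m_def cc_pos)
    then show ?thesis by (simp add: power_divide)
  qed
  have lower: "0 \<le> a ^ k / cc k" for k using assms(1) less_imp_le[OF cc_pos[of k]] by simp
  show ?thesis
    by (rule tendsto_sandwich[OF _ _ tendsto_const lim]) (intro always_eventually allI lower upper)+
qed

text \<open>Multiplication by unimodular scalars moves \<zeta> through infinitely many points of
  equal mass, and their total is at most 1.\<close>

lemma measure_singleton:
  assumes \<zeta>: "\<zeta> \<in> S" shows "emeasure M {\<zeta>} = 0"
proof -
  have sing: "{z} \<in> sets M" if "z \<in> S" for z
    using closed_Int_sets_restrict_borel[of "{z}" S] that by (simp add: sets_M)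
  \<comment> \<open>A quarter of the circle, parametrised by its real part so that injectivity can
    be read off.\<close>
  define X where "X = (\<lambda>t. Complex t (sqrt (1 - t\<^sup>2)) *s \<zeta>) ` {0..1::real}"
  have nz: "\<zeta> \<noteq> 0" using S_nrm[OF \<zeta>] nrm_e0_pos nrm_eq_0[of \<zeta>] by auto
  then obtain i where i: "\<zeta> $ i \<noteq> 0" by (auto simp: vec_eq_iff)
  have "inj_on (\<lambda>t. Complex t (sqrt (1 - t\<^sup>2)) *s \<zeta>) {0..1::real}"
  proof (rule inj_onI)
    fix s t assume "Complex s (sqrt (1 - s\<^sup>2)) *s \<zeta> = Complex t (sqrt (1 - t\<^sup>2)) *s \<zeta>"
    then have "Complex s (sqrt (1 - s\<^sup>2)) * \<zeta> $ i = Complex t (sqrt (1 - t\<^sup>2)) * \<zeta> $ i"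
      by (metis vector_smult_component)
    then show "s = t" using i by simp
  qed
  then have inf: "infinite X" unfolding X_def by (simp add: finite_image_iff)
  have X: "z \<in> S \<and> measure M {z} = measure M {\<zeta>}" if zX: "z \<in> X" for z
  proof -
    obtain t where t: "0 \<le> t" "t \<le> 1" "z = Complex t (sqrt (1 - t\<^sup>2)) *s \<zeta>" using zX by (auto simp: X_def)
    have "cmod (Complex t (sqrt (1 - t\<^sup>2))) = 1" using t by (simp add: cmod_def power_le_one)
    then have g: "(\<lambda>z. Complex t (sqrt (1 - t\<^sup>2)) *s z) \<in> G" by (intro G_gen) (auto simp: gens_def)
    have zS: "z \<in> S" using G_S[OF g \<zeta>] t by simp
    have inj: "inj (\<lambda>z :: complex^'d. Complex t (sqrt (1 - t\<^sup>2)) *s z)" using G_lin_aut[OF g] by (simp add: lin_aut_def)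
    have "emeasure M {z} = emeasure (distr M M (\<lambda>z. Complex t (sqrt (1 - t\<^sup>2)) *s z)) {z}"
      using G_inv_M g by (simp add: G_inv_def)
    also have "\<dots> = emeasure M ((\<lambda>z. Complex t (sqrt (1 - t\<^sup>2)) *s z) -` {z} \<inter> space M)"
      by (rule emeasure_distr[OF G_meas[OF g] sing[OF zS]])
    also have "(\<lambda>z. Complex t (sqrt (1 - t\<^sup>2)) *s z) -` {z} \<inter> space M = {\<zeta>}"
      using \<zeta> injD[OF inj] t(3) by (auto simp: space_M)
    finally show ?thesis using zS by (simp add: emeasure_eq_measure)
  qed
  have "measure M {\<zeta>} = 0"
  proof (rule ccontr)
    assume "measure M {\<zeta>} \<noteq> 0"
    then have pos: "measure M {\<zeta>} > 0" by (simp add: zero_less_measure_iff)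
    obtain n where n: "1 < real n * measure M {\<zeta>}" using reals_Archimedean3[OF pos] by blast
    obtain F where F: "F \<subseteq> X" "finite F" "card F = n" using infinite_arbitrarily_large[OF inf] by blast
    have "real n * measure M {\<zeta>} = (\<Sum>z\<in>F. measure M {z})" using F X by (simp add: subset_iff)
    also have "\<dots> = measure M F"
      using F X sing by (intro finite_measure_eq_sum_singleton[symmetric]) auto
    also have "\<dots> \<le> 1" by simp
    finally show False using n by simp
  qed
  then show ?thesis by (simp add: emeasure_eq_measure)
qed

end

text \<open>The form in which compactness delivers convergence: limits are available only after
  passing to a further subsequence.\<close>

lemma tendsto_zero_subseqI:
  fixes a :: "nat \<Rightarrow> 'a::real_normed_vector"
  assumes "\<And>r :: nat \<Rightarrow> nat. strict_mono r \<Longrightarrow> \<exists>\<sigma> :: nat \<Rightarrow> nat. strict_mono \<sigma> \<and> (\<lambda>n. a (r (\<sigma> n))) \<longlonglongrightarrow> 0"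
  shows "a \<longlonglongrightarrow> 0"
proof (rule ccontr)
  assume "\<not> a \<longlonglongrightarrow> 0"
  then obtain e where e: "e > 0" "\<And>N. \<exists>n\<ge>N. norm (a n) \<ge> e"
    unfolding LIMSEQ_iff by (auto simp: not_less)
  have "infinite {n. norm (a n) \<ge> e}"
    unfolding infinite_nat_iff_unbounded_le using e(2) by blast
  from infinite_enumerate[OF this] obtain r :: "nat \<Rightarrow> nat" where r: "strict_mono r" "\<And>n. norm (a (r n)) \<ge> e" by auto
  obtain \<sigma> where "(\<lambda>n. a (r (\<sigma> n))) \<longlonglongrightarrow> 0" using assms[OF r(1)] by blast
  then obtain n where "norm (a (r (\<sigma> n))) < e"
    using e(1) unfolding LIMSEQ_iff by auto
  then show False using r(2)[of "\<sigma> n"] by linarith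
qed

section \<open>Normalised peak functions and their images under the Toeplitz operator\<close>

context homogeneous_measure
begin

definition fk :: "complex^'d \<Rightarrow> nat \<Rightarrow> complex^'d \<Rightarrow> complex" where
  "fk \<zeta> k z = of_real (1 / sqrt (cc k)) * pk \<zeta> z ^ k"

lemma norm_fk_sq: "(cmod (fk \<zeta> k z))\<^sup>2 = q \<zeta> z ^ k / cc k"
  using less_imp_le[OF cc_pos[of k]]
  by (simp add: fk_def q_def norm_mult norm_divide norm_power power_mult_distrib power_divide power_mult[symmetric] mult.commute)

lemma fk_cpoly: "fk \<zeta> k \<in> cpoly"
proof -
  have ax: "ip z \<zeta> = (\<Sum>i\<in>UNIV. z $ i * ip (axis i 1) \<zeta>)" for z
  proof -
    have "ip z \<zeta> = ip (\<Sum>i\<in>UNIV. z $ i *s axis i 1) \<zeta>" by (simp add: basis_expansion)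
    also have "\<dots> = (\<Sum>i\<in>UNIV. z $ i * ip (axis i 1) \<zeta>)"
      by (simp add: bounded_bilinear.sum_left[OF bounded_bilinear_ip] ip_smult)
    finally show ?thesis .
  qed
  have "(\<lambda>z. \<Sum>i\<in>UNIV. z $ i * ip (axis i 1) \<zeta>) \<in> cpoly"
    by (rule cpoly_sum) (simp_all add: cpoly_mult[OF cpoly_coord cpoly_const])
  from cpoly_mult[OF cpoly_const[of "1 / 2"] cpoly_add[OF cpoly_const[of 1] cpoly_mult[OF cpoly_const[of "1 / of_real (nrm e0)"] this]]]
  have "(\<lambda>z. 1 / 2 * (1 + 1 / of_real (nrm e0) * (\<Sum>i\<in>UNIV. z $ i * ip (axis i 1) \<zeta>))) \<in> cpoly" .
  moreover have "pk \<zeta> = (\<lambda>z. 1 / 2 * (1 + 1 / of_real (nrm e0) * (\<Sum>i\<in>UNIV. z $ i * ip (axis i 1) \<zeta>)))"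
  proof
    fix z
    show "pk \<zeta> z = 1 / 2 * (1 + 1 / of_real (nrm e0) * (\<Sum>i\<in>UNIV. z $ i * ip (axis i 1) \<zeta>))"
      unfolding pk_def ax[of z] by simp
  qed
  ultimately have "pk \<zeta> \<in> cpoly" by simp
  then show ?thesis unfolding fk_def[abs_def] using cpoly_mult[OF cpoly_const cpoly_power] by blast
qed

lemma fk_hardy: "fk \<zeta> k \<in> hardy M"
  by (rule cpoly_hardy[OF fk_cpoly])

lemma fk_sq_int: "sq_int M (fk \<zeta> k)"
  by (rule sq_int_cpoly[OF fk_cpoly])

lemma fk_norm: "\<zeta> \<in> S \<Longrightarrow> (\<integral>z. (cmod (fk \<zeta> k z))\<^sup>2 \<partial>M) = 1"
  using cc_pos[of k] by (simp add: norm_fk_sq integral_q_power)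

text \<open>Split at q > 1 - 1/(n+1). Near \<zeta> the integral of |u|^2 is small because the point
  \<zeta> is a null set; away from it the normalised peak functions tend uniformly to 0.\<close>

lemma fk_weak_null:
  assumes \<zeta>: "\<zeta> \<in> S" and u: "sq_int M u"
  shows "(\<lambda>k. \<integral>z. fk \<zeta> k z * cnj (u z) \<partial>M) \<longlonglongrightarrow> 0"
proof (rule LIMSEQ_I)
  fix e :: real assume "e > 0"
  define \<eta> where "\<eta> = e / 3"
  have \<eta>: "\<eta> > 0" using \<open>e > 0\<close> by (simp add: \<eta>_def)
  have um: "u \<in> borel_measurable M" and u2: "integrable M (\<lambda>z. (cmod (u z))\<^sup>2)" using u by (auto simp: sq_int_def)
  have qm: "q \<zeta> \<in> borel_measurable M" by (rule q_meas)
  have u1: "integrable M (\<lambda>z. cmod (u z))"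
    using sq_int_mult_integrable[OF u sq_int_cpoly[OF cpoly_const[of 1]]] by (simp add: integrable_norm)
  define A where "A n = {z. q \<zeta> z > 1 - 1 / real (Suc n)}" for n
  have Am: "(\<lambda>z. indicator (A n) z :: real) \<in> borel_measurable M" for n
    unfolding A_def by (intro measurable_M borel_measurable_indicator borel_open open_Collect_less continuous_intros)
  have "(\<lambda>n. \<integral>z. indicator (A n) z * (cmod (u z))\<^sup>2 \<partial>M) \<longlonglongrightarrow> (\<integral>z. 0 \<partial>M)"
  proof (rule integral_dominated_convergence[where w="\<lambda>z. (cmod (u z))\<^sup>2"])
    show "(\<lambda>z. indicator (A n) z * (cmod (u z))\<^sup>2) \<in> borel_measurable M" for n
      using Am um by measurable
    have "AE z in M. z \<noteq> \<zeta>"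
      using measure_singleton[OF \<zeta>] closed_Int_sets_restrict_borel[of "{\<zeta>}" S] \<zeta>
      by (intro AE_I[of _ _ "{\<zeta>}"]) (auto simp: sets_M)
    moreover have "AE z in M. z \<in> S" by (rule AE_I2) (simp add: space_M)
    ultimately show "AE z in M. (\<lambda>n. indicator (A n) z * (cmod (u z))\<^sup>2) \<longlonglongrightarrow> 0"
    proof eventually_elim
      case (elim z)
      have "q \<zeta> z < 1" using q_le_1[OF \<zeta> elim(2)] q_eq_1[OF \<zeta> elim(2)] elim(1) by force
      then obtain N where N: "inverse (real (Suc N)) < 1 - q \<zeta> z" using reals_Archimedean[of "1 - q \<zeta> z"] by auto
      have "indicator (A n) z * (cmod (u z))\<^sup>2 = 0" if "n \<ge> N" for n
      proof -
        have "1 / real (Suc n) \<le> 1 / real (Suc N)" using that by (intro divide_left_mono) auto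
        then show ?thesis using N by (simp add: A_def inverse_eq_divide)
      qed
      then show ?case by (intro tendsto_eventually eventually_sequentiallyI[of N])
    qed
    show "AE z in M. norm (indicator (A n) z * (cmod (u z))\<^sup>2) \<le> (cmod (u z))\<^sup>2" for n
      by (rule AE_I2) (simp add: indicator_def)
  qed (use u2 in auto)
  then have "\<forall>\<^sub>F n in sequentially. (\<integral>z. indicator (A n) z * (cmod (u z))\<^sup>2 \<partial>M) < \<eta>\<^sup>2"
    using order_tendstoD(2)[of _ 0 sequentially "\<eta>\<^sup>2"] \<eta> by simp
  then obtain n where n: "(\<integral>z. indicator (A n) z * (cmod (u z))\<^sup>2 \<partial>M) < \<eta>\<^sup>2"
    by (auto simp: eventually_sequentially)
  define a where "a = 1 - 1 / real (Suc n)"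
  have a: "0 \<le> a" "a < 1" by (auto simp: a_def)
  define U where "U = (\<integral>z. cmod (u z) \<partial>M)"
  have "(\<lambda>k. sqrt (a ^ k / cc k) * U) \<longlonglongrightarrow> sqrt 0 * U"
    by (intro tendsto_intros power_div_cc_tendsto_0 a)
  then have "\<forall>\<^sub>F k in sequentially. sqrt (a ^ k / cc k) * U < \<eta>"
    using order_tendstoD(2)[of _ 0 sequentially \<eta>] \<eta> by simp
  then obtain N where N: "\<And>k. k \<ge> N \<Longrightarrow> sqrt (a ^ k / cc k) * U < \<eta>" by (auto simp: eventually_sequentially)
  have "norm ((\<integral>z. fk \<zeta> k z * cnj (u z) \<partial>M) - 0) < e" if k: "k \<ge> N" for k
  proof -
    define F where "F z = cmod (fk \<zeta> k z)" for z
    have F2: "integrable M (\<lambda>z. (F z)\<^sup>2)" "(\<integral>z. (F z)\<^sup>2 \<partial>M) = 1"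
      using fk_sq_int fk_norm[OF \<zeta>] by (auto simp: F_def sq_int_def)
    have iA: "integrable M (\<lambda>z. indicator (A n) z * (cmod (u z))\<^sup>2)"
      by (rule Bochner_Integration.integrable_bound[OF u2]) (use Am um in \<open>auto simp: indicator_def\<close>)
    \<comment> \<open>Near \<zeta>, the inequality x y \<le> \<eta> x^2 / 2 + y^2 / (2 \<eta>) gives
      the unit mass of \<open>F\<close> the small factor \<eta>; away from it \<open>F\<close> is at
      most sqrt (a^k / cc k).\<close>
    have pt: "cmod (fk \<zeta> k z * cnj (u z)) \<le> \<eta> / 2 * (F z)\<^sup>2 + 1 / (2 * \<eta>) * (indicator (A n) z * (cmod (u z))\<^sup>2) + sqrt (a ^ k / cc k) * cmod (u z)" for z
    proof (cases "z \<in> A n")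
      case True
      have "0 \<le> (\<eta> * F z - cmod (u z))\<^sup>2 / (2 * \<eta>)" using \<eta> by simp
      also have "\<dots> = \<eta> / 2 * (F z)\<^sup>2 + 1 / (2 * \<eta>) * (cmod (u z))\<^sup>2 - F z * cmod (u z)"
        using \<eta> by (simp add: power2_diff field_simps power2_eq_square)
      finally have "F z * cmod (u z) \<le> \<eta> / 2 * (F z)\<^sup>2 + 1 / (2 * \<eta>) * (cmod (u z))\<^sup>2" by simp
      moreover have "0 \<le> sqrt (a ^ k / cc k) * cmod (u z)" using a less_imp_le[OF cc_pos[of k]] by simp
      ultimately show ?thesis using True by (simp add: norm_mult F_def)
    next
      case False
      then have "q \<zeta> z \<le> a" by (simp add: A_def a_def)
      then have "(F z)\<^sup>2 \<le> a ^ k / cc k"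
        unfolding F_def norm_fk_sq using less_imp_le[OF cc_pos[of k]] q_nonneg by (intro divide_right_mono power_mono) auto
      then have "F z \<le> sqrt (a ^ k / cc k)" by (rule real_le_rsqrt)
      then have "F z * cmod (u z) \<le> sqrt (a ^ k / cc k) * cmod (u z)" by (intro mult_right_mono) auto
      moreover have "0 \<le> \<eta> / 2 * (F z)\<^sup>2" using \<eta> by simp
      ultimately show ?thesis using False by (simp add: norm_mult F_def)
    qed
    have "cmod (\<integral>z. fk \<zeta> k z * cnj (u z) \<partial>M) \<le> (\<integral>z. cmod (fk \<zeta> k z * cnj (u z)) \<partial>M)"
      by (rule integral_norm_bound)
    also have "\<dots> \<le> (\<integral>z. \<eta> / 2 * (F z)\<^sup>2 + 1 / (2 * \<eta>) * (indicator (A n) z * (cmod (u z))\<^sup>2) + sqrt (a ^ k / cc k) * cmod (u z) \<partial>M)"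
      by (intro integral_mono pt integrable_norm sq_int_mult_integrable fk_sq_int u Bochner_Integration.integrable_add
            integrable_mult_right F2 iA u1)
    also have "\<dots> = \<eta> / 2 + 1 / (2 * \<eta>) * (\<integral>z. indicator (A n) z * (cmod (u z))\<^sup>2 \<partial>M) + sqrt (a ^ k / cc k) * U"
      using F2 iA u1 by (simp add: U_def)
    also have "\<dots> < \<eta> / 2 + 1 / (2 * \<eta>) * \<eta>\<^sup>2 + \<eta>"
      using n N[OF k] \<eta> by (intro add_strict_mono add_strict_left_mono mult_strict_left_mono) auto
    also have "\<dots> \<le> e" using \<eta> by (simp add: \<eta>_def power2_eq_square)
    finally show ?thesis by simp
  qed
  then show "\<exists>no. \<forall>k\<ge>no. norm ((\<integral>z. fk \<zeta> k z * cnj (u z) \<partial>M) - 0) < e" by blast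
qed

text \<open>The integral is the inner product of the projection \<open>g k\<close> with
  \<open>fk \<zeta> k\<close>. Along a subsequence the projections are Cauchy, so up to a small
  error they may be replaced by one fixed term, against which the weakly null peak functions tend to
  0.\<close>

lemma toeplitz_peak_limit:
  assumes \<phi>: "\<phi> \<in> borel_measurable M" and bd: "\<And>z. cmod (\<phi> z) \<le> C"
    and comp: "toeplitz_compact M \<phi>" and \<zeta>: "\<zeta> \<in> S"
  shows "(\<lambda>k. \<integral>z. \<phi> z * of_real (q \<zeta> z ^ k / cc k) \<partial>M) \<longlonglongrightarrow> 0"
proof -
  have sq: "sq_int M (\<lambda>z. \<phi> z * fk \<zeta> k z)" for k
  proof -
    have fm: "fk \<zeta> k \<in> borel_measurable M" and fi: "integrable M (\<lambda>z. C\<^sup>2 * (cmod (fk \<zeta> k z))\<^sup>2)"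
      using fk_sq_int[of \<zeta> k] by (auto simp: sq_int_def)
    have "integrable M (\<lambda>z. (cmod (\<phi> z * fk \<zeta> k z))\<^sup>2)"
      by (rule Bochner_Integration.integrable_bound[OF fi])
         (use fm \<phi> bd in \<open>auto simp: norm_mult power_mult_distrib intro!: mult_right_mono power_mono\<close>)
    then show ?thesis using fm \<phi> by (auto simp: sq_int_def)
  qed
  have "\<forall>k. \<exists>g. szego_proj M (\<lambda>z. \<phi> z * fk \<zeta> k z) g" using szego_proj_exists[OF sq] by metis
  then obtain g where g: "\<And>k. szego_proj M (\<lambda>z. \<phi> z * fk \<zeta> k z) (g k)" by metis
  have gs: "sq_int M (g k)" for k using g[of k] hardy_sq_int by (auto simp: szego_proj_def)
  have eq: "(\<integral>z. \<phi> z * of_real (q \<zeta> z ^ k / cc k) \<partial>M) = (\<integral>z. g k z * cnj (fk \<zeta> k z) \<partial>M)" for k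
  proof -
    have "(\<integral>z. (\<phi> z * fk \<zeta> k z - g k z) * cnj (fk \<zeta> k z) \<partial>M) = 0"
      using g[of k] fk_hardy unfolding szego_proj_def by blast
    then have "(\<integral>z. \<phi> z * fk \<zeta> k z * cnj (fk \<zeta> k z) \<partial>M) = (\<integral>z. g k z * cnj (fk \<zeta> k z) \<partial>M)"
      using sq_int_mult_integrable[OF sq fk_sq_int] sq_int_mult_integrable[OF gs fk_sq_int]
      by (simp add: left_diff_distrib)
    moreover have "\<phi> z * fk \<zeta> k z * cnj (fk \<zeta> k z) = \<phi> z * of_real (q \<zeta> z ^ k / cc k)" for z
      unfolding norm_fk_sq[symmetric] complex_norm_square by simp
    ultimately show ?thesis by simp
  qed
  show ?thesis
    unfolding eq
  proof (rule tendsto_zero_subseqI)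
    fix r :: "nat \<Rightarrow> nat" assume r: "strict_mono r"
    have "\<forall>n. fk \<zeta> (r n) \<in> hardy M \<and> (\<integral>z. (cmod (fk \<zeta> (r n) z))\<^sup>2 \<partial>M) \<le> 1 \<and>
             szego_proj M (\<lambda>z. \<phi> z * fk \<zeta> (r n) z) (g (r n))"
      using fk_hardy fk_norm[OF \<zeta>] g by simp
    from comp[unfolded toeplitz_compact_def, rule_format, of "\<lambda>n. fk \<zeta> (r n)" "\<lambda>n. g (r n)", OF this[rule_format]]
    obtain \<sigma> :: "nat \<Rightarrow> nat" where \<sigma>: "strict_mono \<sigma>"
      and cau: "\<forall>\<epsilon>>0. \<exists>N. \<forall>m\<ge>N. \<forall>k\<ge>N. (\<integral>z. (cmod (g (r (\<sigma> m)) z - g (r (\<sigma> k)) z))\<^sup>2 \<partial>M) < \<epsilon>"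
      by blast
    have "(\<lambda>n. \<integral>z. g (r (\<sigma> n)) z * cnj (fk \<zeta> (r (\<sigma> n)) z) \<partial>M) \<longlonglongrightarrow> 0"
    proof (rule LIMSEQ_I)
      fix e :: real assume e: "e > 0"
      obtain N where N: "\<And>m k. m \<ge> N \<Longrightarrow> k \<ge> N \<Longrightarrow> (\<integral>z. (cmod (g (r (\<sigma> m)) z - g (r (\<sigma> k)) z))\<^sup>2 \<partial>M) < (e / 2)\<^sup>2"
        using cau[rule_format, of "(e / 2)\<^sup>2"] e by auto
      have "strict_mono (r \<circ> \<sigma>)" using r \<sigma> strict_mono_o by blast
      from LIMSEQ_subseq_LIMSEQ[OF fk_weak_null[OF \<zeta> gs[of "r (\<sigma> N)"]] this]
      have "(\<lambda>n. \<integral>z. fk \<zeta> (r (\<sigma> n)) z * cnj (g (r (\<sigma> N)) z) \<partial>M) \<longlonglongrightarrow> 0" by (simp add: comp_def)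
      from LIMSEQ_D[OF this half_gt_zero[OF e]]
      obtain N' where N': "\<forall>n\<ge>N'. norm ((\<integral>z. fk \<zeta> (r (\<sigma> n)) z * cnj (g (r (\<sigma> N)) z) \<partial>M) - 0) < e / 2" by blast
      have "norm ((\<integral>z. g (r (\<sigma> n)) z * cnj (fk \<zeta> (r (\<sigma> n)) z) \<partial>M) - 0) < e" if n: "n \<ge> max N N'" for n
      proof -
        define f where "f = fk \<zeta> (r (\<sigma> n))"
        define u where "u = g (r (\<sigma> N))"
        define v where "v = g (r (\<sigma> n))"
        have s: "sq_int M f" "sq_int M u" "sq_int M v" by (simp_all add: f_def u_def v_def fk_sq_int gs)
        note s' = sq_int_diff[OF s(3,2)]
        have dec: "(\<integral>z. v z * cnj (f z) \<partial>M) = (\<integral>z. (v z - u z) * cnj (f z) \<partial>M) + (\<integral>z. u z * cnj (f z) \<partial>M)"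
          using sq_int_mult_integrable[OF s(3,1)] sq_int_mult_integrable[OF s(2,1)]
          by (simp add: left_diff_distrib)
        have "cmod (\<integral>z. (v z - u z) * cnj (f z) \<partial>M) < e / 2"
        proof -
          have "(cmod (\<integral>z. (v z - u z) * cnj (f z) \<partial>M))\<^sup>2 \<le> (\<integral>z. (cmod (v z - u z))\<^sup>2 \<partial>M) * (\<integral>z. (cmod (f z))\<^sup>2 \<partial>M)"
            by (rule L2_Cauchy_Schwarz[OF s' s(1)])
          also have "\<dots> < (e / 2)\<^sup>2" using N[of n N] n fk_norm[OF \<zeta>] by (simp add: f_def u_def v_def)
          finally show ?thesis by (rule power_less_imp_less_base) (use e in simp)
        qed
        moreover have "cmod (\<integral>z. u z * cnj (f z) \<partial>M) < e / 2"
        proof -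
          have "(\<integral>z. u z * cnj (f z) \<partial>M) = (\<integral>z. cnj (f z * cnj (u z)) \<partial>M)" by (simp add: mult.commute)
          also have "\<dots> = cnj (\<integral>z. f z * cnj (u z) \<partial>M)" by (rule Bochner_Integration.integral_cnj)
          finally have "cmod (\<integral>z. u z * cnj (f z) \<partial>M) = cmod (\<integral>z. f z * cnj (u z) \<partial>M)" by simp
          then show ?thesis using N' n by (simp add: f_def u_def)
        qed
        ultimately have "cmod (\<integral>z. v z * cnj (f z) \<partial>M) < e"
          unfolding dec using norm_triangle_ineq[of "\<integral>z. (v z - u z) * cnj (f z) \<partial>M" "\<integral>z. u z * cnj (f z) \<partial>M"] by linarith
        then show ?thesis by (simp add: f_def v_def)
      qed
      then show "\<exists>no. \<forall>n\<ge>no. norm ((\<integral>z. g (r (\<sigma> n)) z * cnj (fk \<zeta> (r (\<sigma> n)) z) \<partial>M) - 0) < e" by blast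
    qed
    then show "\<exists>\<sigma>. strict_mono \<sigma> \<and> (\<lambda>n. \<integral>z. g (r (\<sigma> n)) z * cnj (fk \<zeta> (r (\<sigma> n)) z) \<partial>M) \<longlonglongrightarrow> 0"
      using \<sigma> by blast
  qed
qed

end

lemma measurable_complex_of_real:
  "v \<in> borel_measurable N \<Longrightarrow> (\<lambda>x. complex_of_real (v x)) \<in> borel_measurable N"
  by (rule measurable_compose[OF _ borel_measurable_continuous_onI]) (auto intro!: continuous_intros)

context homogeneous_measure
begin

text \<open>Since q is symmetric, the kernel K is normalised in both variables. Fubini moves it from
  \<phi> to \<psi>: one side tends to 0 by dominated convergence, the other to the integral of
  \<phi> \<psi>, because smoothing the continuous \<psi> converges uniformly on S.\<close>

lemma toeplitz_orthogonal:
  fixes \<psi> :: "complex^'d \<Rightarrow> real"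
  assumes \<phi>: "\<phi> \<in> borel_measurable M" and bd: "\<And>z. cmod (\<phi> z) \<le> C"
    and comp: "toeplitz_compact M \<phi>" and \<psi>: "continuous_on UNIV \<psi>"
  shows "(\<integral>z. \<phi> z * of_real (\<psi> z) \<partial>M) = 0"
proof -
  have C0: "C \<ge> 0" using bd norm_ge_zero order_trans by blast
  obtain B where B: "\<And>z. z \<in> S \<Longrightarrow> \<bar>\<psi> z\<bar> \<le> B"
  proof -
    have "bounded (\<psi> ` S)"
      by (intro compact_imp_bounded compact_continuous_image compact_S continuous_on_subset[OF \<psi>]) auto
    then show ?thesis using that unfolding bounded_iff by auto
  qed
  have B0: "B \<ge> 0" using B[OF e0_S] by linarith
  define K where "K k z \<zeta> = q \<zeta> z ^ k / cc k" for k z \<zeta>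
  have K0: "K k z \<zeta> \<ge> 0" for k z \<zeta> using q_nonneg less_imp_le[OF cc_pos] by (simp add: K_def)
  have Kc1: "continuous_on UNIV (\<lambda>z. K k z \<zeta>)" and Kc2: "continuous_on UNIV (\<lambda>\<zeta>. K k z \<zeta>)"
    and Kc: "continuous_on UNIV (\<lambda>p. K k (fst p) (snd p))" for k z \<zeta>
    unfolding K_def using cc_pos[of k] by (auto intro!: continuous_intros)
  have Ki1: "integrable M (\<lambda>z. K k z \<zeta>)" and Ki2: "integrable M (\<lambda>\<zeta>. K k z \<zeta>)" for k z \<zeta>
    by (rule integrable_M_continuous, rule continuous_on_subset[OF Kc1], simp)
       (rule integrable_M_continuous, rule continuous_on_subset[OF Kc2], simp)
  have KI1: "(\<integral>z. K k z \<zeta> \<partial>M) = 1" if "\<zeta> \<in> S" for k \<zeta>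
    using integral_q_power[OF that, of k] cc_pos[of k] by (simp add: K_def)
  have KI2: "(\<integral>\<zeta>. K k z \<zeta> \<partial>M) = 1" if "z \<in> S" for k z
    using integral_q_power[OF that, of k] cc_pos[of k] by (simp add: K_def q_sym[of _ z])
  have \<psi>m: "\<psi> \<in> borel_measurable M"
    by (rule measurable_M[OF borel_measurable_continuous_onI[OF \<psi>]])
  interpret P: pair_prob_space M M by unfold_locales
  have idM: "(\<lambda>x. x) \<in> borel_measurable M" by (rule measurable_M) simp
  have "(\<lambda>p. p) \<in> M \<Otimes>\<^sub>M M \<rightarrow>\<^sub>M borel \<Otimes>\<^sub>M borel"
    using measurable_Pair[OF measurable_compose[OF measurable_fst idM] measurable_compose[OF measurable_snd idM]] by simp
  then have idP: "(\<lambda>p. p) \<in> M \<Otimes>\<^sub>M M \<rightarrow>\<^sub>M borel" by (simp add: borel_prod)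
  have Km: "(\<lambda>p. K k (fst p) (snd p)) \<in> borel_measurable (M \<Otimes>\<^sub>M M)" for k
    using measurable_compose[OF idP borel_measurable_continuous_onI[OF Kc]] .
  have \<phi>1: "(\<lambda>p. \<phi> (fst p)) \<in> borel_measurable (M \<Otimes>\<^sub>M M)"
    by (rule measurable_compose[OF measurable_fst \<phi>])
  have \<psi>2: "(\<lambda>p. complex_of_real (\<psi> (snd p))) \<in> borel_measurable (M \<Otimes>\<^sub>M M)"
    by (intro measurable_complex_of_real measurable_compose[OF measurable_snd \<psi>m])
  define J where "J k \<zeta> = (\<integral>z. \<phi> z * of_real (K k z \<zeta>) \<partial>M)" for k \<zeta>
  have int\<phi>: "integrable M (\<lambda>z. \<phi> z * of_real (v z))" if v: "integrable M v" for v :: "_ \<Rightarrow> real"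
  proof (rule Bochner_Integration.integrable_bound)
    show "integrable M (\<lambda>z. C * v z)" using v by simp
    show "(\<lambda>z. \<phi> z * of_real (v z)) \<in> borel_measurable M"
      using \<phi> borel_measurable_integrable[OF v] by (intro borel_measurable_times measurable_complex_of_real)
    show "AE z in M. norm (\<phi> z * of_real (v z)) \<le> norm (C * v z)"
      by (rule AE_I2) (use bd C0 in \<open>auto simp: norm_mult abs_mult intro!: mult_right_mono\<close>)
  qed
  have bound\<phi>: "cmod (\<integral>z. \<phi> z * of_real (v z) \<partial>M) \<le> C * (\<integral>z. \<bar>v z\<bar> \<partial>M)" if v: "integrable M v" for v :: "_ \<Rightarrow> real"
  proof -
    have "cmod (\<integral>z. \<phi> z * of_real (v z) \<partial>M) \<le> (\<integral>z. cmod (\<phi> z * of_real (v z)) \<partial>M)"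
      by (rule integral_norm_bound)
    also have "\<dots> \<le> (\<integral>z. C * \<bar>v z\<bar> \<partial>M)"
    proof (rule integral_mono)
      show "integrable M (\<lambda>z. cmod (\<phi> z * of_real (v z)))" by (rule integrable_norm[OF int\<phi>[OF v]])
      show "integrable M (\<lambda>z. C * \<bar>v z\<bar>)" using v by simp
      show "cmod (\<phi> z * of_real (v z)) \<le> C * \<bar>v z\<bar>" for z
        using bd[of z] by (simp add: norm_mult mult_right_mono)
    qed
    finally show ?thesis by simp
  qed
  have J_bd: "cmod (J k \<zeta>) \<le> C" if "\<zeta> \<in> S" for k \<zeta>
    using bound\<phi>[OF Ki1[of k \<zeta>]] KI1[OF that, of k] K0 by (simp add: J_def)
  have lim0: "(\<lambda>k. \<integral>\<zeta>. of_real (\<psi> \<zeta>) * J k \<zeta> \<partial>M) \<longlonglongrightarrow> (\<integral>\<zeta>. 0 \<partial>M)"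
  proof (rule integral_dominated_convergence[where w="\<lambda>_. B * C"])
    show "(\<lambda>\<zeta>. of_real (\<psi> \<zeta>) * J k \<zeta>) \<in> borel_measurable M" for k
    proof (intro borel_measurable_times measurable_complex_of_real \<psi>m)
      have "(\<lambda>(\<zeta>, z). \<phi> z * of_real (K k z \<zeta>)) \<in> borel_measurable (M \<Otimes>\<^sub>M M)"
      proof -
        have "(\<lambda>p. K k (snd p) (fst p)) \<in> borel_measurable (M \<Otimes>\<^sub>M M)"
          using measurable_compose[OF measurable_pair_swap' Km[of k]] by (simp add: case_prod_beta')
        then show ?thesis
          unfolding case_prod_beta'
          by (intro borel_measurable_times measurable_complex_of_real measurable_compose[OF measurable_snd \<phi>])
      qed
      then show "J k \<in> borel_measurable M"
        unfolding J_def[abs_def] by (rule borel_measurable_lebesgue_integral)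
    qed
    show "AE \<zeta> in M. (\<lambda>k. of_real (\<psi> \<zeta>) * J k \<zeta>) \<longlonglongrightarrow> 0"
    proof (rule AE_I2)
      fix \<zeta> assume "\<zeta> \<in> space M"
      then have "\<zeta> \<in> S" by (simp add: space_M)
      from toeplitz_peak_limit[OF \<phi> bd comp this] have "(\<lambda>k. J k \<zeta>) \<longlonglongrightarrow> 0" by (simp add: J_def K_def)
      then show "(\<lambda>k. of_real (\<psi> \<zeta>) * J k \<zeta>) \<longlonglongrightarrow> 0" by (rule tendsto_mult_right_zero)
    qed
    show "AE \<zeta> in M. norm (of_real (\<psi> \<zeta>) * J k \<zeta>) \<le> B * C" for k
    proof (rule AE_I2)
      fix \<zeta> assume "\<zeta> \<in> space M"
      then have "\<zeta> \<in> S" by (simp add: space_M)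
      then show "norm (of_real (\<psi> \<zeta>) * J k \<zeta>) \<le> B * C"
        using mult_mono[OF B J_bd B0] by (simp add: norm_mult)
    qed
  qed auto
  define L where "L k z = (\<integral>\<zeta>. \<psi> \<zeta> * K k z \<zeta> \<partial>M)" for k z
  have \<psi>K: "integrable M (\<lambda>\<zeta>. \<psi> \<zeta> * K k z \<zeta>)" for k z
    by (rule integrable_M_continuous)
       (intro continuous_on_mult continuous_on_subset[OF \<psi>] continuous_on_subset[OF Kc2]; simp)
  have fub: "(\<integral>\<zeta>. of_real (\<psi> \<zeta>) * J k \<zeta> \<partial>M) = (\<integral>z. \<phi> z * of_real (L k z) \<partial>M)" for k
  proof -
    have bK: "\<exists>R. \<forall>p\<in>S \<times> S. \<bar>K k (fst p) (snd p)\<bar> \<le> R"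
    proof -
      have "bounded ((\<lambda>p. K k (fst p) (snd p)) ` (S \<times> S))"
        by (intro compact_imp_bounded compact_continuous_image compact_Times compact_S continuous_on_subset[OF Kc]) auto
      then show ?thesis unfolding bounded_iff by auto
    qed
    then obtain R where R: "\<And>p. p \<in> S \<times> S \<Longrightarrow> \<bar>K k (fst p) (snd p)\<bar> \<le> R" by blast
    have "integrable (M \<Otimes>\<^sub>M M) (\<lambda>(z, \<zeta>). \<phi> z * (of_real (\<psi> \<zeta>) * of_real (K k z \<zeta>)))"
      unfolding case_prod_beta'
    proof (rule P.P.integrable_const_bound[of _ "C * (B * R)"])
      show "(\<lambda>p. \<phi> (fst p) * (of_real (\<psi> (snd p)) * of_real (K k (fst p) (snd p)))) \<in> borel_measurable (M \<Otimes>\<^sub>M M)"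
        by (intro borel_measurable_times \<phi>1 \<psi>2 measurable_complex_of_real Km)
      show "AE p in M \<Otimes>\<^sub>M M. norm (\<phi> (fst p) * (of_real (\<psi> (snd p)) * of_real (K k (fst p) (snd p)))) \<le> C * (B * R)"
      proof (rule AE_I2)
        fix p assume "p \<in> space (M \<Otimes>\<^sub>M M)"
        then have p: "p \<in> S \<times> S" by (simp add: space_pair_measure space_M)
        then have "\<bar>\<psi> (snd p)\<bar> * \<bar>K k (fst p) (snd p)\<bar> \<le> B * R"
          using B[of "snd p"] R[OF p] B0 by (intro mult_mono) auto
        then show "norm (\<phi> (fst p) * (of_real (\<psi> (snd p)) * of_real (K k (fst p) (snd p)))) \<le> C * (B * R)"
          using mult_mono[OF bd[of "fst p"] _ C0] by (simp add: norm_mult)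
      qed
    qed
    from P.Fubini_integral[OF this]
    have "(\<integral>\<zeta>. \<integral>z. \<phi> z * (of_real (\<psi> \<zeta>) * of_real (K k z \<zeta>)) \<partial>M \<partial>M) =
       (\<integral>z. \<integral>\<zeta>. \<phi> z * (of_real (\<psi> \<zeta>) * of_real (K k z \<zeta>)) \<partial>M \<partial>M)" .
    moreover have "(\<integral>z. \<phi> z * (of_real (\<psi> \<zeta>) * of_real (K k z \<zeta>)) \<partial>M) = of_real (\<psi> \<zeta>) * J k \<zeta>" for \<zeta>
    proof -
      have "(\<lambda>z. \<phi> z * (of_real (\<psi> \<zeta>) * of_real (K k z \<zeta>))) = (\<lambda>z. of_real (\<psi> \<zeta>) * (\<phi> z * of_real (K k z \<zeta>)))"
        by (simp add: fun_eq_iff mult_ac)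
      then show ?thesis by (simp add: J_def)
    qed
    moreover have "(\<integral>\<zeta>. \<phi> z * (of_real (\<psi> \<zeta>) * of_real (K k z \<zeta>)) \<partial>M) = \<phi> z * of_real (L k z)" for z
    proof -
      have "(\<integral>\<zeta>. of_real (\<psi> \<zeta> * K k z \<zeta>) \<partial>M) = complex_of_real (L k z)"
        unfolding L_def by (rule integral_of_real[OF \<psi>K])
      then show ?thesis by simp
    qed
    ultimately show ?thesis by (simp only:)
  qed
  \<comment> \<open>Where q > a the oscillation of \<psi> is below e and the kernel has total mass
    1; elsewhere the kernel is at most a^k / cc k and \<psi> varies by at most 2 B.\<close>
  have L_close: "\<bar>L k z - \<psi> z\<bar> \<le> e + 2 * B * (a ^ k / cc k)"
    if a: "0 \<le> a" "\<And>\<zeta> z. \<zeta> \<in> S \<Longrightarrow> z \<in> S \<Longrightarrow> q \<zeta> z > a \<Longrightarrow> \<bar>\<psi> z - \<psi> \<zeta>\<bar> < e" and e: "e > 0" and z: "z \<in> S" for a e k z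
  proof -
    have "L k z - \<psi> z = (\<integral>\<zeta>. (\<psi> \<zeta> - \<psi> z) * K k z \<zeta> \<partial>M)"
      using \<psi>K[of k z] Ki2[of k z] KI2[OF z, of k] by (simp add: L_def left_diff_distrib)
    also have "\<bar>\<dots>\<bar> \<le> (\<integral>\<zeta>. \<bar>(\<psi> \<zeta> - \<psi> z) * K k z \<zeta>\<bar> \<partial>M)" by (rule integral_abs_bound)
    also have "\<dots> \<le> (\<integral>\<zeta>. e * K k z \<zeta> + 2 * B * (a ^ k / cc k) \<partial>M)"
    proof (rule integral_mono_AE)
      show "integrable M (\<lambda>\<zeta>. \<bar>(\<psi> \<zeta> - \<psi> z) * K k z \<zeta>\<bar>)"
        using \<psi>K[of k z] Ki2[of k z] by (simp add: left_diff_distrib)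
      show "integrable M (\<lambda>\<zeta>. e * K k z \<zeta> + 2 * B * (a ^ k / cc k))" using Ki2 by simp
      show "AE \<zeta> in M. \<bar>(\<psi> \<zeta> - \<psi> z) * K k z \<zeta>\<bar> \<le> e * K k z \<zeta> + 2 * B * (a ^ k / cc k)"
      proof (rule AE_I2)
        fix \<zeta> assume "\<zeta> \<in> space M"
        then have \<zeta>: "\<zeta> \<in> S" by (simp add: space_M)
        have pa: "0 \<le> a ^ k / cc k" using a(1) less_imp_le[OF cc_pos[of k]] by simp
        show "\<bar>(\<psi> \<zeta> - \<psi> z) * K k z \<zeta>\<bar> \<le> e * K k z \<zeta> + 2 * B * (a ^ k / cc k)"
        proof (cases "q \<zeta> z > a")
          case True
          have "\<bar>\<psi> \<zeta> - \<psi> z\<bar> * K k z \<zeta> \<le> e * K k z \<zeta>"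
            using a(2)[OF \<zeta> z True] K0 by (intro mult_right_mono) (auto simp: abs_minus_commute)
          moreover have "0 \<le> 2 * B * (a ^ k / cc k)" using pa B0 by (intro mult_nonneg_nonneg) auto
          moreover have "\<bar>(\<psi> \<zeta> - \<psi> z) * K k z \<zeta>\<bar> = \<bar>\<psi> \<zeta> - \<psi> z\<bar> * K k z \<zeta>" by (simp add: abs_mult K0)
          ultimately show ?thesis by linarith
        next
          case False
          then have "K k z \<zeta> \<le> a ^ k / cc k"
            unfolding K_def using less_imp_le[OF cc_pos[of k]] q_nonneg by (intro divide_right_mono power_mono) auto
          moreover have "\<bar>\<psi> \<zeta> - \<psi> z\<bar> \<le> 2 * B" using B[OF \<zeta>] B[OF z] by linarith
          ultimately have "\<bar>\<psi> \<zeta> - \<psi> z\<bar> * K k z \<zeta> \<le> 2 * B * (a ^ k / cc k)"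
            using K0 B0 by (intro mult_mono) auto
          moreover have "0 \<le> e * K k z \<zeta>" using e K0 by simp
          ultimately show ?thesis using K0[of k z \<zeta>] by (simp add: abs_mult)
        qed
      qed
    qed
    also have "\<dots> = e + 2 * B * (a ^ k / cc k)" using Ki2[of k z] KI2[OF z, of k] by (simp add: prob_space)
    finally show ?thesis .
  qed
  have Lm: "integrable M (L k)" for k
  proof -
    have "(\<lambda>(z, \<zeta>). \<psi> \<zeta> * K k z \<zeta>) \<in> borel_measurable (M \<Otimes>\<^sub>M M)"
      unfolding case_prod_beta' by (intro borel_measurable_times Km measurable_compose[OF measurable_snd \<psi>m])
    then have "L k \<in> borel_measurable M" unfolding L_def[abs_def] by (rule borel_measurable_lebesgue_integral)
    moreover have "\<bar>L k z\<bar> \<le> B" if z: "z \<in> S" for z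
    proof -
      have "\<bar>L k z\<bar> \<le> (\<integral>\<zeta>. \<bar>\<psi> \<zeta> * K k z \<zeta>\<bar> \<partial>M)" unfolding L_def by (rule integral_abs_bound)
      also have "\<dots> \<le> (\<integral>\<zeta>. B * K k z \<zeta> \<partial>M)"
      proof (rule integral_mono_AE)
        show "integrable M (\<lambda>\<zeta>. \<bar>\<psi> \<zeta> * K k z \<zeta>\<bar>)" by (rule integrable_abs[OF \<psi>K])
        show "integrable M (\<lambda>\<zeta>. B * K k z \<zeta>)" using Ki2 by simp
        show "AE \<zeta> in M. \<bar>\<psi> \<zeta> * K k z \<zeta>\<bar> \<le> B * K k z \<zeta>"
          by (rule AE_I2) (use B K0 in \<open>auto simp: space_M abs_mult intro!: mult_right_mono\<close>)
      qed
      also have "\<dots> = B" using KI2[OF z, of k] by simp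
      finally show ?thesis .
    qed
    ultimately show ?thesis by (intro integrable_const_bound[of _ B] AE_I2) (auto simp: space_M)
  qed
  have \<psi>i: "integrable M \<psi>" by (intro integrable_M_continuous continuous_on_subset[OF \<psi>]) simp
  have "cmod (\<integral>z. \<phi> z * of_real (\<psi> z) \<partial>M) \<le> 0"
  proof (rule field_le_epsilon)
    fix e' :: real assume e': "e' > 0"
    define e where "e = e' / (C + 1)"
    have e: "e > 0" using e' C0 by (simp add: e_def add_nonneg_pos)
    obtain a where a: "0 \<le> a" "a < 1" "\<And>\<zeta> z. \<zeta> \<in> S \<Longrightarrow> z \<in> S \<Longrightarrow> q \<zeta> z > a \<Longrightarrow> \<bar>\<psi> z - \<psi> \<zeta>\<bar> < e"
      using q_close[OF \<psi> e] by metis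
    have "cmod (\<integral>z. \<phi> z * of_real (\<psi> z) \<partial>M) \<le> cmod (\<integral>\<zeta>. of_real (\<psi> \<zeta>) * J k \<zeta> \<partial>M) + C * (e + 2 * B * (a ^ k / cc k))" for k
    proof -
      have "(\<integral>z. \<phi> z * of_real (\<psi> z) \<partial>M) = (\<integral>z. \<phi> z * of_real (L k z) \<partial>M) - (\<integral>z. \<phi> z * of_real (L k z - \<psi> z) \<partial>M)"
        using int\<phi>[OF Lm[of k]] int\<phi>[OF \<psi>i] by (simp add: right_diff_distrib)
      then have "cmod (\<integral>z. \<phi> z * of_real (\<psi> z) \<partial>M) \<le> cmod (\<integral>z. \<phi> z * of_real (L k z) \<partial>M) + cmod (\<integral>z. \<phi> z * of_real (L k z - \<psi> z) \<partial>M)"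
        by (simp add: norm_triangle_ineq4)
      also have "cmod (\<integral>z. \<phi> z * of_real (L k z - \<psi> z) \<partial>M) \<le> C * (\<integral>z. \<bar>L k z - \<psi> z\<bar> \<partial>M)"
        by (rule bound\<phi>) (intro Bochner_Integration.integrable_diff Lm \<psi>i)
      also have "(\<integral>z. \<bar>L k z - \<psi> z\<bar> \<partial>M) \<le> (\<integral>z. e + 2 * B * (a ^ k / cc k) \<partial>M)"
        using Lm[of k] \<psi>i L_close[OF a(1,3) e, of _ k]
        by (intro integral_mono_AE AE_I2) (auto simp: space_M)
      also have "\<dots> = e + 2 * B * (a ^ k / cc k)" by (simp add: prob_space)
      finally show ?thesis using C0 by (simp add: fub mult_left_mono)
    qed
    moreover have "(\<lambda>k. cmod (\<integral>\<zeta>. of_real (\<psi> \<zeta>) * J k \<zeta> \<partial>M) + C * (e + 2 * B * (a ^ k / cc k))) \<longlonglongrightarrow> cmod (\<integral>\<zeta>. 0 \<partial>M) + C * (e + 2 * B * 0)"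
      by (intro tendsto_intros lim0 power_div_cc_tendsto_0 a)
    ultimately have "cmod (\<integral>z. \<phi> z * of_real (\<psi> z) \<partial>M) \<le> cmod (\<integral>\<zeta>. 0 \<partial>M) + C * (e + 2 * B * 0)"
      by (intro LIMSEQ_le_const) auto
    also have "\<dots> = C * e" by simp
    also have "\<dots> \<le> (C + 1) * e" using e by simp
    also have "\<dots> = e'" using C0 by (simp add: e_def)
    finally show "cmod (\<integral>z. \<phi> z * of_real (\<psi> z) \<partial>M) \<le> 0 + e'" by simp
  qed
  then show ?thesis by simp
qed

text \<open>\<phi> is bounded only almost everywhere. It is replaced by a truncation bounded at
  every point, which equals it almost everywhere and so has the same projections and the same
  compactness property. Orthogonality to real continuous functions then treats real and imaginary
  parts separately.\<close>

theorem toeplitz_compact_zero: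
  assumes \<phi>: "linf M \<phi>" and comp: "toeplitz_compact M \<phi>"
  shows "AE z in M. \<phi> z = 0"
proof -
  obtain C where C: "AE z in M. cmod (\<phi> z) \<le> C" and \<phi>m: "\<phi> \<in> borel_measurable M"
    using \<phi> by (auto simp: linf_def)
  define \<theta> where "\<theta> z = (if cmod (\<phi> z) \<le> C then \<phi> z else 0)" for z
  have \<theta>m: "\<theta> \<in> borel_measurable M" unfolding \<theta>_def[abs_def] using \<phi>m by measurable
  have eq: "AE z in M. \<theta> z = \<phi> z" using C by eventually_elim (simp add: \<theta>_def)
  have bd: "cmod (\<theta> z) \<le> \<bar>C\<bar>" for z using abs_ge_self[of C] by (auto simp: \<theta>_def simp del: abs_ge_self)
  have comp': "toeplitz_compact M \<theta>"
  proof -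
    have "szego_proj M (\<lambda>z. \<theta> z * h z) g \<longleftrightarrow> szego_proj M (\<lambda>z. \<phi> z * h z) g" if h: "h \<in> hardy M" for h g
    proof -
      have "(\<integral>z. (\<theta> z * h z - g z) * cnj (p z) \<partial>M) = (\<integral>z. (\<phi> z * h z - g z) * cnj (p z) \<partial>M)"
        if g: "g \<in> hardy M" and p: "p \<in> hardy M" for p
      proof (rule integral_cong_AE)
        have "h \<in> borel_measurable M" "g \<in> borel_measurable M" "p \<in> borel_measurable M"
          using h g p by (auto simp: hardy_def sq_int_def)
        then show "(\<lambda>z. (\<theta> z * h z - g z) * cnj (p z)) \<in> borel_measurable M"
          "(\<lambda>z. (\<phi> z * h z - g z) * cnj (p z)) \<in> borel_measurable M"
          using \<theta>m \<phi>m
          by (auto intro!: borel_measurable_times borel_measurable_diff measurable_compose[of p M borel cnj borel]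
              borel_measurable_continuous_onI continuous_intros)
        show "AE z in M. (\<theta> z * h z - g z) * cnj (p z) = (\<phi> z * h z - g z) * cnj (p z)"
          using eq by eventually_elim simp
      qed
      then show ?thesis unfolding szego_proj_def by auto
    qed
    note eqv = this
    show ?thesis
      unfolding toeplitz_compact_def
    proof (intro allI impI)
      fix h g :: "nat \<Rightarrow> complex^'d \<Rightarrow> complex"
      assume "\<forall>n. h n \<in> hardy M \<and> (\<integral>z. (cmod (h n z))\<^sup>2 \<partial>M) \<le> 1 \<and> szego_proj M (\<lambda>z. \<theta> z * h n z) (g n)"
      then have "\<forall>n. h n \<in> hardy M \<and> (\<integral>z. (cmod (h n z))\<^sup>2 \<partial>M) \<le> 1 \<and> szego_proj M (\<lambda>z. \<phi> z * h n z) (g n)"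
        using eqv by blast
      then show "\<exists>\<sigma>. strict_mono \<sigma> \<and>
           (\<forall>\<epsilon>>0. \<exists>N::nat. \<forall>m\<ge>N. \<forall>k\<ge>N. (\<integral>z. (cmod (g (\<sigma> m) z - g (\<sigma> k) z))\<^sup>2 \<partial>M) < \<epsilon>)"
        using comp unfolding toeplitz_compact_def by blast
    qed
  qed
  have orth: "(\<integral>z. \<theta> z * of_real (\<psi> z) \<partial>M) = 0" if "continuous_on UNIV \<psi>" for \<psi>
    by (rule toeplitz_orthogonal[OF \<theta>m bd comp' that])
  have int: "integrable M (\<lambda>z. \<theta> z * of_real (\<psi> z))" if \<psi>: "continuous_on UNIV \<psi>" for \<psi> :: "complex^'d \<Rightarrow> real"
  proof (rule Bochner_Integration.integrable_bound)
    have \<psi>i: "integrable M \<psi>" by (intro integrable_M_continuous continuous_on_subset[OF \<psi>]) simp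
    then show "integrable M (\<lambda>z. \<bar>C\<bar> * \<psi> z)" by simp
    show "(\<lambda>z. \<theta> z * of_real (\<psi> z)) \<in> borel_measurable M"
      by (intro borel_measurable_times measurable_complex_of_real \<theta>m borel_measurable_integrable[OF \<psi>i])
    show "AE z in M. norm (\<theta> z * of_real (\<psi> z)) \<le> norm (\<bar>C\<bar> * \<psi> z)"
      by (rule AE_I2) (use bd in \<open>auto simp: norm_mult abs_mult intro!: mult_right_mono\<close>)
  qed
  have re: "AE z in M. Re (\<theta> z) = 0"
  proof (rule AE_zero_of_continuous)
    show "(\<lambda>z. Re (\<theta> z)) \<in> borel_measurable M" using \<theta>m by simp
    show "\<bar>Re (\<theta> z)\<bar> \<le> \<bar>C\<bar>" for z using abs_Re_le_cmod[of "\<theta> z"] bd[of z] by linarith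
    fix \<psi> :: "complex^'d \<Rightarrow> real" assume \<psi>: "continuous_on UNIV \<psi>"
    have "(\<integral>z. Re (\<theta> z * of_real (\<psi> z)) \<partial>M) = Re (\<integral>z. \<theta> z * of_real (\<psi> z) \<partial>M)"
      by (rule integral_Re[OF int[OF \<psi>]])
    then show "(\<integral>z. Re (\<theta> z) * \<psi> z \<partial>M) = 0" using orth[OF \<psi>] by simp
  qed
  have im: "AE z in M. Im (\<theta> z) = 0"
  proof (rule AE_zero_of_continuous)
    show "(\<lambda>z. Im (\<theta> z)) \<in> borel_measurable M" using \<theta>m by simp
    show "\<bar>Im (\<theta> z)\<bar> \<le> \<bar>C\<bar>" for z using abs_Im_le_cmod[of "\<theta> z"] bd[of z] by linarith
    fix \<psi> :: "complex^'d \<Rightarrow> real" assume \<psi>: "continuous_on UNIV \<psi>"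
    have "(\<integral>z. Im (\<theta> z * of_real (\<psi> z)) \<partial>M) = Im (\<integral>z. \<theta> z * of_real (\<psi> z) \<partial>M)"
      by (rule integral_Im[OF int[OF \<psi>]])
    then show "(\<integral>z. Im (\<theta> z) * \<psi> z \<partial>M) = 0" using orth[OF \<psi>] by simp
  qed
  from re im eq show ?thesis by eventually_elim (simp add: complex_eq_iff)
qed

end

theorem (in homogeneous_domain) toeplitz_zero:
  assumes "linf (shilov_measure \<Omega>) \<phi>" "toeplitz_compact (shilov_measure \<Omega>) \<phi>"
  shows "AE z in shilov_measure \<Omega>. \<phi> z = 0"
proof -
  interpret homogeneous_measure \<Omega> Cl ip Fam e0 "shilov_measure \<Omega>"
    by unfold_locales (rule shilov_measure_G_inv)
  show ?thesis by (rule toeplitz_compact_zero[OF assms])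
qed

section \<open>Type IV\<close>

definition bdot :: "complex^'d::finite \<Rightarrow> complex^'d \<Rightarrow> complex" where
  "bdot z w = (\<Sum>i\<in>UNIV. z $ i * w $ i)"

definition hdot :: "complex^'d::finite \<Rightarrow> complex^'d \<Rightarrow> complex" where
  "hdot z w = (\<Sum>i\<in>UNIV. z $ i * cnj (w $ i))"

definition vcnj :: "complex^'d::finite \<Rightarrow> complex^'d" where
  "vcnj z = (\<chi> i. cnj (z $ i))"

definition cvec :: "real^'d::finite \<Rightarrow> complex^'d" where
  "cvec x = (\<chi> i. complex_of_real (x $ i))"

definition nsq :: "complex^'d::finite \<Rightarrow> real" where
  "nsq z = (\<Sum>i\<in>UNIV. (cmod (z $ i))\<^sup>2)"

lemma bdot_add: "bdot (x + y) z = bdot x z + bdot y z" "bdot z (x + y) = bdot z x + bdot z y"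
  by (simp_all add: bdot_def algebra_simps sum.distrib)

lemma bdot_smult: "bdot (c *s x) z = c * bdot x z" "bdot z (c *s x) = c * bdot z x"
  by (simp_all add: bdot_def algebra_simps sum_distrib_left)

lemma bdot_commute: "bdot x y = bdot y x"
  by (simp add: bdot_def mult.commute)

lemma hdot_bdot: "hdot z w = bdot z (vcnj w)"
  by (simp add: hdot_def bdot_def vcnj_def)

lemma vcnj_simps: "vcnj (x + y) = vcnj x + vcnj y" "vcnj (x - y) = vcnj x - vcnj y" "vcnj (c *s x) = cnj c *s vcnj x" "vcnj (cvec u) = cvec u"
  by (simp_all add: vcnj_def vec_eq_iff cvec_def)

lemma bdot_cvec: "bdot (cvec u) (cvec v) = complex_of_real (u \<bullet> v)"
  by (simp add: bdot_def cvec_def inner_vec_def)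

lemma bdot_vcnj: "bdot (vcnj x) (vcnj y) = cnj (bdot x y)"
  by (simp add: bdot_def vcnj_def)

lemma hdot_self: "hdot z z = complex_of_real (nsq z)"
  by (simp add: hdot_def nsq_def complex_norm_square del: of_real_power)

lemma nsq_norm: "nsq z = (norm z)\<^sup>2"
  by (simp add: nsq_def norm_vec_def L2_set_def sum_nonneg)

lemma bdot_le_nsq: "cmod (bdot z z) \<le> nsq z"
proof -
  have "cmod (bdot z z) \<le> (\<Sum>i\<in>UNIV. cmod (z $ i * z $ i))" unfolding bdot_def by (rule norm_sum)
  then show ?thesis by (simp add: nsq_def norm_mult power2_eq_square)
qed

lemma nsq_smult: "nsq (c *s z) = (cmod c)\<^sup>2 * nsq z"
  by (simp add: nsq_norm norm_smult power_mult_distrib)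

text \<open>For orthonormal u, v and unimodular c: the rotation of the real plane of u and v through
  the argument of c, the identity on the complement, extended complex linearly. Being real, it
  preserves the bilinear and the Hermitian form alike.\<close>

definition rot :: "real^'d::finite \<Rightarrow> real^'d \<Rightarrow> complex \<Rightarrow> complex^'d \<Rightarrow> complex^'d" where
  "rot u v c z = z
     + ((of_real (Re c) - 1) * bdot z (cvec u) - of_real (Im c) * bdot z (cvec v)) *s cvec u
     + (of_real (Im c) * bdot z (cvec u) + (of_real (Re c) - 1) * bdot z (cvec v)) *s cvec v"

definition lie_ball :: "(complex^'d::finite) set" where
  "lie_ball = {z. nsq z < 1 \<and> 1 - 2 * nsq z + (cmod (bdot z z))\<^sup>2 > 0}"

definition lie_cball :: "(complex^'d::finite) set" where
  "lie_cball = {z. nsq z \<le> 1 \<and> 1 - 2 * nsq z + (cmod (bdot z z))\<^sup>2 \<ge> 0}"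

definition rots :: "(complex \<Rightarrow> complex^'d::finite \<Rightarrow> complex^'d) set" where
  "rots = {rot u v | u v. u \<bullet> u = 1 \<and> v \<bullet> v = 1 \<and> u \<bullet> v = 0}"

lemma continuous_on_bdot [continuous_intros]:
  "continuous_on T f \<Longrightarrow> continuous_on T g \<Longrightarrow> continuous_on T (\<lambda>x. bdot (f x) (g x))"
  unfolding bdot_def by (intro continuous_intros)

lemma continuous_on_nsq [continuous_intros]:
  "continuous_on T f \<Longrightarrow> continuous_on T (\<lambda>x. nsq (f x))"
  unfolding nsq_def by (intro continuous_intros)

text \<open>With t = |c|^2, the second defining expression at c z exceeds the one at z by (1 - t) (2
  s - Q^2 (1 + t)), which is positive for s > 0 since Q^2 \<le> s.\<close>

lemma lie_scale:
  assumes z: "z \<in> lie_cball" and c: "cmod c < 1"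
  shows "c *s z \<in> lie_ball"
proof -
  define s Q t where "s = nsq z" and "Q = cmod (bdot z z)" and "t = (cmod c)\<^sup>2"
  have s: "0 \<le> s" "s \<le> 1" "0 \<le> 1 - 2 * s + Q\<^sup>2" using z by (auto simp: lie_cball_def s_def Q_def nsq_norm)
  have Q: "0 \<le> Q" "Q \<le> s" using bdot_le_nsq[of z] by (auto simp: Q_def s_def)
  have t: "0 \<le> t" "t < 1" using c by (auto simp: t_def power_less_one_iff abs_square_less_1)
  have "t * s < 1" using s t mult_left_le[of s t] by linarith
  moreover have "1 - 2 * (t * s) + (t * Q)\<^sup>2 > 0"
  proof (cases "s = 0")
    case True
    then show ?thesis by (simp add: add_pos_nonneg)
  next
    case False
    have "Q\<^sup>2 \<le> s"
    proof -
      have "Q\<^sup>2 \<le> s * s" unfolding power2_eq_square using Q by (intro mult_mono) auto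
      also have "\<dots> \<le> s" using s by (simp add: mult_left_le)
      finally show ?thesis .
    qed
    then have "Q\<^sup>2 * (1 + t) \<le> s * (1 + t)" using t by (intro mult_right_mono) auto
    then have "2 * s - Q\<^sup>2 * (1 + t) \<ge> s * (1 - t)" by (simp add: algebra_simps)
    moreover have "s * (1 - t) > 0" using False s t by simp
    ultimately have "(1 - t) * (2 * s - Q\<^sup>2 * (1 + t)) > 0" using t by simp
    moreover have "1 - 2 * (t * s) + (t * Q)\<^sup>2 = (1 - 2 * s + Q\<^sup>2) + (1 - t) * (2 * s - Q\<^sup>2 * (1 + t))"
      by (simp add: algebra_simps power2_eq_square)
    ultimately show ?thesis using s(3) by linarith
  qed
  moreover have "cmod (bdot (c *s z) (c *s z)) = t * Q"
    by (simp add: bdot_smult norm_mult t_def Q_def power2_eq_square)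
  ultimately show ?thesis by (simp add: lie_ball_def nsq_smult s_def[symmetric] t_def[symmetric])
qed

text \<open>Only the bilinear form is computed; the Hermitian one follows because a real map
  commutes with conjugation.\<close>

lemma rot_props:
  assumes uv: "u \<bullet> u = 1" "v \<bullet> v = 1" "u \<bullet> v = 0" and c: "cmod c = 1"
  shows "clinear (rot u v c)" "bdot (rot u v c z) (rot u v c w) = bdot z w"
    "hdot (rot u v c z) (rot u v c w) = hdot z w" "rot u v c (rot u v (cnj c) z) = z" "rot u v 1 z = z"
proof -
  define C S where "C = complex_of_real (Re c)" and "S = complex_of_real (Im c)"
  have "(Re c)\<^sup>2 + (Im c)\<^sup>2 = 1" using c cmod_power2[of c] by simp
  then have CS: "C * C + S * S = 1"
    unfolding C_def S_def by (simp add: power2_eq_square flip: of_real_mult of_real_add)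
  have b: "bdot (cvec u) (cvec u) = 1" "bdot (cvec v) (cvec v) = 1" "bdot (cvec u) (cvec v) = 0" "bdot (cvec v) (cvec u) = 0"
    using uv by (simp_all add: bdot_cvec inner_commute)
  note d = rot_def C_def[symmetric] S_def[symmetric]
  show "clinear (rot u v c)"
    unfolding clinear_def d by (simp add: bdot_add bdot_smult vec_eq_iff algebra_simps)
  show bd: "bdot (rot u v c z) (rot u v c w) = bdot z w" for z w
  proof -
    define p q p' q' where "p = bdot z (cvec u)" and "q = bdot z (cvec v)" and "p' = bdot w (cvec u)" and "q' = bdot w (cvec v)"
    have "bdot (rot u v c z) (rot u v c w) = bdot z w
       + p * ((C - 1) * p' - S * q') + q * (S * p' + (C - 1) * q')
       + ((C - 1) * p - S * q) * p' + (S * p + (C - 1) * q) * q'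
       + ((C - 1) * p - S * q) * ((C - 1) * p' - S * q') + (S * p + (C - 1) * q) * (S * p' + (C - 1) * q')"
      unfolding d p_def q_def p'_def q'_def
      by (simp only: bdot_add bdot_smult b bdot_commute[of "cvec u" w] bdot_commute[of "cvec v" w])
         (simp add: algebra_simps)
    also have "\<dots> = bdot z w + (C * C + S * S - 1) * (p * p' + q * q')" by (simp add: algebra_simps)
    finally show ?thesis using CS by simp
  qed
  have "vcnj (rot u v c w) = rot u v c (vcnj w)" for w
  proof -
    have "bdot (vcnj w) (cvec x) = cnj (bdot w (cvec x))" for x
      using bdot_vcnj[of w "cvec x"] by (simp add: vcnj_simps)
    then show ?thesis by (simp add: rot_def vcnj_simps)
  qed
  then show "hdot (rot u v c z) (rot u v c w) = hdot z w" by (simp add: hdot_bdot bd)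
  show "rot u v c (rot u v (cnj c) z) = z"
  proof -
    define p q where "p = bdot z (cvec u)" and "q = bdot z (cvec v)"
    define y where "y = rot u v (cnj c) z"
    have y: "y = z + ((C - 1) * p + S * q) *s cvec u + (- S * p + (C - 1) * q) *s cvec v"
      unfolding y_def rot_def p_def q_def C_def S_def by simp
    have yu: "bdot y (cvec u) = C * p + S * q"
      unfolding y by (simp only: bdot_add bdot_smult b p_def[symmetric] q_def[symmetric]) (simp add: algebra_simps)
    have yv: "bdot y (cvec v) = - S * p + C * q"
      unfolding y by (simp only: bdot_add bdot_smult b p_def[symmetric] q_def[symmetric]) (simp add: algebra_simps)
    have "rot u v c y = y + ((C - 1) * (C * p + S * q) - S * (- S * p + C * q)) *s cvec u
        + (S * (C * p + S * q) + (C - 1) * (- S * p + C * q)) *s cvec v"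
      unfolding d yu yv by simp
    also have "(C - 1) * (C * p + S * q) - S * (- S * p + C * q) = (C * C + S * S) * p - C * p - S * q"
      by (simp add: algebra_simps)
    also have "\<dots> = - ((C - 1) * p + S * q)" unfolding CS by (simp add: algebra_simps)
    also have "S * (C * p + S * q) + (C - 1) * (- S * p + C * q) = (C * C + S * S) * q + S * p - C * q"
      by (simp add: algebra_simps)
    also have "\<dots> = - (- S * p + (C - 1) * q)" unfolding CS by (simp add: algebra_simps)
    finally show ?thesis unfolding y_def[symmetric] y by (simp add: vec_eq_iff)
  qed
  show "rot u v 1 z = z" by (simp add: rot_def)
qed

lemma hdot_vcnj_nsq: "hdot (rot u v c z) (rot u v c z) = hdot z z \<Longrightarrow> nsq (rot u v c z) = nsq z"
  unfolding hdot_self by simp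

text \<open>The base point is a real unit vector along an arbitrarily chosen coordinate.\<close>

lemma circular_lie:
  "circular_domain (lie_ball :: (complex^'d::finite) set) lie_cball hdot rots (axis undefined 1)"
proof
  show "open (lie_ball :: (complex^'d) set)"
    unfolding lie_ball_def by (intro open_Collect_conj open_Collect_less continuous_intros)
  show "closed (lie_cball :: (complex^'d) set)"
    unfolding lie_cball_def by (intro closed_Collect_conj closed_Collect_le continuous_intros)
  show "bounded (lie_cball :: (complex^'d) set)"
    unfolding bounded_iff lie_cball_def by (auto simp: nsq_norm power_le_one_iff abs_square_le_1 intro!: exI[of _ 1])
  show "lie_ball \<subseteq> (lie_cball :: (complex^'d) set)" by (auto simp: lie_ball_def lie_cball_def)
  show "c *s z \<in> lie_ball" if "z \<in> lie_cball" "cmod c < 1" for z :: "complex^'d" and c by (rule lie_scale[OF that])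
  show "axis undefined 1 \<in> (lie_cball :: (complex^'d) set)"
  proof -
    have "nsq (axis undefined 1 :: complex^'d) = 1" 
      by (simp add: nsq_def axis_def if_distrib[of cmod] if_distrib[of "\<lambda>x. x\<^sup>2"] cong: if_cong)
    moreover have "bdot (axis undefined 1) (axis undefined 1 :: complex^'d) = 1"
      by (simp add: bdot_def axis_def if_distrib cong: if_cong)
    ultimately show ?thesis by (simp add: lie_cball_def)
  qed
  fix x y z :: "complex^'d" and c :: complex
  show "hdot (x + y) z = hdot x z + hdot y z" by (simp add: hdot_bdot bdot_add)
  show "hdot (c *s x) z = c * hdot x z" by (simp add: hdot_bdot bdot_smult)
  show "hdot y x = cnj (hdot x y)" by (simp add: hdot_def mult.commute)
  show "Re (hdot z z) > 0" if "z \<noteq> 0" using that by (simp add: hdot_self nsq_norm)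
next
  fix \<Psi> :: "complex \<Rightarrow> complex^'d \<Rightarrow> complex^'d" and c :: complex and x y z
  assume "\<Psi> \<in> rots"
  then obtain u v where \<Psi>: "\<Psi> = rot u v" and uv: "u \<bullet> u = 1" "v \<bullet> v = 1" "u \<bullet> v = 0" by (auto simp: rots_def)
  show "continuous_on (sphere 0 1 \<times> UNIV) (\<lambda>(c, z). \<Psi> c z)"
    unfolding \<Psi> rot_def case_prod_beta' by (intro continuous_intros)
  show "\<Psi> 1 z = z" by (simp add: \<Psi> rot_def)
  assume c: "cmod c = 1"
  note p = rot_props[OF uv c]
  show "clinear (\<Psi> c)" "\<Psi> c (\<Psi> (cnj c) z) = z" "hdot (\<Psi> c x) (\<Psi> c y) = hdot x y"
    unfolding \<Psi> by (rule p)+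
  show "\<Psi> c z \<in> lie_ball" if "z \<in> lie_ball"
    using that unfolding lie_ball_def \<Psi> by (simp add: p(2) hdot_vcnj_nsq[OF p(3)])
qed

lemma unit_orthogonal_exists:
  fixes x :: "real^'d::finite"
  assumes "CARD('d) \<ge> 2"
  obtains v where "v \<bullet> v = 1" "x \<bullet> v = 0"
proof -
  obtain y where y: "y \<noteq> 0" "orthogonal x y"
    using orthogonal_to_vector_exists[of x] assms by auto
  show thesis
  proof (rule that[of "y /\<^sub>R norm y"])
    show "(y /\<^sub>R norm y) \<bullet> (y /\<^sub>R norm y) = 1" using y(1) by (simp add: dot_square_norm power2_eq_square)
    show "x \<bullet> (y /\<^sub>R norm y) = 0" using y(2) by (simp add: orthogonal_def)
  qed
qed

lemma nsq_bdot_plane: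
  assumes uv: "u \<bullet> u = 1" "v \<bullet> v = 1" "u \<bullet> v = 0"
  shows "nsq (a *s cvec u + b *s cvec v) = (cmod a)\<^sup>2 + (cmod b)\<^sup>2"
    "bdot (a *s cvec u + b *s cvec v) (a *s cvec u + b *s cvec v) = a\<^sup>2 + b\<^sup>2"
proof -
  have b: "bdot (cvec u) (cvec u) = 1" "bdot (cvec v) (cvec v) = 1" "bdot (cvec u) (cvec v) = 0" "bdot (cvec v) (cvec u) = 0"
    using uv by (simp_all add: bdot_cvec inner_commute)
  show "bdot (a *s cvec u + b *s cvec v) (a *s cvec u + b *s cvec v) = a\<^sup>2 + b\<^sup>2"
    by (simp add: bdot_add bdot_smult b power2_eq_square)
  have "complex_of_real (nsq (a *s cvec u + b *s cvec v)) = a * cnj a + b * cnj b"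
    unfolding hdot_self[symmetric] hdot_bdot by (simp add: vcnj_simps bdot_add bdot_smult b mult.commute)
  also have "\<dots> = complex_of_real ((cmod a)\<^sup>2 + (cmod b)\<^sup>2)" by (simp only: of_real_add complex_norm_square)
  finally show "nsq (a *s cvec u + b *s cvec v) = (cmod a)\<^sup>2 + (cmod b)\<^sup>2" by (simp only: of_real_eq_iff)
qed

text \<open>In the null coordinates A, B of a complexified plane the bilinear square is A B and 2
  |z|^2 = |A|^2 + |B|^2, so the section of the ball is a bidisc: the product condition puts both
  moduli on the same side of 1, and the sum condition selects the inside.\<close>

lemma plane_lie_cball_iff:
  assumes uv: "u \<bullet> u = 1" "v \<bullet> v = 1" "u \<bullet> v = 0"
  shows "((A + B) / 2) *s cvec u + (\<i> * (A - B) / 2) *s cvec v \<in> lie_cball \<longleftrightarrow>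
     (cmod A)\<^sup>2 + (cmod B)\<^sup>2 \<le> 2 \<and> 0 \<le> (1 - (cmod A)\<^sup>2) * (1 - (cmod B)\<^sup>2)"
proof -
  have n: "(cmod ((A + B) / 2))\<^sup>2 + (cmod (\<i> * (A - B) / 2))\<^sup>2 = ((cmod A)\<^sup>2 + (cmod B)\<^sup>2) / 2"
  proof -
    have "(cmod (A + B))\<^sup>2 + (cmod (A - B))\<^sup>2 = 2 * ((cmod A)\<^sup>2 + (cmod B)\<^sup>2)"
      by (simp only: cmod_power2) (simp add: power2_eq_square algebra_simps)
    then show ?thesis by (simp add: norm_divide norm_mult power_divide)
  qed
  have "((A + B) / 2)\<^sup>2 + (\<i> * (A - B) / 2)\<^sup>2 = A * B"
    by (simp add: power2_eq_square field_simps)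
  then show ?thesis
    unfolding lie_cball_def mem_Collect_eq nsq_bdot_plane[OF uv] n
    by (auto simp: norm_mult power_mult_distrib algebra_simps)
qed


text \<open>A phase makes the bilinear square non-negative, hence real and imaginary part
  orthogonal, and z lies in a bidisc with coordinates a + b and a - b. Extremality forces both to be
  1, so z is a real unit vector, which a plane rotation takes to the base point.\<close>

lemma homogeneous_lie:
  assumes card: "CARD('d::finite) \<ge> 2"
  shows "homogeneous_domain (lie_ball :: (complex^'d) set) lie_cball hdot rots (axis undefined 1)"
proof -
  interpret circular_domain "lie_ball :: (complex^'d) set" lie_cball hdot rots "axis undefined 1"
    by (rule circular_lie)
  show ?thesis
  proof unfold_locales
    fix z0 :: "complex^'d" assume z0: "cext z0"
    define \<tau> where "\<tau> = bdot z0 z0"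
    obtain c where c: "cmod c = 1" "c\<^sup>2 * \<tau> = of_real (cmod \<tau>)"
    proof (cases "\<tau> = 0")
      case True
      then show ?thesis by (intro that[of 1]) auto
    next
      case False
      \<comment> \<open>The bilinear square is quadratic in z, so half of the phase of \<tau> has to
        be removed.\<close>
      define d where "d = csqrt (cnj (sgn \<tau>))"
      have d2: "d\<^sup>2 = cnj (sgn \<tau>)" by (simp add: d_def)
      have "(cmod d)\<^sup>2 = 1" using False by (simp add: norm_power[symmetric] d2 norm_sgn)
      then have "cmod d = 1" using norm_ge_zero[of d] power2_eq_1_iff[of "cmod d"] by linarith
      moreover have "d\<^sup>2 * \<tau> = of_real (cmod \<tau>)"
        unfolding d2 using False by (simp add: sgn_eq mult.commute[of "cnj _"] complex_norm_square[symmetric] power2_eq_square)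
      ultimately show ?thesis by (rule that)
    qed
    have gc: "(\<lambda>z. c *s z) \<in> G" by (rule G_gen) (use c in \<open>auto simp: gens_def\<close>)
    define z where "z = c *s z0"
    have z: "cext z" using cext_G[OF z0 gc] by (simp add: z_def)
    have bz: "bdot z z = of_real (cmod \<tau>)"
      using c(2) by (simp add: z_def bdot_smult \<tau>_def power2_eq_square mult.assoc)
    define x y :: "real^'d" where "x = (\<chi> i. Re (z $ i))" and "y = (\<chi> i. Im (z $ i))"
    have zxy: "z = cvec x + \<i> *s cvec y"
      by (simp add: vec_eq_iff cvec_def x_def y_def complex_eq_iff)
    have "bdot z z = of_real (x \<bullet> x - y \<bullet> y) + 2 * \<i> * of_real (x \<bullet> y)"
      unfolding zxy by (simp add: bdot_add bdot_smult bdot_cvec inner_commute[of y x] algebra_simps)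
    then have xy0: "x \<bullet> y = 0" and xy: "x \<bullet> x - y \<bullet> y = cmod \<tau>"
      unfolding bz by (auto simp: complex_eq_iff)
    have ab: "norm y \<le> norm x"
    proof -
      have "y \<bullet> y \<le> x \<bullet> x" using xy norm_ge_zero[of \<tau>] by linarith
      then show ?thesis by (simp add: norm_eq_sqrt_inner)
    qed
    obtain u v where uv: "u \<bullet> u = 1" "v \<bullet> v = 1" "u \<bullet> v = 0" and x: "x = norm x *\<^sub>R u" and y: "y = norm y *\<^sub>R v"
    proof -
      have unit: "(w /\<^sub>R norm w) \<bullet> (w /\<^sub>R norm w) = 1" if "w \<noteq> 0" for w :: "real^'d"
        using that by (simp add: dot_square_norm power2_eq_square)
      consider "x = 0" | "x \<noteq> 0" "y = 0" | "x \<noteq> 0" "y \<noteq> 0" by blast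
      then show ?thesis
      proof cases
        case 1
        then have "y = 0" using ab by simp
        obtain w :: "real^'d" where w: "w \<bullet> w = 1" using unit_orthogonal_exists[OF card, of 0] by blast
        obtain v where v: "v \<bullet> v = 1" "w \<bullet> v = 0" using unit_orthogonal_exists[OF card, of w] by blast
        show ?thesis using that[OF w v] 1 \<open>y = 0\<close> by simp
      next
        case 2
        obtain v where v: "v \<bullet> v = 1" "(x /\<^sub>R norm x) \<bullet> v = 0" using unit_orthogonal_exists[OF card] by blast
        show ?thesis using that[OF unit[OF 2(1)] v] 2 by simp
      next
        case 3
        show ?thesis using that[OF unit[OF 3(1)] unit[OF 3(2)]] 3 xy0 by simp
      qed
    qed
    define a b where "a = norm x" and "b = norm y"
    have "cvec x = of_real a *s cvec u" "cvec y = of_real b *s cvec v"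
      unfolding a_def b_def by (subst x, simp add: vec_eq_iff cvec_def) (subst y, simp add: vec_eq_iff cvec_def)
    then have zplane: "z = ((of_real (a + b) + of_real (a - b)) / 2) *s cvec u + (\<i> * (of_real (a + b) - of_real (a - b)) / 2) *s cvec v"
      unfolding zxy by (simp add: vec_eq_iff)
    have zCl: "z \<in> lie_cball" using z by (simp add: cext_def)
    have cond: "(a + b)\<^sup>2 + (a - b)\<^sup>2 \<le> 2" "0 \<le> (1 - (a + b)\<^sup>2) * (1 - (a - b)\<^sup>2)"
      using zCl[unfolded zplane plane_lie_cball_iff[OF uv]] by (simp_all del: of_real_add of_real_diff)
    have ab0: "0 \<le> a" "0 \<le> b" "b \<le> a" using ab by (simp_all add: a_def b_def)
    have le1: "a + b \<le> 1"
    proof (rule ccontr)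
      assume "\<not> a + b \<le> 1"
      then have "(a + b)\<^sup>2 > 1" using ab0 by (simp add: power_strict_increasing one_less_power)
      then have "(a - b)\<^sup>2 \<ge> 1" using cond(2) by (smt (verit) mult_neg_pos)
      then show False using cond(1) \<open>(a + b)\<^sup>2 > 1\<close> by linarith
    qed
    have ge1: "a - b \<ge> 1"
    proof (rule ccontr)
      assume "\<not> a - b \<ge> 1"
      \<comment> \<open>w moves only the coordinate B, by 2 \<kappa> \<rho>, and 2 \<kappa> is
        exactly the distance of a - b from 1.\<close>
      define \<kappa> where "\<kappa> = (1 - (a - b)) / 2"
      have \<kappa>: "\<kappa> > 0" using \<open>\<not> a - b \<ge> 1\<close> by (simp add: \<kappa>_def)
      define w where "w = of_real \<kappa> *s (cvec u - \<i> *s cvec v)"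
      have "z + \<rho> *s w \<in> lie_cball" if \<rho>: "cmod \<rho> \<le> 1" for \<rho>
      proof -
        define A B where "A = complex_of_real (a + b)" and "B = of_real (a - b) + 2 * of_real \<kappa> * \<rho>"
        have "z + \<rho> *s w = ((A + B) / 2) *s cvec u + (\<i> * (A - B) / 2) *s cvec v"
          unfolding zplane w_def A_def B_def by (simp add: vec_eq_iff field_simps)
        moreover have "cmod A \<le> 1" using le1 ab0 by (simp add: A_def del: of_real_add)
        moreover have "cmod B \<le> 1"
        proof -
          have "cmod B \<le> cmod (complex_of_real (a - b)) + cmod (2 * of_real \<kappa> * \<rho>)"
            unfolding B_def by (rule norm_triangle_ineq)
          also have "\<dots> = (a - b) + 2 * \<kappa> * cmod \<rho>" using ab0 \<kappa> by (simp add: norm_mult del: of_real_diff)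
          also have "\<dots> \<le> (a - b) + 2 * \<kappa> * 1" using \<rho> \<kappa> by (intro add_left_mono mult_left_mono) auto
          also have "\<dots> = 1" unfolding \<kappa>_def by (simp add: field_simps)
          finally show ?thesis .
        qed
        ultimately show ?thesis
          by (simp add: plane_lie_cball_iff[OF uv] power_le_one mult_nonneg_nonneg) (smt (verit) power_le_one norm_ge_zero)
      qed
      then have "w = 0" using z by (simp add: cext_def)
      then have "cvec u - \<i> *s cvec v = 0" using \<kappa> by (simp add: w_def vec_eq_iff)
      then have "u $ i = 0" for i by (simp add: vec_eq_iff cvec_def complex_eq_iff)
      then show False using uv(1) by (simp add: inner_vec_def)
    qed
    have "a = 1" "b = 0" using le1 ge1 ab0 by linarith+
    then have zu: "z = cvec u" unfolding zplane by simp
    define f :: "real^'d" where "f = axis undefined 1"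
    have ff: "f \<bullet> f = 1" by (simp add: f_def inner_axis_axis)
    \<comment> \<open>Gram-Schmidt puts the target f into the plane of u and some unit vector v'; if
      f is a multiple of u, any orthogonal v' does, with S = 0.\<close>
    define k where "k = f - (u \<bullet> f) *\<^sub>R u"
    obtain C S v' where v': "v' \<bullet> v' = 1" "u \<bullet> v' = 0" "f = C *\<^sub>R u + S *\<^sub>R v'" 
    proof (cases "k = 0")
      case True
      obtain v' where "v' \<bullet> v' = 1" "u \<bullet> v' = 0" using unit_orthogonal_exists[OF card] by blast
      then show ?thesis using True that[of v' "u \<bullet> f" 0] by (simp add: k_def)
    next
      case False
      have "u \<bullet> k = 0" by (simp add: k_def inner_diff_right uv(1))
      then show ?thesis using False
        by (intro that[of "k /\<^sub>R norm k" "u \<bullet> f" "norm k"]) (simp_all add: dot_square_norm power2_eq_square, simp add: k_def)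
    qed
    have "C\<^sup>2 + S\<^sup>2 = 1"
      using ff unfolding v'(3) by (simp add: inner_add_left inner_add_right uv(1) v' inner_commute[of v' u] power2_eq_square)
    then have cm: "cmod (Complex C S) = 1" by (simp add: cmod_def)
    have "rot u v' \<in> rots" using uv(1) v' by (auto simp: rots_def)
    then have "rot u v' \<in> gens" unfolding gens_def by (rule insertI2)
    from G_gen[OF this cm] have g2: "rot u v' (Complex C S) \<in> G" .
    have "rot u v' (Complex C S) z = axis undefined 1"
    proof -
      have b: "bdot (cvec u) (cvec u) = 1" "bdot (cvec u) (cvec v') = 0" using uv(1) v' by (simp_all add: bdot_cvec)
      have "rot u v' (Complex C S) z = of_real C *s cvec u + of_real S *s cvec v'"
        unfolding zu rot_def b by (simp add: vec_eq_iff algebra_simps)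
      also have "\<dots> = cvec f" unfolding v'(3) by (simp add: vec_eq_iff cvec_def)
      also have "\<dots> = axis undefined 1" by (simp add: f_def cvec_def vec_eq_iff axis_def)
      finally show ?thesis .
    qed
    then show "\<exists>g\<in>G. g z0 = axis undefined 1"
      using G_compose[OF g2 gc] by (intro bexI[of _ "\<lambda>z. rot u v' (Complex C S) (c *s z)"]) (auto simp: z_def)
  qed
qed

lemma cartan_IV_toeplitz:
  fixes \<Omega> :: "(complex^'d::finite) set"
  assumes "cartan_IV \<Omega>" "linf (shilov_measure \<Omega>) \<phi>" "toeplitz_compact (shilov_measure \<Omega>) \<phi>"
  shows "AE z in shilov_measure \<Omega>. \<phi> z = 0"
proof -
  obtain n and e :: "nat \<Rightarrow> 'd" where n: "3 \<le> n" and e: "bij_betw e {..<n} UNIV"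
    and \<Omega>: "\<Omega> = {z. (\<Sum>i<n. (cmod (z $ e i))\<^sup>2) < 1 \<and>
               1 - 2 * (\<Sum>i<n. (cmod (z $ e i))\<^sup>2) + (cmod (\<Sum>i<n. (z $ e i)\<^sup>2))\<^sup>2 > 0}"
    using assms(1) unfolding cartan_IV_def by blast
  have "(\<Sum>i<n. (cmod (z $ e i))\<^sup>2) = nsq z" "(\<Sum>i<n. (z $ e i)\<^sup>2) = bdot z z" for z
    using sum.reindex_bij_betw[OF e, of "\<lambda>i. (cmod (z $ i))\<^sup>2"] sum.reindex_bij_betw[OF e, of "\<lambda>i. (z $ i)\<^sup>2"]
    by (simp_all add: nsq_def bdot_def power2_eq_square)
  then have eq: "\<Omega> = lie_ball" unfolding \<Omega> lie_ball_def by simp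
  have "CARD('d) \<ge> 2" using bij_betw_same_card[OF e] n by simp
  from homogeneous_domain.toeplitz_zero[OF homogeneous_lie[OF this]] assms(2,3) show ?thesis
    unfolding eq by blast
qed

section \<open>Matrix contractions and reflections\<close>

text \<open>Vectors and matrices are functions on all naturals, and only indices below the explicit
  sizes count. This lets the dimensions m and n vary as ordinary variables.\<close>

definition hp :: "nat \<Rightarrow> (nat \<Rightarrow> complex) \<Rightarrow> (nat \<Rightarrow> complex) \<Rightarrow> complex" where
  "hp k x y = (\<Sum>i<k. x i * cnj (y i))"

definition vsq :: "nat \<Rightarrow> (nat \<Rightarrow> complex) \<Rightarrow> real" where
  "vsq k v = (\<Sum>i<k. (cmod (v i))\<^sup>2)"

definition nv :: "nat \<Rightarrow> (nat \<Rightarrow> complex) \<Rightarrow> real" where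
  "nv k v = sqrt (vsq k v)"

definition mv :: "nat \<Rightarrow> (nat \<Rightarrow> nat \<Rightarrow> complex) \<Rightarrow> (nat \<Rightarrow> complex) \<Rightarrow> nat \<Rightarrow> complex" where
  "mv n A v i = (\<Sum>j<n. A i j * v j)"

definition adj :: "(nat \<Rightarrow> nat \<Rightarrow> complex) \<Rightarrow> nat \<Rightarrow> nat \<Rightarrow> complex" where
  "adj A i j = cnj (A j i)"

lemma vsq_nonneg: "vsq k v \<ge> 0" by (simp add: vsq_def sum_nonneg)

lemma nv_nonneg: "nv k v \<ge> 0" by (simp add: nv_def vsq_nonneg)

lemma nv_power2: "(nv k v)\<^sup>2 = vsq k v" by (simp add: nv_def vsq_nonneg)

lemma nv_L2: "nv k v = L2_set (\<lambda>i. cmod (v i)) {..<k}"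
  by (simp add: nv_def vsq_def L2_set_def)

lemma hp_self: "hp k v v = complex_of_real (vsq k v)"
  by (simp add: hp_def vsq_def complex_norm_square del: of_real_power)

lemma hp_cnj: "hp k y x = cnj (hp k x y)"
  by (simp add: hp_def mult.commute)

lemma hp_add: "hp k (\<lambda>i. x i + y i) z = hp k x z + hp k y z" "hp k z (\<lambda>i. x i + y i) = hp k z x + hp k z y"
  by (simp_all add: hp_def algebra_simps sum.distrib)

lemma hp_diff: "hp k (\<lambda>i. x i - y i) z = hp k x z - hp k y z" "hp k z (\<lambda>i. x i - y i) = hp k z x - hp k z y"
  by (simp_all add: hp_def algebra_simps sum_subtractf)

lemma hp_scale: "hp k (\<lambda>i. c * x i) z = c * hp k x z" "hp k z (\<lambda>i. c * x i) = cnj c * hp k z x"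
  by (simp_all add: hp_def algebra_simps sum_distrib_left)

lemma hp_Cauchy_Schwarz: "cmod (hp k x y) \<le> nv k x * nv k y"
proof -
  have "cmod (hp k x y) \<le> (\<Sum>i<k. cmod (x i * cnj (y i)))" unfolding hp_def by (rule norm_sum)
  also have "\<dots> = (\<Sum>i<k. \<bar>cmod (x i)\<bar> * \<bar>cmod (y i)\<bar>)" by (simp add: norm_mult)
  also have "\<dots> \<le> nv k x * nv k y" unfolding nv_L2 by (rule L2_set_mult_ineq)
  finally show ?thesis .
qed

lemma nv_triangle: "nv k (\<lambda>i. x i + y i) \<le> nv k x + nv k y"
proof -
  have "nv k (\<lambda>i. x i + y i) \<le> L2_set (\<lambda>i. cmod (x i) + cmod (y i)) {..<k}"
    unfolding nv_L2 by (intro L2_set_mono norm_triangle_ineq) auto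
  also have "\<dots> \<le> nv k x + nv k y" unfolding nv_L2 by (rule L2_set_triangle_ineq)
  finally show ?thesis .
qed

lemma vsq_scale: "vsq k (\<lambda>i. c * v i) = (cmod c)\<^sup>2 * vsq k v"
  by (simp add: vsq_def norm_mult power_mult_distrib sum_distrib_left)

lemma nv_scale: "nv k (\<lambda>i. c * v i) = cmod c * nv k v"
  by (simp add: nv_def vsq_scale real_sqrt_mult)

lemma vsq_0_iff: "vsq k v = 0 \<longleftrightarrow> (\<forall>i<k. v i = 0)"
  by (auto simp: vsq_def sum_nonneg_eq_0_iff)

lemma vsq_pos_iff: "vsq k v > 0 \<longleftrightarrow> (\<exists>i<k. v i \<noteq> 0)"
  using vsq_0_iff[of k v] vsq_nonneg[of k v] by (metis less_eq_real_def less_irrefl)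

lemma vsq_add: "vsq k (\<lambda>i. x i + y i) = vsq k x + 2 * Re (hp k x y) + vsq k y"
proof -
  have "complex_of_real (vsq k (\<lambda>i. x i + y i)) = hp k x x + hp k x y + cnj (hp k x y) + hp k y y"
    unfolding hp_self[symmetric] by (simp add: hp_add hp_cnj[of k y x])
  then have "Re (complex_of_real (vsq k (\<lambda>i. x i + y i))) = Re (hp k x x + hp k x y + cnj (hp k x y) + hp k y y)" by simp
  then show ?thesis by (simp add: hp_self)
qed

lemma mv_add: "mv n (\<lambda>i j. A i j + B i j) v i = mv n A v i + mv n B v i"
  by (simp add: mv_def algebra_simps sum.distrib)

lemma mv_scale: "mv n (\<lambda>i j. c * A i j) v i = c * mv n A v i"
  by (simp add: mv_def algebra_simps sum_distrib_left)

lemma mv_diff_right: "mv n A (\<lambda>i. x i - y i) = (\<lambda>i. mv n A x i - mv n A y i)"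
  by (simp add: mv_def algebra_simps sum_subtractf fun_eq_iff)

lemma hp_adj: "hp m (mv n A v) w = hp n v (mv m (adj A) w)"
proof -
  have "hp m (mv n A v) w = (\<Sum>i<m. \<Sum>j<n. A i j * v j * cnj (w i))"
    by (simp add: hp_def mv_def sum_distrib_right)
  also have "\<dots> = (\<Sum>j<n. \<Sum>i<m. A i j * v j * cnj (w i))" by (rule sum.swap)
  also have "\<dots> = hp n v (mv m (adj A) w)"
    by (simp add: hp_def mv_def adj_def sum_distrib_left mult_ac)
  finally show ?thesis .
qed

definition hsn :: "nat \<Rightarrow> nat \<Rightarrow> (nat \<Rightarrow> nat \<Rightarrow> complex) \<Rightarrow> real" where
  "hsn m n A = sqrt (\<Sum>i<m. \<Sum>j<n. (cmod (A i j))\<^sup>2)"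

lemma nv_mv_le: "nv m (mv n A v) \<le> hsn m n A * nv n v"
proof -
  have "(cmod (mv n A v i))\<^sup>2 \<le> (\<Sum>j<n. (cmod (A i j))\<^sup>2) * vsq n v" for i
  proof -
    have "mv n A v i = hp n (A i) (\<lambda>j. cnj (v j))" by (simp add: mv_def hp_def)
    then have "cmod (mv n A v i) \<le> nv n (A i) * nv n (\<lambda>j. cnj (v j))" using hp_Cauchy_Schwarz by metis
    then have "(cmod (mv n A v i))\<^sup>2 \<le> (nv n (A i) * nv n (\<lambda>j. cnj (v j)))\<^sup>2" by (rule power_mono) simp
    then show ?thesis by (simp add: power_mult_distrib nv_power2) (simp add: vsq_def)
  qed
  then have "vsq m (mv n A v) \<le> (\<Sum>i<m. (\<Sum>j<n. (cmod (A i j))\<^sup>2) * vsq n v)"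
    unfolding vsq_def[of m] by (rule sum_mono)
  also have "\<dots> = (\<Sum>i<m. \<Sum>j<n. (cmod (A i j))\<^sup>2) * vsq n v" by (simp add: sum_distrib_right)
  finally have "sqrt (vsq m (mv n A v)) \<le> sqrt ((\<Sum>i<m. \<Sum>j<n. (cmod (A i j))\<^sup>2) * vsq n v)" by simp
  then show ?thesis by (simp add: nv_def hsn_def real_sqrt_mult)
qed

definition contr :: "nat \<Rightarrow> nat \<Rightarrow> (nat \<Rightarrow> nat \<Rightarrow> complex) \<Rightarrow> real \<Rightarrow> bool" where
  "contr m n A r \<longleftrightarrow> (\<forall>v. nv m (mv n A v) \<le> r * nv n v)"

text \<open>The gap \<open>r < 1\<close> comes from compactness of the unit sphere, which lives in the product topology.\<close>
lemma mat_contr_iff: "mat_contr m n A \<longleftrightarrow> (\<exists>r. 0 \<le> r \<and> r < 1 \<and> contr m n A r)"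
proof
  have def: "mat_contr m n A \<longleftrightarrow> (\<forall>v. (\<exists>j<n. v j \<noteq> 0) \<longrightarrow> vsq m (mv n A v) < vsq n v)"
    by (simp add: mat_contr_def vsq_def mv_def)
  {
    assume "\<exists>r. 0 \<le> r \<and> r < 1 \<and> contr m n A r"
    then obtain r where r: "0 \<le> r" "r < 1" "contr m n A r" by blast
    show "mat_contr m n A"
      unfolding def
    proof (intro allI impI)
      fix v :: "nat \<Rightarrow> complex" assume "\<exists>j<n. v j \<noteq> 0"
      then have pos: "nv n v > 0" using vsq_pos_iff by (simp add: nv_def)
      have "nv m (mv n A v) \<le> r * nv n v" using r(3) by (simp add: contr_def)
      also have "\<dots> < 1 * nv n v" using r(2) pos by (intro mult_strict_right_mono) auto
      finally show "vsq m (mv n A v) < vsq n v" by (simp add: nv_def)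
    qed
  }
  assume mc: "mat_contr m n A"
  define K where "K = {v \<in> PiE UNIV (\<lambda>j. if j < n then cball (0::complex) 1 else {0}). vsq n v = 1}"
  have vc: "continuous_on UNIV (\<lambda>v. vsq n v)" unfolding vsq_def
    by (intro continuous_intros continuous_on_product_coordinates)
  have "compactin (product_topology (\<lambda>i. euclidean) UNIV) (PiE UNIV (\<lambda>j. if j < n then cball (0::complex) 1 else {0}))"
    by (subst compactin_PiE) (auto simp: compactin_euclidean_iff)
  then have "compact (PiE UNIV (\<lambda>j. if j < n then cball (0::complex) 1 else {0}))"
    by (simp add: euclidean_product_topology compactin_euclidean_iff)
  moreover have "closed {v. vsq n v = 1}" by (intro closed_Collect_eq vc continuous_intros)
  ultimately have "compact (PiE UNIV (\<lambda>j. if j < n then cball (0::complex) 1 else {0}) \<inter> {v. vsq n v = 1})"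
    by (rule compact_Int_closed)
  then have K: "compact K" unfolding K_def by (simp add: Collect_conj_eq)
  have inK: "\<exists>w\<in>K. \<forall>j<n. v j = of_real (nv n v) * w j" if pos: "nv n v > 0" for v
  proof (rule bexI)
    define w where "w j = (if j < n then v j / of_real (nv n v) else 0)" for j
    show "\<forall>j<n. v j = of_real (nv n v) * w j" using pos by (simp add: w_def)
    have "vsq n w = vsq n (\<lambda>j. (1 / of_real (nv n v)) * v j)" by (simp add: vsq_def w_def)
    also have "\<dots> = 1" unfolding vsq_scale nv_power2[symmetric] using pos by (simp add: norm_divide power_divide)
    finally have w1: "vsq n w = 1" .
    have "cmod (w j) \<le> 1" if "j < n" for j
    proof -
      have "(cmod (w j))\<^sup>2 \<le> vsq n w" unfolding vsq_def using that by (intro member_le_sum) auto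
      then show ?thesis using w1 power2_le_imp_le[of "cmod (w j)" 1] by simp
    qed
    then show "w \<in> K" using w1 by (auto simp: K_def w_def)
  qed
  show "\<exists>r. 0 \<le> r \<and> r < 1 \<and> contr m n A r"
  proof (cases "K = {}")
    case True
    then have nz: "nv n v = 0" for v using inK[of v] nv_nonneg[of n v] by force
    have "mv n A v i = 0" for v i
    proof -
      have "\<forall>j<n. v j = 0" using nz[of v] by (simp add: nv_def vsq_0_iff)
      then show ?thesis by (simp add: mv_def)
    qed
    then have "nv m (mv n A v) = 0" for v by (simp add: nv_def vsq_0_iff)
    then show ?thesis by (intro exI[of _ 0]) (simp add: contr_def)
  next
    case False
    have "continuous_on K (\<lambda>v. nv m (mv n A v))"
      unfolding nv_def vsq_def mv_def
      by (intro continuous_intros continuous_on_subset[OF continuous_on_product_coordinates]) auto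
    from continuous_attains_sup[OF K False this]
    obtain v0 where v0: "v0 \<in> K" "\<And>v. v \<in> K \<Longrightarrow> nv m (mv n A v) \<le> nv m (mv n A v0)" by blast
    define r where "r = nv m (mv n A v0)"
    have "vsq n v0 = 1" using v0 by (simp add: K_def)
    then have "vsq m (mv n A v0) < 1" using mc vsq_pos_iff[of n v0] unfolding def by auto
    then have r1: "r < 1" by (simp add: r_def nv_def)
    have "nv m (mv n A v) \<le> r * nv n v" for v
    proof (cases "nv n v = 0")
      case True
      then have "\<forall>j<n. v j = 0" by (simp add: nv_def vsq_0_iff)
      then have "mv n A v i = 0" for i by (simp add: mv_def)
      then have "nv m (mv n A v) = 0" by (simp add: nv_def vsq_0_iff)
      then show ?thesis using True by simp
    next
      case False
      then have "nv n v > 0" using nv_nonneg[of n v] by linarith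
      then obtain w where w: "w \<in> K" "\<forall>j<n. v j = of_real (nv n v) * w j" using inK by blast
      have "mv n A v i = of_real (nv n v) * mv n A w i" for i
        using w(2) by (simp add: mv_def sum_distrib_left mult_ac)
      then have "nv m (mv n A v) = nv n v * nv m (mv n A w)"
        using nv_scale[of m "of_real (nv n v)" "mv n A w"] nv_nonneg[of n v] by (simp add: nv_def vsq_def)
      also have "\<dots> \<le> nv n v * r" unfolding r_def by (intro mult_left_mono v0 w nv_nonneg)
      finally show ?thesis by (simp add: mult.commute)
    qed
    then show ?thesis using r1 by (intro exI[of _ r]) (auto simp: contr_def r_def nv_nonneg)
  qed
qed

lemma contr_perturb:
  assumes "contr m n A r" shows "contr m n (\<lambda>i j. A i j + B i j) (r + hsn m n B)"
  unfolding contr_def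
proof
  fix v
  have "nv m (mv n (\<lambda>i j. A i j + B i j) v) = nv m (\<lambda>i. mv n A v i + mv n B v i)"
    by (simp add: mv_add[abs_def])
  also have "\<dots> \<le> nv m (mv n A v) + nv m (mv n B v)" by (rule nv_triangle)
  also have "\<dots> \<le> r * nv n v + hsn m n B * nv n v"
    using assms nv_mv_le by (intro add_mono) (auto simp: contr_def)
  finally show "nv m (mv n (\<lambda>i j. A i j + B i j) v) \<le> (r + hsn m n B) * nv n v" by (simp add: algebra_simps)
qed

lemma contr_adj:
  assumes "contr m n A 1" shows "contr n m (adj A) 1"
  unfolding contr_def
proof
  fix w
  define y where "y = mv m (adj A) w"
  have "vsq n y = Re (hp n y (mv m (adj A) w))" by (simp add: y_def hp_self)
  also have "hp n y (mv m (adj A) w) = hp m (mv n A y) w" by (rule hp_adj[symmetric])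
  also have "Re (hp m (mv n A y) w) \<le> cmod (hp m (mv n A y) w)" by (rule complex_Re_le_cmod)
  also have "\<dots> \<le> nv m (mv n A y) * nv m w" by (rule hp_Cauchy_Schwarz)
  also have "\<dots> \<le> nv n y * nv m w" using assms nv_nonneg by (intro mult_right_mono) (auto simp: contr_def)
  finally have le: "nv n y * nv n y \<le> nv n y * nv m w" by (simp add: nv_power2[symmetric] power2_eq_square)
  show "nv n (mv m (adj A) w) \<le> 1 * nv m w"
  proof (cases "nv n y = 0")
    case True
    then show ?thesis using nv_nonneg[of m w] by (simp add: y_def)
  next
    case False
    then have "nv n y > 0" using nv_nonneg[of n y] by linarith
    then show ?thesis using le by (simp add: y_def)
  qed
qed

definition defect :: "nat \<Rightarrow> (nat \<Rightarrow> nat \<Rightarrow> complex) \<Rightarrow> nat \<Rightarrow> nat \<Rightarrow> complex" where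
  "defect m A i j = of_bool (i = j) - (\<Sum>k<m. cnj (A k i) * A k j)"

definition defect' :: "nat \<Rightarrow> (nat \<Rightarrow> nat \<Rightarrow> complex) \<Rightarrow> nat \<Rightarrow> nat \<Rightarrow> complex" where
  "defect' n A i j = of_bool (i = j) - (\<Sum>k<n. A i k * cnj (A j k))"

text \<open>The Bergman operator at A applied to X, that is (I - A A') X (I - A' A) with A' the
  adjoint of A.\<close>

definition sandwich :: "nat \<Rightarrow> nat \<Rightarrow> (nat \<Rightarrow> nat \<Rightarrow> complex) \<Rightarrow> (nat \<Rightarrow> nat \<Rightarrow> complex) \<Rightarrow> nat \<Rightarrow> nat \<Rightarrow> complex" where
  "sandwich m n A X i j = (\<Sum>p<m. \<Sum>q<n. defect' n A i p * X p q * defect m A q j)"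

lemma mv_defect:
  assumes "i < n" shows "mv n (defect m A) v i = v i - mv m (adj A) (mv n A v) i"
proof -
  have "mv n (defect m A) v i = (\<Sum>j<n. of_bool (i = j) * v j) - (\<Sum>j<n. \<Sum>k<m. cnj (A k i) * A k j * v j)"
    by (simp add: mv_def defect_def left_diff_distrib sum_subtractf sum_distrib_right)
  also have "(\<Sum>j<n. of_bool (i = j) * v j) = v i"
    using assms by (simp add: of_bool_def if_distrib[of "\<lambda>x. x * _"] cong: if_cong)
  also have "(\<Sum>j<n. \<Sum>k<m. cnj (A k i) * A k j * v j) = (\<Sum>k<m. \<Sum>j<n. cnj (A k i) * A k j * v j)"
    by (rule sum.swap)
  also have "\<dots> = mv m (adj A) (mv n A v) i" by (simp add: mv_def adj_def sum_distrib_left mult_ac)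
  finally show ?thesis .
qed

lemma mv_defect':
  assumes "i < m" shows "mv m (defect' n A) w i = w i - mv n A (mv m (adj A) w) i"
proof -
  have "defect' n A = defect n (adj A)" by (simp add: fun_eq_iff defect_def defect'_def adj_def mult.commute)
  moreover have "adj (adj A) = A" by (simp add: fun_eq_iff adj_def)
  ultimately show ?thesis using mv_defect[OF assms, of n "adj A" w] by simp
qed

lemma mv_sandwich: "mv n (sandwich m n A X) v i = mv m (defect' n A) (mv n X (mv n (defect m A) v)) i"
proof -
  have "mv n (sandwich m n A X) v i = (\<Sum>j<n. \<Sum>p<m. \<Sum>q<n. defect' n A i p * X p q * defect m A q j * v j)"
    by (simp add: mv_def sandwich_def sum_distrib_right)
  also have "\<dots> = (\<Sum>p<m. \<Sum>j<n. \<Sum>q<n. defect' n A i p * X p q * defect m A q j * v j)"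
    by (rule sum.swap)
  also have "\<dots> = (\<Sum>p<m. \<Sum>q<n. \<Sum>j<n. defect' n A i p * X p q * defect m A q j * v j)"
    by (intro sum.cong refl sum.swap)
  also have "\<dots> = mv m (defect' n A) (mv n X (mv n (defect m A) v)) i"
    by (simp add: mv_def sum_distrib_left mult_ac)
  finally show ?thesis .
qed

lemma mv_cong: "(\<And>j. j < n \<Longrightarrow> v j = w j) \<Longrightarrow> mv n A v = mv n A w"
  by (simp add: mv_def fun_eq_iff)

lemma vsq_cong: "(\<And>j. j < n \<Longrightarrow> v j = w j) \<Longrightarrow> vsq n v = vsq n w"
  by (simp add: vsq_def)

lemma hp_cong: "(\<And>j. j < n \<Longrightarrow> v j = v' j) \<Longrightarrow> (\<And>j. j < n \<Longrightarrow> w j = w' j) \<Longrightarrow> hp n v w = hp n v' w'"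
  by (simp add: hp_def)

text \<open>With \<open>D = I - A\<^sup>*A\<close> and \<open>D' = I - AA\<^sup>*\<close> one has \<open>D'A = AD\<close> and \<open>D\<^sup>2 \<le> D\<close>, so a small multiple of
  \<open>D'XD\<close> can be added to the contraction \<open>A\<close> without leaving the unit ball.\<close>
lemma contr_sandwich:
  assumes A: "contr m n A 1"
  obtains \<epsilon> :: real where "\<epsilon> > 0"
    "\<And>c. cmod c \<le> 1 \<Longrightarrow> contr m n (\<lambda>i j. A i j + c * (of_real \<epsilon> * sandwich m n A X i j)) 1"
proof -
  define C where "C = hsn m n X"
  have C0: "C \<ge> 0" by (simp add: C_def hsn_def sum_nonneg)
  \<comment> \<open>With \<epsilon> C \<le> 1/4 one has 2 \<epsilon> C + 4 (\<epsilon> C)^2 \<le>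
    3/4, so the perturbation costs less than the slack in \<open>yv\<close>.\<close>
  define \<epsilon> where "\<epsilon> = 1 / (4 * (C + 1))"
  have e: "\<epsilon> > 0" "\<epsilon> * C \<le> 1 / 4" using C0 by (auto simp: \<epsilon>_def divide_simps)
  have A': "contr n m (adj A) 1" by (rule contr_adj[OF A])
  have nA: "nv m (mv n A v) \<le> nv n v" and nA': "nv n (mv m (adj A) w) \<le> nv m w" for v w
    using A A' by (auto simp: contr_def)
  show thesis
  proof (rule that[OF e(1)])
    fix c assume c: "cmod c \<le> 1"
    have "vsq m (mv n (\<lambda>i j. A i j + c * (of_real \<epsilon> * sandwich m n A X i j)) v) \<le> vsq n v" for v
    proof -
      define a where "a = mv n A v"
      define y where "y i = v i - mv m (adj A) a i" for i
      define x where "x = mv n X y"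
      define w where "w i = x i - mv n A (mv m (adj A) x) i" for i
      have yD: "mv n X (mv n (defect m A) v) = x"
        unfolding x_def by (rule mv_cong) (simp add: mv_defect y_def a_def)
      have eq: "mv n (\<lambda>i j. A i j + c * (of_real \<epsilon> * sandwich m n A X i j)) v i = a i + (c * of_real \<epsilon>) * w i" if "i < m" for i
      proof -
        have "mv n (\<lambda>i j. A i j + c * (of_real \<epsilon> * sandwich m n A X i j)) v i = a i + c * (of_real \<epsilon> * mv n (sandwich m n A X) v i)"
          by (simp add: mv_add mv_scale a_def)
        then show ?thesis using that by (simp add: mv_sandwich yD mv_defect' w_def)
      qed
      \<comment> \<open>The inequality D^2 \<le> D tested on v: the length that A takes away from v
        bounds y = D v.\<close>
      have yv: "vsq n y \<le> vsq n v - vsq m a"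
      proof -
        have "vsq n y = vsq n v - 2 * Re (hp n v (mv m (adj A) a)) + vsq n (mv m (adj A) a)"
          using vsq_add[of n v "\<lambda>i. - 1 * mv m (adj A) a i"] hp_scale(2)[of n v "-1" "mv m (adj A) a"] vsq_scale[of n "-1" "mv m (adj A) a"]
          by (simp add: y_def[abs_def])
        also have "hp n v (mv m (adj A) a) = of_real (vsq m a)" using hp_adj[of m n A v a] by (simp add: a_def hp_self)
        also have "vsq n (mv m (adj A) a) \<le> vsq m a"
          using nA'[of a] by (simp add: nv_def)
        finally show ?thesis by simp
      qed
      \<comment> \<open>Since D' A = A D, the cross term pairs A y with x = X y and is therefore
        quadratic in y.\<close>
      have ip: "hp m a w = hp m (mv n A y) x"
      proof -
        have "hp m a w = hp m a x - hp m a (mv n A (mv m (adj A) x))" by (simp add: w_def[abs_def] hp_diff)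
        also have "hp m a (mv n A (mv m (adj A) x)) = hp m (mv n A (mv m (adj A) a)) x"
        proof -
          have "hp m a (mv n A (mv m (adj A) x)) = cnj (hp m (mv n A (mv m (adj A) x)) a)" by (rule hp_cnj)
          also have "\<dots> = cnj (hp n (mv m (adj A) x) (mv m (adj A) a))" by (simp only: hp_adj)
          also have "\<dots> = hp n (mv m (adj A) a) (mv m (adj A) x)" by (simp only: hp_cnj[symmetric])
          also have "\<dots> = hp m (mv n A (mv m (adj A) a)) x" by (simp only: hp_adj)
          finally show ?thesis .
        qed
        also have "hp m a x - hp m (mv n A (mv m (adj A) a)) x = hp m (mv n A y) x"
          unfolding y_def[abs_def] mv_diff_right by (simp add: hp_diff a_def)
        finally show ?thesis .
      qed
      have xC: "nv m x \<le> C * nv n y" unfolding x_def C_def by (rule nv_mv_le)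
      have ip_le: "cmod (hp m a w) \<le> C * vsq n y"
      proof -
        have "cmod (hp m a w) \<le> nv m (mv n A y) * nv m x" unfolding ip by (rule hp_Cauchy_Schwarz)
        also have "\<dots> \<le> nv n y * (C * nv n y)" using nA[of y] xC nv_nonneg by (intro mult_mono) auto
        finally show ?thesis by (simp add: nv_power2[symmetric] power2_eq_square mult_ac)
      qed
      have w_le: "vsq m w \<le> 4 * C\<^sup>2 * vsq n y"
      proof -
        have "nv m w \<le> nv m x + nv m (\<lambda>i. - 1 * mv n A (mv m (adj A) x) i)"
          using nv_triangle[of m x "\<lambda>i. - 1 * mv n A (mv m (adj A) x) i"] by (simp add: w_def[abs_def])
        also have "nv m (\<lambda>i. - 1 * mv n A (mv m (adj A) x) i) = nv m (mv n A (mv m (adj A) x))" by (simp only: nv_scale) simp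
        also have "\<dots> \<le> nv m x" using nA[of "mv m (adj A) x"] nA'[of x] by linarith
        finally have "nv m w \<le> 2 * C * nv n y" using xC by linarith
        then have "(nv m w)\<^sup>2 \<le> (2 * C * nv n y)\<^sup>2" by (rule power_mono[OF _ nv_nonneg])
        then show ?thesis by (simp add: nv_power2 power_mult_distrib)
      qed
      have "vsq m (mv n (\<lambda>i j. A i j + c * (of_real \<epsilon> * sandwich m n A X i j)) v) = vsq m (\<lambda>i. a i + (c * of_real \<epsilon>) * w i)"
        by (rule vsq_cong) (rule eq)
      also have "\<dots> = vsq m a + 2 * Re (cnj (c * of_real \<epsilon>) * hp m a w) + (cmod (c * of_real \<epsilon>))\<^sup>2 * vsq m w"
        by (simp only: vsq_add hp_scale vsq_scale)
      also have "\<dots> \<le> vsq m a + 2 * (\<epsilon> * (C * vsq n y)) + \<epsilon>\<^sup>2 * (4 * C\<^sup>2 * vsq n y)"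
      proof -
        have ce: "cmod (c * of_real \<epsilon>) \<le> \<epsilon>" using c e(1) by (simp add: norm_mult mult_left_le_one_le)
        have "Re (cnj (c * of_real \<epsilon>) * hp m a w) \<le> cmod (cnj (c * of_real \<epsilon>) * hp m a w)" by (rule complex_Re_le_cmod)
        also have "\<dots> = cmod (c * of_real \<epsilon>) * cmod (hp m a w)" by (simp only: norm_mult complex_mod_cnj)
        also have "\<dots> \<le> \<epsilon> * (C * vsq n y)" using ce ip_le e(1) by (intro mult_mono) auto
        finally have "Re (cnj (c * of_real \<epsilon>) * hp m a w) \<le> \<epsilon> * (C * vsq n y)" .
        moreover have "(cmod (c * of_real \<epsilon>))\<^sup>2 * vsq m w \<le> \<epsilon>\<^sup>2 * (4 * C\<^sup>2 * vsq n y)"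
          using ce w_le vsq_nonneg by (intro mult_mono power_mono) auto
        ultimately show ?thesis by linarith
      qed
      also have "\<dots> = vsq m a + (2 * (\<epsilon> * C) + 4 * (\<epsilon> * C)\<^sup>2) * vsq n y" by (simp add: algebra_simps power2_eq_square)
      also have "\<dots> \<le> vsq m a + 1 * vsq n y"
      proof -
        have "(\<epsilon> * C)\<^sup>2 \<le> (1 / 4)\<^sup>2" using e C0 by (intro power_mono) auto
        then have "2 * (\<epsilon> * C) + 4 * (\<epsilon> * C)\<^sup>2 \<le> 1" using e(2) by (simp add: power2_eq_square)
        then show ?thesis by (intro add_left_mono mult_right_mono vsq_nonneg)
      qed
      also have "\<dots> \<le> vsq n v" using yv by simp
      finally show ?thesis .
    qed
    then show "contr m n (\<lambda>i j. A i j + c * (of_real \<epsilon> * sandwich m n A X i j)) 1"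
      unfolding contr_def by (simp add: nv_def)
  qed
qed

section \<open>Complex reflections, which scale one line by c and fix its complement\<close>

definition refl :: "nat \<Rightarrow> (nat \<Rightarrow> complex) \<Rightarrow> complex \<Rightarrow> (nat \<Rightarrow> complex) \<Rightarrow> nat \<Rightarrow> complex" where
  "refl k u c v i = v i + (c - 1) * hp k v u * u i"

definition uz :: "nat \<Rightarrow> (nat \<Rightarrow> complex) \<Rightarrow> bool" where
  "uz k u \<longleftrightarrow> vsq k u = 1 \<or> (\<forall>i<k. u i = 0)"

lemma refl_zero: "\<forall>i<k. u i = 0 \<Longrightarrow> refl k u c v = v"
  by (simp add: refl_def hp_def fun_eq_iff)

lemma refl_one: "refl k u 1 v = v"
  by (simp add: refl_def fun_eq_iff)

lemma hp_refl:
  assumes u: "uz k u" and c: "cmod c = 1"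
  shows "hp k (refl k u c v) (refl k u c w) = hp k v w"
  using u unfolding uz_def
proof
  assume "\<forall>i<k. u i = 0"
  then show ?thesis by (simp add: refl_zero)
next
  assume u1: "vsq k u = 1"
  have cc: "c * cnj c = 1" using c complex_norm_square[of c] by simp
  define p q where "p = hp k v u" and "q = hp k w u"
  have "hp k (refl k u c v) (refl k u c w) = hp k v w + cnj ((c - 1) * q) * hp k v u + (c - 1) * p * hp k u w
      + (c - 1) * p * (cnj ((c - 1) * q) * hp k u u)"
    unfolding refl_def[abs_def] p_def q_def by (simp only: hp_add hp_scale mult.assoc[symmetric]) (simp only: hp_add hp_scale algebra_simps)
  also have "\<dots> = hp k v w + (c * cnj c - 1) * (p * cnj q)"
    by (simp add: hp_self u1 p_def[symmetric] hp_cnj[of k u w] q_def[symmetric] algebra_simps)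
  finally show ?thesis by (simp add: cc)
qed

lemma refl_inverse:
  assumes u: "uz k u" and c: "cmod c = 1"
  shows "refl k u c (refl k u (cnj c) v) = v"
  using u unfolding uz_def
proof
  assume "\<forall>i<k. u i = 0"
  then show ?thesis by (simp add: refl_zero)
next
  assume u1: "vsq k u = 1"
  have cc: "c * cnj c = 1" using c complex_norm_square[of c] by simp
  have "hp k (refl k u (cnj c) v) u = hp k v u + (cnj c - 1) * hp k v u * hp k u u"
    unfolding refl_def[abs_def] by (simp only: hp_add hp_scale)
  then have h: "hp k (refl k u (cnj c) v) u = cnj c * hp k v u" by (simp add: hp_self u1 algebra_simps)
  have "refl k u c (refl k u (cnj c) v) i = v i + (c * cnj c - 1) * (hp k v u * u i)" for i
    unfolding refl_def[of k u c] h by (simp add: refl_def algebra_simps)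
  then show ?thesis by (simp add: fun_eq_iff cc)
qed

lemma vsq_refl:
  assumes "uz k u" "cmod c = 1" shows "vsq k (refl k u c v) = vsq k v"
  using hp_refl[OF assms, of v v] unfolding hp_self by simp

text \<open>The vector \<open>u\<close> is a multiple of \<open>x - y\<close>, and \<open>c = - cnj s / s\<close> for \<open>s = \<langle>x, x - y\<rangle>\<close>.\<close>
lemma refl_exists:
  assumes xy: "vsq k x = vsq k y"
  obtains u c where "uz k u" "cmod c = 1" "\<And>i. i < k \<Longrightarrow> refl k u c x i = y i"
    "\<And>v i. hp k v x = 0 \<Longrightarrow> hp k v y = 0 \<Longrightarrow> refl k u c v i = v i"
proof (cases "\<forall>i<k. x i = y i")
  case True
  show ?thesis
    by (rule that[of "\<lambda>_. 0" 1]) (use True in \<open>auto simp: uz_def refl_def\<close>)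
next
  case False
  define w where "w i = x i - y i" for i
  define s where "s = hp k x w"
  have w0: "vsq k w > 0" using False by (auto simp: vsq_pos_iff w_def)
  have ww: "vsq k w = 2 * Re s"
  proof -
    have "complex_of_real (vsq k w) = hp k x w - hp k y w" unfolding hp_self[symmetric] by (simp add: w_def[abs_def] hp_diff)
    also have "hp k y w = hp k y x - of_real (vsq k y)" by (simp add: w_def[abs_def] hp_diff hp_self)
    finally have "vsq k w = Re s - Re (hp k y x) + vsq k y" by (simp add: s_def complex_eq_iff)
    moreover have "s = of_real (vsq k x) - hp k x y" by (simp add: s_def w_def[abs_def] hp_diff hp_self)
    moreover have "Re (hp k y x) = Re (hp k x y)" by (subst hp_cnj) simp
    ultimately show ?thesis using xy by simp
  qed
  have s0: "s \<noteq> 0" using ww w0 by auto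
  define u where "u i = of_real (1 / nv k w) * w i" for i
  define c where "c = - cnj s / s"
  have nw: "nv k w > 0" using w0 by (simp add: nv_def)
  have u1: "vsq k u = 1"
    unfolding u_def[abs_def] vsq_scale using nw by (simp add: norm_divide power_divide nv_power2[symmetric])
  show ?thesis
  proof (rule that[of u c])
    show "uz k u" using u1 by (simp add: uz_def)
    show "cmod c = 1" using s0 by (simp add: c_def norm_divide)
    have hu: "hp k v u = of_real (1 / nv k w) * hp k v w" for v
      unfolding u_def[abs_def] hp_scale by simp
    have r: "refl k u c v i = v i + (c - 1) * hp k v w / of_real (vsq k w) * w i" for v i
      unfolding refl_def hu u_def nv_power2[symmetric] using nw by (simp add: power2_eq_square)
    have "(c - 1) * s = - (s + cnj s)" using s0 by (simp add: c_def algebra_simps)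
    also have "\<dots> = - of_real (vsq k w)" unfolding ww by (simp add: complex_eq_iff)
    finally have cs: "(c - 1) * s / of_real (vsq k w) = - 1" using w0 by simp
    show "refl k u c x i = y i" if "i < k" for i
      unfolding r s_def[symmetric] cs by (simp add: w_def)
    show "refl k u c v i = v i" if "hp k v x = 0" "hp k v y = 0" for v i
    proof -
      have "hp k v w = 0" using that by (simp add: w_def[abs_def] hp_diff)
      then show ?thesis by (simp add: r)
    qed
  qed
qed

definition lmul :: "nat \<Rightarrow> (nat \<Rightarrow> complex) \<Rightarrow> complex \<Rightarrow> (nat \<Rightarrow> nat \<Rightarrow> complex) \<Rightarrow> nat \<Rightarrow> nat \<Rightarrow> complex" where
  "lmul m u c A i j = refl m u c (\<lambda>i. A i j) i"

text \<open>Multiplication on the right by the transpose of the reflection. With the same vector on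
  both sides the result is U A U^T, which preserves symmetric and skew-symmetric matrices.\<close>

definition rmul :: "nat \<Rightarrow> (nat \<Rightarrow> complex) \<Rightarrow> complex \<Rightarrow> (nat \<Rightarrow> nat \<Rightarrow> complex) \<Rightarrow> nat \<Rightarrow> nat \<Rightarrow> complex" where
  "rmul n w c A i j = refl n w c (A i) j"

definition hs :: "nat \<Rightarrow> nat \<Rightarrow> (nat \<Rightarrow> nat \<Rightarrow> complex) \<Rightarrow> (nat \<Rightarrow> nat \<Rightarrow> complex) \<Rightarrow> complex" where
  "hs m n A B = (\<Sum>i<m. \<Sum>j<n. A i j * cnj (B i j))"

definition eqm :: "nat \<Rightarrow> nat \<Rightarrow> (nat \<Rightarrow> nat \<Rightarrow> complex) \<Rightarrow> (nat \<Rightarrow> nat \<Rightarrow> complex) \<Rightarrow> bool" where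
  "eqm m n A B \<longleftrightarrow> (\<forall>i<m. \<forall>j<n. A i j = B i j)"

lemma hs_rows: "hs m n A B = (\<Sum>i<m. hp n (A i) (B i))"
  by (simp add: hs_def hp_def)

lemma hs_cols: "hs m n A B = (\<Sum>j<n. hp m (\<lambda>i. A i j) (\<lambda>i. B i j))"
  unfolding hs_def hp_def by (rule sum.swap)

lemma hs_lmul: "uz m u \<Longrightarrow> cmod c = 1 \<Longrightarrow> hs m n (lmul m u c A) (lmul m u c B) = hs m n A B"
  unfolding hs_cols lmul_def[abs_def] by (simp add: hp_refl)

lemma hs_rmul: "uz n w \<Longrightarrow> cmod c = 1 \<Longrightarrow> hs m n (rmul n w c A) (rmul n w c B) = hs m n A B"
  unfolding hs_rows rmul_def[abs_def] by (simp add: hp_refl)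

lemma mv_lmul: "mv n (lmul m u c A) v = refl m u c (mv n A v)"
proof
  fix i
  have "hp m (mv n A v) u = (\<Sum>j<n. hp m (\<lambda>i. A i j) u * v j)"
    unfolding hp_def mv_def sum_distrib_right by (subst sum.swap) (simp add: mult_ac)
  then show "mv n (lmul m u c A) v i = refl m u c (mv n A v) i"
    by (simp add: mv_def lmul_def refl_def algebra_simps sum.distrib sum_distrib_left sum_subtractf)
qed

text \<open>The transpose of a reflection is the reflection in the conjugate vector.\<close>

lemma mv_rmul: "mv n (rmul n w c A) v = mv n A (refl n (\<lambda>j. cnj (w j)) c v)"
proof
  fix i
  define h where "h = hp n v (\<lambda>j. cnj (w j))"
  have "mv n (rmul n w c A) v i = mv n A v i + (c - 1) * hp n (A i) w * (\<Sum>j<n. v j * w j)"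
    by (simp add: mv_def rmul_def refl_def distrib_left distrib_right sum.distrib sum_distrib_left mult_ac)
  also have "(\<Sum>j<n. v j * w j) = h" by (simp add: h_def hp_def)
  also have "mv n A v i + (c - 1) * hp n (A i) w * h = (\<Sum>j<n. A i j * v j + (c - 1) * (A i j * cnj (w j)) * h)"
    by (simp add: mv_def hp_def sum.distrib sum_distrib_left sum_distrib_right)
  also have "\<dots> = mv n A (refl n (\<lambda>j. cnj (w j)) c v) i"
    unfolding mv_def refl_def h_def[symmetric] by (simp add: algebra_simps)
  finally show "mv n (rmul n w c A) v i = mv n A (refl n (\<lambda>j. cnj (w j)) c v) i" .
qed

lemma uz_cnj: "uz k u \<Longrightarrow> uz k (\<lambda>j. cnj (u j))"
  by (simp add: uz_def vsq_def)

lemma contr_lmul: "uz m u \<Longrightarrow> cmod c = 1 \<Longrightarrow> contr m n (lmul m u c A) r \<longleftrightarrow> contr m n A r"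
  by (simp add: contr_def mv_lmul nv_def vsq_refl)

lemma contr_rmul:
  assumes "uz n w" "cmod c = 1" "contr m n A r" shows "contr m n (rmul n w c A) r"
  using assms(3) vsq_refl[OF uz_cnj[OF assms(1)] assms(2)] by (auto simp: contr_def mv_rmul nv_def) metis

lemma refl_cong: "(\<And>i. i < k \<Longrightarrow> v i = v' i) \<Longrightarrow> i < k \<Longrightarrow> refl k u c v i = refl k u c v' i"
  by (simp add: refl_def hp_def)

lemma lmul_cong: "eqm m n A B \<Longrightarrow> eqm m n (lmul m u c A) (lmul m u c B)"
  unfolding eqm_def lmul_def by (auto intro!: refl_cong)

lemma rmul_cong: "eqm m n A B \<Longrightarrow> eqm m n (rmul n u c A) (rmul n u c B)"
  unfolding eqm_def rmul_def by (auto intro!: refl_cong)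

lemma contr_cong:
  assumes "eqm m n A B" shows "contr m n A r \<longleftrightarrow> contr m n B r"
proof -
  have "nv m (mv n A v) = nv m (mv n B v)" for v
    unfolding nv_def by (rule arg_cong[of _ _ sqrt], rule vsq_cong) (use assms in \<open>auto simp: eqm_def mv_def\<close>)
  then show ?thesis by (simp add: contr_def)
qed

lemma hs_cong: "eqm m n A B \<Longrightarrow> eqm m n A' B' \<Longrightarrow> hs m n A A' = hs m n B B'"
  by (simp add: hs_def eqm_def)

lemma lmul_inverse: "uz m u \<Longrightarrow> cmod c = 1 \<Longrightarrow> lmul m u c (lmul m u (cnj c) A) = A"
  unfolding lmul_def[abs_def] by (simp add: fun_eq_iff refl_inverse)

lemma rmul_inverse: "uz n u \<Longrightarrow> cmod c = 1 \<Longrightarrow> rmul n u c (rmul n u (cnj c) A) = A"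
  unfolding rmul_def[abs_def] by (simp add: fun_eq_iff refl_inverse)

lemma lmul_rmul: "lmul m u c (rmul n w d A) = rmul n w d (lmul m u c A)"
proof (intro ext)
  fix i j
  have 1: "hp m (\<lambda>i. A i j + (d - 1) * hp n (A i) w * w j) u = hp m (\<lambda>i. A i j) u + (d - 1) * w j * hp m (\<lambda>i. hp n (A i) w) u"
    by (simp add: hp_def sum.distrib algebra_simps sum_distrib_left)
  have 2: "hp n (\<lambda>j. A i j + (c - 1) * hp m (\<lambda>i. A i j) u * u i) w = hp n (A i) w + (c - 1) * u i * hp n (\<lambda>j. hp m (\<lambda>i. A i j) u) w"
    by (simp add: hp_def sum.distrib algebra_simps sum_distrib_left)
  have 3: "hp m (\<lambda>i. hp n (A i) w) u = hp n (\<lambda>j. hp m (\<lambda>i. A i j) u) w"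
    unfolding hp_def sum_distrib_right by (subst sum.swap) (simp add: mult_ac)
  show "lmul m u c (rmul n w d A) i j = rmul n w d (lmul m u c A) i j"
    unfolding lmul_def rmul_def refl_def 1 2 3 by (simp add: algebra_simps)
qed

lemma refl_linear: "refl k u c (\<lambda>i. x i + y i) i = refl k u c x i + refl k u c y i"
  "refl k u c (\<lambda>i. a * x i) i = a * refl k u c x i"
  by (simp_all add: refl_def hp_add hp_scale algebra_simps)

text \<open>Types I, II and III at once: \<open>emb\<close> writes a point as a matrix, P singles
  out the structured matrices (all, skew or symmetric), \<open>dec\<close> reads the free entries
  back, and UW lists the pairs of vectors whose reflections preserve P. E becomes the normal form of
  the extreme points.\<close>

locale matrix_domain =
  fixes m n :: nat and emb :: "complex^'d::finite \<Rightarrow> nat \<Rightarrow> nat \<Rightarrow> complex"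
    and dec :: "(nat \<Rightarrow> nat \<Rightarrow> complex) \<Rightarrow> complex^'d" and P :: "(nat \<Rightarrow> nat \<Rightarrow> complex) \<Rightarrow> bool"
    and UW :: "((nat \<Rightarrow> complex) \<times> (nat \<Rightarrow> complex)) set" and E :: "nat \<Rightarrow> nat \<Rightarrow> complex"
  assumes emb_add: "\<And>z w i j. emb (z + w) i j = emb z i j + emb w i j"
    and emb_smult: "\<And>c z i j. emb (c *s z) i j = c * emb z i j"
    and emb_dec: "\<And>A. P A \<Longrightarrow> eqm m n (emb (dec A)) A"
    and emb_coord: "\<And>k. \<exists>i<m. \<exists>j<n. \<forall>z. z $ k = emb z i j"
    and P_emb: "\<And>z. P (emb z)"
    and UW: "\<And>u w. (u, w) \<in> UW \<Longrightarrow> uz m u \<and> uz n w"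
    and P_UW: "\<And>u w c A. (u, w) \<in> UW \<Longrightarrow> P A \<Longrightarrow> P (lmul m u c (rmul n w c A))"
    and E: "P E" "contr m n E 1"
    and P_sandwich: "\<And>A X. P A \<Longrightarrow> P X \<Longrightarrow> P (sandwich m n A X)"
begin

definition dom :: "(complex^'d) set" where "dom = {z. mat_contr m n (emb z)}"
definition cdom :: "(complex^'d) set" where "cdom = {z. contr m n (emb z) 1}"
definition mip :: "complex^'d \<Rightarrow> complex^'d \<Rightarrow> complex" where "mip z w = hs m n (emb z) (emb w)"
definition act :: "(nat \<Rightarrow> complex) \<Rightarrow> (nat \<Rightarrow> complex) \<Rightarrow> complex \<Rightarrow> complex^'d \<Rightarrow> complex^'d" where
  "act u w c z = dec (lmul m u c (rmul n w c (emb z)))"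
definition acts :: "(complex \<Rightarrow> complex^'d \<Rightarrow> complex^'d) set" where
  "acts = {act u w | u w. (u, w) \<in> UW}"

lemma emb_inj: "eqm m n (emb z) (emb w) \<Longrightarrow> z = w"
  unfolding vec_eq_iff eqm_def using emb_coord by metis

lemma emb_act:
  assumes "(u, w) \<in> UW" shows "eqm m n (emb (act u w c z)) (lmul m u c (rmul n w c (emb z)))"
  unfolding act_def by (rule emb_dec[OF P_UW[OF assms P_emb]])

lemma linear_emb: "linear (\<lambda>z. emb z i j)"
  unfolding linear_iff by (simp add: emb_add scaleR_eq_smult emb_smult scaleR_conv_of_real)

lemma continuous_on_emb [continuous_intros]: "continuous_on T f \<Longrightarrow> continuous_on T (\<lambda>x. emb (f x) i j)"
proof -
  have "continuous_on UNIV (\<lambda>z. emb z i j)"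
    by (rule linear_continuous_on) (simp add: linear_conv_bounded_linear[symmetric] linear_emb)
  then show "continuous_on T f \<Longrightarrow> continuous_on T (\<lambda>x. emb (f x) i j)"
    by (rule continuous_on_compose2) auto
qed

lemma circular: "circular_domain dom cdom mip acts (dec E)"
proof (rule circular_domain.intro)
  show "open dom"
  proof (rule Topological_Spaces.openI)
    fix z assume "z \<in> dom"
    then obtain r where r: "0 \<le> r" "r < 1" "contr m n (emb z) r" by (auto simp: dom_def mat_contr_iff)
    \<comment> \<open>A strict contraction leaves a gap 1 - r, and perturbations of smaller
      Hilbert-Schmidt norm stay within it.\<close>
    define T where "T = {w. hsn m n (emb (w - z)) < 1 - r}"
    have "open T" unfolding T_def hsn_def by (intro open_Collect_less continuous_intros)
    moreover have "emb 0 i j = 0" for i j using emb_smult[of 0 0 i j] by simp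
    then have "z \<in> T" using r(2) by (simp add: T_def hsn_def)
    moreover have "w \<in> dom" if "w \<in> T" for w
    proof -
      have "emb w = (\<lambda>i j. emb z i j + emb (w - z) i j)"
        by (simp add: fun_eq_iff emb_add[symmetric])
      then have "contr m n (emb w) (r + hsn m n (emb (w - z)))" using contr_perturb[OF r(3)] by simp
      moreover have "0 \<le> hsn m n (emb (w - z))" by (simp add: hsn_def sum_nonneg)
      ultimately show ?thesis unfolding dom_def mat_contr_iff using that r(1)
        by (intro CollectI exI[of _ "r + hsn m n (emb (w - z))"]) (auto simp: T_def)
    qed
    ultimately show "\<exists>T. open T \<and> z \<in> T \<and> T \<subseteq> dom" by blast
  qed
  have cdom_alt: "cdom = (\<Inter>v. {z. nv m (mv n (emb z) v) \<le> nv n v})" by (auto simp: cdom_def contr_def)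
  show "closed cdom"
    unfolding cdom_alt nv_def[of m] vsq_def[of m] mv_def
    by (intro closed_INT ballI closed_Collect_le continuous_intros)
  show "bounded cdom"
    unfolding bounded_iff
  proof (intro exI ballI)
    fix z assume z: "z \<in> cdom"
    have ent: "cmod (emb z i j) \<le> 1" if "i < m" "j < n" for i j
    proof -
      define v :: "nat \<Rightarrow> complex" where "v k = of_bool (k = j)" for k
      have "mv n (emb z) v i = emb z i j" using that by (simp add: mv_def v_def of_bool_def if_distrib cong: if_cong)
      then have "(cmod (emb z i j))\<^sup>2 \<le> vsq m (mv n (emb z) v)"
        unfolding vsq_def using that member_le_sum[of i "{..<m}" "\<lambda>i. (cmod (mv n (emb z) v i))\<^sup>2"] by simp
      also have "\<dots> \<le> vsq n v" using z by (auto simp: cdom_def contr_def nv_def)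
      also have "\<dots> = 1"
      proof -
        have "(cmod (v k))\<^sup>2 = (if k = j then 1 else 0)" for k by (simp add: v_def)
        then show ?thesis using that by (simp add: vsq_def)
      qed
      finally show ?thesis using power2_le_imp_le[of "cmod (emb z i j)" 1] by simp
    qed
    have "norm z \<le> (\<Sum>k\<in>UNIV. norm (z $ k))" unfolding norm_vec_def by (rule L2_set_le_sum) auto
    also have "\<dots> \<le> (\<Sum>k\<in>(UNIV::'d set). 1)" using emb_coord ent by (intro sum_mono) metis
    finally show "norm z \<le> real CARD('d)" by simp
  qed
  show "dom \<subseteq> cdom"
  proof
    fix z assume "z \<in> dom"
    then obtain r where r: "r < 1" "contr m n (emb z) r" by (auto simp: dom_def mat_contr_iff)
    have "nv m (mv n (emb z) v) \<le> 1 * nv n v" for v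
    proof -
      have "nv m (mv n (emb z) v) \<le> r * nv n v" using r(2) by (simp add: contr_def)
      also have "\<dots> \<le> 1 * nv n v" using r(1) nv_nonneg[of n v] by (intro mult_right_mono) auto
      finally show ?thesis .
    qed
    then show "z \<in> cdom" by (simp add: cdom_def contr_def)
  qed
  show "c *s z \<in> dom" if "z \<in> cdom" "cmod c < 1" for z c
  proof -
    have "mv n (emb (c *s z)) v = (\<lambda>i. c * mv n (emb z) v i)" for v
      by (simp add: mv_def emb_smult sum_distrib_left mult.assoc fun_eq_iff)
    then have "nv m (mv n (emb (c *s z)) v) = cmod c * nv m (mv n (emb z) v)" for v
      by (simp add: nv_scale)
    then have "contr m n (emb (c *s z)) (cmod c)"
      using that(1) by (auto simp: contr_def cdom_def intro!: mult_left_mono)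
    then show ?thesis using that(2) unfolding dom_def mat_contr_iff by (intro CollectI exI[of _ "cmod c"]) simp
  qed
  show "dec E \<in> cdom" using contr_cong[OF emb_dec[OF E(1)]] E(2) by (simp add: cdom_def)
  show "mip (x + y) z = mip x z + mip y z" for x y z
    by (simp add: mip_def hs_def emb_add algebra_simps sum.distrib)
  show "mip (c *s x) z = c * mip x z" for c x z
    by (simp add: mip_def hs_def emb_smult algebra_simps sum_distrib_left)
  show "mip y x = cnj (mip x y)" for x y by (simp add: mip_def hs_def mult.commute)
  show "Re (mip z z) > 0" if z0: "z \<noteq> 0" for z
  proof -
    have z2: "Re (mip z z) = (\<Sum>i<m. \<Sum>j<n. (cmod (emb z i j))\<^sup>2)"
      unfolding cmod_power2 by (simp add: mip_def hs_def power2_eq_square)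
    obtain k where "z $ k \<noteq> 0" using z0 by (auto simp: vec_eq_iff)
    then obtain i j where ij: "i < m" "j < n" "emb z i j \<noteq> 0" using emb_coord by metis
    have "0 < (cmod (emb z i j))\<^sup>2" using ij by simp
    also have "\<dots> \<le> (\<Sum>j<n. (cmod (emb z i j))\<^sup>2)" using ij by (intro member_le_sum) auto
    also have "\<dots> \<le> (\<Sum>i<m. \<Sum>j<n. (cmod (emb z i j))\<^sup>2)"
      using ij member_le_sum[of i "{..<m}" "\<lambda>i. \<Sum>j<n. (cmod (emb z i j))\<^sup>2"] by (simp add: sum_nonneg)
    finally show ?thesis by (simp add: z2)
  qed
  fix \<Psi> assume "\<Psi> \<in> acts"
  then obtain u w where \<Psi>: "\<Psi> = act u w" and uw: "(u, w) \<in> UW" by (auto simp: acts_def)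
  note uzs = UW[OF uw, THEN conjunct1] UW[OF uw, THEN conjunct2]
  have a: "emb (act u w c z) i j = lmul m u c (rmul n w c (emb z)) i j" if "i < m" "j < n" for c z i j
    using emb_act[OF uw] that by (simp add: eqm_def)
  show "clinear (\<Psi> c)" for c
    unfolding clinear_def \<Psi>
  proof (intro conjI allI; rule emb_inj)
    show "eqm m n (emb (act u w c (x + y))) (emb (act u w c x + act u w c y))" for x y
      by (auto simp: eqm_def emb_add a lmul_def rmul_def refl_linear emb_add[abs_def])
    show "eqm m n (emb (act u w c (b *s x))) (emb (b *s act u w c x))" for b x
      by (auto simp: eqm_def emb_smult a lmul_def rmul_def refl_linear emb_smult[abs_def])
  qed
  show "\<Psi> 1 z = z" for z
    unfolding \<Psi> by (rule emb_inj) (auto simp: eqm_def a lmul_def rmul_def refl_one)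
  show "continuous_on (sphere 0 1 \<times> UNIV) (\<lambda>(c, z). \<Psi> c z)"
  proof -
    have "continuous_on (sphere 0 1 \<times> UNIV) (\<lambda>p. act u w (fst p) (snd p) $ k)" for k
    proof -
      obtain i j where ij: "i < m" "j < n" "\<And>z. z $ k = emb z i j" using emb_coord by metis
      have "continuous_on (sphere 0 1 \<times> UNIV) (\<lambda>p. lmul m u (fst p) (rmul n w (fst p) (emb (snd p))) i j)"
        unfolding lmul_def rmul_def refl_def hp_def by (intro continuous_intros)
      then show ?thesis using ij a by simp
    qed
    then have "continuous_on (sphere 0 1 \<times> UNIV) (\<lambda>p. \<chi> k. act u w (fst p) (snd p) $ k)"
      by (intro continuous_on_vec_lambda)
    then show ?thesis by (simp add: \<Psi> case_prod_beta')
  qed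
  fix c assume c: "cmod c = 1"
  have c': "cmod (cnj c) = 1" using c by simp
  show "\<Psi> c (\<Psi> (cnj c) z) = z" for z
    unfolding \<Psi>
  proof (rule emb_inj)
    have "eqm m n (emb (act u w c (act u w (cnj c) z))) (lmul m u c (rmul n w c (emb (act u w (cnj c) z))))"
      by (rule emb_act[OF uw])
    moreover have "eqm m n (lmul m u c (rmul n w c (emb (act u w (cnj c) z)))) (lmul m u c (rmul n w c (lmul m u (cnj c) (rmul n w (cnj c) (emb z)))))"
      by (intro lmul_cong rmul_cong emb_act[OF uw])
    moreover have "lmul m u c (rmul n w c (lmul m u (cnj c) (rmul n w (cnj c) (emb z)))) = emb z"
      by (simp only: lmul_rmul[symmetric] lmul_inverse[OF uzs(1) c] rmul_inverse[OF uzs(2) c])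
    ultimately show "eqm m n (emb (act u w c (act u w (cnj c) z))) (emb z)" by (simp add: eqm_def)
  qed
  show "mip (\<Psi> c x) (\<Psi> c y) = mip x y" for x y
    unfolding \<Psi> mip_def hs_cong[OF emb_act[OF uw] emb_act[OF uw]] using uzs c by (simp add: hs_lmul hs_rmul)
  show "\<Psi> c z \<in> dom" if zd: "z \<in> dom" for z
  proof -
    obtain r where r: "0 \<le> r" "r < 1" "contr m n (emb z) r" using zd by (auto simp: dom_def mat_contr_iff)
    have "contr m n (lmul m u c (rmul n w c (emb z))) r"
      using contr_rmul[OF uzs(2) c r(3)] by (simp add: contr_lmul[OF uzs(1) c])
    then have "contr m n (emb (act u w c z)) r" using contr_cong[OF emb_act[OF uw]] by simp
    then show ?thesis using r by (auto simp: \<Psi> dom_def mat_contr_iff)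
  qed
qed

sublocale cd: circular_domain dom cdom mip acts "dec E"
  by (rule circular)

text \<open>The disc \<open>z + c *s w\<close>, with w the decoded small multiple of the sandwich,
  stays in the closed domain, so extremality makes w vanish. \<open>P_sandwich\<close> is what
  allows the sandwich to be decoded.\<close>

lemma cext_sandwich:
  assumes z: "cd.cext z" and X: "P X" and ij: "i < m" "j < n"
  shows "sandwich m n (emb z) X i j = 0"
proof -
  have "z \<in> cdom" using z unfolding cd.cext_def by blast
  then have zc: "contr m n (emb z) 1" by (simp add: cdom_def)
  obtain \<epsilon> :: real where e: "\<epsilon> > 0"
    "\<And>c. cmod c \<le> 1 \<Longrightarrow> contr m n (\<lambda>i j. emb z i j + c * (of_real \<epsilon> * sandwich m n (emb z) X i j)) 1"
    using contr_sandwich[OF zc, of X] by blast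
  define w where "w = of_real \<epsilon> *s dec (sandwich m n (emb z) X)"
  have ew: "emb w i j = of_real \<epsilon> * sandwich m n (emb z) X i j" if "i < m" "j < n" for i j
    using emb_dec[OF P_sandwich[OF P_emb[of z] X]] that by (simp add: w_def emb_smult eqm_def)
  have "z + c *s w \<in> cdom" if "cmod c \<le> 1" for c
  proof -
    have "eqm m n (emb (z + c *s w)) (\<lambda>i j. emb z i j + c * (of_real \<epsilon> * sandwich m n (emb z) X i j))"
      by (simp add: eqm_def emb_add emb_smult ew)
    then show ?thesis using e(2)[OF that] contr_cong by (auto simp: cdom_def)
  qed
  then have "w = 0" using z by (simp add: cd.cext_def)
  then have "emb w i j = 0" using emb_smult[of 0 0 i j] by simp
  then show ?thesis using ew[OF ij] e(1) by simp
qed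

lemma act_G: "(u, w) \<in> UW \<Longrightarrow> cmod c = 1 \<Longrightarrow> act u w c \<in> cd.G"
proof (rule cd.G_gen)
  show "act u w \<in> cd.gens" if "(u, w) \<in> UW" unfolding cd.gens_def using that by (auto simp: acts_def)
qed

end

section \<open>Type I\<close>

definition dl :: "nat \<Rightarrow> nat \<Rightarrow> complex" where "dl k i = of_bool (i = k)"

lemma sum_dl: "k < n \<Longrightarrow> (\<Sum>i<n. f i * dl k i) = f k" "k < n \<Longrightarrow> (\<Sum>i<n. dl k i * f i) = f k"
  by (simp_all add: dl_def of_bool_def if_distrib[of "\<lambda>x. x * _"] if_distrib[of "(*) _"] cong: if_cong)

lemma cnj_dl [simp]: "cnj (dl k i) = dl k i" by (simp add: dl_def)

lemma hp_dl: "k < n \<Longrightarrow> hp n v (dl k) = v k" "k < n \<Longrightarrow> hp n (dl k) v = cnj (v k)"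
  by (simp_all add: hp_def sum_dl)

lemma vsq_dl: "k < n \<Longrightarrow> vsq n (dl k) = 1"
  using hp_self[of n "dl k"] hp_dl(1)[of k n "dl k"] by (simp add: dl_def)

lemma mv_dl: "k < n \<Longrightarrow> mv n A (dl k) i = A i k"
  by (simp add: mv_def sum_dl)

text \<open>Covers the normal forms of types I, II and III, which permute some coordinates up to a
  phase and delete the others.\<close>

lemma contr_signed_perm:
  assumes "\<And>v i. i \<in> I \<Longrightarrow> cmod (mv n A v i) = cmod (v (\<pi> i))" "\<And>v i. i < m \<Longrightarrow> i \<notin> I \<Longrightarrow> mv n A v i = 0"
    and "I \<subseteq> {..<m}" "inj_on \<pi> I" "\<pi> ` I \<subseteq> {..<n}"
  shows "contr m n A 1"
proof -
  have "vsq m (mv n A v) \<le> vsq n v" for v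
  proof -
    have "vsq m (mv n A v) = (\<Sum>i\<in>I. (cmod (mv n A v i))\<^sup>2)"
      unfolding vsq_def using assms(2,3) by (intro sum.mono_neutral_right) auto
    also have "\<dots> = (\<Sum>i\<in>I. (cmod (v (\<pi> i)))\<^sup>2)" using assms(1) by simp
    also have "\<dots> = (\<Sum>j\<in>\<pi> ` I. (cmod (v j))\<^sup>2)" by (simp add: sum.reindex[OF assms(4)])
    also have "\<dots> \<le> vsq n v" unfolding vsq_def using assms(5) by (intro sum_mono2) auto
    finally show ?thesis .
  qed
  then show ?thesis by (simp add: contr_def nv_def)
qed

definition frefl :: "nat \<Rightarrow> ((nat \<Rightarrow> complex) \<times> complex) list \<Rightarrow> (nat \<Rightarrow> complex) \<Rightarrow> nat \<Rightarrow> complex" where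
  "frefl k l v = foldr (\<lambda>(u, c) v. refl k u c v) l v"

lemma frefl_simps: "frefl k [] v = v" "frefl k ((u, c) # l) v = refl k u c (frefl k l v)"
  by (simp_all add: frefl_def)

definition okl :: "nat \<Rightarrow> ((nat \<Rightarrow> complex) \<times> complex) list \<Rightarrow> bool" where
  "okl k l \<longleftrightarrow> (\<forall>(u, c)\<in>set l. uz k u \<and> cmod c = 1)"

lemma hp_frefl: "okl k l \<Longrightarrow> hp k (frefl k l v) (frefl k l w) = hp k v w"
  by (induction l) (auto simp: frefl_simps okl_def hp_refl)

text \<open>Reflections move the vectors one after another to standard ones. The next reflection
  fixes those already placed, since they are orthogonal both to the vector being moved and to its
  target.\<close>

lemma orthonormal_to_standard:
  assumes X: "\<And>a b. a < N \<Longrightarrow> b < N \<Longrightarrow> hp M (X a) (X b) = of_bool (a = b)"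
  obtains l where "okl M l" "\<And>a i. a < N \<Longrightarrow> i < M \<Longrightarrow> frefl M l (X a) i = of_bool (i = a)"
proof -
  have "\<exists>l. okl M l \<and> (\<forall>a<k. \<forall>i<M. frefl M l (X a) i = dl a i)" if "k \<le> N" for k
    using that
  proof (induction k)
    case 0
    then show ?case by (intro exI[of _ "[]"]) (simp add: okl_def)
  next
    case (Suc k)
    then obtain l where l: "okl M l" "\<And>a i. a < k \<Longrightarrow> i < M \<Longrightarrow> frefl M l (X a) i = dl a i" by auto
    define Y where "Y a = frefl M l (X a)" for a
    have Y: "hp M (Y a) (Y b) = of_bool (a = b)" if "a < N" "b < N" for a b
      using X[OF that] by (simp add: Y_def hp_frefl[OF l(1)])
    have k: "k < N" using Suc by simp
    have Yd: "hp M v (Y a) = hp M v (dl a)" if "a < k" for v a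
      by (rule hp_cong) (use l(2) that in \<open>auto simp: Y_def\<close>)
    have z: "Y k a = 0" if "a < k" "a < M" for a
      using Y[of k a] Yd[OF that(1), of "Y k"] that k by (simp add: hp_dl)
    have Yk: "vsq M (Y k) = 1" using Y[OF k k] by (simp add: hp_self)
    \<comment> \<open>The image of \<open>X k\<close> has length 1 and vanishes in the first k
      coordinates, so a further coordinate must exist.\<close>
    have kM: "k < M"
    proof (rule ccontr)
      assume "\<not> k < M"
      then have "vsq M (Y k) = 0" using z by (simp add: vsq_0_iff)
      then show False using Yk by simp
    qed
    obtain u c where u: "uz M u" "cmod c = 1" "\<And>i. i < M \<Longrightarrow> refl M u c (Y k) i = dl k i"
      "\<And>v i. hp M v (Y k) = 0 \<Longrightarrow> hp M v (dl k) = 0 \<Longrightarrow> refl M u c v i = v i"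
      using refl_exists[of M "Y k" "dl k"] Yk vsq_dl[OF kM] by metis
    have "frefl M ((u, c) # l) (X a) i = dl a i" if a: "a < Suc k" and i: "i < M" for a i
    proof (cases "a = k")
      case True
      then show ?thesis using u(3)[OF i] by (simp add: frefl_simps Y_def)
    next
      case False
      then have ak: "a < k" using a by simp
      have "hp M (Y a) (Y k) = 0" using Y[of a k] ak k by simp
      moreover have "hp M (Y a) (dl k) = 0" using l(2)[OF ak kM] ak kM by (simp add: hp_dl Y_def dl_def)
      ultimately have "refl M u c (Y a) i = Y a i" by (rule u(4))
      then show ?thesis using l(2)[OF ak i] by (simp add: frefl_simps Y_def)
    qed
    moreover have "okl M ((u, c) # l)" using l(1) u by (simp add: okl_def)
    ultimately show ?case by blast
  qed
  from this[of N] obtain l where "okl M l" "\<forall>a<N. \<forall>i<M. frefl M l (X a) i = dl a i" by auto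
  then show thesis using that[of l] by (auto simp: dl_def)
qed

definition unitm :: "nat \<Rightarrow> nat \<Rightarrow> nat \<Rightarrow> nat \<Rightarrow> complex" where
  "unitm p q i j = dl p i * dl q j"

lemma sandwich_unitm:
  assumes "p < m" "q < n"
  shows "sandwich m n A (unitm p q) i j = defect' n A i p * defect m A q j"
proof -
  have "sandwich m n A (unitm p q) i j = (\<Sum>p'<m. (defect' n A i p' * dl p p') * (\<Sum>q'<n. dl q q' * defect m A q' j))"
    by (simp add: sandwich_def unitm_def sum_distrib_left mult_ac)
  then show ?thesis using assms by (simp only: sum_dl) (simp add: sum_distrib_right[symmetric] sum_dl)
qed

lemma sandwich_diff: "sandwich m n A (\<lambda>i j. X i j - Y i j) i j = sandwich m n A X i j - sandwich m n A Y i j"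
  by (simp add: sandwich_def algebra_simps sum_subtractf)

locale type_I =
  fixes m n :: nat and e :: "nat \<times> nat \<Rightarrow> 'd::finite"
  assumes e: "bij_betw e ({..<m} \<times> {..<n}) UNIV"
begin

definition embI :: "complex^'d \<Rightarrow> nat \<Rightarrow> nat \<Rightarrow> complex" where "embI z i j = z $ e (i, j)"
definition decI :: "(nat \<Rightarrow> nat \<Rightarrow> complex) \<Rightarrow> complex^'d" where
  "decI A = (\<chi> k. case inv_into ({..<m} \<times> {..<n}) e k of (i, j) \<Rightarrow> A i j)"
definition UWI :: "((nat \<Rightarrow> complex) \<times> (nat \<Rightarrow> complex)) set" where "UWI = {(u, w). uz m u \<and> uz n w}"
definition EI :: "nat \<Rightarrow> nat \<Rightarrow> complex" where "EI i j = of_bool (i = j)"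

sublocale matrix_domain m n embI decI "\<lambda>_. True" UWI EI
proof
  show "eqm m n (embI (decI A)) A" for A
    unfolding eqm_def embI_def decI_def by (auto simp: bij_betw_inv_into_left[OF e])
  show "\<exists>i<m. \<exists>j<n. \<forall>z. z $ k = embI z i j" for k
  proof -
    have "k \<in> e ` ({..<m} \<times> {..<n})" using bij_betw_imp_surj_on[OF e] by simp
    then show ?thesis by (auto simp: embI_def)
  qed
  show "contr m n EI 1"
  proof (rule contr_signed_perm[where I="{..<min m n}" and \<pi>="\<lambda>i. i"])
    have "mv n EI v i = (if i < n then v i else 0)" for v i
      by (simp add: mv_def EI_def of_bool_def if_distrib[of "\<lambda>x. x * _"] cong: if_cong)
    then show "\<And>v i. i \<in> {..<min m n} \<Longrightarrow> cmod (mv n EI v i) = cmod (v i)"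
      "\<And>v i. i < m \<Longrightarrow> i \<notin> {..<min m n} \<Longrightarrow> mv n EI v i = 0" by auto
  qed auto
qed (auto simp: embI_def UWI_def)

text \<open>Pairing u with the zero vector makes the right factor trivial, so the group contains
  every product of reflections acting on columns alone.\<close>

lemma cols_G:
  assumes "okl m l"
  shows "\<exists>g\<in>cd.G. eqm m n (embI (g z)) (\<lambda>i j. frefl m l (\<lambda>i. embI z i j) i)"
  using assms
proof (induction l)
  case Nil
  show ?case by (rule bexI[OF _ cd.G_id]) (simp add: eqm_def frefl_simps)
next
  case (Cons uc l)
  obtain u c where uc: "uc = (u, c)" by (cases uc)
  have l: "okl m l" and u: "uz m u" "cmod c = 1" using Cons.prems by (auto simp: okl_def uc)
  obtain g where g: "g \<in> cd.G" "eqm m n (embI (g z)) (\<lambda>i j. frefl m l (\<lambda>i. embI z i j) i)" using Cons.IH[OF l] by blast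
  have UW0: "(u, \<lambda>_. 0) \<in> UWI" using u by (simp add: UWI_def uz_def)
  have "eqm m n (embI (act u (\<lambda>_. 0) c (g z))) (lmul m u c (rmul n (\<lambda>_. 0) c (embI (g z))))" by (rule emb_act[OF UW0])
  moreover have "rmul n (\<lambda>_. 0) c (embI (g z)) = embI (g z)" by (simp add: rmul_def fun_eq_iff refl_zero)
  moreover have "eqm m n (lmul m u c (embI (g z))) (lmul m u c (\<lambda>i j. frefl m l (\<lambda>i. embI z i j) i))" by (rule lmul_cong[OF g(2)])
  ultimately have "eqm m n (embI (act u (\<lambda>_. 0) c (g z))) (\<lambda>i j. frefl m (uc # l) (\<lambda>i. embI z i j) i)"
    by (simp add: eqm_def lmul_def uc frefl_simps)
  then show ?case using cd.G_compose[OF act_G[OF UW0 u(2)] g(1)] by (rule bexI)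
qed

lemma rows_G:
  assumes "okl n l"
  shows "\<exists>g\<in>cd.G. eqm m n (embI (g z)) (\<lambda>i j. frefl n l (embI z i) j)"
  using assms
proof (induction l)
  case Nil
  show ?case by (rule bexI[OF _ cd.G_id]) (simp add: eqm_def frefl_simps)
next
  case (Cons uc l)
  obtain u c where uc: "uc = (u, c)" by (cases uc)
  have l: "okl n l" and u: "uz n u" "cmod c = 1" using Cons.prems by (auto simp: okl_def uc)
  obtain g where g: "g \<in> cd.G" "eqm m n (embI (g z)) (\<lambda>i j. frefl n l (embI z i) j)" using Cons.IH[OF l] by blast
  have UW0: "(\<lambda>_. 0, u) \<in> UWI" using u by (simp add: UWI_def uz_def)
  have "eqm m n (embI (act (\<lambda>_. 0) u c (g z))) (lmul m (\<lambda>_. 0) c (rmul n u c (embI (g z))))" by (rule emb_act[OF UW0])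
  moreover have "lmul m (\<lambda>_. 0) c B = B" for B by (simp add: lmul_def fun_eq_iff refl_zero)
  moreover have "eqm m n (rmul n u c (embI (g z))) (rmul n u c (\<lambda>i j. frefl n l (embI z i) j))" by (rule rmul_cong[OF g(2)])
  ultimately have "eqm m n (embI (act (\<lambda>_. 0) u c (g z))) (\<lambda>i j. frefl n (uc # l) (embI z i) j)"
    by (simp add: eqm_def rmul_def uc frefl_simps)
  then show ?case using cd.G_compose[OF act_G[OF UW0 u(2)] g(1)] by (rule bexI)
qed

text \<open>Sandwiching matrix units shows that every entry of one defect times every entry of the
  other is 0, so one defect vanishes. Hence the columns or the rows of the matrix are orthonormal
  and can be moved to standard vectors.\<close>

lemma homogeneous: "homogeneous_domain dom cdom mip acts (decI EI)"
proof unfold_locales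
  fix z assume z: "cd.cext z"
  define A where "A = embI z"
  have prod0: "defect' n A i p * defect m A q j = 0" if "i < m" "p < m" "q < n" "j < n" for i p q j
    using cext_sandwich[OF z TrueI that(1,4), of "unitm p q"] that by (simp add: sandwich_unitm A_def)
  have fin: "\<exists>g\<in>cd.G. g z = decI EI" if ex: "\<exists>g\<in>cd.G. eqm m n (embI (g z)) EI"
  proof -
    obtain g where g: "g \<in> cd.G" "eqm m n (embI (g z)) EI" using ex by blast
    have "g z = decI EI" by (rule emb_inj) (use g(2) emb_dec[of EI] in \<open>simp add: eqm_def\<close>)
    then show ?thesis using g(1) by blast
  qed
  show "\<exists>g\<in>cd.G. g z = decI EI"
  proof (cases "\<forall>q<n. \<forall>j<n. defect m A q j = 0")
    case True
    have "hp m (\<lambda>i. A i a) (\<lambda>i. A i b) = of_bool (a = b)" if "a < n" "b < n" for a b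
      using True[rule_format, OF that(2,1)] by (auto simp: defect_def hp_def mult.commute)
    then obtain l where l: "okl m l" "\<And>a i. a < n \<Longrightarrow> i < m \<Longrightarrow> frefl m l (\<lambda>i. A i a) i = of_bool (i = a)"
      using orthonormal_to_standard[of n m "\<lambda>a i. A i a"] by blast
    obtain g where g: "g \<in> cd.G" "eqm m n (embI (g z)) (\<lambda>i j. frefl m l (\<lambda>i. embI z i j) i)"
      using cols_G[OF l(1)] by blast
    have "eqm m n (embI (g z)) EI" using g(2) l(2) by (auto simp: eqm_def EI_def A_def)
    then show ?thesis using fin g(1) by blast
  next
    case False
    then have D0: "defect' n A i p = 0" if "i < m" "p < m" for i p using prod0 that by fastforce
    have "hp n (A a) (A b) = of_bool (a = b)" if "a < m" "b < m" for a b
      using D0[OF that] by (auto simp: defect'_def hp_def)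
    then obtain l where l: "okl n l" "\<And>a i. a < m \<Longrightarrow> i < n \<Longrightarrow> frefl n l (A a) i = of_bool (i = a)"
      using orthonormal_to_standard[of m n A] by blast
    obtain g where g: "g \<in> cd.G" "eqm m n (embI (g z)) (\<lambda>i j. frefl n l (embI z i) j)"
      using rows_G[OF l(1)] by blast
    have "eqm m n (embI (g z)) EI" using g(2) l(2) by (auto simp: eqm_def EI_def A_def)
    then show ?thesis using fin g(1) by blast
  qed
qed

end

lemma cartan_I_toeplitz:
  fixes \<Omega> :: "(complex^'d::finite) set"
  assumes "cartan_I \<Omega>" "linf (shilov_measure \<Omega>) \<phi>" "toeplitz_compact (shilov_measure \<Omega>) \<phi>"
  shows "AE z in shilov_measure \<Omega>. \<phi> z = 0"
proof -
  obtain m n and e :: "nat \<times> nat \<Rightarrow> 'd" where e: "bij_betw e ({..<m} \<times> {..<n}) UNIV"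
    and \<Omega>: "\<Omega> = {z. mat_contr m n (\<lambda>i j. z $ e (i, j))}"
    using assms(1) unfolding cartan_I_def by blast
  interpret type_I m n e by unfold_locales (rule e)
  have eq: "\<Omega> = dom" unfolding \<Omega> dom_def by (simp add: embI_def[abs_def])
  from homogeneous_domain.toeplitz_zero[OF homogeneous] assms(2,3) show ?thesis
    unfolding eq by blast
qed

section \<open>Type III\<close>

text \<open>Both structured cases in one: s = 1 for symmetric, s = -1 for skew-symmetric
  matrices.\<close>

definition Ps :: "nat \<Rightarrow> complex \<Rightarrow> (nat \<Rightarrow> nat \<Rightarrow> complex) \<Rightarrow> bool" where
  "Ps n s A \<longleftrightarrow> (\<forall>i<n. \<forall>j<n. A j i = s * A i j)"

lemma PsD: "Ps n s A \<Longrightarrow> i < n \<Longrightarrow> j < n \<Longrightarrow> A j i = s * A i j"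
  unfolding Ps_def by blast

definition diag_uz :: "nat \<Rightarrow> ((nat \<Rightarrow> complex) \<times> (nat \<Rightarrow> complex)) set" where
  "diag_uz n = {(u, u) | u. uz n u}"

text \<open>Transposition exchanges the left and the right factor, and these commute.\<close>

lemma Ps_act:
  assumes A: "Ps n s A" shows "Ps n s (lmul n u c (rmul n u c A))"
  unfolding Ps_def
proof (intro allI impI)
  fix i j assume ij: "i < n" "j < n"
  have tr: "lmul n u c B j i = rmul n u c (\<lambda>i j. B j i) i j" "rmul n u c B j i = lmul n u c (\<lambda>i j. B j i) i j" for B i j
    by (simp_all add: lmul_def rmul_def)
  have "lmul n u c (rmul n u c A) j i = lmul n u c (rmul n u c (\<lambda>i j. A j i)) i j"
  proof -
    have "(\<lambda>i j. rmul n u c A j i) = lmul n u c (\<lambda>i j. A j i)" by (intro ext) (rule tr(2))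
    then show ?thesis unfolding tr(1)[of "rmul n u c A" j i] by (simp only: lmul_rmul)
  qed
  also have "\<dots> = lmul n u c (rmul n u c (\<lambda>i j. s * A i j)) i j"
  proof -
    have "eqm n n (\<lambda>i j. A j i) (\<lambda>i j. s * A i j)" unfolding eqm_def by (intro allI impI PsD[OF A])
    from lmul_cong[OF rmul_cong[OF this]] show ?thesis using ij by (simp add: eqm_def)
  qed
  also have "\<dots> = s * lmul n u c (rmul n u c A) i j" by (simp add: lmul_def rmul_def refl_linear)
  finally show "lmul n u c (rmul n u c A) j i = s * lmul n u c (rmul n u c A) i j" .
qed

text \<open>If the transpose of A is s A with s unimodular, the two defects are transposes of each
  other, so statements about the sandwich concern a single matrix.\<close>

lemma defect'_Ps:
  assumes A: "Ps n s A" and s: "s * cnj s = 1" and ip: "i < n" "p < n"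
  shows "defect' n A i p = defect n A p i"
proof -
  have "A i k * cnj (A p k) = cnj (A k p) * A k i" if "k < n" for k
  proof -
    have "A i k = s * A k i" "A p k = s * A k p" by (rule PsD[OF A that ip(1)], rule PsD[OF A that ip(2)])
    then have "A i k * cnj (A p k) = (s * cnj s) * (cnj (A k p) * A k i)" by (simp add: mult_ac)
    then show ?thesis by (simp add: s)
  qed
  then show ?thesis by (auto simp: defect_def defect'_def)
qed

lemma Ps_sandwich:
  assumes A: "Ps n s A" and X: "Ps n s X" and s: "s = 1 \<or> s = - 1"
  shows "Ps n s (sandwich n n A X)"
  unfolding Ps_def
proof (intro allI impI)
  fix i j assume ij: "i < n" "j < n"
  have s1: "s * cnj s = 1" and s2: "s * s = 1" using s by auto
  have "sandwich n n A X j i = (\<Sum>p<n. \<Sum>q<n. defect n A p j * X p q * defect n A q i)"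
    unfolding sandwich_def using ij by (intro sum.cong refl) (simp add: defect'_Ps[OF A s1])
  also have "\<dots> = (\<Sum>q<n. \<Sum>p<n. defect n A p j * X p q * defect n A q i)" by (rule sum.swap)
  also have "\<dots> = (\<Sum>q<n. \<Sum>p<n. s * (defect n A q i * X q p * defect n A p j))"
  proof (intro sum.cong refl)
    fix q p assume "q \<in> {..<n}" "p \<in> {..<n}"
    then have "X p q = s * X q p" by (intro PsD[OF X]) auto
    then show "defect n A p j * X p q * defect n A q i = s * (defect n A q i * X q p * defect n A p j)" by (simp add: mult_ac)
  qed
  also have "\<dots> = s * (\<Sum>q<n. \<Sum>p<n. defect' n A i q * X q p * defect n A p j)"
    unfolding sum_distrib_left using ij by (intro sum.cong refl) (simp add: defect'_Ps[OF A s1])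
  finally show "sandwich n n A X j i = s * sandwich n n A X i j" by (simp add: sandwich_def)
qed

text \<open>Under congruence by U the relation A (cnj x) = a turns into U A U^T (cnj (U x)) = U a,
  because U^T inverts the conjugate of the unitary U.\<close>

lemma mv_two_sided:
  assumes u: "uz n u" "cmod c = 1"
    and x: "\<And>i. i < n \<Longrightarrow> refl n u c x i = y i" and a: "\<And>i. i < n \<Longrightarrow> refl n u c a i = b i"
    and A: "\<And>i. i < n \<Longrightarrow> mv n A (\<lambda>j. cnj (x j)) i = a i" and i: "i < n"
  shows "mv n (lmul n u c (rmul n u c A)) (\<lambda>j. cnj (y j)) i = b i"
proof -
  have c': "cmod (cnj c) = 1" using u(2) by simp
  have bk: "refl n u (cnj c) y j = x j" if "j < n" for j
  proof -
    have "refl n u (cnj c) y j = refl n u (cnj c) (refl n u c x) j" by (rule refl_cong[OF _ that]) (simp add: x)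
    also have "\<dots> = x j" using refl_inverse[OF u(1) c', of x] by simp
    finally show ?thesis .
  qed
  have cj: "refl n (\<lambda>j. cnj (u j)) c (\<lambda>j. cnj (y j)) j = cnj (refl n u (cnj c) y j)" for j
    by (simp add: refl_def hp_def)
  have "mv n (lmul n u c (rmul n u c A)) (\<lambda>j. cnj (y j)) i
      = refl n u c (mv n A (refl n (\<lambda>j. cnj (u j)) c (\<lambda>j. cnj (y j)))) i"
    by (simp add: mv_lmul mv_rmul)
  also have "\<dots> = refl n u c (mv n A (\<lambda>j. cnj (x j))) i"
    by (rule arg_cong[of _ _ "\<lambda>v. refl n u c v i"], rule mv_cong) (simp add: cj bk)
  also have "\<dots> = refl n u c a i" by (rule refl_cong[OF A i])
  finally show ?thesis using a[OF i] by simp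
qed

locale sym_matrix_domain = matrix_domain n n emb dec "Ps n s" "diag_uz n" E
  for n :: nat and s :: complex and emb :: "complex^'d::finite \<Rightarrow> nat \<Rightarrow> nat \<Rightarrow> complex" and dec E +
  assumes s: "s = 1 \<or> s = - 1"
begin

lemma emb_sym: "i < n \<Longrightarrow> j < n \<Longrightarrow> emb z j i = s * emb z i j"
  by (rule PsD[OF P_emb])

lemma finish:
  assumes "g \<in> cd.G" "eqm n n (emb (g z)) E"
  shows "\<exists>g\<in>cd.G. g z = dec E"
proof -
  have "g z = dec E" by (rule emb_inj) (use assms(2) emb_dec[OF E(1)] in \<open>simp add: eqm_def\<close>)
  then show ?thesis using assms(1) by blast
qed

lemma act_props:
  assumes u: "uz n u" "cmod c = 1" and z: "cd.cext z"
  shows "act u u c \<in> cd.G" "cd.cext (act u u c z)"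
    "i < n \<Longrightarrow> mv n (emb (act u u c z)) v i = mv n (lmul n u c (rmul n u c (emb z))) v i"
proof -
  have uw: "(u, u) \<in> diag_uz n" using u by (simp add: diag_uz_def)
  show g: "act u u c \<in> cd.G" by (rule act_G[OF uw u(2)])
  show "cd.cext (act u u c z)" by (rule cd.cext_G[OF z g])
  show "mv n (emb (act u u c z)) v i = mv n (lmul n u c (rmul n u c (emb z))) v i" if "i < n"
    using emb_act[OF uw, of c z] that by (simp add: mv_def eqm_def)
qed

end

locale type_III =
  fixes n :: nat and e :: "nat \<times> nat \<Rightarrow> 'd::finite"
  assumes e: "bij_betw e {(i, j). i \<le> j \<and> j < n} UNIV"
begin

definition embS :: "complex^'d \<Rightarrow> nat \<Rightarrow> nat \<Rightarrow> complex" where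
  "embS z i j = (if i \<le> j then z $ e (i, j) else z $ e (j, i))"
definition decS :: "(nat \<Rightarrow> nat \<Rightarrow> complex) \<Rightarrow> complex^'d" where
  "decS A = (\<chi> k. case inv_into {(i, j). i \<le> j \<and> j < n} e k of (i, j) \<Rightarrow> A i j)"
definition ES :: "nat \<Rightarrow> nat \<Rightarrow> complex" where "ES i j = dl j i"

sublocale sym_matrix_domain n 1 embS decS ES
proof
  show "eqm n n (embS (decS A)) A" if A: "Ps n 1 A" for A
    unfolding eqm_def
  proof (intro allI impI)
    fix i j assume ij: "i < n" "j < n"
    have "decS A $ e (i, j) = A i j" if "i \<le> j" "j < n" for i j
      using that by (simp add: decS_def bij_betw_inv_into_left[OF e])
    then have "embS (decS A) i j = (if i \<le> j then A i j else A j i)" using ij by (simp add: embS_def)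
    moreover have "A j i = A i j" using PsD[OF A ij] by simp
    ultimately show "embS (decS A) i j = A i j" by presburger
  qed
  show "\<exists>i<n. \<exists>j<n. \<forall>z. z $ k = embS z i j" for k
  proof -
    have "k \<in> e ` {(i, j). i \<le> j \<and> j < n}" using bij_betw_imp_surj_on[OF e] by simp
    then obtain i j where "i \<le> j" "j < n" "k = e (i, j)" by auto
    then show ?thesis by (intro exI[of _ i] conjI exI[of _ j]) (auto simp: embS_def)
  qed
  show "contr n n ES 1"
  proof (rule contr_signed_perm[where I="{..<n}" and \<pi>="\<lambda>i. i"])
    have "mv n ES v i = v i" if "i < n" for v i
      using that sum_dl(2)[of i n v] by (simp add: mv_def ES_def dl_def eq_commute)
    then show "\<And>v i. i \<in> {..<n} \<Longrightarrow> cmod (mv n ES v i) = cmod (v i)" by simp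
  qed auto
  show "Ps n 1 (embS z)" for z by (auto simp: Ps_def embS_def)
  show "Ps n 1 ES" by (simp add: Ps_def ES_def dl_def eq_commute)
  show "Ps n 1 (lmul n u c (rmul n w c A))" if "(u, w) \<in> diag_uz n" "Ps n 1 A" for u w c A
    using that by (auto simp: diag_uz_def intro: Ps_act)
  show "Ps n 1 (sandwich n n A X)" if "Ps n 1 A" "Ps n 1 X" for A X by (rule Ps_sandwich[OF that]) simp
qed (auto simp: embS_def diag_uz_def)

text \<open>Sandwiching the matrix unit at (j, j) gives, at (i, i), the square of one defect entry;
  thus the whole defect vanishes.\<close>

lemma cext_unitary:
  assumes z: "cd.cext z" and ij: "i < n" "j < n"
  shows "(\<Sum>k<n. embS z i k * cnj (embS z j k)) = of_bool (i = j)"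
proof -
  have "Ps n 1 (unitm j j)" by (simp add: Ps_def unitm_def mult.commute)
  from cext_sandwich[OF z this ij(1) ij(1)] have "defect' n (embS z) i j * defect n (embS z) j i = 0"
    using ij by (simp add: sandwich_unitm)
  moreover have "defect' n (embS z) i j = defect n (embS z) j i"
    by (rule defect'_Ps[OF P_emb]) (use ij in auto)
  ultimately have "defect' n (embS z) i j = 0" by simp
  then show ?thesis by (simp add: defect'_def)
qed

text \<open>Takagi's argument: \<open>x \<mapsto> A (cnj x)\<close> is an antilinear involution, hence has a fixed vector in the span of
  \<open>\<delta>\<^sub>k\<close> and \<open>A \<delta>\<^sub>k\<close>; a reflection taking it to \<open>\<delta>\<^sub>k\<close> splits off one dimension.\<close>
lemma reduce_cols:
  assumes z: "cd.cext z"
  shows "k \<le> n \<Longrightarrow> \<exists>g\<in>cd.G. cd.cext (g z) \<and> (\<forall>j<k. \<forall>i<n. embS (g z) i j = dl j i)"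
proof (induction k)
  case 0
  show ?case by (rule bexI[OF _ cd.G_id]) (use z in simp)
next
  case (Suc k)
  then obtain g where g: "g \<in> cd.G" "cd.cext (g z)" "\<And>i j. j < k \<Longrightarrow> i < n \<Longrightarrow> embS (g z) i j = dl j i" by auto
  have k: "k < n" using Suc by simp
  define A where "A = embS (g z)"
  have sym: "A j i = A i j" if "i < n" "j < n" for i j using emb_sym[OF that, of "g z"] by (simp add: A_def)
  have uni: "(\<Sum>l<n. A i l * cnj (A j l)) = of_bool (i = j)" if "i < n" "j < n" for i j
    unfolding A_def by (rule cext_unitary[OF g(2) that])
  have Ak0: "A j k = 0" if "j < k" for j
    using sym[of j k] g(3)[OF that k] k that by (simp add: A_def dl_def)
  \<comment> \<open>By unitarity and symmetry the antilinear map fixes \<delta>_k + A \<delta>_k. If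
    this vector is 0, then A \<delta>_k = -\<delta>_k and \<i> \<delta>_k is fixed instead. Rows and
    columns before k are already standard, so x0 has no component there.\<close>
  obtain x0 where x0: "vsq n x0 > 0" "\<And>i. i < n \<Longrightarrow> mv n A (\<lambda>j. cnj (x0 j)) i = x0 i" "\<And>j. j < k \<Longrightarrow> x0 j = 0"
  proof (cases "\<forall>i<n. dl k i + A i k = 0")
    case True
    show ?thesis
    proof (rule that[of "\<lambda>i. \<i> * dl k i"])
      show "vsq n (\<lambda>i. \<i> * dl k i) > 0" using vsq_dl[OF k] by (simp add: vsq_scale)
      show "mv n A (\<lambda>j. cnj (\<i> * dl k j)) i = \<i> * dl k i" if i: "i < n" for i
      proof -
        have "mv n A (\<lambda>j. cnj (\<i> * dl k j)) i = - \<i> * mv n A (dl k) i" by (simp add: mv_def sum_distrib_left mult_ac sum_negf)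
        also have "\<dots> = - \<i> * A i k" by (simp add: mv_dl[OF k])
        also have "A i k = - dl k i" using True i by (simp add: add_eq_0_iff)
        finally show ?thesis by simp
      qed
      show "\<i> * dl k j = 0" if "j < k" for j using that by (simp add: dl_def)
    qed
  next
    case False
    show ?thesis
    proof (rule that[of "\<lambda>i. dl k i + A i k"])
      show "vsq n (\<lambda>i. dl k i + A i k) > 0" using False by (auto simp: vsq_pos_iff)
      show "mv n A (\<lambda>j. cnj (dl k j + A j k)) i = dl k i + A i k" if i: "i < n" for i
      proof -
        have "mv n A (\<lambda>j. cnj (dl k j + A j k)) i = mv n A (dl k) i + (\<Sum>j<n. A i j * cnj (A j k))"
          by (simp add: mv_def distrib_left sum.distrib)
        also have "(\<Sum>j<n. A i j * cnj (A j k)) = (\<Sum>j<n. A i j * cnj (A k j))"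
        proof (intro sum.cong refl)
          fix j assume "j \<in> {..<n}"
          then have "A j k = A k j" by (intro sym k) simp
          then show "A i j * cnj (A j k) = A i j * cnj (A k j)" by (rule arg_cong)
        qed
        also have "\<dots> = dl k i" using uni[OF i k] by (simp add: dl_def)
        finally show ?thesis by (simp add: mv_dl[OF k])
      qed
      show "dl k j + A j k = 0" if "j < k" for j using that Ak0[OF that] by (simp add: dl_def)
    qed
  qed
  define x where "x i = of_real (1 / nv n x0) * x0 i" for i
  have nx0: "nv n x0 > 0" using x0(1) by (simp add: nv_def)
  have x1: "vsq n x = 1"
    unfolding x_def[abs_def] vsq_scale using nx0 by (simp add: norm_divide power_divide nv_power2[symmetric])
  have Ax: "mv n A (\<lambda>j. cnj (x j)) i = x i" if "i < n" for i
  proof -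
    have "mv n A (\<lambda>j. cnj (x j)) i = of_real (1 / nv n x0) * mv n A (\<lambda>j. cnj (x0 j)) i"
      by (simp add: mv_def x_def sum_distrib_left mult_ac)
    then show ?thesis by (simp add: x0(2)[OF that] x_def)
  qed
  have "vsq n x = vsq n (dl k)" by (simp add: x1 vsq_dl[OF k])
  from refl_exists[OF this] obtain u c where u: "uz n u" "cmod c = 1" "\<And>i. i < n \<Longrightarrow> refl n u c x i = dl k i"
    "\<And>v i. hp n v x = 0 \<Longrightarrow> hp n v (dl k) = 0 \<Longrightarrow> refl n u c v i = v i" by metis
  note p = act_props[OF u(1,2) g(2)]
  have "embS (act u u c (g z)) i j = dl j i" if j: "j < Suc k" and i: "i < n" for i j
  proof -
    have jn: "j < n" using j k by simp
    have "mv n (lmul n u c (rmul n u c A)) (\<lambda>i. cnj (dl j i)) i = dl j i"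
    proof (cases "j = k")
      case True
      show ?thesis unfolding True by (rule mv_two_sided[OF u(1,2) u(3) u(3) Ax i])
    next
      case False
      then have jk: "j < k" using j by simp
      \<comment> \<open>The earlier standard vectors are orthogonal to x and \<delta>_k, so the
        reflection leaves the finished columns alone.\<close>
      have fx: "refl n u c (dl j) i = dl j i" for i
        by (rule u(4)) (use jk jn k in \<open>simp_all add: hp_dl x_def x0(3) dl_def\<close>)
      show ?thesis
        by (rule mv_two_sided[OF u(1,2) fx fx _ i]) (use g(3)[OF jk] jn in \<open>simp add: mv_dl A_def\<close>)
    qed
    then show ?thesis using p(3)[OF i, of "dl j"] by (simp add: A_def mv_dl[OF jn])
  qed
  moreover have "(\<lambda>z. act u u c (g z)) \<in> cd.G" by (rule cd.G_compose[OF p(1) g(1)])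
  ultimately show ?case using p(2) by (intro bexI[of _ "\<lambda>z. act u u c (g z)"]) auto
qed

lemma homogeneous: "homogeneous_domain dom cdom mip acts (decS ES)"
proof unfold_locales
  fix z assume "cd.cext z"
  from reduce_cols[OF this, of n] obtain g where "g \<in> cd.G" "\<forall>j<n. \<forall>i<n. embS (g z) i j = dl j i" by auto
  then show "\<exists>g\<in>cd.G. g z = decS ES" by (intro finish) (auto simp: eqm_def ES_def)
qed

end

lemma cartan_III_toeplitz:
  fixes \<Omega> :: "(complex^'d::finite) set"
  assumes "cartan_III \<Omega>" "linf (shilov_measure \<Omega>) \<phi>" "toeplitz_compact (shilov_measure \<Omega>) \<phi>"
  shows "AE z in shilov_measure \<Omega>. \<phi> z = 0"
proof -
  obtain n and e :: "nat \<times> nat \<Rightarrow> 'd" where e: "bij_betw e {(i, j). i \<le> j \<and> j < n} UNIV"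
    and \<Omega>: "\<Omega> = {z. mat_contr n n (\<lambda>i j. if i \<le> j then z $ e (i, j) else z $ e (j, i))}"
    using assms(1) unfolding cartan_III_def by blast
  interpret type_III n e by unfold_locales (rule e)
  have eq: "\<Omega> = dom" unfolding \<Omega> dom_def by (simp add: embS_def[abs_def])
  from homogeneous_domain.toeplitz_zero[OF homogeneous] assms(2,3) show ?thesis
    unfolding eq by blast
qed

section \<open>Type II\<close>

text \<open>Diagonal blocks with rows (0, -1) and (1, 0). For odd n the last row has even index and
  points at column n, so within the range it is 0.\<close>

definition JJ :: "nat \<Rightarrow> nat \<Rightarrow> complex" where
  "JJ i j = (if odd i then dl (i - 1) j else - dl (Suc i) j)"

lemma JJ_skew: "JJ j i = - JJ i j"
proof -
  have "(j = i - 1) = (i = Suc j)" if "odd i" "even j" using that by (auto elim: oddE)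
  moreover have "(i = j - 1) = (j = Suc i)" if "odd j" "even i" using that by (auto elim: oddE)
  moreover have "j \<noteq> i - 1" "i \<noteq> j - 1" if "odd i" "odd j" using that by presburger+
  moreover have "j \<noteq> Suc i" "i \<noteq> Suc j" if "even i" "even j" using that by auto
  ultimately show ?thesis by (cases "even i"; cases "even j") (auto simp: JJ_def dl_def)
qed

lemma JJ_col: "JJ i j = (if even j then dl (Suc j) i else - dl (j - 1) i)"
  using JJ_skew[of i j] by (simp add: JJ_def)

locale type_II =
  fixes n :: nat and e :: "nat \<times> nat \<Rightarrow> 'd::finite"
  assumes e: "bij_betw e {(i, j). i < j \<and> j < n} UNIV"
begin

definition embA :: "complex^'d \<Rightarrow> nat \<Rightarrow> nat \<Rightarrow> complex" where
  "embA z i j = (if i < j then z $ e (i, j) else if j < i then - (z $ e (j, i)) else 0)"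
definition decA :: "(nat \<Rightarrow> nat \<Rightarrow> complex) \<Rightarrow> complex^'d" where
  "decA A = (\<chi> k. case inv_into {(i, j). i < j \<and> j < n} e k of (i, j) \<Rightarrow> A i j)"

sublocale sym_matrix_domain n "- 1" embA decA JJ
proof
  show "eqm n n (embA (decA A)) A" if A: "Ps n (- 1) A" for A
    unfolding eqm_def
  proof (intro allI impI)
    fix i j assume ij: "i < n" "j < n"
    have d: "decA A $ e (i, j) = A i j" if "i < j" "j < n" for i j
      using that by (simp add: decA_def bij_betw_inv_into_left[OF e])
    have "A i i = - A i i" using PsD[OF A ij(1) ij(1)] by simp
    then have "A i i = 0" by simp
    moreover have "A j i = - A i j" using PsD[OF A ij] by simp
    ultimately show "embA (decA A) i j = A i j" using ij d[of i j] d[of j i]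
      by (cases i j rule: linorder_cases) (auto simp: embA_def)
  qed
  show "\<exists>i<n. \<exists>j<n. \<forall>z. z $ k = embA z i j" for k
  proof -
    have "k \<in> e ` {(i, j). i < j \<and> j < n}" using bij_betw_imp_surj_on[OF e] by simp
    then obtain i j where "i < j" "j < n" "k = e (i, j)" by auto
    then show ?thesis by (intro exI[of _ i] conjI exI[of _ j]) (auto simp: embA_def)
  qed
  show "contr n n JJ 1"
  proof (rule contr_signed_perm[where I="{i. i < n \<and> (odd i \<or> Suc i < n)}" and \<pi>="\<lambda>i. if odd i then i - 1 else Suc i"])
    show "cmod (mv n JJ v i) = cmod (v (if odd i then i - 1 else Suc i))" if "i \<in> {i. i < n \<and> (odd i \<or> Suc i < n)}" for v i
      using that sum_dl(2)[of "i - 1" n v] sum_dl(2)[of "Suc i" n v] by (auto simp: mv_def JJ_def sum_negf)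
    show "mv n JJ v i = 0" if "i < n" "i \<notin> {i. i < n \<and> (odd i \<or> Suc i < n)}" for v i
      using that by (auto simp: mv_def JJ_def dl_def intro!: sum.neutral)
    show "inj_on (\<lambda>i. if odd i then i - 1 else Suc i) {i. i < n \<and> (odd i \<or> Suc i < n)}"
      by (rule inj_on_inverseI[of _ "\<lambda>i. if odd i then i - 1 else Suc i"]) auto
  qed auto
  show "Ps n (- 1) (embA z)" for z by (auto simp: Ps_def embA_def)
  show "Ps n (- 1) JJ" unfolding Ps_def mult_minus1 by (intro allI impI JJ_skew)
  show "Ps n (- 1) (lmul n u c (rmul n w c A))" if "(u, w) \<in> diag_uz n" "Ps n (- 1) A" for u w c A
    using that by (auto simp: diag_uz_def intro: Ps_act)
  show "Ps n (- 1) (sandwich n n A X)" if "Ps n (- 1) A" "Ps n (- 1) X" for A X by (rule Ps_sandwich[OF that]) simp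
qed (auto simp: embA_def diag_uz_def algebra_simps)

text \<open>Sandwiching the difference of the matrix units at (p, q) and (q, p) makes all 2 by 2
  minors of the defect vanish: it has rank at most 1.\<close>

lemma cext_minors:
  assumes z: "cd.cext z" and "p < n" "q < n" "i < n" "j < n"
  shows "defect n (embA z) p i * defect n (embA z) q j = defect n (embA z) q i * defect n (embA z) p j"
proof -
  have "Ps n (- 1) (\<lambda>i j. unitm p q i j - unitm q p i j)" by (simp add: Ps_def unitm_def mult.commute)
  from cext_sandwich[OF z this assms(4,5)]
  have "defect' n (embA z) i p * defect n (embA z) q j = defect' n (embA z) i q * defect n (embA z) p j"
    using assms by (simp add: sandwich_diff sandwich_unitm)
  then show ?thesis using assms by (simp add: defect'_Ps[OF P_emb])
qed

text \<open>A defect of rank at most 1 kills some unit x in the span of \<delta>_k and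
  \<delta>_(k+1). Then y = A x is a unit vector, orthogonal to cnj x by skew-symmetry. Two
  reflections take cnj x to \<delta>_k and y to \<delta>_(k+1), which brings column k into normal
  form; column k+1 follows.\<close>

lemma reduce_step:
  assumes z: "cd.cext z" and k: "even k" "Suc k < n"
    and A: "\<And>i j. j < k \<Longrightarrow> i < n \<Longrightarrow> embA z i j = JJ i j"
  shows "\<exists>g\<in>cd.G. cd.cext (g z) \<and> (\<forall>j<k + 2. \<forall>i<n. embA (g z) i j = JJ i j)"
proof -
  define A' where "A' = embA z"
  define D where "D = defect n A'"
  have kn: "k < n" using k by simp
  obtain x0 where x0: "vsq n x0 > 0" "\<And>i. i < n \<Longrightarrow> mv n D x0 i = 0" "\<And>j. j \<noteq> k \<Longrightarrow> j \<noteq> Suc k \<Longrightarrow> x0 j = 0"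
  proof (cases "\<forall>i<n. D i (Suc k) = 0")
    case True
    show ?thesis
      by (rule that[of "dl (Suc k)"]) (use True k in \<open>auto simp: vsq_dl mv_dl dl_def\<close>)
  next
    case False
    then obtain r where r: "r < n" "D r (Suc k) \<noteq> 0" by blast
    \<comment> \<open>This combination is annihilated by row r, and by every other row because the
      minors vanish.\<close>
    define y where "y i = D r (Suc k) * dl k i + (- D r k) * dl (Suc k) i" for i
    show ?thesis
    proof (rule that[of y])
      have "y k \<noteq> 0" using r by (simp add: y_def dl_def)
      then show "vsq n y > 0" using kn by (auto simp: vsq_pos_iff)
      show "mv n D y i = 0" if i: "i < n" for i
      proof -
        have "mv n D y i = D r (Suc k) * mv n D (dl k) i + (- D r k) * mv n D (dl (Suc k)) i"
          by (simp add: mv_def y_def algebra_simps sum.distrib sum_distrib_left sum_negf sum_subtractf)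
        also have "\<dots> = D r (Suc k) * D i k - D r k * D i (Suc k)" using kn k by (simp add: mv_dl)
        also have "\<dots> = 0"
          using cext_minors[OF z r(1) i, of "Suc k" k] k kn by (simp add: D_def A'_def mult.commute)
        finally show ?thesis .
      qed
      show "y j = 0" if "j \<noteq> k" "j \<noteq> Suc k" for j using that by (simp add: y_def dl_def)
    qed
  qed
  define x where "x i = of_real (1 / nv n x0) * x0 i" for i
  have nx0: "nv n x0 > 0" using x0(1) by (simp add: nv_def)
  have x1: "vsq n x = 1"
    unfolding x_def[abs_def] vsq_scale using nx0 by (simp add: norm_divide power_divide nv_power2[symmetric])
  have Dx: "mv n D x i = 0" if "i < n" for i
  proof -
    have "mv n D x i = of_real (1 / nv n x0) * mv n D x0 i" by (simp add: mv_def x_def sum_distrib_left mult_ac)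
    then show ?thesis using x0(2)[OF that] by simp
  qed
  have xs: "x j = 0" if "j \<noteq> k" "j \<noteq> Suc k" for j using x0(3)[OF that] by (simp add: x_def)
  define y where "y = mv n A' x"
  \<comment> \<open>D x = 0 means that x is the adjoint of A applied to A x, so A preserves the
    length of x.\<close>
  have y1: "vsq n y = 1"
  proof -
    have "x i = mv n (adj A') y i" if "i < n" for i
      using Dx[OF that] mv_defect[OF that, of n A' x] by (simp add: D_def y_def)
    then have "hp n x (mv n (adj A') y) = hp n x x" by (intro hp_cong) auto
    then have "hp n y y = hp n x x" using hp_adj[of n n A' x y] by (simp add: y_def)
    then show ?thesis using x1 unfolding hp_self by simp
  qed
  have skew: "A' j i = - A' i j" if "i < n" "j < n" for i j using emb_sym[OF that, of z] by (simp add: A'_def)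
  have ys: "y j = 0" if j: "j < k" for j
    unfolding y_def mv_def
  proof (rule sum.neutral, rule ballI)
    fix i assume "i \<in> {..<n}"
    then have i: "i < n" by simp
    show "A' j i * x i = 0"
    proof (cases "i = k \<or> i = Suc k")
      case True
      have "A' j i = - JJ i j" using skew[OF i, of j] A[OF j i] j kn by (simp add: A'_def)
      also have "JJ i j = 0" using True j k(1) by (auto simp: JJ_col dl_def)
      finally show ?thesis by simp
    qed (use xs in auto)
  qed
  \<comment> \<open>The pairing is x^T A x, which is its own negative for skew-symmetric A.\<close>
  have orth: "hp n y (\<lambda>i. cnj (x i)) = 0"
  proof -
    have "hp n y (\<lambda>i. cnj (x i)) = (\<Sum>i<n. \<Sum>j<n. A' i j * x j * x i)"
      by (simp add: hp_def y_def mv_def sum_distrib_right)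
    also have "\<dots> = (\<Sum>j<n. \<Sum>i<n. A' i j * x j * x i)" by (rule sum.swap)
    also have "\<dots> = (\<Sum>j<n. \<Sum>i<n. - (A' j i * x i * x j))"
    proof (intro sum.cong refl)
      fix i j assume "j \<in> {..<n}" "i \<in> {..<n}"
      then have "A' i j = - A' j i" by (intro skew) auto
      then show "A' i j * x j * x i = - (A' j i * x i * x j)" by (simp only: mult_minus_left mult_minus_right mult_ac)
    qed
    also have "\<dots> = - hp n y (\<lambda>i. cnj (x i))"
      by (simp add: hp_def y_def mv_def sum_distrib_right sum_negf)
    finally show ?thesis by simp
  qed
  define xc where "xc i = cnj (x i)" for i
  have xc1: "vsq n xc = vsq n (dl k)" using x1 vsq_dl[OF kn] by (simp add: xc_def vsq_def)
  from refl_exists[OF xc1] obtain u c where u: "uz n u" "cmod c = 1" "\<And>i. i < n \<Longrightarrow> refl n u c xc i = dl k i"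
    "\<And>v i. hp n v xc = 0 \<Longrightarrow> hp n v (dl k) = 0 \<Longrightarrow> refl n u c v i = v i" by metis
  define y1 where "y1 = refl n u c y"
  have fx: "refl n u c (dl j) i = dl j i" if "j < k" for i j
    by (rule u(4)) (use that kn xs[of j] in \<open>simp_all add: hp_dl xc_def dl_def\<close>)
  have y1n: "vsq n y1 = vsq n (dl (Suc k))" using y1 vsq_dl[OF k(2)] by (simp add: y1_def vsq_refl[OF u(1,2)])
  have y1k: "y1 k = 0"
  proof -
    have "hp n y1 (dl k) = hp n y1 (refl n u c xc)" by (rule hp_cong) (simp_all add: u(3))
    also have "\<dots> = hp n y xc" unfolding y1_def by (rule hp_refl[OF u(1,2)])
    also have "\<dots> = 0" using orth by (simp add: xc_def[abs_def])
    finally show ?thesis using kn by (simp add: hp_dl)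
  qed
  have y1s: "y1 j = 0" if j: "j < k" for j
  proof -
    have "hp n y1 (dl j) = hp n y1 (refl n u c (dl j))" by (rule hp_cong) (simp_all add: fx[OF j])
    also have "\<dots> = hp n y (dl j)" unfolding y1_def by (rule hp_refl[OF u(1,2)])
    finally show ?thesis using ys[OF j] j kn by (simp add: hp_dl)
  qed
  from refl_exists[OF y1n] obtain w d where w: "uz n w" "cmod d = 1" "\<And>i. i < n \<Longrightarrow> refl n w d y1 i = dl (Suc k) i"
    "\<And>v i. hp n v y1 = 0 \<Longrightarrow> hp n v (dl (Suc k)) = 0 \<Longrightarrow> refl n w d v i = v i" by metis
  \<comment> \<open>The second reflection fixes \<delta>_k too, as \<open>y1\<close> and
    \<delta>_(k+1) are both orthogonal to it, so it does not undo the first.\<close>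
  have fw: "refl n w d (dl j) i = dl j i" if "j \<le> k" for i j
    by (rule w(4)) (use that kn k(2) y1k y1s[of j] in \<open>cases "j = k"; simp add: hp_dl dl_def\<close>)+
  note p = act_props[OF u(1,2) z]
  note q = act_props[OF w(1,2) p(2)]
  define B where "B = embA (act u u c z)"
  define C where "C = embA (act w w d (act u u c z))"
  have moveB: "mv n B (\<lambda>j. cnj (b j)) i = b' i"
    if "\<And>i. i < n \<Longrightarrow> refl n u c a i = b i" "\<And>i. i < n \<Longrightarrow> refl n u c a' i = b' i"
      "\<And>i. i < n \<Longrightarrow> mv n A' (\<lambda>j. cnj (a j)) i = a' i" "i < n" for a a' b b' i
    unfolding B_def p(3)[OF that(4)] using mv_two_sided[OF u(1,2) that] by (simp add: A'_def)
  have moveC: "mv n C (\<lambda>j. cnj (b j)) i = b' i"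
    if "\<And>i. i < n \<Longrightarrow> refl n w d a i = b i" "\<And>i. i < n \<Longrightarrow> refl n w d a' i = b' i"
      "\<And>i. i < n \<Longrightarrow> mv n B (\<lambda>j. cnj (a j)) i = a' i" "i < n" for a a' b b' i
    unfolding C_def q(3)[OF that(4)] using mv_two_sided[OF w(1,2) that] by (simp add: B_def)
  have Cskew: "C j i = - C i j" if "i < n" "j < n" for i j using emb_sym[OF that] by (simp add: C_def)
  have Ck: "C i k = dl (Suc k) i" if i: "i < n" for i
  proof -
    have 1: "mv n B (\<lambda>j. cnj (dl k j)) i = y1 i" if "i < n" for i
      by (rule moveB[OF u(3) _ _ that, of y]) (simp_all add: y1_def xc_def y_def)
    have "mv n C (\<lambda>j. cnj (dl k j)) i = dl (Suc k) i"
      by (rule moveC[OF fw[OF order_refl] w(3) 1 i])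
    then show ?thesis using kn by (simp add: mv_dl)
  qed
  have Cj: "C i j = JJ i j" if j: "j < k" and i: "i < n" for i j
  proof -
    have jn: "j < n" using j kn by simp
    \<comment> \<open>As k is even, the blocks before k are complete: column j of \<open>JJ\<close>
      is a signed standard vector with index below k, and both reflections fix it.\<close>
    obtain j' \<sigma> where j': "j' < k" "\<And>i. JJ i j = \<sigma> * dl j' i"
    proof (cases "even j")
      case True
      have "Suc j < k" using True j k(1) by (metis Suc_lessI even_Suc)
      then show ?thesis using True by (intro that[of "Suc j" 1]) (simp_all add: JJ_col)
    next
      case False
      then show ?thesis using j by (intro that[of "j - 1" "-1"]) (simp_all add: JJ_col)
    qed
    have 1: "mv n B (\<lambda>l. cnj (dl j l)) i = \<sigma> * dl j' i" if "i < n" for i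
      by (rule moveB[OF fx[OF j] _ _ that, of "\<lambda>i. \<sigma> * dl j' i"])
         (use A[OF j] jn j'(2) in \<open>simp_all add: refl_linear fx[OF j'(1)] mv_dl A'_def\<close>)
    have "mv n C (\<lambda>l. cnj (dl j l)) i = \<sigma> * dl j' i"
      by (rule moveC[OF fw _ 1 i]) (use j j'(1) in \<open>simp_all add: refl_linear fw\<close>)
    then show ?thesis using jn j'(2) by (simp add: mv_dl)
  qed
  \<comment> \<open>Skew-symmetry supplies the entry -1, and a contraction leaves no room for
    anything else in that column.\<close>
  have Ck1: "C i (Suc k) = - dl k i" if i: "i < n" for i
  proof -
    have Ckk: "C k (Suc k) = - 1" using Cskew[OF k(2) kn] Ck[OF k(2)] by (simp add: dl_def)
    have "vsq n (mv n C (dl (Suc k))) \<le> vsq n (dl (Suc k))"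
    proof -
      have "act w w d (act u u c z) \<in> cdom" using q(2) unfolding cd.cext_def by blast
      then have "contr n n C 1" by (simp add: cdom_def C_def)
      then show ?thesis by (auto simp: contr_def nv_def)
    qed
    then have le: "vsq n (\<lambda>i. C i (Suc k)) \<le> 1" using k(2) by (simp add: vsq_dl mv_dl[OF k(2), abs_def])
    show ?thesis
    proof (cases "i = k")
      case True
      then show ?thesis using Ckk by (simp add: dl_def)
    next
      case False
      have "(\<Sum>l\<in>{i, k}. (cmod (C l (Suc k)))\<^sup>2) \<le> vsq n (\<lambda>i. C i (Suc k))"
        unfolding vsq_def using i kn by (intro sum_mono2) auto
      moreover have "(\<Sum>l\<in>{i, k}. (cmod (C l (Suc k)))\<^sup>2) = (cmod (C i (Suc k)))\<^sup>2 + 1" using False Ckk by simp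
      ultimately have "(cmod (C i (Suc k)))\<^sup>2 \<le> 0" using le by linarith
      then show ?thesis using False by (simp add: dl_def)
    qed
  qed
  have "C i j = JJ i j" if "j < k + 2" "i < n" for i j
  proof -
    consider "j < k" | "j = k" | "j = Suc k" using \<open>j < k + 2\<close> by linarith
    then show ?thesis
      by cases (use Cj Ck Ck1 that k(1) in \<open>simp_all add: JJ_col\<close>)
  qed
  moreover have "(\<lambda>z. act w w d (act u u c z)) \<in> cd.G" by (rule cd.G_compose[OF q(1) p(1)])
  ultimately show ?thesis using q(2) by (intro bexI[of _ "\<lambda>z. act w w d (act u u c z)"]) (auto simp: C_def)
qed

lemma reduce_cols:
  assumes z: "cd.cext z"
  shows "2 * l \<le> n \<Longrightarrow> \<exists>g\<in>cd.G. cd.cext (g z) \<and> (\<forall>j<2 * l. \<forall>i<n. embA (g z) i j = JJ i j)"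
proof (induction l)
  case 0
  show ?case by (rule bexI[OF _ cd.G_id]) (use z in simp)
next
  case (Suc l)
  then obtain g where g: "g \<in> cd.G" "cd.cext (g z)" "\<And>i j. j < 2 * l \<Longrightarrow> i < n \<Longrightarrow> embA (g z) i j = JJ i j" by auto
  have "\<exists>h\<in>cd.G. cd.cext (h (g z)) \<and> (\<forall>j<2 * l + 2. \<forall>i<n. embA (h (g z)) i j = JJ i j)"
    by (rule reduce_step[OF g(2) _ _ g(3)]) (use Suc.prems in auto)
  then obtain h where h: "h \<in> cd.G" "cd.cext (h (g z))" "\<forall>j<2 * l + 2. \<forall>i<n. embA (h (g z)) i j = JJ i j" by blast
  then show ?case using cd.G_compose[OF h(1) g(1)] by (intro bexI[of _ "\<lambda>z. h (g z)"]) auto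
qed

lemma homogeneous: "homogeneous_domain dom cdom mip acts (decA JJ)"
proof unfold_locales
  fix z assume "cd.cext z"
  from reduce_cols[OF this, of "n div 2"] obtain g where g: "g \<in> cd.G"
    "\<And>i j. j < 2 * (n div 2) \<Longrightarrow> i < n \<Longrightarrow> embA (g z) i j = JJ i j" by auto
  have "embA (g z) i j = JJ i j" if ij: "i < n" "j < n" for i j
  proof -
    \<comment> \<open>For odd n one column is left over; skew-symmetry recovers its entries except
      the diagonal one, which is 0.\<close>
    have "j < 2 * (n div 2) \<or> i < 2 * (n div 2) \<or> i = j" using ij by presburger
    then consider "j < 2 * (n div 2)" | "i < 2 * (n div 2)" | "i = j" by blast
    then show ?thesis
    proof cases
      case 2
      then show ?thesis using g(2)[OF 2 ij(2)] emb_sym[OF ij(2,1), of "g z"] JJ_skew[of i j] by simp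
    next
      case 3
      have "JJ j j = 0" using JJ_skew[of j j] by simp
      then show ?thesis using 3 by (simp add: embA_def)
    qed (use g ij in auto)
  qed
  then show "\<exists>g\<in>cd.G. g z = decA JJ" using g(1) by (intro finish) (auto simp: eqm_def)
qed

end

lemma cartan_II_toeplitz:
  fixes \<Omega> :: "(complex^'d::finite) set"
  assumes "cartan_II \<Omega>" "linf (shilov_measure \<Omega>) \<phi>" "toeplitz_compact (shilov_measure \<Omega>) \<phi>"
  shows "AE z in shilov_measure \<Omega>. \<phi> z = 0"
proof -
  obtain n and e :: "nat \<times> nat \<Rightarrow> 'd" where e: "bij_betw e {(i, j). i < j \<and> j < n} UNIV"
    and \<Omega>: "\<Omega> = {z. mat_contr n n (\<lambda>i j. if i < j then z $ e (i, j)
                                    else if j < i then - (z $ e (j, i)) else 0)}"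
    using assms(1) unfolding cartan_II_def by blast
  interpret type_II n e by unfold_locales (rule e)
  have eq: "\<Omega> = dom" unfolding \<Omega> dom_def by (simp add: embA_def[abs_def])
  from homogeneous_domain.toeplitz_zero[OF homogeneous] assms(2,3) show ?thesis
    unfolding eq by blast
qed

section \<open>Classical Cartan domains\<close>

theorem theorem3p6:
  fixes \<Omega> :: "(complex^'d::finite) set" and \<phi> :: "complex^'d \<Rightarrow> complex"
  assumes "classical_cartan \<Omega>"
    and "linf (shilov_measure \<Omega>) \<phi>"
    and "toeplitz_compact (shilov_measure \<Omega>) \<phi>"
  shows "AE z in shilov_measure \<Omega>. \<phi> z = 0"
  using assms cartan_I_toeplitz cartan_II_toeplitz cartan_III_toeplitz cartan_IV_toeplitz
  unfolding classical_cartan_def by blast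

end
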